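(* Let $c\in(0,1)$, $p\in(0,\infty)$ and, for $i=1,2$, let $\mathfrak M_i$ be a finite factor equipped with its tracial state $\tau_i$ such that $\mathscr P_c(\mathfrak M_i)\neq\emptyset$. Let $\phi$ be a surjective $L^p$-isometry from $\mathscr P_c(\mathfrak M_1)$ to $\mathscr P_c(\mathfrak M_2)$. If $c\neq 1/2$, then there is a $*$-isomorphism or a $*$-anti-isomorphism $\varphi:\mathfrak M_1\to\mathfrak M_2$ such that $\phi(P)=\varphi(P)$ for all $P\in\mathscr P_c(\mathfrak M_1)$. If $c=1/2$, then there is a $*$-isomorphism or a $*$-anti-isomorphism $\varphi:\mathfrak M_1\to\mathfrak M_2$ such that either $\phi(P)=\varphi(P)$ for all $P\in\mathscr P_{1/2}(\mathfrak M_1)$, or $\phi(P)=I-\varphi(P)$ for all $P\in\mathscr P_{1/2}(\mathfrak M_1)$.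
   Context: A finite factor is a von Neumann algebra factor admitting a (unique, faithful, normal) tracial state, i.e. $M_n(\mathbb C)$ or a $\mathrm{II}_1$ factor. For a finite factor $\mathfrak M$ with tracial state $\tau$, $\mathscr P_c(\mathfrak M)$ is the set of projections $P\in\mathfrak M$ with $\tau(P)=c$, and $\|A\|_p:=\tau(|A|^p)^{1/p}$. A map $\phi:\mathscr P_c(\mathfrak M_1)\to\mathscr P_c(\mathfrak M_2)$ is an $L^p$-isometry if $\|P-Q\|_p=\|\phi(P)-\phi(Q)\|_p$ for all $P,Q\in\mathscr P_c(\mathfrak M_1)$, each side computed with the respective tracial state. A $*$-anti-isomorphism is a complex-linear bijection $\varphi$ with $\varphi(A^* )=\varphi(A)^*$ and $\varphi(AB)=\varphi(B)\varphi(A)$. *)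

theory Defs
  imports "HOL-Analysis.Analysis" "HOL-Computational_Algebra.Polynomial"
begin

section \<open>Complex Hilbert spaces\<close>

text \<open>
  A complex Hilbert space of arbitrary dimension. The complex inner product is linear in its first
  argument. The underlying real inner product is its real part, so that the norm inherited from
  \<^class>\<open>real_inner\<close> is the Hilbert space norm.
\<close>

class chilbert_space = real_inner + complete_space +
  fixes scaleC :: "complex \<Rightarrow> 'a \<Rightarrow> 'a"  (infixr "*\<^sub>C" 75)
    and cinner :: "'a \<Rightarrow> 'a \<Rightarrow> complex"
  assumes scaleC_add_right: "a *\<^sub>C (x + y) = a *\<^sub>C x + a *\<^sub>C y"
    and scaleC_add_left: "(a + b) *\<^sub>C x = a *\<^sub>C x + b *\<^sub>C x"
    and scaleC_scaleC: "a *\<^sub>C b *\<^sub>C x = (a * b) *\<^sub>C x"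
    and scaleC_of_real: "complex_of_real r *\<^sub>C x = r *\<^sub>R x"
    and cinner_commute: "cinner x y = cnj (cinner y x)"
    and cinner_add_left: "cinner (x + y) z = cinner x z + cinner y z"
    and cinner_scaleC_left: "cinner (a *\<^sub>C x) y = a * cinner x y"
    and inner_eq_Re_cinner: "inner x y = Re (cinner x y)"

lemma cinner_scaleC_right:
  "cinner x (a *\<^sub>C y) = cnj a * cinner x (y :: 'a :: chilbert_space)"
  by (metis cinner_commute cinner_scaleC_left complex_cnj_mult)

lemma norm_scaleC: "norm (a *\<^sub>C x) = cmod a * norm (x :: 'a :: chilbert_space)"
proof -
  have "cinner (a *\<^sub>C x) (a *\<^sub>C x) = (a * cnj a) * cinner x x"
    by (simp add: cinner_scaleC_left cinner_scaleC_right)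
  then have "inner (a *\<^sub>C x) (a *\<^sub>C x) = (cmod a)\<^sup>2 * inner x x"
    by (simp add: inner_eq_Re_cinner flip: complex_norm_square)
  then show ?thesis
    by (simp add: norm_eq_sqrt_inner real_sqrt_mult)
qed

lemma bounded_linear_scaleC: "bounded_linear ((*\<^sub>C) a :: 'a :: chilbert_space \<Rightarrow> 'a)"
proof (rule bounded_linear_intro)
  fix x y :: 'a and r :: real
  show "a *\<^sub>C (x + y) = a *\<^sub>C x + a *\<^sub>C y"
    by (rule scaleC_add_right)
  show "a *\<^sub>C r *\<^sub>R x = r *\<^sub>R a *\<^sub>C x"
    by (simp only: scaleC_of_real [symmetric] scaleC_scaleC mult.commute)
  show "norm (a *\<^sub>C x) \<le> norm x * cmod a"
    by (simp add: norm_scaleC mult.commute)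
qed


section \<open>Bounded operators\<close>

text \<open>
  The elements of \<^typ>\<open>'a \<Rightarrow>\<^sub>L 'a\<close> are only real-linear; \<open>bounded_ops\<close> is the set of
  those that are complex-linear.
\<close>

definition bounded_ops :: "('a :: chilbert_space \<Rightarrow>\<^sub>L 'a) set" where
  "bounded_ops = {T. \<forall>a x. blinfun_apply T (a *\<^sub>C x) = a *\<^sub>C blinfun_apply T x}"

definition scale_op :: "complex \<Rightarrow> ('a :: chilbert_space \<Rightarrow>\<^sub>L 'a) \<Rightarrow> ('a \<Rightarrow>\<^sub>L 'a)" where
  "scale_op a T = Blinfun (\<lambda>x. a *\<^sub>C blinfun_apply T x)"

lemma blinfun_apply_scale_op [simp]:
  "blinfun_apply (scale_op a T) x = a *\<^sub>C blinfun_apply T x"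
  unfolding scale_op_def
  by (subst bounded_linear_Blinfun_apply)
    (auto intro: bounded_linear_compose [OF bounded_linear_scaleC blinfun.bounded_linear_right])

definition adj_op :: "('a :: chilbert_space \<Rightarrow>\<^sub>L 'a) \<Rightarrow> ('a \<Rightarrow>\<^sub>L 'a)" where
  "adj_op T = (THE S. S \<in> bounded_ops \<and>
     (\<forall>x y. cinner (blinfun_apply T x) y = cinner x (blinfun_apply S y)))"

definition positive_op :: "('a :: chilbert_space \<Rightarrow>\<^sub>L 'a) \<Rightarrow> bool" where
  "positive_op T \<longleftrightarrow> T \<in> bounded_ops \<and> (\<forall>x. cinner (blinfun_apply T x) x \<in> \<real>\<^sub>\<ge>\<^sub>0)"

definition op_le :: "('a :: chilbert_space \<Rightarrow>\<^sub>L 'a) \<Rightarrow> ('a \<Rightarrow>\<^sub>L 'a) \<Rightarrow> bool" where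
  "op_le S T \<longleftrightarrow> positive_op (T - S)"

definition projection_op :: "('a :: chilbert_space \<Rightarrow>\<^sub>L 'a) \<Rightarrow> bool" where
  "projection_op P \<longleftrightarrow> P \<in> bounded_ops \<and> P o\<^sub>L P = P \<and> adj_op P = P"

definition op_spectrum :: "('a :: chilbert_space \<Rightarrow>\<^sub>L 'a) \<Rightarrow> complex set" where
  "op_spectrum T = {z. \<not> (\<exists>S \<in> bounded_ops.
     S o\<^sub>L (T - scale_op z id_blinfun) = id_blinfun \<and>
     (T - scale_op z id_blinfun) o\<^sub>L S = id_blinfun)}"


section \<open>Continuous functional calculus\<close>

definition poly_op :: "real poly \<Rightarrow> ('a :: chilbert_space \<Rightarrow>\<^sub>L 'a) \<Rightarrow> ('a \<Rightarrow>\<^sub>L 'a)" where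
  "poly_op q T = (\<Sum>i\<le>degree q. coeff q i *\<^sub>R (((o\<^sub>L) T) ^^ i) id_blinfun)"

text \<open>
  For self-adjoint \<open>T\<close> and real \<open>f\<close> continuous on the spectrum of \<open>T\<close>, the operator \<open>f(T)\<close> is the
  norm limit of \<open>q\<^sub>n(T)\<close> for any polynomials \<open>q\<^sub>n\<close> converging to \<open>f\<close> uniformly on the spectrum. The
  spectrum of a self-adjoint operator is real and compact, so such \<open>q\<^sub>n\<close> exist.
\<close>

definition fun_op :: "(real \<Rightarrow> real) \<Rightarrow> ('a :: chilbert_space \<Rightarrow>\<^sub>L 'a) \<Rightarrow> ('a \<Rightarrow>\<^sub>L 'a)" where
  "fun_op f T = (THE S. \<forall>q :: nat \<Rightarrow> real poly.
     uniform_limit {t. complex_of_real t \<in> op_spectrum T} (\<lambda>n t. poly (q n) t) f sequentially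
       \<longrightarrow> (\<lambda>n. poly_op (q n) T) \<longlonglongrightarrow> S)"

definition abs_op :: "('a :: chilbert_space \<Rightarrow>\<^sub>L 'a) \<Rightarrow> ('a \<Rightarrow>\<^sub>L 'a)" where
  "abs_op T = fun_op sqrt (adj_op T o\<^sub>L T)"


section \<open>Finite factors\<close>

definition commutant :: "('a :: chilbert_space \<Rightarrow>\<^sub>L 'a) set \<Rightarrow> ('a \<Rightarrow>\<^sub>L 'a) set" where
  "commutant M = {T \<in> bounded_ops. \<forall>A \<in> M. T o\<^sub>L A = A o\<^sub>L T}"

text \<open>
  A self-adjoint set of operators that equals its bicommutant is automatically a unital subalgebra.
\<close>

definition von_neumann_algebra :: "('a :: chilbert_space \<Rightarrow>\<^sub>L 'a) set \<Rightarrow> bool" where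
  "von_neumann_algebra M \<longleftrightarrow>
     M \<subseteq> bounded_ops \<and> (\<forall>A \<in> M. adj_op A \<in> M) \<and> commutant (commutant M) = M"

definition factor :: "('a :: chilbert_space \<Rightarrow>\<^sub>L 'a) set \<Rightarrow> bool" where
  "factor M \<longleftrightarrow>
     von_neumann_algebra M \<and> M \<inter> commutant M = range (\<lambda>a. scale_op a id_blinfun)"

definition tracial_state ::
  "('a :: chilbert_space \<Rightarrow>\<^sub>L 'a) set \<Rightarrow> (('a \<Rightarrow>\<^sub>L 'a) \<Rightarrow> complex) \<Rightarrow> bool" where
  "tracial_state M \<tau> \<longleftrightarrow>
     (\<forall>A \<in> M. \<forall>B \<in> M. \<tau> (A + B) = \<tau> A + \<tau> B) \<and>
     (\<forall>a. \<forall>A \<in> M. \<tau> (scale_op a A) = a * \<tau> A) \<and>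
     (\<forall>A \<in> M. positive_op A \<longrightarrow> \<tau> A \<in> \<real>\<^sub>\<ge>\<^sub>0) \<and>
     \<tau> id_blinfun = 1 \<and>
     (\<forall>A \<in> M. \<forall>B \<in> M. \<tau> (A o\<^sub>L B) = \<tau> (B o\<^sub>L A))"

definition faithful_state ::
  "('a :: chilbert_space \<Rightarrow>\<^sub>L 'a) set \<Rightarrow> (('a \<Rightarrow>\<^sub>L 'a) \<Rightarrow> complex) \<Rightarrow> bool" where
  "faithful_state M \<tau> \<longleftrightarrow> (\<forall>A \<in> M. positive_op A \<longrightarrow> \<tau> A = 0 \<longrightarrow> A = 0)"

text \<open>
  Normality: the value at the supremum \<open>A\<close> in \<open>M\<close> of an upward directed set \<open>D\<close> of positive
  elements is the supremum of the values on \<open>D\<close>.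
\<close>

definition normal_state ::
  "('a :: chilbert_space \<Rightarrow>\<^sub>L 'a) set \<Rightarrow> (('a \<Rightarrow>\<^sub>L 'a) \<Rightarrow> complex) \<Rightarrow> bool" where
  "normal_state M \<tau> \<longleftrightarrow> (\<forall>D A.
     D \<subseteq> M \<and> D \<noteq> {} \<and> (\<forall>T \<in> D. positive_op T) \<and>
     (\<forall>S \<in> D. \<forall>T \<in> D. \<exists>U \<in> D. op_le S U \<and> op_le T U) \<and>
     A \<in> M \<and> (\<forall>T \<in> D. op_le T A) \<and> (\<forall>B \<in> M. (\<forall>T \<in> D. op_le T B) \<longrightarrow> op_le A B)
     \<longrightarrow> Re (\<tau> A) = (SUP T \<in> D. Re (\<tau> T)))"

definition finite_factor ::
  "('a :: chilbert_space \<Rightarrow>\<^sub>L 'a) set \<Rightarrow> (('a \<Rightarrow>\<^sub>L 'a) \<Rightarrow> complex) \<Rightarrow> bool" where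
  "finite_factor M \<tau> \<longleftrightarrow>
     factor M \<and> tracial_state M \<tau> \<and> faithful_state M \<tau> \<and> normal_state M \<tau>"

definition projections_of_trace ::
  "('a :: chilbert_space \<Rightarrow>\<^sub>L 'a) set \<Rightarrow> (('a \<Rightarrow>\<^sub>L 'a) \<Rightarrow> complex) \<Rightarrow> real \<Rightarrow> ('a \<Rightarrow>\<^sub>L 'a) set"
  where "projections_of_trace M \<tau> c = {P \<in> M. projection_op P \<and> \<tau> P = complex_of_real c}"

definition Lp_norm ::
  "(('a :: chilbert_space \<Rightarrow>\<^sub>L 'a) \<Rightarrow> complex) \<Rightarrow> real \<Rightarrow> ('a \<Rightarrow>\<^sub>L 'a) \<Rightarrow> real" where
  "Lp_norm \<tau> p A = Re (\<tau> (fun_op (\<lambda>t. t powr p) (abs_op A))) powr (1 / p)"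

definition Lp_isometry_on ::
  "('a :: chilbert_space \<Rightarrow>\<^sub>L 'a) set \<Rightarrow> (('a \<Rightarrow>\<^sub>L 'a) \<Rightarrow> complex) \<Rightarrow>
   (('b :: chilbert_space \<Rightarrow>\<^sub>L 'b) \<Rightarrow> complex) \<Rightarrow> real \<Rightarrow> (('a \<Rightarrow>\<^sub>L 'a) \<Rightarrow> ('b \<Rightarrow>\<^sub>L 'b)) \<Rightarrow> bool"
  where "Lp_isometry_on X \<tau>1 \<tau>2 p f \<longleftrightarrow>
     (\<forall>P \<in> X. \<forall>Q \<in> X. Lp_norm \<tau>1 p (P - Q) = Lp_norm \<tau>2 p (f P - f Q))"


section \<open>Isomorphisms and anti-isomorphisms\<close>

definition star_linear_bij ::
  "('a :: chilbert_space \<Rightarrow>\<^sub>L 'a) set \<Rightarrow> ('b :: chilbert_space \<Rightarrow>\<^sub>L 'b) set \<Rightarrow>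
   (('a \<Rightarrow>\<^sub>L 'a) \<Rightarrow> ('b \<Rightarrow>\<^sub>L 'b)) \<Rightarrow> bool" where
  "star_linear_bij M N f \<longleftrightarrow>
     bij_betw f M N \<and>
     (\<forall>A \<in> M. \<forall>B \<in> M. f (A + B) = f A + f B) \<and>
     (\<forall>a. \<forall>A \<in> M. f (scale_op a A) = scale_op a (f A)) \<and>
     (\<forall>A \<in> M. f (adj_op A) = adj_op (f A))"

definition star_isomorphism ::
  "('a :: chilbert_space \<Rightarrow>\<^sub>L 'a) set \<Rightarrow> ('b :: chilbert_space \<Rightarrow>\<^sub>L 'b) set \<Rightarrow>
   (('a \<Rightarrow>\<^sub>L 'a) \<Rightarrow> ('b \<Rightarrow>\<^sub>L 'b)) \<Rightarrow> bool" where
  "star_isomorphism M N f \<longleftrightarrow>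
     star_linear_bij M N f \<and> (\<forall>A \<in> M. \<forall>B \<in> M. f (A o\<^sub>L B) = f A o\<^sub>L f B)"

definition star_anti_isomorphism ::
  "('a :: chilbert_space \<Rightarrow>\<^sub>L 'a) set \<Rightarrow> ('b :: chilbert_space \<Rightarrow>\<^sub>L 'b) set \<Rightarrow>
   (('a \<Rightarrow>\<^sub>L 'a) \<Rightarrow> ('b \<Rightarrow>\<^sub>L 'b)) \<Rightarrow> bool" where
  "star_anti_isomorphism M N f \<longleftrightarrow>
     star_linear_bij M N f \<and> (\<forall>A \<in> M. \<forall>B \<in> M. f (A o\<^sub>L B) = f B o\<^sub>L f A)"

end

theory Submission
  imports Defs "HOL-Computational_Algebra.Fundamental_Theorem_Algebra"
begin

text \<open>
  Let \<open>c \<le> 1/2\<close>; larger \<open>c\<close> are reduced to this case by passing to complements. The distance of two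
  projections of trace \<open>c\<close> is maximal exactly if they are orthogonal, so \<open>\<phi>\<close> preserves orthogonality,
  and from this one sees that \<open>\<phi>\<close> maps the circles spanned by two anticommuting symmetries to circles.
  Differentiating the distance from \<open>P\<close> along such a circle through \<open>Q\<close> recovers \<open>\<tau>(PQ)\<close>, so \<open>\<phi>\<close>
  preserves \<open>\<tau>(PQ)\<close> and extends to an isometry of the real spans of the projections.

  Near a fixed \<open>P\<close> the projections are \<open>P + s(b + b\<^sup>*) + s\<^sup>2(bb\<^sup>* - b\<^sup>*b) + \<dots>\<close> with \<open>b \<in> (1 - P)MP\<close>.
  The linear extension maps \<open>b + b\<^sup>*\<close> to \<open>\<rho>(b) + \<rho>(b)\<^sup>*\<close>, and comparing the second order terms shows
  \<open>\<rho>(ab\<^sup>*a) = \<rho>(a)\<rho>(b)\<^sup>*\<rho>(a)\<close>. By an argument of Herstein, \<open>\<rho>(ab\<^sup>*e)\<close> is then always \<open>\<rho>(a)\<rho>(b)\<^sup>*\<rho>(e)\<close>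
  or always \<open>\<rho>(e)\<rho>(b)\<^sup>*\<rho>(a)\<close>. In the first case \<open>\<rho>\<close>, in the second case \<open>-\<rho>\<^sup>*\<close>, extends to a linear or
  antilinear isomorphism \<open>g\<close> of the factors. The operator \<open>\<phi>(Q) - g(Q)\<close>, respectively
  \<open>\<phi>(Q) + g(Q)\<close>, commutes with the factor and hence is scalar. Comparing traces, it is \<open>0\<close> in the first
  case and \<open>2c\<close> in the second case, which is possible only for \<open>c = 1/2\<close>.
\<close>

section \<open>Hilbert space preliminaries\<close>

\<comment> \<open>Three obstacles shape the proof. For general p the distance between P and Q is a
  single spectral average of \<open>(P - Q)\<^sup>2\<close> and does not show the trace of PQ. That
  trace becomes a first order quantity near pairs of anticommuting symmetries, where
  \<open>(P - Q)\<^sup>2\<close> is half the unit of a corner. With q = p/2, the cases q > 1 and q <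
  1 need opposite convexity arguments, while for q = 1 the distance already determines the trace of
  PQ. Secondly, no smoothness of the map is known: differentiation is replaced by estimates for the
  inner product given by the trace, which the linear extension preserves. That extension lives on an
  algebraic real span only; second order terms, which are not shown to lie in the span, are handled
  through their pairings with projections. Thirdly, room is needed: c at most 1/2 provides a
  symmetry in a corner of trace 2c that anticommutes with two given projections, and a copy of P
  inside 1 - P. This copy lets the corner (1 - P)MP determine the whole factor.\<close>
subclass (in chilbert_space) banach ..

lemma parallelogram_law:
  fixes x y :: "'a :: real_inner"
  shows "(norm (x - y))\<^sup>2 = 2 * (norm x)\<^sup>2 + 2 * (norm y)\<^sup>2 - (norm (x + y))\<^sup>2"
  by (simp add: power2_norm_eq_inner inner_diff_left inner_diff_right inner_add_left inner_add_right
      inner_commute)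

lemma closed_convex_has_nearest_point:
  fixes S :: "'a :: {real_inner, complete_space} set"
  assumes "closed S" "convex S" "S \<noteq> {}"
  obtains z where "z \<in> S" "\<And>y. y \<in> S \<Longrightarrow> norm (x - z) \<le> norm (x - y)"
proof -
  define d where "d = infdist x S"
  have d_le: "d \<le> norm (x - y)" if "y \<in> S" for y
    using that infdist_le[of y S x] by (simp add: d_def dist_norm)
  have d0: "d \<ge> 0"
    by (simp add: d_def infdist_nonneg)
  have "\<exists>y. y \<in> S \<and> norm (x - y) < d + 1 / real (Suc n)" for n
  proof (rule ccontr)
    assume "\<not> ?thesis"
    then have "d + 1 / real (Suc n) \<le> dist x y" if "y \<in> S" for y
      using that by (force simp: dist_norm)
    then have "d + 1 / real (Suc n) \<le> infdist x S"
      using assms(3) by (auto simp: infdist_def intro!: cINF_greatest)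
    then show False
      by (simp add: d_def)
  qed
  then obtain u where u: "\<And>n. u n \<in> S" "\<And>n. norm (x - u n) < d + 1 / real (Suc n)"
    by metis
  have lim: "(\<lambda>n. norm (x - u n)) \<longlonglongrightarrow> d"
  proof (rule tendsto_sandwich[of "\<lambda>_. d" _ _ "\<lambda>n. d + 1 / real (Suc n)"])
    show "(\<lambda>n. d + 1 / real (Suc n)) \<longlonglongrightarrow> d"
      using LIMSEQ_inverse_real_of_nat_add[of d] by (simp add: inverse_eq_divide)
  qed (use u d_le in \<open>auto intro!: always_eventually less_imp_le\<close>)
  have "Cauchy u"
  proof (rule metric_CauchyI)
    fix e :: real assume e: "e > 0"
    have "(\<lambda>n. (norm (x - u n))\<^sup>2) \<longlonglongrightarrow> d\<^sup>2"
      by (intro tendsto_power lim)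
    then obtain N where N: "\<And>n. n \<ge> N \<Longrightarrow> (norm (x - u n))\<^sup>2 < d\<^sup>2 + e\<^sup>2 / 4"
      using order_tendstoD(2)[of _ "d\<^sup>2" sequentially "d\<^sup>2 + e\<^sup>2 / 4"] e
      by (auto simp: eventually_sequentially)
    have "dist (u m) (u n) < e" if "m \<ge> N" "n \<ge> N" for m n
    proof -
      \<comment> \<open>Convexity puts the midpoint into \<open>S\<close>, at distance at least
        \<open>d\<close> from \<open>x\<close>; the parallelogram law then forces the two points to
        be close.\<close>
      have mid: "(1/2) *\<^sub>R u m + (1/2) *\<^sub>R u n \<in> S"
        using convexD[OF assms(2) u(1)[of m] u(1)[of n], of "1/2" "1/2"] by simp
      have "(x - u m) + (x - u n) = 2 *\<^sub>R (x - ((1/2) *\<^sub>R u m + (1/2) *\<^sub>R u n))"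
        by (simp add: algebra_simps scaleR_2)
      then have "norm ((x - u m) + (x - u n)) \<ge> 2 * d"
        using d_le[OF mid] by simp
      then have "4 * d\<^sup>2 \<le> (norm ((x - u m) + (x - u n)))\<^sup>2"
        using d0 power_mono[of "2 * d" _ 2] by (simp add: power_mult_distrib)
      then have "(norm (u n - u m))\<^sup>2 < e\<^sup>2"
        using parallelogram_law[of "x - u m" "x - u n"] N[OF that(1)] N[OF that(2)] by simp
      then show ?thesis
        using e power2_less_imp_less[of "norm (u n - u m)" e] by (simp add: dist_norm norm_minus_commute)
    qed
    then show "\<exists>M. \<forall>m\<ge>M. \<forall>n\<ge>M. dist (u m) (u n) < e"
      by blast
  qed
  then obtain z where z: "u \<longlonglongrightarrow> z"
    using Cauchy_convergent convergent_def by blast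
  have "z \<in> S"
    using closed_sequentially[OF assms(1) _ z] u(1) by blast
  moreover have "norm (x - z) = d"
    using LIMSEQ_unique[OF lim] tendsto_norm[OF tendsto_diff[OF tendsto_const z]] by metis
  ultimately show ?thesis
    using that d_le by auto
qed

lemma orthogonal_of_norm_minimal:
  fixes w v :: "'a :: real_inner"
  assumes "\<And>s :: real. norm w \<le> norm (w - s *\<^sub>R v)"
  shows "inner w v = 0"
proof (rule ccontr)
  assume neq: "inner w v \<noteq> 0"
  then have v: "inner v v > 0"
    by auto
  define s where "s = inner w v / inner v v"
  have "(norm w)\<^sup>2 \<le> (norm (w - s *\<^sub>R v))\<^sup>2"
    using assms by (simp add: power_mono)
  also have "\<dots> = (norm w)\<^sup>2 - 2 * s * inner w v + s\<^sup>2 * inner v v"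
    by (simp only: power2_norm_eq_inner inner_diff_left inner_diff_right inner_commute[of v w]
        inner_scaleR_left inner_scaleR_right) (simp add: power2_eq_square algebra_simps)
  also have "\<dots> = (norm w)\<^sup>2 - (inner w v)\<^sup>2 / inner v v"
    using v by (simp add: s_def field_simps power2_eq_square)
  finally show False
    using v neq by (simp add: field_simps)
qed

lemma orthogonal_projection_exists:
  fixes S :: "'a :: {real_inner, complete_space} set"
  assumes "closed S" "subspace S"
  obtains z where "z \<in> S" "\<And>y. y \<in> S \<Longrightarrow> inner (x - z) y = 0"
proof -
  obtain z where z: "z \<in> S" "\<And>y. y \<in> S \<Longrightarrow> norm (x - z) \<le> norm (x - y)"
    using closed_convex_has_nearest_point[OF assms(1) subspace_imp_convex[OF assms(2)]]
      subspace_0[OF assms(2)] by blast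
  have "inner (x - z) y = 0" if "y \<in> S" for y
  proof (rule orthogonal_of_norm_minimal)
    fix s :: real
    have "z + s *\<^sub>R y \<in> S"
      by (intro subspace_add[OF assms(2)] subspace_scale[OF assms(2)] z that)
    from z(2)[OF this] show "norm (x - z) \<le> norm (x - z - s *\<^sub>R y)"
      by (simp add: diff_diff_add)
  qed
  with z(1) show ?thesis
    using that by blast
qed

text \<open>The real form is enough: \<open>cop_adjoint_exists\<close> recovers the complex identity
  by also testing with \<open>\<i> *\<^sub>C \<xi>\<close>.\<close>

lemma riesz_representation:
  fixes f :: "'a :: {real_inner, complete_space} \<Rightarrow> real"
  assumes "bounded_linear f"
  obtains z where "\<And>x. f x = inner x z"
proof (cases "\<forall>x. f x = 0")
  case True
  then show ?thesis
    using that[of 0] by simp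
next
  case False
  then obtain x0 where x0: "f x0 \<noteq> 0"
    by blast
  interpret f: bounded_linear f by fact
  define S where "S = {x. f x = 0}"
  have "closed S"
    unfolding S_def using f.continuous_on[OF continuous_on_id]
    by (intro closed_Collect_eq continuous_intros) auto
  moreover have "subspace S"
    by (auto simp: S_def subspace_def f.add f.scaleR f.zero)
  ultimately obtain z where z: "z \<in> S" "\<And>y. y \<in> S \<Longrightarrow> inner (x0 - z) y = 0"
    using orthogonal_projection_exists[of S x0] by blast
  define w where "w = x0 - z"
  have fw: "f w = f x0"
    using z(1) by (simp add: w_def f.diff S_def)
  then have w: "inner w w > 0"
    using x0 by (auto simp: f.zero)
  have "f x = inner x ((f w / inner w w) *\<^sub>R w)" for x
  proof -
    have "x - (f x / f w) *\<^sub>R w \<in> S"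
      using x0 fw by (simp add: S_def f.diff f.scaleR)
    then have "inner w (x - (f x / f w) *\<^sub>R w) = 0"
      using z(2) w_def by blast
    then show ?thesis
      using x0 fw w by (simp add: inner_diff_right inner_commute field_simps)
  qed
  then show ?thesis
    using that by blast
qed

lemma scaleC_zero_left [simp]: "0 *\<^sub>C x = (0 :: 'a :: chilbert_space)"
  using scaleC_of_real[of 0 x] by simp

lemma scaleC_one [simp]: "1 *\<^sub>C x = (x :: 'a :: chilbert_space)"
  using scaleC_of_real[of 1 x] by simp

lemma scaleC_minus_one: "(- 1) *\<^sub>C x = - (x :: 'a :: chilbert_space)"
  using scaleC_of_real[of "- 1" x] by simp

lemma scaleR_scaleC: "r *\<^sub>R a *\<^sub>C x = a *\<^sub>C r *\<^sub>R (x :: 'a :: chilbert_space)"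
  by (simp only: scaleC_of_real[symmetric] scaleC_scaleC mult.commute)

lemma scaleC_minus_right: "a *\<^sub>C (- x) = - (a *\<^sub>C (x :: 'a :: chilbert_space))"
  by (simp only: scaleC_minus_one[symmetric] scaleC_scaleC mult.commute)

lemma scaleC_diff_right: "a *\<^sub>C (x - y) = a *\<^sub>C x - a *\<^sub>C (y :: 'a :: chilbert_space)"
  using scaleC_add_right[of a x "- y"] by (simp add: scaleC_minus_right)

lemma scaleC_zero_right [simp]: "a *\<^sub>C 0 = (0 :: 'a :: chilbert_space)"
  using scaleC_diff_right[of a 0 0] by simp

lemma cinner_minus_left: "cinner (- x) y = - cinner x (y :: 'a :: chilbert_space)"
  using cinner_scaleC_left[of "- 1" x y] by (simp add: scaleC_minus_one)

lemma cinner_diff_left: "cinner (x - y) z = cinner x z - cinner y (z :: 'a :: chilbert_space)"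
  using cinner_add_left[of x "- y" z] by (simp add: cinner_minus_left)

lemma cinner_add_right: "cinner z (x + y) = cinner z x + cinner z (y :: 'a :: chilbert_space)"
  by (metis cinner_add_left cinner_commute complex_cnj_add)

lemma cinner_diff_right: "cinner z (x - y) = cinner z x - cinner z (y :: 'a :: chilbert_space)"
  by (metis cinner_diff_left cinner_commute complex_cnj_diff)

lemma cinner_scaleR_left: "cinner (r *\<^sub>R x) y = r *\<^sub>R cinner x (y :: 'a :: chilbert_space)"
  by (metis cinner_scaleC_left scaleC_of_real scaleR_conv_of_real)

lemma cinner_scaleR_right: "cinner x (r *\<^sub>R y) = r *\<^sub>R cinner x (y :: 'a :: chilbert_space)"
  using cinner_scaleC_right[of x "complex_of_real r" y]
  by (simp add: scaleC_of_real scaleR_conv_of_real)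

lemma cinner_zero_left [simp]: "cinner 0 (y :: 'a :: chilbert_space) = 0"
  using cinner_diff_left[of 0 0 y] by simp

lemma cinner_zero_right [simp]: "cinner (y :: 'a :: chilbert_space) 0 = 0"
  using cinner_diff_right[of y 0 0] by simp

lemma inner_scaleC_i: "inner (\<i> *\<^sub>C x) y = - Im (cinner x (y :: 'a :: chilbert_space))"
  by (simp add: inner_eq_Re_cinner cinner_scaleC_left)

lemma cinner_eq_complex: "cinner x y = Complex (inner x y) (- inner (\<i> *\<^sub>C x) (y :: 'a :: chilbert_space))"
  by (simp add: complex_eq_iff inner_scaleC_i) (simp add: inner_eq_Re_cinner)

lemma Im_cinner_self [simp]: "Im (cinner x x) = 0" for x :: "'a :: chilbert_space"
proof -
  have "Im (cinner x x) = Im (cnj (cinner x x))"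
    by (metis cinner_commute)
  then show ?thesis
    by simp
qed

lemma cinner_self: "cinner x x = of_real ((norm x)\<^sup>2)" for x :: "'a :: chilbert_space"
  by (simp add: complex_eq_iff power2_norm_eq_inner) (simp add: inner_eq_Re_cinner)

lemma cinner_extensionality:
  fixes x y :: "'a :: chilbert_space"
  assumes "\<And>z. cinner x z = cinner y z"
  shows "x = y"
proof -
  have "inner (x - y) (x - y) = 0"
    using assms[of "x - y"] by (simp add: inner_eq_Re_cinner cinner_diff_left)
  then show ?thesis
    by simp
qed

section \<open>The algebra of bounded complex-linear operators\<close>

text \<open>This type is not an instance of \<^class>\<open>ring_1\<close>, because \<open>0 = 1\<close> over the zero space.\<close>

typedef (overloaded) ('a :: chilbert_space) cop = "bounded_ops :: ('a \<Rightarrow>\<^sub>L 'a) set"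
  by (rule exI[of _ 0]) (simp add: bounded_ops_def)

setup_lifting type_definition_cop

definition app :: "'a :: chilbert_space cop \<Rightarrow> 'a \<Rightarrow> 'a" where
  "app x = blinfun_apply (Rep_cop x)"

lemma cop_eqI: "(\<And>\<xi>. app x \<xi> = app y \<xi>) \<Longrightarrow> x = y"
  by (metis Rep_cop_inject app_def blinfun_eqI)

instantiation cop :: (chilbert_space) "{zero, one, plus, minus, uminus, times, scaleR, norm}"
begin

lift_definition zero_cop :: "'a cop" is 0 by (simp add: bounded_ops_def)
lift_definition one_cop :: "'a cop" is id_blinfun by (simp add: bounded_ops_def)
lift_definition plus_cop :: "'a cop \<Rightarrow> 'a cop \<Rightarrow> 'a cop" is "(+)"
  by (simp add: bounded_ops_def plus_blinfun.rep_eq scaleC_add_right)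
lift_definition minus_cop :: "'a cop \<Rightarrow> 'a cop \<Rightarrow> 'a cop" is "(-)"
  by (simp add: bounded_ops_def minus_blinfun.rep_eq scaleC_diff_right)
lift_definition uminus_cop :: "'a cop \<Rightarrow> 'a cop" is uminus
  by (simp add: bounded_ops_def uminus_blinfun.rep_eq scaleC_minus_right)
lift_definition scaleR_cop :: "real \<Rightarrow> 'a cop \<Rightarrow> 'a cop" is "(*\<^sub>R)"
  by (simp add: bounded_ops_def scaleR_blinfun.rep_eq scaleR_scaleC)
lift_definition times_cop :: "'a cop \<Rightarrow> 'a cop \<Rightarrow> 'a cop" is "(o\<^sub>L)"
  by (simp add: bounded_ops_def)
lift_definition norm_cop :: "'a cop \<Rightarrow> real" is norm .

instance ..

end

instantiation cop :: (chilbert_space) "{real_normed_algebra, monoid_mult}"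
begin

definition dist_cop :: "'a cop \<Rightarrow> 'a cop \<Rightarrow> real" where
  "dist_cop x y = norm (x - y)"
definition sgn_cop :: "'a cop \<Rightarrow> 'a cop" where
  "sgn_cop x = x /\<^sub>R norm x"
definition uniformity_cop :: "('a cop \<times> 'a cop) filter" where
  "uniformity_cop = (INF e\<in>{0 <..}. principal {(x, y). dist x y < e})"
definition open_cop :: "'a cop set \<Rightarrow> bool" where
  "open_cop S = (\<forall>x\<in>S. \<forall>\<^sub>F (x', y) in uniformity. x' = x \<longrightarrow> y \<in> S)"

instance
proof
  fix x y z :: "'a cop" and r s :: real
  show "dist x y = norm (x - y)" by (fact dist_cop_def)
  show "sgn x = x /\<^sub>R norm x" by (fact sgn_cop_def)
  show "uniformity = (INF e\<in>{0 <..}. principal {(x :: 'a cop, y). dist x y < e})"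
    by (fact uniformity_cop_def)
  show "open S = (\<forall>x\<in>S. \<forall>\<^sub>F (x', y) in uniformity. x' = x \<longrightarrow> y \<in> S)" for S :: "'a cop set"
    by (fact open_cop_def)
  show "norm (x + y) \<le> norm x + norm y" by transfer (rule norm_triangle_ineq)
  show "norm (x * y) \<le> norm x * norm y" by transfer (rule norm_blinfun_compose)
qed (transfer; simp add: algebra_simps blinfun_eqI plus_blinfun.rep_eq minus_blinfun.rep_eq
    scaleR_blinfun.rep_eq blinfun.add_right blinfun.scaleR_right; fail)+

end

lemma app_add [simp]: "app (x + y) \<xi> = app x \<xi> + app y \<xi>"
  by (simp add: app_def plus_cop.rep_eq plus_blinfun.rep_eq)

lemma app_diff [simp]: "app (x - y) \<xi> = app x \<xi> - app y \<xi>"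
  by (simp add: app_def minus_cop.rep_eq minus_blinfun.rep_eq)

lemma app_minus [simp]: "app (- x) \<xi> = - app x \<xi>"
  by (simp add: app_def uminus_cop.rep_eq uminus_blinfun.rep_eq)

lemma app_zero [simp]: "app 0 \<xi> = 0"
  by (simp add: app_def zero_cop.rep_eq)

lemma app_one [simp]: "app 1 \<xi> = \<xi>"
  by (simp add: app_def one_cop.rep_eq)

lemma app_mult [simp]: "app (x * y) \<xi> = app x (app y \<xi>)"
  by (simp add: app_def times_cop.rep_eq)

lemma app_scaleR [simp]: "app (r *\<^sub>R x) \<xi> = r *\<^sub>R app x \<xi>"
  by (simp add: app_def scaleR_cop.rep_eq scaleR_blinfun.rep_eq)

lemma app_add_vec [simp]: "app x (\<xi> + \<eta>) = app x \<xi> + app x \<eta>"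
  by (simp add: app_def blinfun.add_right)

lemma app_diff_vec [simp]: "app x (\<xi> - \<eta>) = app x \<xi> - app x \<eta>"
  by (simp add: app_def blinfun.diff_right)

lemma app_zero_vec [simp]: "app x 0 = 0"
  by (simp add: app_def blinfun.zero_right)

lemma app_scaleR_vec [simp]: "app x (r *\<^sub>R \<xi>) = r *\<^sub>R app x \<xi>"
  by (simp add: app_def blinfun.scaleR_right)

lemma app_scaleC_vec [simp]: "app x (a *\<^sub>C \<xi>) = a *\<^sub>C app x \<xi>"
  using Rep_cop[of x] by (simp add: app_def bounded_ops_def)

lemma bounded_linear_app: "bounded_linear (app x)"
  unfolding app_def by (rule blinfun.bounded_linear_right)

lemma norm_app: "norm (app x \<xi>) \<le> norm x * norm \<xi>"
  by (simp add: app_def norm_cop.rep_eq norm_blinfun)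

lemma norm_cop_bound:
  assumes "0 \<le> b" "\<And>\<xi>. norm (app x \<xi>) \<le> b * norm \<xi>"
  shows "norm x \<le> b"
  using assms unfolding app_def norm_cop.rep_eq by (rule norm_blinfun_bound)

text \<open>Builds an operator from its action on vectors; used for adjoints, strong limits and
  orthogonal projections onto closed subspaces.\<close>

lemma cop_from_linear:
  assumes "\<And>\<xi> \<eta>. f (\<xi> + \<eta>) = f \<xi> + f \<eta>" "\<And>a \<xi>. f (a *\<^sub>C \<xi>) = a *\<^sub>C f \<xi>"
    "\<And>\<xi>. norm (f \<xi>) \<le> b * norm \<xi>"
  obtains x :: "'a :: chilbert_space cop" where "\<And>\<xi>. app x \<xi> = f \<xi>"
proof -
  have "bounded_linear f"
  proof (rule bounded_linear_intro[of _ b])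
    show "f (r *\<^sub>R \<xi>) = r *\<^sub>R f \<xi>" for r \<xi>
      using assms(2)[of "complex_of_real r" \<xi>] by (simp add: scaleC_of_real)
  qed (use assms in \<open>auto simp: mult.commute\<close>)
  then have "app (Abs_cop (Blinfun f)) \<xi> = f \<xi>" for \<xi>
    by (simp add: app_def Abs_cop_inverse bounded_ops_def bounded_linear_Blinfun_apply assms)
  then show ?thesis
    using that by blast
qed

lemma closed_bounded_ops: "closed (bounded_ops :: ('a :: chilbert_space \<Rightarrow>\<^sub>L 'a) set)"
proof -
  have "bounded_ops = (\<Inter>a. \<Inter>x. {T :: 'a \<Rightarrow>\<^sub>L 'a. blinfun_apply T (a *\<^sub>C x) = a *\<^sub>C blinfun_apply T x})"
    by (auto simp: bounded_ops_def)
  moreover have "closed {T :: 'a \<Rightarrow>\<^sub>L 'a. blinfun_apply T (a *\<^sub>C x) = a *\<^sub>C blinfun_apply T x}" for a x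
    by (intro closed_Collect_eq continuous_intros bounded_linear.continuous_on[OF bounded_linear_scaleC])
  ultimately show ?thesis
    by (metis (no_types, lifting) closed_INT)
qed

instance cop :: (chilbert_space) banach
proof
  fix X :: "nat \<Rightarrow> 'a cop"
  assume X: "Cauchy X"
  have d: "dist (Rep_cop x) (Rep_cop y) = dist x y" for x y :: "'a cop"
    by (simp add: dist_norm norm_cop.rep_eq minus_cop.rep_eq)
  have "Cauchy (\<lambda>n. Rep_cop (X n))"
    using X by (simp add: Cauchy_def d)
  then obtain L where L: "(\<lambda>n. Rep_cop (X n)) \<longlonglongrightarrow> L"
    using Cauchy_convergent convergent_def by blast
  have "L \<in> bounded_ops"
    using closed_sequentially[OF closed_bounded_ops _ L] Rep_cop by blast
  then have "Rep_cop (Abs_cop L) = L"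
    by (rule Abs_cop_inverse)
  then have "X \<longlonglongrightarrow> Abs_cop L"
    using L by (simp add: tendsto_dist_iff[of X] tendsto_dist_iff[of "\<lambda>n. Rep_cop (X n)"] flip: d)
  then show "convergent X"
    by (auto simp: convergent_def)
qed

lemma tendsto_app: "(X \<longlongrightarrow> x) F \<Longrightarrow> ((\<lambda>n. app (X n) \<xi>) \<longlongrightarrow> app x \<xi>) F"
proof -
  assume *: "(X \<longlongrightarrow> x) F"
  have "bounded_linear (\<lambda>x. app x \<xi>)"
    by (rule bounded_linear_intro[of _ "norm \<xi>"]) (simp_all add: norm_app)
  then show ?thesis
    using * by (rule bounded_linear.tendsto)
qed

subsection \<open>Adjoints\<close>

lemma cop_adjoint_exists:
  fixes x :: "'a :: chilbert_space cop"
  shows "\<exists>y. \<forall>\<xi> \<eta>. cinner (app x \<xi>) \<eta> = cinner \<xi> (app y \<eta>)"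
proof -
  have "\<exists>\<zeta>. \<forall>\<xi>. cinner (app x \<xi>) \<eta> = cinner \<xi> \<zeta>" for \<eta>
  proof -
    have "bounded_linear (\<lambda>\<xi>. inner (app x \<xi>) \<eta>)"
      using bounded_linear_compose[OF bounded_linear_inner_left bounded_linear_app] .
    then obtain \<zeta> where \<zeta>: "\<And>\<xi>. inner (app x \<xi>) \<eta> = inner \<xi> \<zeta>"
      using riesz_representation by blast
    have "cinner (app x \<xi>) \<eta> = cinner \<xi> \<zeta>" for \<xi>
      using \<zeta>[of \<xi>] \<zeta>[of "\<i> *\<^sub>C \<xi>"] by (simp add: cinner_eq_complex)
    then show ?thesis by blast
  qed
  then obtain f where f: "\<And>\<xi> \<eta>. cinner (app x \<xi>) \<eta> = cinner \<xi> (f \<eta>)"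
    by metis
  have eqI: "\<zeta> = \<zeta>'" if "\<And>\<xi>. cinner \<xi> \<zeta> = cinner \<xi> \<zeta>'" for \<zeta> \<zeta>' :: 'a
    by (rule cinner_extensionality) (metis that cinner_commute)
  have "f (\<eta> + \<eta>') = f \<eta> + f \<eta>'" for \<eta> \<eta>'
    by (rule eqI) (simp add: cinner_add_right flip: f)
  moreover have "f (a *\<^sub>C \<eta>) = a *\<^sub>C f \<eta>" for a \<eta>
    by (rule eqI) (simp add: cinner_scaleC_right flip: f)
  moreover have "norm (f \<eta>) \<le> norm x * norm \<eta>" for \<eta>
  proof (cases "f \<eta> = 0")
    case False
    have "norm (f \<eta>) * norm (f \<eta>) = inner (app x (f \<eta>)) \<eta>"
      using f[of "f \<eta>" \<eta>] by (simp add: inner_eq_Re_cinner cinner_self power2_eq_square)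
    also have "\<dots> \<le> norm (app x (f \<eta>)) * norm \<eta>"
      by (rule norm_cauchy_schwarz)
    also have "\<dots> \<le> (norm x * norm (f \<eta>)) * norm \<eta>"
      by (intro mult_right_mono norm_app) auto
    finally have "norm (f \<eta>) * norm (f \<eta>) \<le> norm (f \<eta>) * (norm x * norm \<eta>)"
      by (simp add: algebra_simps)
    then show ?thesis
      using False by simp
  qed auto
  ultimately obtain y where "\<And>\<eta>. app y \<eta> = f \<eta>"
    using cop_from_linear[of f "norm x"] by blast
  then show ?thesis
    using f by (intro exI[of _ y]) simp
qed

definition star :: "'a :: chilbert_space cop \<Rightarrow> 'a cop" where
  "star x = (SOME y. \<forall>\<xi> \<eta>. cinner (app x \<xi>) \<eta> = cinner \<xi> (app y \<eta>))"

lemma cinner_app: "cinner (app x \<xi>) \<eta> = cinner \<xi> (app (star x) \<eta>)"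
  unfolding star_def using someI_ex[OF cop_adjoint_exists[of x]] by blast

lemma inner_app: "inner (app x \<xi>) \<eta> = inner \<xi> (app (star x) \<eta>)"
  by (simp add: inner_eq_Re_cinner cinner_app)

lemma star_unique:
  assumes "\<And>\<xi> \<eta>. cinner (app x \<xi>) \<eta> = cinner \<xi> (app y \<eta>)"
  shows "star x = y"
proof (rule cop_eqI, rule cinner_extensionality)
  fix \<eta> \<xi>
  have "cinner \<xi> (app (star x) \<eta>) = cinner \<xi> (app y \<eta>)"
    using assms by (simp flip: cinner_app)
  then show "cinner (app (star x) \<eta>) \<xi> = cinner (app y \<eta>) \<xi>"
    by (metis cinner_commute)
qed

lemma cinner_app_right: "cinner \<xi> (app x \<eta>) = cinner (app (star x) \<xi>) \<eta>"
  by (metis cinner_app cinner_commute)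

lemma inner_app_right: "inner \<xi> (app x \<eta>) = inner (app (star x) \<xi>) \<eta>"
  by (simp add: inner_eq_Re_cinner cinner_app_right)

lemma star_star [simp]: "star (star x) = x"
  by (rule star_unique) (simp add: cinner_app_right)

lemma star_zero [simp]: "star 0 = 0"
  by (rule star_unique) simp

lemma star_one [simp]: "star 1 = 1"
  by (rule star_unique) simp

lemma star_add [simp]: "star (x + y) = star x + star y"
  by (rule star_unique) (simp add: cinner_add_left cinner_add_right cinner_app)

lemma star_diff [simp]: "star (x - y) = star x - star y"
  by (rule star_unique) (simp add: cinner_diff_left cinner_diff_right cinner_app)

lemma star_minus [simp]: "star (- x) = - star x"
  using star_diff[of 0 x] by simp

lemma star_mult [simp]: "star (x * y) = star y * star x"
  by (rule star_unique) (simp add: cinner_app)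

lemma star_scaleR [simp]: "star (r *\<^sub>R x) = r *\<^sub>R star x"
  by (rule star_unique) (simp add: cinner_scaleR_left cinner_scaleR_right cinner_app)

lemma star_eq_zero_iff [simp]: "star x = 0 \<longleftrightarrow> x = 0"
  by (metis star_star star_zero)

lemma norm_star_le: "norm (star x) \<le> norm x"
proof (rule norm_cop_bound)
  fix \<xi>
  show "norm (app (star x) \<xi>) \<le> norm x * norm \<xi>"
  proof (cases "app (star x) \<xi> = 0")
    case False
    have "norm (app (star x) \<xi>) * norm (app (star x) \<xi>) = inner (app x (app (star x) \<xi>)) \<xi>"
      by (simp add: inner_app flip: power2_eq_square power2_norm_eq_inner)
    also have "\<dots> \<le> norm (app x (app (star x) \<xi>)) * norm \<xi>"
      by (rule norm_cauchy_schwarz)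
    also have "\<dots> \<le> (norm x * norm (app (star x) \<xi>)) * norm \<xi>"
      by (intro mult_right_mono norm_app) auto
    finally have "norm (app (star x) \<xi>) * norm (app (star x) \<xi>) \<le> norm (app (star x) \<xi>) * (norm x * norm \<xi>)"
      by (simp add: algebra_simps)
    then show ?thesis
      using False by simp
  qed auto
qed auto

lemma norm_star [simp]: "norm (star x) = norm x"
  using norm_star_le[of x] norm_star_le[of "star x"] by simp

lemma tendsto_star: "(X \<longlongrightarrow> x) F \<Longrightarrow> ((\<lambda>n. star (X n)) \<longlongrightarrow> star x) F"
  unfolding tendsto_dist_iff[of X] tendsto_dist_iff[of "\<lambda>n. star (X n)"]
  by (simp add: dist_norm flip: star_diff)

lift_definition scalar :: "complex \<Rightarrow> 'a :: chilbert_space cop" is "\<lambda>a. scale_op a id_blinfun"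
  by (simp add: bounded_ops_def scaleC_scaleC mult.commute)

lemma app_scalar [simp]: "app (scalar a) \<xi> = a *\<^sub>C \<xi>"
  by (simp add: app_def scalar.rep_eq)

lemma scalar_commute: "scalar a * x = x * scalar a"
  by (rule cop_eqI) simp

lemma scalar_mult [simp]: "scalar a * scalar b = scalar (a * b)"
  by (rule cop_eqI) (simp add: scaleC_scaleC mult.commute)

lemma scalar_mult_left [simp]: "scalar a * (scalar b * x) = scalar (a * b) * x"
  by (simp flip: mult.assoc)

lemma scalar_left_commute: "x * (scalar a * y) = scalar a * (x * y)"
  by (metis mult.assoc scalar_commute)

lemma scalar_of_real: "scalar (complex_of_real r) = r *\<^sub>R 1"
  by (rule cop_eqI) (simp add: scaleC_of_real)

lemma scalar_one [simp]: "scalar 1 = 1"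
  by (rule cop_eqI) simp

lemma scalar_minus_one [simp]: "scalar (- 1) = - 1"
  by (rule cop_eqI) (simp add: scaleC_minus_one)

lemma star_scalar [simp]: "star (scalar a) = scalar (cnj a)"
  by (rule star_unique) (simp add: cinner_scaleC_left cinner_scaleC_right)

lemma scaleR_eq_scalar: "r *\<^sub>R x = scalar (complex_of_real r) * x"
  by (simp add: scalar_of_real)

subsection \<open>The order\<close>

instantiation cop :: (chilbert_space) ord
begin

definition less_eq_cop :: "'a cop \<Rightarrow> 'a cop \<Rightarrow> bool" where
  "x \<le> y \<longleftrightarrow> (\<forall>\<xi>. cinner (app (y - x) \<xi>) \<xi> \<in> \<real>\<^sub>\<ge>\<^sub>0)"

definition less_cop :: "'a cop \<Rightarrow> 'a cop \<Rightarrow> bool" where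
  "x < y \<longleftrightarrow> x \<le> y \<and> \<not> y \<le> (x :: 'a cop)"

instance ..

end

text \<open>Polarization with \<open>\<xi> + \<eta>\<close> and
  \<open>\<xi> + \<i> *\<^sub>C \<eta>\<close>. Complex scalars are essential: a rotation of the
  real plane by a right angle has zero quadratic form.\<close>

lemma quadratic_form_zero_imp_zero:
  assumes "\<And>\<xi>. cinner (app x \<xi>) \<xi> = 0"
  shows "x = 0"
proof -
  have "cinner (app x \<xi>) \<eta> = 0" for \<xi> \<eta>
  proof -
    have s: "cinner (app x \<xi>) \<eta> + cinner (app x \<eta>) \<xi> = 0"
      using assms[of "\<xi> + \<eta>"] assms[of \<xi>] assms[of \<eta>]
      by (simp add: cinner_add_left cinner_add_right add.commute)
    have "cinner (app x \<xi>) (\<i> *\<^sub>C \<eta>) + cinner (app x (\<i> *\<^sub>C \<eta>)) \<xi> = 0"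
      using assms[of "\<xi> + \<i> *\<^sub>C \<eta>"] assms[of \<xi>] assms[of "\<i> *\<^sub>C \<eta>"]
      by (simp add: cinner_add_left cinner_add_right add.commute)
    then have "\<i> * (cinner (app x \<eta>) \<xi> - cinner (app x \<xi>) \<eta>) = 0"
      by (simp add: cinner_scaleC_right cinner_scaleC_left algebra_simps)
    then show ?thesis
      using s by simp
  qed
  then show ?thesis
    by (intro cop_eqI cinner_extensionality) simp
qed

text \<open>A quadratic form with real values already forces self-adjointness, by polarization. The
  order, defined by complex values as in \<open>positive_op\<close>, can therefore be checked with
  the real inner product.\<close>

lemma cop_nonneg_iff: "0 \<le> x \<longleftrightarrow> star x = x \<and> (\<forall>\<xi>. 0 \<le> inner (app x \<xi>) \<xi>)"
proof
  assume *: "0 \<le> x"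
  then have c: "cinner (app x \<xi>) \<xi> \<in> \<real>\<^sub>\<ge>\<^sub>0" for \<xi>
    by (simp add: less_eq_cop_def)
  have "cinner (app (star x - x) \<xi>) \<xi> = 0" for \<xi>
  proof -
    have "cinner (app (star x) \<xi>) \<xi> = cnj (cinner (app x \<xi>) \<xi>)"
      by (metis cinner_app cinner_commute star_star)
    then show ?thesis
      using c[of \<xi>] by (auto simp: cinner_diff_left complex_nonneg_Reals_iff complex_eq_iff)
  qed
  then have "star x - x = 0"
    by (rule quadratic_form_zero_imp_zero)
  then show "star x = x \<and> (\<forall>\<xi>. 0 \<le> inner (app x \<xi>) \<xi>)"
    using c by (simp add: inner_eq_Re_cinner complex_nonneg_Reals_iff)
next
  assume *: "star x = x \<and> (\<forall>\<xi>. 0 \<le> inner (app x \<xi>) \<xi>)"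
  have "Im (cinner (app x \<xi>) \<xi>) = 0" for \<xi>
  proof -
    have "cinner (app x \<xi>) \<xi> = cnj (cinner (app x \<xi>) \<xi>)"
      by (metis * cinner_app cinner_commute)
    then show ?thesis
      by (simp add: complex_eq_iff)
  qed
  then show "0 \<le> x"
    using * by (simp add: less_eq_cop_def complex_nonneg_Reals_iff inner_eq_Re_cinner)
qed

lemma cop_add_nonneg:
  "0 \<le> x \<Longrightarrow> 0 \<le> y \<Longrightarrow> 0 \<le> x + (y :: 'a :: chilbert_space cop)"
  by (simp add: cop_nonneg_iff inner_add_left)

lemma cop_le_iff_diff: "x \<le> y \<longleftrightarrow> 0 \<le> y - (x :: 'a :: chilbert_space cop)"
  by (simp add: less_eq_cop_def)

lemma cop_le_iff:
  assumes "star x = x" "star y = y"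
  shows "x \<le> y \<longleftrightarrow> (\<forall>\<xi>. inner (app x \<xi>) \<xi> \<le> inner (app y \<xi>) \<xi>)"
  using assms by (simp add: cop_le_iff_diff[of x] cop_nonneg_iff inner_diff_left)

instance cop :: (chilbert_space) ordered_real_vector
proof
  fix x y z :: "'a cop" and a b :: real
  show "(x < y) = (x \<le> y \<and> \<not> y \<le> x)"
    by (rule less_cop_def)
  show "x \<le> x"
    by (simp add: less_eq_cop_def)
  show "x \<le> z" if "x \<le> y" "y \<le> z"
  proof -
    have "z - x = (z - y) + (y - x)"
      by simp
    then show ?thesis
      using that cop_add_nonneg[of "z - y" "y - x"]
      by (simp add: cop_le_iff_diff[of x] cop_le_iff_diff[of y])
  qed
  show "x = y" if "x \<le> y" "y \<le> x"
  proof -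
    have "cinner (app (y - x) \<xi>) \<xi> = 0" for \<xi>
    proof -
      have "cinner (app (y - x) \<xi>) \<xi> \<in> \<real>\<^sub>\<ge>\<^sub>0" "- cinner (app (y - x) \<xi>) \<xi> \<in> \<real>\<^sub>\<ge>\<^sub>0"
        using that by (auto simp: less_eq_cop_def simp flip: cinner_minus_left)
      then show ?thesis
        by (auto simp: complex_nonneg_Reals_iff complex_eq_iff)
    qed
    then show ?thesis
      using quadratic_form_zero_imp_zero[of "y - x"] by simp
  qed
  show "z + x \<le> z + y" if "x \<le> y"
    using that by (simp add: cop_le_iff_diff[of x] cop_le_iff_diff[of "z + x"])
  show "a *\<^sub>R x \<le> a *\<^sub>R y" if "x \<le> y" "0 \<le> a"
    using that by (simp add: cop_le_iff_diff[of x] cop_le_iff_diff[of "a *\<^sub>R x"] cop_nonneg_iff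
        flip: scaleR_diff_right)
  show "a *\<^sub>R x \<le> b *\<^sub>R x" if "a \<le> b" "0 \<le> x"
    using that by (simp add: cop_le_iff_diff[of "a *\<^sub>R x"] cop_nonneg_iff flip: scaleR_diff_left)
qed

lemma star_nonneg: "0 \<le> x \<Longrightarrow> star x = x"
  by (simp add: cop_nonneg_iff)

lemma star_mult_self_nonneg [simp]: "0 \<le> star x * x"
  using inner_app[of "star x" "app x _"] by (simp add: cop_nonneg_iff)

lemma mult_star_self_nonneg [simp]: "0 \<le> x * star x"
  using star_mult_self_nonneg[of "star x"] by simp

lemma square_nonneg: "star x = x \<Longrightarrow> 0 \<le> x * x"
  using star_mult_self_nonneg[of x] by simp

lemma one_nonneg [simp]: "(0 :: 'a :: chilbert_space cop) \<le> 1"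
  using star_mult_self_nonneg[of 1] by simp

lemma conj_nonneg: "0 \<le> a \<Longrightarrow> 0 \<le> star x * a * x"
  using inner_app[of "star x" "app a (app x _)"] by (simp add: cop_nonneg_iff mult.assoc)

lemma conj_mono: "a \<le> b \<Longrightarrow> star x * a * x \<le> star x * b * x"
  using conj_nonneg[of "b - a" x] by (simp add: algebra_simps)

lemma self_adjoint_norm_bound:
  assumes "star a = a" "0 \<le> r" "- (r *\<^sub>R 1) \<le> a" "a \<le> r *\<^sub>R 1"
  shows "norm a \<le> r"
proof -
  have q: "\<bar>inner (app a \<xi>) \<xi>\<bar> \<le> r * (norm \<xi>)\<^sup>2" for \<xi>
  proof -
    have "inner (app a \<xi>) \<xi> \<le> inner (app (r *\<^sub>R 1) \<xi>) \<xi>" "inner (app (- (r *\<^sub>R 1)) \<xi>) \<xi> \<le> inner (app a \<xi>) \<xi>"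
      using assms(3,4,1) cop_le_iff[of a "r *\<^sub>R 1"] cop_le_iff[of "- (r *\<^sub>R 1)" a] by auto
    then show ?thesis
      by (simp add: power2_norm_eq_inner)
  qed
  have main: "inner (app a \<xi>) \<eta> \<le> r * ((norm \<xi>)\<^sup>2 + (norm \<eta>)\<^sup>2) / 2" for \<xi> \<eta>
  proof -
    have "inner (app a \<eta>) \<xi> = inner (app a \<xi>) \<eta>"
      by (metis inner_app assms(1) inner_commute)
    then have "4 * inner (app a \<xi>) \<eta> = inner (app a (\<xi> + \<eta>)) (\<xi> + \<eta>) - inner (app a (\<xi> - \<eta>)) (\<xi> - \<eta>)"
      by (simp add: inner_add_left inner_add_right inner_diff_left inner_diff_right)
    also have "\<dots> \<le> r * (norm (\<xi> + \<eta>))\<^sup>2 + r * (norm (\<xi> - \<eta>))\<^sup>2"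
      using q[of "\<xi> + \<eta>"] q[of "\<xi> - \<eta>"] by linarith
    also have "\<dots> = 2 * r * ((norm \<xi>)\<^sup>2 + (norm \<eta>)\<^sup>2)"
      unfolding parallelogram_law[of \<xi> \<eta>] by (simp add: algebra_simps)
    finally show ?thesis by simp
  qed
  show ?thesis
  proof (rule norm_cop_bound[OF assms(2)])
    fix \<xi>
    show "norm (app a \<xi>) \<le> r * norm \<xi>"
    proof (cases "app a \<xi> = 0 \<or> \<xi> = 0")
      case False
      \<comment> \<open>The vector of norm \<open>norm \<xi>\<close> in the direction of
        \<open>app a \<xi>\<close>, for which the polarized bound is sharpest.\<close>
      define \<eta> where "\<eta> = (norm \<xi> / norm (app a \<xi>)) *\<^sub>R app a \<xi>"
      have "norm \<eta> = norm \<xi>"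
        using False by (simp add: \<eta>_def)
      moreover have "inner (app a \<xi>) \<eta> = norm \<xi> * norm (app a \<xi>)"
        using False by (simp add: \<eta>_def power2_eq_square flip: power2_norm_eq_inner)
      ultimately have "norm \<xi> * norm (app a \<xi>) \<le> norm \<xi> * (r * norm \<xi>)"
        using main[of \<xi> \<eta>] by (simp add: power2_eq_square mult.left_commute)
      then show ?thesis
        using False by simp
    qed (use assms(2) in auto)
  qed
qed

lemma self_adjoint_le_norm:
  assumes "star a = a"
  shows "a \<le> norm a *\<^sub>R 1" "- (norm a *\<^sub>R 1) \<le> a"
proof -
  have q: "\<bar>inner (app a \<xi>) \<xi>\<bar> \<le> norm a * inner \<xi> \<xi>" for \<xi>
  proof -
    have "\<bar>inner (app a \<xi>) \<xi>\<bar> \<le> norm (app a \<xi>) * norm \<xi>"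
      by (rule Cauchy_Schwarz_ineq2)
    also have "\<dots> \<le> (norm a * norm \<xi>) * norm \<xi>"
      by (intro mult_right_mono norm_app) auto
    finally show ?thesis
      by (simp add: power2_eq_square flip: power2_norm_eq_inner)
  qed
  show "a \<le> norm a *\<^sub>R 1" "- (norm a *\<^sub>R 1) \<le> a"
    using q assms by (auto simp: cop_le_iff abs_le_iff minus_le_iff[of "norm a * _"])
qed

lemma norm_one_le: "norm (1 :: 'a :: chilbert_space cop) \<le> 1"
  by (rule norm_cop_bound) auto

lemma norm_star_mult_self: "norm (star x * x) = (norm x)\<^sup>2"
proof (rule antisym)
  show "norm (star x * x) \<le> (norm x)\<^sup>2"
    using norm_mult_ineq[of "star x" x] by (simp add: power2_eq_square)
  have "norm x \<le> sqrt (norm (star x * x))"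
  proof (rule norm_cop_bound)
    fix \<xi>
    have "(norm (app x \<xi>))\<^sup>2 = inner (app (star x * x) \<xi>) \<xi>"
      by (simp add: power2_norm_eq_inner inner_app)
    also have "\<dots> \<le> norm (app (star x * x) \<xi>) * norm \<xi>"
      by (rule norm_cauchy_schwarz)
    also have "\<dots> \<le> (norm (star x * x) * norm \<xi>) * norm \<xi>"
      by (intro mult_right_mono norm_app) auto
    also have "\<dots> = (sqrt (norm (star x * x)) * norm \<xi>)\<^sup>2"
      by (simp add: power2_eq_square power_mult_distrib)
    finally show "norm (app x \<xi>) \<le> sqrt (norm (star x * x)) * norm \<xi>"
      by (rule power2_le_imp_le) auto
  qed auto
  then show "(norm x)\<^sup>2 \<le> norm (star x * x)"
    using power_mono[of "norm x" "sqrt (norm (star x * x))" 2] by simp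
qed

section \<open>Functional calculus for self-adjoint operators\<close>

text \<open>If a root \<open>z\<close> is not real, the remainder of \<open>p\<close> modulo the
  real quadratic with roots \<open>z\<close> and its conjugate has degree below 2 and vanishes at
  \<open>z\<close>, so it is zero. Evaluated at a self-adjoint operator, this quadratic is a square
  plus a positive number, which is always invertible.\<close>

lemma real_poly_root_or_quadratic_factor:
  fixes p :: "real poly"
  assumes "degree p > 0"
  obtains t where "poly p t = 0"
  | u v where "v \<noteq> 0" "[:u\<^sup>2 + v\<^sup>2, - 2 * u, 1:] dvd p"
proof -
  define ev where "ev q z = poly (map_poly complex_of_real q) z" for q z
  have ev_pCons: "ev (pCons c q) z = of_real c + z * ev q z" for c q z
    by (simp add: ev_def map_poly_pCons)
  have ev_0: "ev 0 z = 0" for z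
    by (simp add: ev_def)
  have ev_add: "ev (q + r) z = ev q z + ev r z" for q r z
    by (induction q r rule: poly_induct2) (simp_all add: ev_pCons ev_0 algebra_simps)
  have ev_smult: "ev (smult c q) z = of_real c * ev q z" for c q z
    by (induction q) (simp_all add: ev_pCons ev_0 algebra_simps)
  have ev_mult: "ev (q * r) z = ev q z * ev r z" for q r z
    by (induction q) (simp_all add: ev_pCons ev_0 ev_add ev_smult algebra_simps)
  have ev_real: "ev q (of_real t) = of_real (poly q t)" for q t
    by (induction q) (simp_all add: ev_pCons ev_0)
  have "degree (map_poly complex_of_real p) > 0"
    using assms by (simp add: degree_map_poly)
  then obtain z where z: "ev p z = 0"
    unfolding ev_def using alg_closed_imp_poly_has_root by blast
  show ?thesis
  proof (cases "Im z = 0")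
    case True
    then have "z = of_real (Re z)"
      by (simp add: complex_eq_iff)
    then have "complex_of_real (poly p (Re z)) = 0"
      using z ev_real by metis
    then show ?thesis
      using that(1)[of "Re z"] by simp
  next
    case False
    define d where "d = [:(Re z)\<^sup>2 + (Im z)\<^sup>2, - 2 * Re z, 1:]"
    have ed: "ev d z = 0"
      by (simp add: d_def ev_pCons ev_0 complex_eq_iff power2_eq_square algebra_simps)
    have deg: "degree d = 2"
      by (simp add: d_def)
    define r where "r = p mod d"
    have "ev p z = ev (p div d) z * ev d z + ev r z"
      by (simp add: r_def flip: ev_mult ev_add)
    then have r0: "ev r z = 0"
      using z ed by simp
    have "degree r < 2"
    proof (cases "r = 0")
      case False
      then show ?thesis
        using degree_mod_less[of d p] deg unfolding r_def by fastforce
    qed auto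
    then have "r = [:coeff r 0, coeff r 1:]"
      by (intro poly_eqI) (auto simp: coeff_pCons coeff_eq_0 split: nat.split)
    then obtain \<alpha> \<beta> where r: "r = [:\<alpha>, \<beta>:]"
      by blast
    then have "of_real \<alpha> + z * of_real \<beta> = 0"
      using r0 by (simp add: ev_pCons ev_0)
    then have "\<alpha> = 0 \<and> \<beta> = 0"
      using False by (simp add: complex_eq_iff) auto
    then have "d dvd p"
      using r by (simp add: r_def dvd_eq_mod_eq_0)
    then show ?thesis
      using that(2)[of "Im z" "Re z"] False by (simp add: d_def)
  qed
qed

text \<open>Horner form, so that the algebraic laws follow by induction over \<open>pCons\<close>;
  \<open>pev_altdef\<close> connects it with the sum of powers in \<open>poly_op\<close>.\<close>

definition pev :: "real poly \<Rightarrow> 'a :: chilbert_space cop \<Rightarrow> 'a cop" where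
  "pev q a = fold_coeffs (\<lambda>c b. c *\<^sub>R 1 + a * b) q 0"

lemma pev_0 [simp]: "pev 0 a = 0"
  by (simp add: pev_def)

lemma pev_pCons [simp]: "pev (pCons c q) a = c *\<^sub>R 1 + a * pev q a"
  by (cases "c = 0 \<and> q = 0") (auto simp: pev_def)

lemma pev_add [simp]: "pev (p + q) a = pev p a + pev q a"
  by (induction p q rule: poly_induct2) (simp_all add: algebra_simps)

lemma pev_smult [simp]: "pev (smult c q) a = c *\<^sub>R pev q a"
  by (induction q) (simp_all add: algebra_simps)

lemma pev_diff [simp]: "pev (p - q) a = pev p a - pev q a"
  using pev_add[of "p - q" q a] by simp

lemma pev_mult [simp]: "pev (p * q) a = pev p a * pev q a"
  by (induction p) (simp_all add: algebra_simps)

lemma pev_intertwine: "x * a = b * x \<Longrightarrow> x * pev q a = pev q b * x"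
  by (induction q) (simp_all add: algebra_simps, metis mult.assoc)

lemma star_pev: "star a = a \<Longrightarrow> star (pev q a) = pev q a"
  by (induction q) (simp_all add: pev_intertwine[of a a a])

lemma pev_altdef: "pev q a = (\<Sum>i\<le>degree q. coeff q i *\<^sub>R a ^ i)"
proof (induction q)
  case (pCons c q)
  show ?case
  proof (cases "q = 0")
    case False
    then have "(\<Sum>i\<le>degree (pCons c q). coeff (pCons c q) i *\<^sub>R a ^ i) =
        c *\<^sub>R 1 + (\<Sum>i\<le>degree q. coeff q i *\<^sub>R a ^ Suc i)"
      by (simp add: sum.atMost_Suc_shift del: sum.atMost_Suc)
    then show ?thesis
      using pCons by (simp add: sum_distrib_left)
  qed simp
qed simp

definition invertible_op :: "'a :: chilbert_space cop \<Rightarrow> bool" where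
  "invertible_op a \<longleftrightarrow> (\<exists>b. b * a = 1 \<and> a * b = 1)"

text \<open>Only real points are recorded; the calculus is applied to self-adjoint operators, and
  its norm bound refers to real points only.\<close>

definition spec :: "'a :: chilbert_space cop \<Rightarrow> real set" where
  "spec a = {t. \<not> invertible_op (a - t *\<^sub>R 1)}"

lemma invertible_op_mult: "invertible_op a \<Longrightarrow> invertible_op b \<Longrightarrow> invertible_op (a * b)"
  unfolding invertible_op_def
proof (elim exE conjE)
  fix a' b' assume *: "a' * a = 1" "a * a' = 1" "b' * b = 1" "b * b' = 1"
  have "(b' * a') * (a * b) = b' * (a' * a) * b" "(a * b) * (b' * a') = a * (b * b') * a'"
    by (simp_all only: mult.assoc)
  then show "\<exists>c. c * (a * b) = 1 \<and> a * b * c = 1"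
    using * by auto
qed

lemma invertible_op_scaleR: "c \<noteq> 0 \<Longrightarrow> invertible_op (c *\<^sub>R 1)"
  unfolding invertible_op_def by (rule exI[of _ "(1 / c) *\<^sub>R 1"]) simp

text \<open>With \<open>c = 1 - a / K\<close> the bounds on \<open>a\<close> give norm at most
  \<open>1 - d / K < 1\<close> for \<open>c\<close>, so \<open>x\<close> goes to
  \<open>c * x + 1 / K\<close> by a contraction. Its fixed point is a right inverse of
  \<open>a\<close>, and passing to adjoints makes it two-sided.\<close>

lemma invertible_op_bounded_below:
  fixes a :: "'a :: chilbert_space cop"
  assumes "star a = a" "d > 0" "d *\<^sub>R 1 \<le> a"
  shows "invertible_op a"
proof -
  define K where "K = max d (norm a)"
  have K: "K > 0" "d \<le> K"
    using assms(2) by (auto simp: K_def)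
  define c where "c = 1 - (1 / K) *\<^sub>R a"
  have sc: "star c = c"
    by (simp add: c_def assms)
  have "a \<le> K *\<^sub>R 1"
  proof -
    have "a \<le> norm a *\<^sub>R 1"
      by (rule self_adjoint_le_norm[OF assms(1)])
    also have "\<dots> \<le> K *\<^sub>R 1"
      by (intro scaleR_right_mono) (auto simp: K_def)
    finally show ?thesis .
  qed
  then have "(1 / K) *\<^sub>R a \<le> (1 / K) *\<^sub>R K *\<^sub>R 1"
    using K by (intro scaleR_left_mono) auto
  then have "0 \<le> c"
    using K by (simp add: c_def)
  moreover have "c \<le> (1 - d / K) *\<^sub>R 1"
    using scaleR_left_mono[OF assms(3), of "1 / K"] K by (simp add: c_def algebra_simps)
  moreover have "- ((1 - d / K) *\<^sub>R 1) \<le> (0 :: 'a cop)"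
    using K scaleR_right_mono[of 0 "1 - d / K" "1 :: 'a cop"] by simp
  ultimately have nc: "norm c \<le> 1 - d / K"
    using K order_trans[of "- ((1 - d / K) *\<^sub>R 1)" 0 c]
    by (intro self_adjoint_norm_bound[OF sc]) auto
  have "\<exists>!x. c * x + (1 / K) *\<^sub>R 1 = x"
  proof (rule banach_fix_type[of "1 - d / K"])
    show "\<forall>x y. dist (c * x + (1 / K) *\<^sub>R 1) (c * y + (1 / K) *\<^sub>R 1) \<le> (1 - d / K) * dist x y"
    proof (intro allI)
      fix x y
      have "dist (c * x + (1 / K) *\<^sub>R 1) (c * y + (1 / K) *\<^sub>R 1) = norm (c * (x - y))"
        by (simp add: dist_norm algebra_simps)
      also have "\<dots> \<le> norm c * norm (x - y)"
        by (rule norm_mult_ineq)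
      also have "\<dots> \<le> (1 - d / K) * dist x y"
        unfolding dist_norm by (intro mult_right_mono nc) auto
      finally show "dist (c * x + (1 / K) *\<^sub>R 1) (c * y + (1 / K) *\<^sub>R 1) \<le> (1 - d / K) * dist x y" .
    qed
  qed (use K assms(2) in auto)
  then obtain x where "c * x + (1 / K) *\<^sub>R 1 = x"
    by blast
  then have "(1 / K) *\<^sub>R (a * x) = (1 / K) *\<^sub>R 1"
    by (simp add: c_def algebra_simps)
  then have ax: "a * x = 1"
    using K by simp
  then have xa: "star x * a = 1"
    using assms(1) by (metis star_mult star_one)
  have "star x = x"
    by (metis ax xa mult.assoc mult_1_left mult_1_right)
  then show ?thesis
    using ax xa by (auto simp: invertible_op_def)
qed

lemma invertible_op_minus: "invertible_op a \<Longrightarrow> invertible_op (- a)"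
  using invertible_op_mult[OF invertible_op_scaleR[of "- 1"], of a] by simp

lemma spec_lower_bound:
  assumes "star a = a" "m *\<^sub>R 1 \<le> a" "t \<in> spec a"
  shows "m \<le> t"
proof (rule ccontr)
  assume "\<not> m \<le> t"
  then have "invertible_op (a - t *\<^sub>R 1)"
    using assms(1,2) by (intro invertible_op_bounded_below[of _ "m - t"]) (auto simp: algebra_simps)
  then show False
    using assms(3) by (simp add: spec_def)
qed

lemma spec_upper_bound:
  assumes "star a = a" "a \<le> m *\<^sub>R 1" "t \<in> spec a"
  shows "t \<le> m"
proof (rule ccontr)
  assume "\<not> t \<le> m"
  then have "invertible_op (t *\<^sub>R 1 - a)"
    using assms(1,2) by (intro invertible_op_bounded_below[of _ "t - m"]) (auto simp: algebra_simps)
  then have "invertible_op (a - t *\<^sub>R 1)"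
    using invertible_op_minus by fastforce
  then show False
    using assms(3) by (simp add: spec_def)
qed

lemma spec_norm_bound:
  assumes "star a = a" "t \<in> spec a"
  shows "\<bar>t\<bar> \<le> norm a"
  using spec_lower_bound[of a "- norm a" t] spec_upper_bound[of a "norm a" t]
    self_adjoint_le_norm[of a] assms by auto

text \<open>The half of spectral mapping that is needed. Each step splits off either a linear
  factor, invertible because its root lies outside the spectrum, or a quadratic factor of the form
  \<open>b * b + v\<^sup>2\<close>.\<close>

lemma invertible_pev:
  assumes "star a = a" "q \<noteq> 0" "\<And>t. t \<in> spec a \<Longrightarrow> poly q t \<noteq> 0"
  shows "invertible_op (pev q a)"
  using assms(2,3)
proof (induction "degree q" arbitrary: q rule: less_induct)
  case less
  show ?case
  proof (cases "degree q = 0")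
    case True
    then obtain c where "q = [:c:]"
      by (rule degree_eq_zeroE)
    then show ?thesis
      using less.prems(1) invertible_op_scaleR[of c] by simp
  next
    case False
    have factor: "invertible_op (pev q a)"
      if d: "d dvd q" "degree d > 0" "invertible_op (pev d a)" for d
    proof -
      obtain r where r: "q = d * r"
        using d(1) by (elim dvdE)
      have "r \<noteq> 0" "d \<noteq> 0"
        using less.prems(1) r by auto
      then have "invertible_op (pev r a)"
        using r d(2) less.prems(2) by (intro less.hyps) (auto simp: degree_mult_eq)
      then show ?thesis
        unfolding r pev_mult by (rule invertible_op_mult[OF d(3)])
    qed
    from False have "degree q > 0" by simp
    then show ?thesis
    proof (cases rule: real_poly_root_or_quadratic_factor)
      case (1 t)
      then have "t \<notin> spec a"
        using less.prems(2) by blast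
      then have "invertible_op (pev [:- t, 1:] a)"
        by (simp add: spec_def)
      then show ?thesis
        using 1 by (intro factor[of "[:- t, 1:]"]) (auto simp: poly_eq_0_iff_dvd)
    next
      case (2 u v)
      define b where "b = a - u *\<^sub>R 1"
      have sb: "star b = b"
        by (simp add: b_def assms(1))
      have e: "pev [:u\<^sup>2 + v\<^sup>2, - 2 * u, 1:] a = b * b + v\<^sup>2 *\<^sub>R 1"
        by (simp add: b_def algebra_simps power2_eq_square scaleR_2 flip: scaleR_scaleR)
      have "invertible_op (b * b + v\<^sup>2 *\<^sub>R 1)"
        using 2(1) square_nonneg[OF sb] sb by (intro invertible_op_bounded_below[of _ "v\<^sup>2"]) auto
      then show ?thesis
        using 2(2) e by (intro factor[of "[:u\<^sup>2 + v\<^sup>2, - 2 * u, 1:]"]) auto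
    qed
  qed
qed

lemma zero_algebra: "(1 :: 'a :: chilbert_space cop) = 0 \<Longrightarrow> x = (0 :: 'a cop)"
  by (metis mult_1_left mult_zero_left)

text \<open>If \<open>c = N\<^sup>2 - b * b\<close> had an inverse \<open>d\<close>, then
  \<open>norm \<xi>\<close> would be at most \<open>norm d * norm (app c \<xi>)\<close>, while the
  square of the last norm is at most \<open>2 * N\<^sup>2\<close> times \<open>N\<^sup>2 * (norm
  \<xi>)\<^sup>2 - (norm (app b \<xi>))\<^sup>2\<close>. This pushes the norm of \<open>b\<close>
  strictly below \<open>N\<close>. The conclusion \<open>1 = 0\<close> leaves room for the zero
  space, where the spectrum is empty.\<close>

lemma norm_in_spectrum:
  fixes b :: "'a :: chilbert_space cop"
  assumes "star b = b" "invertible_op (b - norm b *\<^sub>R 1)" "invertible_op (b + norm b *\<^sub>R 1)"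
  shows "(1 :: 'a cop) = 0"
proof (cases "norm b = 0")
  case True
  then show ?thesis
    using assms(2) by (auto simp: invertible_op_def)
next
  case False
  define N where "N = norm b"
  define c where "c = N\<^sup>2 *\<^sub>R 1 - b * b"
  have N: "N > 0"
    using False by (simp add: N_def)
  have "c = - ((b - N *\<^sub>R 1) * (b + N *\<^sub>R 1))"
    by (simp add: c_def algebra_simps power2_eq_square)
  then have "invertible_op c"
    using invertible_op_minus[OF invertible_op_mult[OF assms(2,3)]] by (simp add: N_def)
  then obtain d where d: "d * c = 1"
    by (auto simp: invertible_op_def)
  \<comment> \<open>The estimate produces \<open>2 * N\<^sup>2 * (norm d)\<^sup>2\<close>; the
    summand 1 makes the constant positive.\<close>
  define K where "K = 2 * N\<^sup>2 * (norm d)\<^sup>2 + 1"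
  have K: "K > 0"
    by (simp add: K_def add_nonneg_pos)
  have "(norm (app b \<xi>))\<^sup>2 \<le> (N\<^sup>2 - 1 / K) * (norm \<xi>)\<^sup>2" for \<xi>
  proof -
    have bb: "(norm (app b (app b \<xi>)))\<^sup>2 \<le> N\<^sup>2 * (norm (app b \<xi>))\<^sup>2"
      unfolding N_def power_mult_distrib[symmetric] by (intro power_mono norm_app) auto
    have s: "inner \<xi> (app b (app b \<xi>)) = (norm (app b \<xi>))\<^sup>2"
      by (simp add: inner_app_right assms(1) power2_norm_eq_inner)
    have "(norm (app c \<xi>))\<^sup>2 = N ^ 4 * (norm \<xi>)\<^sup>2 - 2 * N\<^sup>2 * inner \<xi> (app b (app b \<xi>)) +
        (norm (app b (app b \<xi>)))\<^sup>2"
    proof -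
      have "(norm (\<eta> - \<zeta>))\<^sup>2 = (norm \<eta>)\<^sup>2 - 2 * inner \<eta> \<zeta> + (norm \<zeta>)\<^sup>2" for \<eta> \<zeta> :: 'a
        by (simp add: power2_norm_eq_inner inner_diff_left inner_diff_right inner_commute)
      from this[of "N\<^sup>2 *\<^sub>R \<xi>" "app b (app b \<xi>)"] show ?thesis
        by (simp add: c_def power_mult_distrib)
    qed
    also have "\<dots> \<le> 2 * N\<^sup>2 * (N\<^sup>2 * (norm \<xi>)\<^sup>2 - (norm (app b \<xi>))\<^sup>2)"
    proof -
      have "(norm (app b \<xi>))\<^sup>2 \<le> N\<^sup>2 * (norm \<xi>)\<^sup>2"
        unfolding N_def power_mult_distrib[symmetric] by (intro power_mono norm_app) auto
      then have "N\<^sup>2 * (norm (app b \<xi>))\<^sup>2 \<le> N\<^sup>2 * (N\<^sup>2 * (norm \<xi>)\<^sup>2)"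
        by (intro mult_left_mono) auto
      then show ?thesis
        using bb unfolding s by (simp add: algebra_simps power4_eq_xxxx power2_eq_square)
    qed
    finally have c: "(norm (app c \<xi>))\<^sup>2 \<le> 2 * N\<^sup>2 * (N\<^sup>2 * (norm \<xi>)\<^sup>2 - (norm (app b \<xi>))\<^sup>2)" .
    have diff: "0 \<le> N\<^sup>2 * (norm \<xi>)\<^sup>2 - (norm (app b \<xi>))\<^sup>2"
      using c N zero_le_power2[of "norm (app c \<xi>)"]
      by (metis (no_types, lifting) mult_pos_pos order_trans zero_le_mult_iff zero_less_numeral
          zero_less_power not_less)
    have "norm \<xi> = norm (app d (app c \<xi>))"
      using d by (metis app_mult app_one)
    also have "\<dots> \<le> norm d * norm (app c \<xi>)"
      by (rule norm_app)
    finally have "(norm \<xi>)\<^sup>2 \<le> (norm d)\<^sup>2 * (norm (app c \<xi>))\<^sup>2"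
      unfolding power_mult_distrib[symmetric] by (intro power_mono) auto
    also have "\<dots> \<le> (norm d)\<^sup>2 * (2 * N\<^sup>2 * (N\<^sup>2 * (norm \<xi>)\<^sup>2 - (norm (app b \<xi>))\<^sup>2))"
      by (intro mult_left_mono c) auto
    also have "\<dots> \<le> K * (N\<^sup>2 * (norm \<xi>)\<^sup>2 - (norm (app b \<xi>))\<^sup>2)"
      using diff by (simp add: K_def algebra_simps)
    finally show ?thesis
      using K by (simp add: field_simps)
  qed
  note bd = this
  define L where "L = sqrt (max 0 (N\<^sup>2 - 1 / K))"
  have "norm b \<le> L"
  proof (rule norm_cop_bound)
    fix \<xi>
    have "(norm (app b \<xi>))\<^sup>2 \<le> (L * norm \<xi>)\<^sup>2"
      using bd[of \<xi>] mult_right_mono[of "N\<^sup>2 - 1 / K" "max 0 (N\<^sup>2 - 1 / K)" "(norm \<xi>)\<^sup>2"]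
      by (simp add: L_def power_mult_distrib)
    then show "norm (app b \<xi>) \<le> L * norm \<xi>"
      by (rule power2_le_imp_le) (simp add: L_def)
  qed (simp add: L_def)
  then have "N\<^sup>2 \<le> L\<^sup>2"
    using N by (simp add: N_def power_mono)
  then have False
    using N K by (simp add: L_def max_def split: if_splits)
  then show ?thesis ..
qed

text \<open>If the norm \<open>N\<close> of \<open>pev q a\<close> exceeded \<open>B\<close>,
  neither \<open>q - N\<close> nor \<open>q + N\<close> would vanish on the spectrum. Both shifts of
  \<open>pev q a\<close> would be invertible, against \<open>norm_in_spectrum\<close>.\<close>

lemma norm_pev_le:
  assumes "star a = a" "0 \<le> B" "\<And>t. t \<in> spec a \<Longrightarrow> \<bar>poly q t\<bar> \<le> B"
  shows "norm (pev q a) \<le> B"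
proof (cases "(1 :: 'a cop) = 0")
  case True
  then show ?thesis
    using zero_algebra[OF True, of "pev q a"] assms(2) by simp
next
  case False
  show ?thesis
  proof (rule ccontr)
    define N where "N = norm (pev q a)"
    assume "\<not> norm (pev q a) \<le> B"
    then have N: "N > B"
      by (simp add: N_def)
    \<comment> \<open>A point of the spectrum is needed to exclude that \<open>q - [:N:]\<close> or
      \<open>q + [:N:]\<close> is the zero polynomial.\<close>
    have "norm a \<in> spec a \<or> - norm a \<in> spec a"
      using False norm_in_spectrum[OF assms(1)] by (auto simp: spec_def)
    then obtain t where t: "t \<in> spec a"
      by blast
    have "invertible_op (pev (q - [:N:]) a)"
    proof (rule invertible_pev[OF assms(1)])
      show "q - [:N:] \<noteq> 0"
        using assms(3)[OF t] N by auto
    qed (use assms(3) N in fastforce)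
    moreover have "invertible_op (pev (q + [:N:]) a)"
    proof (rule invertible_pev[OF assms(1)])
      show "q + [:N:] \<noteq> 0"
      proof
        assume "q + [:N:] = 0"
        then have "poly (q + [:N:]) t = 0"
          by simp
        then show False
          using assms(3)[OF t] N by auto
      qed
    qed (use assms(3) N assms(2) in fastforce)
    ultimately show False
      using norm_in_spectrum[OF star_pev[OF assms(1), of q]] False by (simp add: N_def)
  qed
qed

lemma weierstrass_poly:
  fixes f :: "real \<Rightarrow> real"
  assumes "continuous_on UNIV f"
  obtains q :: "nat \<Rightarrow> real poly" where "uniform_limit {- K..K} (\<lambda>n. poly (q n)) f sequentially"
proof -
  have "\<exists>q :: real poly. \<forall>x\<in>{- K..K}. \<bar>poly q x - f x\<bar> < 1 / real (Suc n)" for n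
  proof -
    obtain g where g: "real_polynomial_function g" "\<And>x. x \<in> {- K..K} \<Longrightarrow> \<bar>f x - g x\<bar> < 1 / real (Suc n)"
      by (rule Stone_Weierstrass_real_polynomial_function[of "{- K..K}" f "1 / real (Suc n)"])
        (use continuous_on_subset[OF assms] in auto)
    obtain a N where "g = (\<lambda>x. \<Sum>i\<le>(N::nat). a i * x ^ i)"
      using g(1) real_polynomial_function_iff_sum by auto
    then have "poly (\<Sum>i\<le>N. monom (a i) i) = g"
      by (simp add: fun_eq_iff poly_sum poly_monom)
    then show ?thesis
      using g(2) by (intro exI[of _ "\<Sum>i\<le>N. monom (a i) i"]) (auto simp: abs_minus_commute)
  qed
  then obtain q where q: "\<And>n x. x \<in> {- K..K} \<Longrightarrow> \<bar>poly (q n) x - f x\<bar> < 1 / real (Suc n)"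
    by metis
  have "uniform_limit {- K..K} (\<lambda>n. poly (q n)) f sequentially"
  proof (rule uniform_limitI)
    fix e :: real assume "e > 0"
    then obtain N where N: "1 / real (Suc N) < e"
      using nat_approx_posE by blast
    have "\<bar>poly (q n) x - f x\<bar> < e" if "n \<ge> N" "x \<in> {- K..K}" for n x
    proof -
      have "1 / real (Suc n) \<le> 1 / real (Suc N)"
        using that by (simp add: field_simps)
      then show ?thesis
        using q[OF that(2), of n] N by linarith
    qed
    then show "\<forall>\<^sub>F n in sequentially. \<forall>x\<in>{- K..K}. dist (poly (q n) x) (f x) < e"
      unfolding eventually_sequentially dist_real_def by blast
  qed
  then show ?thesis
    using that by blast
qed

text \<open>Mirrors \<open>fun_op\<close>, including the limit along every approximating sequence,
  so that the two can be identified in \<open>fun_op_Rep_cop\<close>.\<close>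

definition fc :: "(real \<Rightarrow> real) \<Rightarrow> 'a :: chilbert_space cop \<Rightarrow> 'a cop" where
  "fc f a = (SOME b. \<forall>q. uniform_limit (spec a) (\<lambda>n. poly (q n)) f sequentially \<longrightarrow>
     (\<lambda>n. pev (q n) a) \<longlonglongrightarrow> b)"

text \<open>By \<open>norm_pev_le\<close>, evaluation at \<open>a\<close> is a contraction for the
  uniform norm on the spectrum. Hence the approximants form a Cauchy sequence, and any two
  approximating sequences have the same limit.\<close>

lemma fc_exists:
  assumes "star a = a" "continuous_on UNIV f"
  shows "\<exists>b. \<forall>q. uniform_limit (spec a) (\<lambda>n. poly (q n)) f sequentially \<longrightarrow>
    (\<lambda>n. pev (q n) a) \<longlonglongrightarrow> b"
proof -
  obtain p where "uniform_limit {- norm a..norm a} (\<lambda>n. poly (p n)) f sequentially"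
    using weierstrass_poly[OF assms(2)] by blast
  then have p: "uniform_limit (spec a) (\<lambda>n. poly (p n)) f sequentially"
    by (rule uniform_limit_on_subset) (use spec_norm_bound[OF assms(1)] in \<open>force simp: abs_le_iff\<close>)
  have near: "\<forall>\<^sub>F n in sequentially. \<forall>m\<ge>n. norm (pev (q m) a - pev (r m) a) \<le> e"
    if q: "uniform_limit (spec a) (\<lambda>n. poly (q n)) f sequentially"
      and r: "uniform_limit (spec a) (\<lambda>n. poly (r n)) f sequentially" and e: "e > 0" for q r e
  proof -
    have "\<forall>\<^sub>F n in sequentially. \<forall>x\<in>spec a. dist (poly (q n) x) (f x) < e / 2"
      "\<forall>\<^sub>F n in sequentially. \<forall>x\<in>spec a. dist (poly (r n) x) (f x) < e / 2"
      using uniform_limitD[OF q, of "e / 2"] uniform_limitD[OF r, of "e / 2"] e by auto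
    then have "\<forall>\<^sub>F n in sequentially. norm (pev (q n) a - pev (r n) a) \<le> e"
    proof eventually_elim
      case (elim n)
      have "\<bar>poly (q n) x - poly (r n) x\<bar> \<le> e" if "x \<in> spec a" for x
        using bspec[OF elim(1) that] bspec[OF elim(2) that] unfolding dist_real_def by linarith
      then show ?case
        using norm_pev_le[OF assms(1), of e "q n - r n"] e by simp
    qed
    then show ?thesis
      by (rule eventually_all_ge_at_top)
  qed
  have "Cauchy (\<lambda>n. pev (p n) a)"
  proof (rule metric_CauchyI)
    fix e :: real assume e: "e > 0"
    then have "\<forall>\<^sub>F n in sequentially. \<forall>x\<in>spec a. dist (poly (p n) x) (f x) < e / 4"
      using uniform_limitD[OF p, of "e / 4"] by auto
    then obtain N where N: "\<And>n x. n \<ge> N \<Longrightarrow> x \<in> spec a \<Longrightarrow> \<bar>poly (p n) x - f x\<bar> < e / 4"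
      by (auto simp: eventually_sequentially dist_real_def)
    have triangle: "\<bar>u - v\<bar> \<le> e / 2" if "\<bar>u - w\<bar> < e / 4" "\<bar>v - w\<bar> < e / 4" for u v w :: real
      using that by linarith
    have "dist (pev (p m) a) (pev (p n) a) < e" if "m \<ge> N" "n \<ge> N" for m n
    proof -
      have "\<bar>poly (p m - p n) x\<bar> \<le> e / 2" if "x \<in> spec a" for x
        unfolding poly_diff
        by (rule triangle[OF N[OF \<open>m \<ge> N\<close> that] N[OF \<open>n \<ge> N\<close> that]])
      then have "norm (pev (p m - p n) a) \<le> e / 2"
        using e by (intro norm_pev_le[OF assms(1)]) auto
      then show ?thesis
        using e by (simp add: dist_norm)
    qed
    then show "\<exists>M. \<forall>m\<ge>M. \<forall>n\<ge>M. dist (pev (p m) a) (pev (p n) a) < e"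
      by blast
  qed
  then obtain b where b: "(\<lambda>n. pev (p n) a) \<longlonglongrightarrow> b"
    using Cauchy_convergent convergent_def by blast
  have "(\<lambda>n. pev (q n) a) \<longlonglongrightarrow> b"
    if q: "uniform_limit (spec a) (\<lambda>n. poly (q n)) f sequentially" for q
  proof -
    have "(\<lambda>n. pev (q n) a - pev (p n) a) \<longlonglongrightarrow> 0"
    proof (rule tendsto_norm_zero_cancel, rule LIMSEQ_I)
      fix e :: real assume "e > 0"
      then have "\<forall>\<^sub>F n in sequentially. \<forall>m\<ge>n. norm (pev (q m) a - pev (p m) a) \<le> e / 2"
        by (intro near[OF q p]) auto
      then obtain n0 where "\<forall>m\<ge>n0. norm (pev (q m) a - pev (p m) a) \<le> e / 2"
        by (auto simp: eventually_sequentially)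
      then show "\<exists>n0. \<forall>n\<ge>n0. norm (norm (pev (q n) a - pev (p n) a) - 0) < e"
        using \<open>e > 0\<close> by (intro exI[of _ n0]) force
    qed
    from tendsto_add[OF this b] show ?thesis
      by simp
  qed
  then show ?thesis
    by blast
qed

lemma fc_limit_spec:
  assumes "star a = a" "continuous_on UNIV f"
    and "uniform_limit (spec a) (\<lambda>n. poly (q n)) f sequentially"
  shows "(\<lambda>n. pev (q n) a) \<longlonglongrightarrow> fc f a"
  unfolding fc_def using someI_ex[OF fc_exists[OF assms(1,2)]] assms(3) by blast

text \<open>Uniform convergence on an interval, rather than on one spectrum, lets the same
  polynomials serve two operators at once, as in \<open>fc_intertwine\<close> and
  \<open>t_fc_eq\<close>.\<close>

lemma fc_limit:
  assumes "star a = a" "continuous_on UNIV f" "norm a \<le> K"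
    and "uniform_limit {- K..K} (\<lambda>n. poly (q n)) f sequentially"
  shows "(\<lambda>n. pev (q n) a) \<longlonglongrightarrow> fc f a"
  by (rule fc_limit_spec[OF assms(1,2)], rule uniform_limit_on_subset[OF assms(4)])
    (use spec_norm_bound[OF assms(1)] assms(3) in \<open>force simp: abs_le_iff\<close>)

lemma fc_poly:
  assumes "star a = a"
  shows "fc (poly q) a = pev q a"
proof -
  have "continuous_on UNIV (poly q)"
    by (intro continuous_intros)
  then have "(\<lambda>n. pev q a) \<longlonglongrightarrow> fc (poly q) a"
    by (intro fc_limit_spec[OF assms]) (auto simp: uniform_limit_iff)
  then show ?thesis
    using LIMSEQ_unique tendsto_const by blast
qed

lemma fc_cong:
  assumes "\<And>t. t \<in> spec a \<Longrightarrow> f t = g t"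
  shows "fc f a = fc g a"
proof -
  have "uniform_limit (spec a) (\<lambda>n. poly (q n)) f sequentially =
      uniform_limit (spec a) (\<lambda>n. poly (q n)) g sequentially" for q
    by (rule uniform_limit_cong') (use assms in auto)
  then show ?thesis
    by (simp add: fc_def)
qed

lemma fc_intertwine:
  assumes "star a = a" "star b = b" "continuous_on UNIV f" "x * a = b * x"
  shows "x * fc f a = fc f b * x"
proof -
  define K where "K = max (norm a) (norm b)"
  obtain q where q: "uniform_limit {- K..K} (\<lambda>n. poly (q n)) f sequentially"
    using weierstrass_poly[OF assms(3)] by blast
  have "(\<lambda>n. x * pev (q n) a) \<longlonglongrightarrow> x * fc f a" "(\<lambda>n. pev (q n) b * x) \<longlonglongrightarrow> fc f b * x"
    using fc_limit[OF assms(1,3) _ q] fc_limit[OF assms(2,3) _ q]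
    by (auto simp: K_def intro!: tendsto_intros)
  then show ?thesis
    using pev_intertwine[OF assms(4)] LIMSEQ_unique by simp
qed

lemma star_fc:
  assumes "star a = a" "continuous_on UNIV f"
  shows "star (fc f a) = fc f a"
proof -
  obtain q where q: "uniform_limit {- norm a..norm a} (\<lambda>n. poly (q n)) f sequentially"
    using weierstrass_poly[OF assms(2)] by blast
  note l = fc_limit[OF assms order_refl q]
  show ?thesis
    using LIMSEQ_unique[OF tendsto_star[OF l]] l by (simp add: star_pev assms(1))
qed

lemma fc_add:
  assumes "star a = a" "continuous_on UNIV f" "continuous_on UNIV g"
  shows "fc (\<lambda>t. f t + g t) a = fc f a + fc g a"
proof -
  obtain q where q: "uniform_limit {- norm a..norm a} (\<lambda>n. poly (q n)) f sequentially"
    using weierstrass_poly[OF assms(2)] by blast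
  obtain r where r: "uniform_limit {- norm a..norm a} (\<lambda>n. poly (r n)) g sequentially"
    using weierstrass_poly[OF assms(3)] by blast
  have "uniform_limit {- norm a..norm a} (\<lambda>n. poly (q n + r n)) (\<lambda>t. f t + g t) sequentially"
    using uniform_limit_add[OF q r] by (simp only: poly_add[abs_def])
  then have "(\<lambda>n. pev (q n + r n) a) \<longlonglongrightarrow> fc (\<lambda>t. f t + g t) a"
    by (intro fc_limit[OF assms(1) _ order_refl] continuous_intros assms)
  moreover have "(\<lambda>n. pev (q n + r n) a) \<longlonglongrightarrow> fc f a + fc g a"
    using tendsto_add[OF fc_limit[OF assms(1,2) order_refl q] fc_limit[OF assms(1,3) order_refl r]]
    by simp
  ultimately show ?thesis
    using LIMSEQ_unique by blast
qed

lemma fc_mult: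
  assumes "star a = a" "continuous_on UNIV f" "continuous_on UNIV g"
  shows "fc (\<lambda>t. f t * g t) a = fc f a * fc g a"
proof -
  obtain q where q: "uniform_limit {- norm a..norm a} (\<lambda>n. poly (q n)) f sequentially"
    using weierstrass_poly[OF assms(2)] by blast
  obtain r where r: "uniform_limit {- norm a..norm a} (\<lambda>n. poly (r n)) g sequentially"
    using weierstrass_poly[OF assms(3)] by blast
  have bdd: "bounded (f ` {- norm a..norm a})" "bounded (g ` {- norm a..norm a})"
    by (intro compact_imp_bounded compact_continuous_image
        continuous_on_subset[OF assms(2)] continuous_on_subset[OF assms(3)]; simp)+
  have "uniform_limit {- norm a..norm a} (\<lambda>n. poly (q n * r n)) (\<lambda>t. f t * g t) sequentially"
    using bounded_bilinear.bounded_uniform_limit[OF bounded_bilinear_mult q r bdd(2,1)]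
    by (simp only: poly_mult[abs_def])
  then have "(\<lambda>n. pev (q n * r n) a) \<longlonglongrightarrow> fc (\<lambda>t. f t * g t) a"
    by (intro fc_limit[OF assms(1) _ order_refl] continuous_intros assms)
  moreover have "(\<lambda>n. pev (q n * r n) a) \<longlonglongrightarrow> fc f a * fc g a"
    using tendsto_mult[OF fc_limit[OF assms(1,2) order_refl q] fc_limit[OF assms(1,3) order_refl r]]
    by simp
  ultimately show ?thesis
    using LIMSEQ_unique by blast
qed

lemma fc_const: "star a = a \<Longrightarrow> fc (\<lambda>_. c) a = c *\<^sub>R 1"
  using fc_poly[of a "[:c:]"] fc_cong[of a "poly [:c:]" "\<lambda>_. c"] by simp

lemma fc_id: "star a = a \<Longrightarrow> fc (\<lambda>t. t) a = a"
  using fc_poly[of a "[:0, 1:]"] fc_cong[of a "poly [:0, 1:]" "\<lambda>t. t"] by simp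

lemma fc_scale:
  assumes "star a = a" "continuous_on UNIV f"
  shows "fc (\<lambda>t. c * f t) a = c *\<^sub>R fc f a"
  using fc_mult[OF assms(1) continuous_on_const assms(2), of c] by (simp add: fc_const assms(1))

lemma fc_diff:
  assumes "star a = a" "continuous_on UNIV f" "continuous_on UNIV g"
  shows "fc (\<lambda>t. f t - g t) a = fc f a - fc g a"
  using fc_add[OF assms(1,2), of "\<lambda>t. (- 1) * g t"] fc_scale[OF assms(1,3), of "- 1"] assms(3)
  by (simp add: continuous_on_minus)

lemma fc_commute:
  assumes "star a = a" "continuous_on UNIV f" "x * a = a * x"
  shows "x * fc f a = fc f a * x"
  by (rule fc_intertwine[OF assms(1,1,2,3)])

text \<open>On the spectrum \<open>f\<close> is the square of \<open>sqrt (max 0 f)\<close>, so the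
  value is the square of a self-adjoint operator.\<close>

lemma fc_nonneg:
  assumes "star a = a" "continuous_on UNIV f" "\<And>t. t \<in> spec a \<Longrightarrow> 0 \<le> f t"
  shows "0 \<le> fc f a"
proof -
  define g where "g t = sqrt (max 0 (f t))" for t
  have g: "continuous_on UNIV g"
    unfolding g_def by (intro continuous_intros assms)
  have "fc f a = fc (\<lambda>t. g t * g t) a"
    by (rule fc_cong) (use assms(3) in \<open>auto simp: g_def\<close>)
  also have "\<dots> = fc g a * fc g a"
    by (rule fc_mult[OF assms(1) g g])
  finally show ?thesis
    by (simp add: square_nonneg star_fc assms(1) g)
qed

lemma fc_mono:
  assumes "star a = a" "continuous_on UNIV f" "continuous_on UNIV g"
    and "\<And>t. t \<in> spec a \<Longrightarrow> f t \<le> g t"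
  shows "fc f a \<le> fc g a"
  using fc_nonneg[OF assms(1), of "\<lambda>t. g t - f t"] fc_diff[OF assms(1,3,2)] assms
  by (simp add: continuous_on_diff)

lemma norm_fc_le:
  assumes "star a = a" "continuous_on UNIV f" "0 \<le> B" "\<And>t. t \<in> spec a \<Longrightarrow> \<bar>f t\<bar> \<le> B"
  shows "norm (fc f a) \<le> B"
proof (rule self_adjoint_norm_bound)
  show "star (fc f a) = fc f a"
    by (rule star_fc[OF assms(1,2)])
  show "fc f a \<le> B *\<^sub>R 1"
    using fc_mono[OF assms(1,2) continuous_on_const, of B] assms(4)
    by (force simp: fc_const assms(1))
  show "- (B *\<^sub>R 1) \<le> fc f a"
    using fc_mono[OF assms(1) continuous_on_const assms(2), of "- B"] assms(4)
    by (force simp: fc_const assms(1))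
qed fact

lemma spec_subset:
  assumes "m *\<^sub>R 1 \<le> a" "a \<le> M *\<^sub>R 1" "star a = a"
  shows "spec a \<subseteq> {m..M}"
  using spec_lower_bound[OF assms(3,1)] spec_upper_bound[OF assms(3,2)] by auto

lemma spec_nonneg: "0 \<le> a \<Longrightarrow> t \<in> spec a \<Longrightarrow> 0 \<le> t"
  using spec_lower_bound[of a 0 t] by (simp add: star_nonneg)

section \<open>Finite factors\<close>

text \<open>\<open>t\<close> plays the role of the real part of the trace.\<close>

locale fin_factor =
  fixes M :: "'a :: chilbert_space cop set" and t :: "'a cop \<Rightarrow> real"
  assumes add_closed: "x \<in> M \<Longrightarrow> y \<in> M \<Longrightarrow> x + y \<in> M"
    and mult_closed: "x \<in> M \<Longrightarrow> y \<in> M \<Longrightarrow> x * y \<in> M"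
    and scalar_in: "scalar a \<in> M"
    and star_closed: "x \<in> M \<Longrightarrow> star x \<in> M"
    and strongly_closed: "(\<And>n. X n \<in> M) \<Longrightarrow> (\<And>\<xi>. (\<lambda>n. app (X n) \<xi>) \<longlonglongrightarrow> app x \<xi>) \<Longrightarrow> x \<in> M"
    and prime: "x \<in> M \<Longrightarrow> y \<in> M \<Longrightarrow> (\<And>z. z \<in> M \<Longrightarrow> x * z * y = 0) \<Longrightarrow> x = 0 \<or> y = 0"
    and center: "x \<in> M \<Longrightarrow> (\<And>y. y \<in> M \<Longrightarrow> x * y = y * x) \<Longrightarrow> \<exists>c. x = scalar c"
    and t_add: "x \<in> M \<Longrightarrow> y \<in> M \<Longrightarrow> t (x + y) = t x + t y"
    and t_scaleR: "x \<in> M \<Longrightarrow> t (r *\<^sub>R x) = r * t x"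
    and t_star: "x \<in> M \<Longrightarrow> t (star x) = t x"
    and t_comm: "x \<in> M \<Longrightarrow> y \<in> M \<Longrightarrow> t (x * y) = t (y * x)"
    and t_one: "t 1 = 1"
    and t_nonneg: "x \<in> M \<Longrightarrow> 0 \<le> x \<Longrightarrow> 0 \<le> t x"
    and t_faithful: "x \<in> M \<Longrightarrow> 0 \<le> x \<Longrightarrow> t x = 0 \<Longrightarrow> x = 0"

section \<open>The notions of the statement expressed in \<open>cop\<close>, and finite factors as
  instances of \<open>fin_factor\<close>\<close>

lemma scalar_minus: "scalar (- a) = - scalar a"
  by (rule cop_eqI) (simp add: scaleC_scaleC flip: scaleC_minus_one)

lemma Rep_cop_in [simp]: "Rep_cop x \<in> bounded_ops"
  by (rule Rep_cop)

lemma adj_op_Rep_cop: "adj_op (Rep_cop x) = Rep_cop (star x)"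
  unfolding adj_op_def
proof (rule the_equality)
  show "Rep_cop (star x) \<in> bounded_ops \<and>
      (\<forall>\<xi> \<eta>. cinner (blinfun_apply (Rep_cop x) \<xi>) \<eta> = cinner \<xi> (blinfun_apply (Rep_cop (star x)) \<eta>))"
    using cinner_app[of x] by (simp add: app_def)
next
  fix S assume S: "S \<in> bounded_ops \<and>
      (\<forall>\<xi> \<eta>. cinner (blinfun_apply (Rep_cop x) \<xi>) \<eta> = cinner \<xi> (blinfun_apply S \<eta>))"
  then have "star x = Abs_cop S"
    by (intro star_unique) (simp add: app_def Abs_cop_inverse)
  then show "S = Rep_cop (star x)"
    using S by (simp add: Abs_cop_inverse)
qed

lemma positive_op_Rep_cop: "positive_op (Rep_cop x) \<longleftrightarrow> 0 \<le> x"
  by (simp add: positive_op_def less_eq_cop_def app_def)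

lemma projection_op_Rep_cop: "projection_op (Rep_cop x) \<longleftrightarrow> x * x = x \<and> star x = x"
  by (simp add: projection_op_def adj_op_Rep_cop Rep_cop_inject flip: times_cop.rep_eq)

lemma closure_subspace:
  fixes S :: "'a :: real_normed_vector set"
  assumes "subspace S"
  shows "subspace (closure S)"
  unfolding subspace_def
proof (intro conjI ballI allI)
  show "0 \<in> closure S"
    using subspace_0[OF assms] closure_subset by blast
next
  fix x y assume "x \<in> closure S" "y \<in> closure S"
  then obtain f g where "\<And>n. f n \<in> S" "f \<longlonglongrightarrow> x" "\<And>n. g n \<in> S" "g \<longlonglongrightarrow> y"
    by (metis closure_sequential)
  then show "x + y \<in> closure S"
    unfolding closure_sequential
    by (intro exI[of _ "\<lambda>n. f n + g n"]) (auto intro: tendsto_intros subspace_add[OF assms])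
next
  fix r :: real and x assume "x \<in> closure S"
  then obtain f where "\<And>n. f n \<in> S" "f \<longlonglongrightarrow> x"
    by (metis closure_sequential)
  then show "r *\<^sub>R x \<in> closure S"
    unfolding closure_sequential
    by (intro exI[of _ "\<lambda>n. r *\<^sub>R f n"]) (auto intro: tendsto_intros subspace_scale[OF assms])
qed

lemma closed_subspace_projection:
  fixes S :: "'a :: chilbert_space set"
  assumes "closed S" "subspace S" "\<And>a \<xi>. \<xi> \<in> S \<Longrightarrow> a *\<^sub>C \<xi> \<in> S"
  obtains E where "star E = E" "\<And>\<xi>. app E \<xi> \<in> S" "\<And>\<xi>. \<xi> \<in> S \<Longrightarrow> app E \<xi> = \<xi>"
proof -
  define f where "f \<xi> = (SOME z. z \<in> S \<and> (\<forall>\<eta>\<in>S. inner (\<xi> - z) \<eta> = 0))" for \<xi>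
  have "f \<xi> \<in> S \<and> (\<forall>\<eta>\<in>S. inner (\<xi> - f \<xi>) \<eta> = 0)" for \<xi>
  proof -
    obtain z where "z \<in> S" "\<And>\<eta>. \<eta> \<in> S \<Longrightarrow> inner (\<xi> - z) \<eta> = 0"
      by (rule orthogonal_projection_exists[OF assms(1,2), where x = \<xi>]) auto
    then have "\<exists>z. z \<in> S \<and> (\<forall>\<eta>\<in>S. inner (\<xi> - z) \<eta> = 0)"
      by blast
    then show ?thesis
      unfolding f_def by (rule someI_ex)
  qed
  then have f: "\<And>\<xi>. f \<xi> \<in> S" "\<And>\<xi> \<eta>. \<eta> \<in> S \<Longrightarrow> inner (\<xi> - f \<xi>) \<eta> = 0"
    by auto
  have cf: "cinner (\<xi> - f \<xi>) \<eta> = 0" if "\<eta> \<in> S" for \<xi> \<eta>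
    using f(2)[of \<eta> \<xi>] f(2)[OF assms(3)[OF that, of \<i>], of \<xi>] that
    by (simp add: complex_eq_iff inner_eq_Re_cinner cinner_scaleC_right)
  \<comment> \<open>Membership and orthogonality determine the chosen value, and linearity of
    \<open>f\<close> follows from this uniqueness.\<close>
  have uniq: "f \<xi> = \<zeta>" if "\<zeta> \<in> S" "\<And>\<eta>. \<eta> \<in> S \<Longrightarrow> inner (\<xi> - \<zeta>) \<eta> = 0" for \<xi> \<zeta>
  proof -
    have "f \<xi> - \<zeta> \<in> S"
      by (intro subspace_diff assms f that)
    then have "inner (f \<xi> - \<zeta>) (f \<xi> - \<zeta>) = 0"
      using f(2)[of "f \<xi> - \<zeta>" \<xi>] that(2)[of "f \<xi> - \<zeta>"] by (simp add: inner_diff_left)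
    then show ?thesis
      by simp
  qed
  have "f (\<xi> + \<eta>) = f \<xi> + f \<eta>" for \<xi> \<eta>
  proof (rule uniq)
    fix \<zeta> assume "\<zeta> \<in> S"
    then show "inner (\<xi> + \<eta> - (f \<xi> + f \<eta>)) \<zeta> = 0"
      using f(2)[of \<zeta> \<xi>] f(2)[of \<zeta> \<eta>] by (simp add: inner_diff_left inner_add_left)
  qed (intro subspace_add assms f)
  moreover have "f (a *\<^sub>C \<xi>) = a *\<^sub>C f \<xi>" for a \<xi>
  proof (rule uniq)
    fix \<zeta> assume "\<zeta> \<in> S"
    then show "inner (a *\<^sub>C \<xi> - a *\<^sub>C f \<xi>) \<zeta> = 0"
      using cf[of \<zeta> \<xi>] by (simp add: inner_eq_Re_cinner cinner_scaleC_left flip: scaleC_diff_right)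
  qed (intro assms f)
  moreover have "norm (f \<xi>) \<le> 1 * norm \<xi>" for \<xi>
  proof (cases "f \<xi> = 0")
    case False
    have "norm (f \<xi>) * norm (f \<xi>) = inner \<xi> (f \<xi>)"
      using f(2)[OF f(1), of \<xi> \<xi>] by (simp add: inner_diff_left power2_eq_square flip: power2_norm_eq_inner)
    also have "\<dots> \<le> norm \<xi> * norm (f \<xi>)"
      by (rule norm_cauchy_schwarz)
    finally show ?thesis
      using False by simp
  qed auto
  ultimately obtain E where E: "\<And>\<xi>. app E \<xi> = f \<xi>"
    using cop_from_linear[of f 1] by blast
  have "cinner (f \<xi>) \<eta> = cinner \<xi> (f \<eta>)" for \<xi> \<eta>
  proof -
    have "cinner (f \<xi>) \<eta> = cinner (f \<xi>) (f \<eta>)"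
      using cf[OF f(1), of \<eta> \<xi>] cinner_commute[of "\<eta> - f \<eta>" "f \<xi>"]
      by (metis cinner_commute cinner_diff_left complex_cnj_cancel_iff eq_iff_diff_eq_0)
    also have "\<dots> = cinner \<xi> (f \<eta>)"
      using cf[OF f(1), of \<xi> \<eta>] by (simp add: cinner_diff_left)
    finally show ?thesis .
  qed
  then have "star E = E"
    by (intro star_unique) (simp add: E)
  moreover have "f \<xi> = \<xi>" if "\<xi> \<in> S" for \<xi>
    using that by (intro uniq) auto
  ultimately show ?thesis
    using that E f(1) by auto
qed

definition comm :: "'a :: chilbert_space cop set \<Rightarrow> 'a cop set" where
  "comm A = {x. \<forall>y\<in>A. x * y = y * x}"

lemma comm_star: "(\<And>x. x \<in> A \<Longrightarrow> star x \<in> A) \<Longrightarrow> x \<in> comm A \<Longrightarrow> star x \<in> comm A"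
proof -
  assume A: "\<And>x. x \<in> A \<Longrightarrow> star x \<in> A" and x: "x \<in> comm A"
  have "star x * y = y * star x" if "y \<in> A" for y
  proof -
    have "x * star y = star y * x"
      using x A[OF that] by (simp add: comm_def)
    then have "star (x * star y) = star (star y * x)"
      by (rule arg_cong)
    then show ?thesis
      by simp
  qed
  then show "star x \<in> comm A"
    by (simp add: comm_def)
qed

text \<open>The projection \<open>E\<close> onto the closed span of the ranges of all
  \<open>z * y\<close> commutes with \<open>N\<close> and with the commutant of \<open>N\<close>. By
  the bicommutant property it is a central element of \<open>N\<close>, hence scalar, and it is 1
  because \<open>y\<close> is not 0. Now \<open>x\<close> vanishes on the range of
  \<open>E\<close>.\<close>

lemma bicommutant_prime:
  assumes bic: "comm (comm N) = N" and st: "\<And>x. x \<in> N \<Longrightarrow> star x \<in> N"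
    and cen: "\<And>x. x \<in> N \<Longrightarrow> x \<in> comm N \<Longrightarrow> \<exists>c. x = scalar c"
    and xy: "x \<in> N" "y \<in> N" "\<And>z. z \<in> N \<Longrightarrow> x * z * y = 0"
  shows "x = 0 \<or> y = 0"
proof (cases "y = 0")
  case False
  have inN: "u \<in> N" if "\<And>w. w \<in> comm N \<Longrightarrow> u * w = w * u" for u
  proof -
    have "u \<in> comm (comm N)"
      using that by (simp add: comm_def[of "comm N"])
    then show ?thesis
      by (simp only: bic)
  qed
  have mul: "u * v \<in> N" if "u \<in> N" "v \<in> N" for u v
  proof -
    have "u * v * w = w * (u * v)" if w: "w \<in> comm N" for w
    proof -
      have "v * w = w * v" "u * w = w * u"
        using w \<open>u \<in> N\<close> \<open>v \<in> N\<close> by (auto simp: comm_def)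
      then show ?thesis
        by (metis mult.assoc)
    qed
    then show ?thesis
      by (rule inN)
  qed
  define G where "G = {app (z * y) \<xi> | z \<xi>. z \<in> N}"
  define S where "S = closure (span G)"
  have closure_map: "app T \<zeta> \<in> S" if "\<And>\<xi>. \<xi> \<in> G \<Longrightarrow> app T \<xi> \<in> G" "\<zeta> \<in> S" for T \<zeta>
  proof -
    have "app T \<zeta> \<in> span G" if "\<zeta> \<in> span G" for \<zeta>
      using that
    proof (induction rule: span_induct_alt)
      case (step c b v)
      then show ?case
        using \<open>\<And>\<xi>. \<xi> \<in> G \<Longrightarrow> app T \<xi> \<in> G\<close> by (auto intro: span_add span_scale span_base)
    qed (auto intro: span_zero)
    then have "app T ` span G \<subseteq> span G"
      by blast
    then have "app T ` closure (span G) \<subseteq> closure (span G)"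
      using image_closure_subset[of "span G" "app T" "closure (span G)"]
        linear_continuous_on[OF bounded_linear_app] closure_subset by fastforce
    then show ?thesis
      using that(2) by (auto simp: S_def)
  qed
  have "a *\<^sub>C \<xi> \<in> S" if "\<xi> \<in> S" for a \<xi>
  proof -
    have "app (scalar a) \<xi> \<in> S"
    proof (rule closure_map[OF _ that])
      fix \<zeta> assume "\<zeta> \<in> G"
      then obtain z \<eta> where "\<zeta> = app (z * y) \<eta>" "z \<in> N"
        unfolding G_def by blast
      then have "app (scalar a) \<zeta> = app (z * y) (a *\<^sub>C \<eta>)"
        by simp
      then show "app (scalar a) \<zeta> \<in> G"
        using \<open>z \<in> N\<close> unfolding G_def by blast
    qed
    then show ?thesis
      by simp
  qed
  then obtain E where E: "star E = E" "\<And>\<xi>. app E \<xi> \<in> S" "\<And>\<xi>. \<xi> \<in> S \<Longrightarrow> app E \<xi> = \<xi>"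
    using closed_subspace_projection[of S] closure_subspace[OF subspace_span]
    by (metis S_def closed_closure)
  \<comment> \<open>A projection commutes with \<open>T\<close> as soon as its range is invariant
    under both \<open>T\<close> and the adjoint of \<open>T\<close>.\<close>
  have commE: "E * T = T * E"
    if "\<And>\<xi>. \<xi> \<in> G \<Longrightarrow> app T \<xi> \<in> G" "\<And>\<xi>. \<xi> \<in> G \<Longrightarrow> app (star T) \<xi> \<in> G" for T
  proof -
    have "E * T * E = T * E" "E * star T * E = star T * E"
      by (rule cop_eqI; simp add: E closure_map that)+
    then show ?thesis
      by (metis E(1) mult.assoc star_mult star_star)
  qed
  have NG: "app T \<xi> \<in> G" if "T \<in> N" "\<xi> \<in> G" for T \<xi>
  proof -
    obtain z \<eta> where z: "\<xi> = app (z * y) \<eta>" "z \<in> N"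
      using \<open>\<xi> \<in> G\<close> unfolding G_def by blast
    have "T * z \<in> N"
      by (rule mul[OF that(1) z(2)])
    moreover have "app T \<xi> = app (T * z * y) \<eta>"
      using z(1) by simp
    ultimately show ?thesis
      unfolding G_def by blast
  qed
  have CG: "app T \<xi> \<in> G" if "T \<in> comm N" "\<xi> \<in> G" for T \<xi>
  proof -
    obtain z \<eta> where z: "\<xi> = app (z * y) \<eta>" "z \<in> N"
      using \<open>\<xi> \<in> G\<close> unfolding G_def by blast
    have "T * (z * y) = (z * y) * T"
      using that(1) mul[OF z(2) xy(2)] unfolding comm_def by auto
    then have "app T \<xi> = app (z * y) (app T \<eta>)"
      using z(1) by (metis app_mult)
    then show ?thesis
      using z(2) unfolding G_def by blast
  qed
  have "E \<in> comm N"
    unfolding comm_def using commE NG st by auto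
  moreover have "E \<in> N"
    using commE CG comm_star[OF st] by (intro inN) auto
  ultimately obtain c where c: "E = scalar c"
    using cen by blast
  obtain \<xi> where \<xi>: "app y \<xi> \<noteq> 0"
    using False cop_eqI[of y 0] by auto
  have one: "1 \<in> N"
    by (intro inN) simp
  have "app y \<xi> \<in> G"
    unfolding G_def using one mult_1_left[of y] by force
  then have "app y \<xi> \<in> S"
    unfolding S_def using span_base closure_subset by blast
  from E(3)[OF this] have "(c - 1) *\<^sub>C app y \<xi> = 0"
    using scaleC_add_left[of "c - 1" 1 "app y \<xi>"] by (simp add: c)
  then have "c = 1"
    using \<xi> norm_scaleC[of "c - 1" "app y \<xi>"] by auto
  then have S: "\<zeta> \<in> S" for \<zeta>
    using E(2)[of \<zeta>] by (simp add: c)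
  have "app x \<zeta> = 0" for \<zeta>
  proof -
    have "span G \<subseteq> {\<zeta>. app x \<zeta> = 0}"
    proof (rule span_minimal)
      show "G \<subseteq> {\<zeta>. app x \<zeta> = 0}"
      proof
        fix \<zeta> assume "\<zeta> \<in> G"
        then obtain z \<eta> where z: "\<zeta> = app (z * y) \<eta>" "z \<in> N"
          unfolding G_def by blast
        then have "app x \<zeta> = app (x * z * y) \<eta>"
          by simp
        then show "\<zeta> \<in> {\<zeta>. app x \<zeta> = 0}"
          using xy(3)[OF z(2)] by simp
      qed
    qed (auto simp: subspace_def)
    moreover have "closed {\<zeta>. app x \<zeta> = 0}"
      by (intro closed_Collect_eq linear_continuous_on[OF bounded_linear_app] continuous_intros)
    ultimately have "S \<subseteq> {\<zeta>. app x \<zeta> = 0}"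
      unfolding S_def by (rule closure_minimal)
    then show ?thesis
      using S by blast
  qed
  then show ?thesis
    using cop_eqI[of x 0] by simp
qed simp

lemma commutant_Rep_cop: "commutant (Rep_cop ` N) = Rep_cop ` comm N"
proof (intro set_eqI iffI)
  fix T assume T: "T \<in> commutant (Rep_cop ` N)"
  then have "T = Rep_cop (Abs_cop T)"
    by (simp add: commutant_def Abs_cop_inverse)
  moreover have "Abs_cop T \<in> comm N"
    using T calculation by (auto simp: commutant_def comm_def simp flip: Rep_cop_inject times_cop.rep_eq)
      (metis times_cop.rep_eq)
  ultimately show "T \<in> Rep_cop ` comm N"
    by blast
next
  fix T assume "T \<in> Rep_cop ` comm N"
  then show "T \<in> commutant (Rep_cop ` N)"
    by (auto simp: commutant_def comm_def simp flip: times_cop.rep_eq)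
qed

text \<open>An element belongs to \<open>N\<close> once it commutes with the commutant, a condition
  stable under the algebraic operations and strong limits. The trace is real on self-adjoint
  elements because these become positive after adding a multiple of 1; this lets the real part of
  the trace stand for the trace on projections.\<close>

lemma fin_factor_of_finite_factor:
  assumes "finite_factor M \<tau>"
  defines "N \<equiv> {x. Rep_cop x \<in> M}"
  shows "fin_factor N (\<lambda>x. Re (\<tau> (Rep_cop x)))" "Rep_cop ` N = M"
    "\<And>x. x \<in> N \<Longrightarrow> star x = x \<Longrightarrow> \<tau> (Rep_cop x) \<in> \<real>"
proof -
  have F: "factor M" "tracial_state M \<tau>" "faithful_state M \<tau>"
    using assms(1) by (simp_all add: finite_factor_def)
  have V: "von_neumann_algebra M" and cenM: "M \<inter> commutant M = range (\<lambda>a. scale_op a id_blinfun)"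
    using F(1) by (simp_all add: factor_def)
  have sub: "M \<subseteq> bounded_ops" and adj: "\<And>A. A \<in> M \<Longrightarrow> adj_op A \<in> M"
    and bicM: "commutant (commutant M) = M"
    using V by (simp_all add: von_neumann_algebra_def)
  have tadd: "\<And>A B. A \<in> M \<Longrightarrow> B \<in> M \<Longrightarrow> \<tau> (A + B) = \<tau> A + \<tau> B"
    and tsc: "\<And>a A. A \<in> M \<Longrightarrow> \<tau> (scale_op a A) = a * \<tau> A"
    and tpos: "\<And>A. A \<in> M \<Longrightarrow> positive_op A \<Longrightarrow> \<tau> A \<in> \<real>\<^sub>\<ge>\<^sub>0"
    and tone: "\<tau> id_blinfun = 1"
    and tcomm: "\<And>A B. A \<in> M \<Longrightarrow> B \<in> M \<Longrightarrow> \<tau> (A o\<^sub>L B) = \<tau> (B o\<^sub>L A)"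
    using F(2) unfolding tracial_state_def by (elim conjE; simp)+
  have tf: "\<And>A. A \<in> M \<Longrightarrow> positive_op A \<Longrightarrow> \<tau> A = 0 \<Longrightarrow> A = 0"
    using F(3) by (simp add: faithful_state_def)
  show RN: "Rep_cop ` N = M"
    using sub by (auto simp: N_def image_iff) (metis Abs_cop_inverse subsetD)
  have bic: "comm (comm N) = N"
  proof -
    have "Rep_cop ` comm (comm N) = Rep_cop ` N"
      using bicM by (simp add: RN flip: commutant_Rep_cop)
    then show ?thesis
      by (simp add: inj_image_eq_iff inj_def Rep_cop_inject)
  qed
  have inN: "u \<in> N" if "\<And>w. w \<in> comm N \<Longrightarrow> u * w = w * u" for u
  proof -
    have "u \<in> comm (comm N)"
      using that by (simp add: comm_def[of "comm N"])
    then show ?thesis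
      by (simp only: bic)
  qed
  have st: "star x \<in> N" if "x \<in> N" for x
    using adj[of "Rep_cop x"] that by (simp add: N_def adj_op_Rep_cop)
  have cen: "\<exists>c. x = scalar c" if "x \<in> N" "x \<in> comm N" for x
  proof -
    have "Rep_cop x \<in> M \<inter> commutant M"
      using that RN commutant_Rep_cop[of N] by auto
    then obtain c where "Rep_cop x = scale_op c id_blinfun"
      unfolding cenM by blast
    then have "x = scalar c"
      by (simp flip: Rep_cop_inject add: scalar.rep_eq)
    then show ?thesis ..
  qed
  have mul: "x * y \<in> N" and ad: "x + y \<in> N" if "x \<in> N" "y \<in> N" for x y
  proof -
    have c: "u * w = w * u" if "w \<in> comm N" "u \<in> N" for u w
      using that by (auto simp: comm_def)
    have "x * y * w = w * (x * y)" "(x + y) * w = w * (x + y)" if "w \<in> comm N" for w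
      using c[OF that \<open>x \<in> N\<close>] c[OF that \<open>y \<in> N\<close>] by (metis mult.assoc, simp add: algebra_simps)
    then show "x * y \<in> N" "x + y \<in> N"
      by (simp_all add: inN)
  qed
  have sc: "scalar a \<in> N" for a
    by (intro inN scalar_commute)
  have scale: "scale_op a (Rep_cop x) = Rep_cop (scalar a * x)" for a x
    by (rule blinfun_eqI) (simp add: times_cop.rep_eq scalar.rep_eq)
  have one: "1 \<in> N"
    using sc[of 1] by simp
  have tr_scale: "\<tau> (Rep_cop (scalar a * x)) = a * \<tau> (Rep_cop x)" if "x \<in> N" for a x
    using tsc[of "Rep_cop x" a] that by (simp add: N_def scale)
  have tr_add: "\<tau> (Rep_cop (x + y)) = \<tau> (Rep_cop x) + \<tau> (Rep_cop y)" if "x \<in> N" "y \<in> N" for x y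
    using tadd that by (simp add: N_def plus_cop.rep_eq)
  have tr_pos: "\<tau> (Rep_cop x) \<in> \<real>\<^sub>\<ge>\<^sub>0" if "x \<in> N" "0 \<le> x" for x
    using tpos that by (simp add: N_def positive_op_Rep_cop)
  have tr_sub: "\<tau> (Rep_cop (x - y)) = \<tau> (Rep_cop x) - \<tau> (Rep_cop y)" if "x \<in> N" "y \<in> N" for x y
    using tr_add[OF that(1) mul[OF sc[of "-1"] that(2)]] tr_scale[OF that(2), of "- 1"] by simp
  show sa: "\<tau> (Rep_cop x) \<in> \<real>" if "x \<in> N" "star x = x" for x
  proof -
    define y where "y = scalar (of_real (norm x)) * (1 :: 'a cop)"
    have y: "y \<in> N"
      unfolding y_def by (intro mul sc one)
    have "0 \<le> x + y"
      using add_right_mono[OF self_adjoint_le_norm(2)[OF that(2)], of y]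
      by (simp add: y_def scalar_of_real)
    moreover have "0 \<le> y"
      by (simp add: y_def scalar_of_real scaleR_nonneg_nonneg)
    ultimately have "\<tau> (Rep_cop (x + y)) \<in> \<real>\<^sub>\<ge>\<^sub>0" "\<tau> (Rep_cop y) \<in> \<real>\<^sub>\<ge>\<^sub>0"
      using tr_pos[OF ad[OF that(1) y]] tr_pos[OF y] by auto
    then show ?thesis
      using tr_add[OF that(1) y] by (auto simp: complex_nonneg_Reals_iff complex_is_Real_iff)
  qed
  show "fin_factor N (\<lambda>x. Re (\<tau> (Rep_cop x)))"
  proof
    fix x y :: "'a cop" and a :: complex and r :: real
    show "x \<in> N \<Longrightarrow> y \<in> N \<Longrightarrow> x + y \<in> N" "x \<in> N \<Longrightarrow> y \<in> N \<Longrightarrow> x * y \<in> N"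
      "scalar a \<in> N" "x \<in> N \<Longrightarrow> star x \<in> N"
      by (fact ad mul sc st)+
    show "x \<in> N" if "\<And>n. X n \<in> N" "\<And>\<xi>. (\<lambda>n. app (X n) \<xi>) \<longlonglongrightarrow> app x \<xi>" for X
    proof -
      have "x * z = z * x" if "z \<in> comm N" for z
      proof (rule cop_eqI)
        fix \<xi>
        have "app (X n) (app z \<xi>) = app z (app (X n) \<xi>)" for n
        proof -
          have "z * X n = X n * z"
            using that \<open>\<And>n. X n \<in> N\<close> by (auto simp: comm_def)
          then show ?thesis
            by (metis app_mult)
        qed
        moreover have "(\<lambda>n. app z (app (X n) \<xi>)) \<longlonglongrightarrow> app z (app x \<xi>)"
          by (intro bounded_linear.tendsto[OF bounded_linear_app] that \<open>\<And>\<xi>. (\<lambda>n. app (X n) \<xi>) \<longlonglongrightarrow> app x \<xi>\<close>)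
        ultimately show "app (x * z) \<xi> = app (z * x) \<xi>"
          using LIMSEQ_unique[OF \<open>\<And>\<xi>. (\<lambda>n. app (X n) \<xi>) \<longlonglongrightarrow> app x \<xi>\<close>[of "app z \<xi>"]] by simp
      qed
      then show ?thesis
        by (rule inN)
    qed
    show "x \<in> N \<Longrightarrow> y \<in> N \<Longrightarrow> (\<And>z. z \<in> N \<Longrightarrow> x * z * y = 0) \<Longrightarrow> x = 0 \<or> y = 0"
      by (rule bicommutant_prime[OF bic st cen])
    show "x \<in> N \<Longrightarrow> (\<And>y. y \<in> N \<Longrightarrow> x * y = y * x) \<Longrightarrow> \<exists>c. x = scalar c"
      by (rule cen) (auto simp: comm_def)
    show "x \<in> N \<Longrightarrow> y \<in> N \<Longrightarrow> Re (\<tau> (Rep_cop (x + y))) = Re (\<tau> (Rep_cop x)) + Re (\<tau> (Rep_cop y))"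
      by (simp add: tr_add)
    show "x \<in> N \<Longrightarrow> Re (\<tau> (Rep_cop (r *\<^sub>R x))) = r * Re (\<tau> (Rep_cop x))"
      by (simp add: scaleR_eq_scalar tr_scale)
    show "x \<in> N \<Longrightarrow> y \<in> N \<Longrightarrow> Re (\<tau> (Rep_cop (x * y))) = Re (\<tau> (Rep_cop (y * x)))"
      using tcomm by (simp add: N_def times_cop.rep_eq)
    show "Re (\<tau> (Rep_cop 1)) = 1"
      by (simp add: one_cop.rep_eq tone)
    show "x \<in> N \<Longrightarrow> 0 \<le> x \<Longrightarrow> 0 \<le> Re (\<tau> (Rep_cop x))"
      using tr_pos by (auto simp: complex_nonneg_Reals_iff)
    show "x = 0" if "x \<in> N" "0 \<le> x" "Re (\<tau> (Rep_cop x)) = 0"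
    proof -
      have "\<tau> (Rep_cop x) = 0"
        using tr_pos[OF that(1,2)] that(3) by (auto simp: complex_nonneg_Reals_iff complex_eq_iff)
      then have "Rep_cop x = 0"
        using tf[of "Rep_cop x"] that by (simp add: N_def positive_op_Rep_cop)
      then show ?thesis
        by (simp flip: Rep_cop_inject add: zero_cop.rep_eq)
    qed
    show "Re (\<tau> (Rep_cop (star x))) = Re (\<tau> (Rep_cop x))" if "x \<in> N"
    proof -
      \<comment> \<open>\<open>z\<close> is self-adjoint, so its trace is real. Its trace is
        \<open>\<i>\<close> times the difference of the traces of \<open>x\<close> and
        \<open>star x\<close>, whose real part is therefore 0.\<close>
      define z where "z = scalar \<i> * (x - star x)"
      have "x - star x = x + scalar (- 1) * star x"
        by simp
      then have d: "x - star x \<in> N"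
        using that by (metis ad mul sc st)
      have "z \<in> N"
        unfolding z_def by (rule mul[OF sc d])
      moreover have "star z = z"
        unfolding z_def by (simp add: algebra_simps scalar_minus scalar_commute[of \<i>])
      ultimately have "\<tau> (Rep_cop z) \<in> \<real>"
        by (rule sa)
      then show ?thesis
        using tr_scale[OF d, of \<i>] tr_sub[OF that st[OF that]] by (simp add: z_def complex_is_Real_iff)
    qed
  qed
qed

section \<open>Absolute values, powers and the p-norm through the functional calculus\<close>

lemma pev_pcompose: "pev (pcompose q r) a = pev q (pev r a)"
  by (induction q) (simp_all add: pcompose_pCons)

text \<open>The instance of the composition rule that rewrites the p-th power of the absolute value
  of \<open>x\<close> as the power p/2 of \<open>x * x\<close>, so that absolute values disappear
  from the argument.\<close>

lemma fc_square:
  assumes "star c = c" "continuous_on UNIV f"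
  shows "fc f (c * c) = fc (\<lambda>s. f (s * s)) c"
proof -
  define K where "K = max (norm c * norm c) (norm c)"
  have K: "norm c \<le> K" "norm (c * c) \<le> K"
    using norm_mult_ineq[of c c] by (auto simp: K_def)
  obtain q where q: "uniform_limit {- K * K..K * K} (\<lambda>n. poly (q n)) f sequentially"
    using weierstrass_poly[OF assms(2), of "K * K"] by auto
  have q': "uniform_limit (spec (c * c)) (\<lambda>n. poly (q n)) f sequentially"
  proof (rule uniform_limit_on_subset[OF q], rule subsetI)
    fix s assume s: "s \<in> spec (c * c)"
    have "0 \<le> s"
      using s spec_nonneg square_nonneg[OF assms(1)] by blast
    moreover have "s \<le> norm c * norm c"
      using spec_norm_bound[OF _ s] norm_mult_ineq[of c c] assms(1) by auto
    moreover have "norm c * norm c \<le> K * K"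
      by (intro mult_mono K) (auto intro: order_trans[OF _ K(1)])
    ultimately show "s \<in> {- K * K..K * K}"
      by auto
  qed
  have "uniform_limit (spec c) (\<lambda>n. poly (pcompose (q n) [:0, 0, 1:])) (\<lambda>s. f (s * s)) sequentially"
  proof (rule uniform_limitI)
    fix e :: real assume "e > 0"
    from uniform_limitD[OF q this]
    show "\<forall>\<^sub>F n in sequentially. \<forall>x\<in>spec c. dist (poly (pcompose (q n) [:0, 0, 1:]) x) (f (x * x)) < e"
    proof eventually_elim
      case (elim n)
      show ?case
      proof
        fix x assume x: "x \<in> spec c"
        have "\<bar>x\<bar> * \<bar>x\<bar> \<le> K * K"
          using spec_norm_bound[OF assms(1) x] K(1) by (intro mult_mono) auto
        moreover have "0 \<le> K * K"
          by simp
        ultimately have "x * x \<in> {- K * K..K * K}"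
          using zero_le_square[of x] by (simp add: abs_mult_self_eq)
        then show "dist (poly (pcompose (q n) [:0, 0, 1:]) x) (f (x * x)) < e"
          using bspec[OF elim, of "x * x"] by (simp add: poly_pcompose)
      qed
    qed
  qed
  then have "(\<lambda>n. pev (pcompose (q n) [:0, 0, 1:]) c) \<longlonglongrightarrow> fc (\<lambda>s. f (s * s)) c"
    by (intro fc_limit_spec assms continuous_on_compose2[OF assms(2)] continuous_intros) auto
  moreover have "(\<lambda>n. pev (q n) (c * c)) \<longlonglongrightarrow> fc f (c * c)"
    by (intro fc_limit_spec assms q') (simp add: assms(1))
  ultimately show ?thesis
    using LIMSEQ_unique by (simp add: pev_pcompose)
qed

lemma Rep_cop_sum: "Rep_cop (sum f A) = (\<Sum>i\<in>A. Rep_cop (f i))"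
  by (induction A rule: infinite_finite_induct) (simp_all add: zero_cop.rep_eq plus_cop.rep_eq)

lemma poly_op_Rep_cop: "poly_op q (Rep_cop a) = Rep_cop (pev q a)"
proof -
  have "(((o\<^sub>L) (Rep_cop a)) ^^ i) id_blinfun = Rep_cop (a ^ i)" for i
    by (induction i) (simp_all add: one_cop.rep_eq times_cop.rep_eq)
  then show ?thesis
    by (simp add: poly_op_def pev_altdef Rep_cop_sum scaleR_cop.rep_eq)
qed

lemma op_spectrum_Rep_cop: "{s. complex_of_real s \<in> op_spectrum (Rep_cop a)} = spec a"
proof -
  have e: "Rep_cop a - scale_op (complex_of_real s) id_blinfun = Rep_cop (a - s *\<^sub>R 1)" for s
    by (simp add: minus_cop.rep_eq scalar.rep_eq flip: scalar_of_real)
  have inv: "(\<exists>S\<in>bounded_ops. S o\<^sub>L Rep_cop b = id_blinfun \<and> Rep_cop b o\<^sub>L S = id_blinfun) \<longleftrightarrow> invertible_op b"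
    for b :: "'a cop"
    unfolding invertible_op_def
  proof
    assume "\<exists>S\<in>bounded_ops. S o\<^sub>L Rep_cop b = id_blinfun \<and> Rep_cop b o\<^sub>L S = id_blinfun"
    then obtain S where S: "S \<in> bounded_ops" "S o\<^sub>L Rep_cop b = id_blinfun" "Rep_cop b o\<^sub>L S = id_blinfun"
      by blast
    have "Abs_cop S * b = 1" "b * Abs_cop S = 1"
      using S by (simp_all flip: Rep_cop_inject add: times_cop.rep_eq one_cop.rep_eq Abs_cop_inverse)
    then show "\<exists>c. c * b = 1 \<and> b * c = 1"
      by blast
  next
    assume "\<exists>c. c * b = 1 \<and> b * c = 1"
    then obtain c where "c * b = 1" "b * c = 1"
      by blast
    then show "\<exists>S\<in>bounded_ops. S o\<^sub>L Rep_cop b = id_blinfun \<and> Rep_cop b o\<^sub>L S = id_blinfun"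
      by (intro bexI[of _ "Rep_cop c"]) (simp_all flip: times_cop.rep_eq one_cop.rep_eq)
  qed
  show ?thesis
    by (simp only: op_spectrum_def spec_def e mem_Collect_eq inv)
qed

lemma tendsto_Rep_cop: "(\<lambda>n. Rep_cop (X n)) \<longlonglongrightarrow> Rep_cop x \<longleftrightarrow> X \<longlonglongrightarrow> x"
  by (simp add: tendsto_dist_iff[of X] tendsto_dist_iff[of "\<lambda>n. Rep_cop (X n)"] dist_norm
      norm_cop.rep_eq minus_cop.rep_eq)

text \<open>Agreement on the spectrum suffices. Thus \<open>s powr p\<close>, which matters only for
  nonnegative \<open>s\<close>, may be replaced by a function continuous on the whole line, as the
  lemmas on \<open>fc\<close> require.\<close>

lemma fun_op_Rep_cop:
  assumes "star a = a" "continuous_on UNIV g" "\<And>s. s \<in> spec a \<Longrightarrow> f s = g s"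
  shows "fun_op f (Rep_cop a) = Rep_cop (fc g a)"
  unfolding fun_op_def op_spectrum_Rep_cop poly_op_Rep_cop
proof (rule the_equality)
  have cong: "uniform_limit (spec a) (\<lambda>n. poly (q n)) f sequentially \<longleftrightarrow>
      uniform_limit (spec a) (\<lambda>n. poly (q n)) g sequentially" for q
    by (rule uniform_limit_cong') (use assms in auto)
  show main: "\<forall>q. uniform_limit (spec a) (\<lambda>n. poly (q n)) f sequentially \<longrightarrow>
      (\<lambda>n. Rep_cop (pev (q n) a)) \<longlonglongrightarrow> Rep_cop (fc g a)"
    using fc_limit_spec[OF assms(1,2)] by (simp add: tendsto_Rep_cop cong)
  fix S assume S: "\<forall>q. uniform_limit (spec a) (\<lambda>n. poly (q n)) f sequentially \<longrightarrow>
      (\<lambda>n. Rep_cop (pev (q n) a)) \<longlonglongrightarrow> S"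
  obtain q where "uniform_limit {- norm a..norm a} (\<lambda>n. poly (q n)) g sequentially"
    using weierstrass_poly[OF assms(2)] by blast
  then have "uniform_limit (spec a) (\<lambda>n. poly (q n)) g sequentially"
    by (rule uniform_limit_on_subset) (use spec_norm_bound[OF assms(1)] in \<open>force simp: abs_le_iff\<close>)
  then show "S = Rep_cop (fc g a)"
    using S main LIMSEQ_unique unfolding cong by blast
qed

text \<open>Cutting off at 0 makes the power continuous on the whole line for positive exponents. In
  the end the exponent is p/2.\<close>

definition pw :: "real \<Rightarrow> real \<Rightarrow> real" where
  "pw q s = (max 0 s) powr q"

lemma continuous_pw: "q > 0 \<Longrightarrow> continuous_on UNIV (pw q)"
  unfolding pw_def by (intro continuous_on_powr' continuous_intros) auto

lemma pw_0 [simp]: "pw q 0 = 0" and pw_1 [simp]: "pw q 1 = 1"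
  by (simp_all add: pw_def)

lemma pw_nonneg [simp]: "0 \<le> pw q s"
  by (simp add: pw_def)

lemma Lp_norm_Rep_cop:
  assumes "star x = x" "p > 0"
  shows "Lp_norm \<tau> p (Rep_cop x) = Re (\<tau> (Rep_cop (fc (pw (p / 2)) (x * x)))) powr (1 / p)"
proof -
  define c where "c = fc sqrt (x * x)"
  have sx: "star (x * x) = x * x"
    by (simp add: assms)
  have cs: "continuous_on UNIV sqrt"
    by (intro continuous_intros)
  have x0: "0 \<le> x * x"
    using square_nonneg assms by blast
  have "abs_op (Rep_cop x) = Rep_cop c"
    unfolding abs_op_def adj_op_Rep_cop assms(1) times_cop.rep_eq[symmetric] c_def
    by (rule fun_op_Rep_cop[OF sx cs refl])
  have c0: "0 \<le> c" and sc: "star c = c"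
    unfolding c_def by (intro fc_nonneg star_fc sx cs; use spec_nonneg[OF x0] in auto)+
  have cc: "c * c = x * x"
  proof -
    have "c * c = fc (\<lambda>s. sqrt s * sqrt s) (x * x)"
      unfolding c_def by (rule fc_mult[OF sx cs cs, symmetric])
    also have "\<dots> = fc (\<lambda>s. s) (x * x)"
      by (rule fc_cong) (use spec_nonneg[OF x0] in auto)
    finally show ?thesis
      by (simp only: fc_id[OF sx])
  qed
  have pw2: "pw (p / 2) (s * s) = \<bar>s\<bar> powr p" for s
  proof -
    have "max 0 (s * s) = \<bar>s\<bar> powr 2"
      by (cases "s = 0") (simp_all add: powr_numeral power2_eq_square)
    then have "pw (p / 2) (s * s) = (\<bar>s\<bar> powr 2) powr (p / 2)"
      by (simp only: pw_def)
    then show ?thesis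
      by (simp only: powr_powr) simp
  qed
  have "fun_op (\<lambda>s. s powr p) (Rep_cop c) = Rep_cop (fc (\<lambda>s. pw (p / 2) (s * s)) c)"
  proof (rule fun_op_Rep_cop[OF sc])
    show "continuous_on UNIV (\<lambda>s. pw (p / 2) (s * s))"
      by (rule continuous_on_compose2[OF continuous_pw]) (use assms(2) in \<open>auto intro: continuous_intros\<close>)
    show "s powr p = pw (p / 2) (s * s)" if "s \<in> spec c" for s
      using spec_nonneg[OF c0 that] by (simp add: pw2)
  qed
  also have "\<dots> = Rep_cop (fc (pw (p / 2)) (x * x))"
    using fc_square[OF sc continuous_pw, of "p / 2"] assms(2) by (simp add: cc)
  finally show ?thesis
    by (simp add: Lp_norm_def \<open>abs_op (Rep_cop x) = Rep_cop c\<close>)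
qed

section \<open>Closure properties and trace inequalities in a finite factor\<close>

context fin_factor
begin

lemma one_in [simp]: "1 \<in> M"
  using scalar_in[of 1] by simp

lemma scaleR_closed [simp]: "x \<in> M \<Longrightarrow> r *\<^sub>R x \<in> M"
  by (simp add: scaleR_eq_scalar mult_closed scalar_in)

lemma zero_in [simp]: "0 \<in> M"
  using scaleR_closed[OF one_in, of 0] by simp

lemma minus_closed [simp]: "x \<in> M \<Longrightarrow> - x \<in> M"
  using scaleR_closed[of x "- 1"] by simp

lemma diff_closed [simp]: "x \<in> M \<Longrightarrow> y \<in> M \<Longrightarrow> x - y \<in> M"
  using add_closed[of x "- y"] by simp

lemmas [simp] = add_closed mult_closed scalar_in star_closed

lemma sum_closed [simp]: "(\<And>i. i \<in> A \<Longrightarrow> f i \<in> M) \<Longrightarrow> sum f A \<in> M"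
  by (induction A rule: infinite_finite_induct) auto

lemma limit_closed: "(\<And>n. X n \<in> M) \<Longrightarrow> X \<longlonglongrightarrow> x \<Longrightarrow> x \<in> M"
  using strongly_closed[of X x] tendsto_app[of X x] by blast

lemma pev_closed [simp]: "a \<in> M \<Longrightarrow> pev q a \<in> M"
  by (induction q) simp_all

lemma fc_closed:
  assumes "a \<in> M" "star a = a" "continuous_on UNIV f"
  shows "fc f a \<in> M"
proof -
  obtain q where "uniform_limit {- norm a..norm a} (\<lambda>n. poly (q n)) f sequentially"
    using weierstrass_poly[OF assms(3)] by blast
  from fc_limit[OF assms(2,3) order_refl this] show ?thesis
    by (rule limit_closed[rotated]) (use assms(1) in simp)
qed

lemma t_zero [simp]: "t 0 = 0"
  using t_scaleR[OF zero_in, of 0] by simp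

lemma t_minus: "x \<in> M \<Longrightarrow> t (- x) = - t x"
  using t_scaleR[of x "- 1"] by simp

lemma t_diff: "x \<in> M \<Longrightarrow> y \<in> M \<Longrightarrow> t (x - y) = t x - t y"
  using t_add[of x "- y"] by (simp add: t_minus)

lemma t_sum: "(\<And>i. i \<in> A \<Longrightarrow> f i \<in> M) \<Longrightarrow> t (sum f A) = (\<Sum>i\<in>A. t (f i))"
  by (induction A rule: infinite_finite_induct) (auto simp: t_add)

lemmas t_linear = t_add t_diff t_minus t_scaleR

lemma t_mono: "x \<in> M \<Longrightarrow> y \<in> M \<Longrightarrow> x \<le> y \<Longrightarrow> t x \<le> t y"
  using t_nonneg[of "y - x"] by (simp add: t_diff)

lemma t_abs_le: "x \<in> M \<Longrightarrow> star x = x \<Longrightarrow> \<bar>t x\<bar> \<le> norm x"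
  using t_mono[of x "norm x *\<^sub>R 1"] t_mono[of "- (norm x *\<^sub>R 1)" x] self_adjoint_le_norm[of x]
  by (simp add: t_linear t_one)

lemma t_abs_le_norm:
  assumes "x \<in> M"
  shows "\<bar>t x\<bar> \<le> norm x"
proof -
  define y where "y = (1/2) *\<^sub>R (x + star x)"
  have "norm y \<le> norm x"
    using norm_triangle_ineq[of x "star x"] by (simp add: y_def)
  moreover have "t y = t x"
    using assms by (simp add: y_def t_linear t_star)
  moreover have "\<bar>t y\<bar> \<le> norm y"
    using assms by (intro t_abs_le) (simp_all add: y_def add.commute)
  ultimately show ?thesis
    by simp
qed

lemma t_tendsto:
  assumes "\<And>n. X n \<in> M" "X \<longlonglongrightarrow> x"
  shows "(\<lambda>n. t (X n)) \<longlonglongrightarrow> t x"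
proof -
  have x: "x \<in> M"
    using limit_closed assms by blast
  have "(\<lambda>n. t (X n - x)) \<longlonglongrightarrow> 0"
  proof (rule Lim_null_comparison)
    show "\<forall>\<^sub>F n in sequentially. norm (t (X n - x)) \<le> norm (X n - x)"
      using t_abs_le_norm assms(1) x by (intro always_eventually) simp
    show "(\<lambda>n. norm (X n - x)) \<longlonglongrightarrow> 0"
      using assms(2) by (simp add: LIM_zero_iff tendsto_norm_zero_iff)
  qed
  then show ?thesis
    using assms(1) x by (simp add: t_diff LIM_zero_iff)
qed

lemma t_star_mult_nonneg: "x \<in> M \<Longrightarrow> 0 \<le> t (star x * x)"
  by (simp add: t_nonneg)

lemma t_star_mult_zero: "x \<in> M \<Longrightarrow> t (star x * x) = 0 \<longleftrightarrow> x = 0"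
  using t_faithful[of "star x * x"] norm_star_mult_self[of x] by auto

lemma t_star_mult_le_zero: "x \<in> M \<Longrightarrow> t (star x * x) \<le> 0 \<Longrightarrow> x = 0"
  using t_star_mult_nonneg[of x] t_star_mult_zero[of x] by simp

lemma t_Cauchy_Schwarz:
  assumes "x \<in> M" "y \<in> M"
  shows "(t (star x * y))\<^sup>2 \<le> t (star x * x) * t (star y * y)"
proof (cases "y = 0")
  case False
  define s where "s = t (star x * y) / t (star y * y)"
  have pos: "t (star y * y) > 0"
    using t_star_mult_nonneg[OF assms(2)] t_star_mult_zero[OF assms(2)] False by linarith
  have e: "star (x - s *\<^sub>R y) * (x - s *\<^sub>R y) =
      star x * x - s *\<^sub>R (star x * y) - s *\<^sub>R (star y * x) + s\<^sup>2 *\<^sub>R (star y * y)"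
    by (simp add: algebra_simps power2_eq_square)
  have sym: "t (star y * x) = t (star x * y)"
    using t_star[of "star x * y"] assms by simp
  have "0 \<le> t (star (x - s *\<^sub>R y) * (x - s *\<^sub>R y))"
    using assms by (intro t_star_mult_nonneg) simp
  also have "\<dots> = t (star x * x) - 2 * s * t (star x * y) + s\<^sup>2 * t (star y * y)"
    unfolding e using assms by (simp add: t_linear sym)
  also have "\<dots> = t (star x * x) - (t (star x * y))\<^sup>2 / t (star y * y)"
    using pos by (simp add: s_def field_simps power2_eq_square)
  finally show ?thesis
    using pos by (simp add: field_simps)
qed simp

text \<open>Invariance of \<open>t\<close> under adjoints lets \<open>z\<close> be replaced by its
  self-adjoint part, which lies between plus and minus its norm.\<close>

lemma t_conj_le:
  assumes "x \<in> M" "z \<in> M"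
  shows "\<bar>t (star x * z * x)\<bar> \<le> norm z * t (star x * x)"
proof -
  define y where "y = (1/2) *\<^sub>R (z + star z)"
  have y: "y \<in> M" "star y = y"
    using assms by (simp_all add: y_def add.commute)
  have ny: "norm y \<le> norm z"
    using norm_triangle_ineq[of z "star z"] by (simp add: y_def)
  have ty: "t (star x * y * x) = t (star x * z * x)"
  proof -
    have "star x * y * x = (1/2) *\<^sub>R (star x * z * x + star (star x * z * x))"
      by (simp add: y_def algebra_simps)
    then show ?thesis
      using assms t_star[of "star x * z * x"] by (simp add: t_linear)
  qed
  have "t (star x * y * x) \<le> norm y * t (star x * x)"
    using t_mono[OF _ _ conj_mono[OF self_adjoint_le_norm(1)[OF y(2)]], of x] assms y
    by (simp add: t_linear)
  moreover have "- (norm y * t (star x * x)) \<le> t (star x * y * x)"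
    using t_mono[OF _ _ conj_mono[OF self_adjoint_le_norm(2)[OF y(2)]], of x] assms y
    by (simp add: t_linear)
  moreover have "norm y * t (star x * x) \<le> norm z * t (star x * x)"
    using ny assms by (intro mult_right_mono t_star_mult_nonneg)
  ultimately show ?thesis
    unfolding ty by linarith
qed

text \<open>Since \<open>f 0 = 0\<close>, approximating polynomials without constant term suffice.\<close>

lemma t_fc_eq:
  assumes a: "a \<in> M" "star a = a" and b: "b \<in> M" "star b = b"
    and f: "continuous_on UNIV f" "f 0 = 0"
    and eq: "\<And>q. t (a * pev q a) = k * t (b * pev q b)"
  shows "t (fc f a) = k * t (fc f b)"
proof -
  define K where "K = max (norm a) (norm b)"
  obtain q where q: "uniform_limit {- K..K} (\<lambda>n. poly (q n)) f sequentially"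
    using weierstrass_poly[OF f(1)] by blast
  have K0: "0 \<in> {- K..K}"
    by (auto simp: K_def intro: order_trans[OF norm_ge_zero max.cobounded1])
  define r where "r n = q n - [:poly (q n) 0:]" for n
  have r: "uniform_limit {- K..K} (\<lambda>n. poly (r n)) f sequentially"
  proof -
    have c: "uniform_limit {- K..K} (\<lambda>n x. poly (q n) 0) (\<lambda>x. f 0) sequentially"
      using tendsto_uniform_limitI[OF q K0] by (auto simp: uniform_limit_iff tendsto_iff)
    moreover have "(\<lambda>n. poly (r n)) = (\<lambda>n x. poly (q n) x - poly (q n) 0)"
      by (simp add: r_def fun_eq_iff)
    ultimately show ?thesis
      using uniform_limit_minus[OF q c] by (simp add: f(2))
  qed
  have "\<exists>g. r n = pCons 0 g" for n
  proof -
    have "poly (r n) 0 = 0"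
      by (simp add: r_def)
    then show ?thesis
      by (cases "r n") simp
  qed
  then have "t (pev (r n) a) = k * t (pev (r n) b)" for n
    using eq by (metis add_0 pev_pCons scale_zero_left)
  moreover have "(\<lambda>n. t (pev (r n) a)) \<longlonglongrightarrow> t (fc f a)" "(\<lambda>n. k * t (pev (r n) b)) \<longlonglongrightarrow> k * t (fc f b)"
    by (intro tendsto_intros t_tendsto fc_limit[OF _ f(1) _ r] a b pev_closed; simp add: K_def)+
  ultimately show ?thesis
    using LIMSEQ_unique by simp
qed

text \<open>\<open>x\<close> intertwines \<open>star x * x\<close> with \<open>x * star x\<close>,
  and under the trace it can be moved around cyclically.\<close>

lemma t_fc_star_mult:
  assumes "x \<in> M" "continuous_on UNIV f" "f 0 = 0"
  shows "t (fc f (star x * x)) = t (fc f (x * star x))"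
proof -
  have "t (star x * x * pev q (star x * x)) = 1 * t (x * star x * pev q (x * star x))" for q
  proof -
    have "x * pev q (star x * x) = pev q (x * star x) * x"
      by (rule pev_intertwine) (simp add: mult.assoc)
    then have "t (star x * x * pev q (star x * x)) = t (star x * (pev q (x * star x) * x))"
      by (simp add: mult.assoc)
    also have "\<dots> = t (pev q (x * star x) * x * star x)"
      using assms(1) by (intro t_comm) simp_all
    also have "\<dots> = t (x * star x * pev q (x * star x))"
      using t_comm[of "pev q (x * star x)" "x * star x"] assms(1) by (simp add: mult.assoc)
    finally show ?thesis
      by simp
  qed
  from t_fc_eq[OF _ _ _ _ assms(2,3) this] show ?thesis
    using assms(1) by simp
qed

end

section \<open>Strong limits and partial isometries\<close>

definition strong_limit :: "(nat \<Rightarrow> 'a :: chilbert_space cop) \<Rightarrow> 'a cop \<Rightarrow> bool" where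
  "strong_limit X x \<longleftrightarrow> (\<forall>\<xi>. (\<lambda>n. app (X n) \<xi>) \<longlonglongrightarrow> app x \<xi>)"

lemma strong_limit_unique: "strong_limit X x \<Longrightarrow> strong_limit X y \<Longrightarrow> x = y"
  unfolding strong_limit_def by (rule cop_eqI) (metis LIMSEQ_unique)

lemma strong_limit_const: "strong_limit (\<lambda>n. x) x"
  by (simp add: strong_limit_def)

lemma strong_limit_norm: "X \<longlonglongrightarrow> x \<Longrightarrow> strong_limit X x"
  by (simp add: strong_limit_def tendsto_app)

lemma strong_limit_mult_left: "strong_limit X x \<Longrightarrow> strong_limit (\<lambda>n. y * X n) (y * x)"
  unfolding strong_limit_def app_mult
  by (intro allI bounded_linear.tendsto[OF bounded_linear_app]) blast

lemma strong_limit_mult_right: "strong_limit X x \<Longrightarrow> strong_limit (\<lambda>n. X n * y) (x * y)"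
  by (simp add: strong_limit_def)

lemma strong_limit_minus: "strong_limit X x \<Longrightarrow> strong_limit (\<lambda>n. - X n) (- x)"
  by (simp add: strong_limit_def tendsto_minus)

lemma strong_limit_mult:
  assumes "strong_limit X x" "strong_limit Y y" "\<And>n. norm (X n) \<le> B"
  shows "strong_limit (\<lambda>n. X n * Y n) (x * y)"
  unfolding strong_limit_def
proof
  fix \<xi>
  have "(\<lambda>n. app (X n) (app (Y n) \<xi> - app y \<xi>)) \<longlonglongrightarrow> 0"
  proof (rule Lim_null_comparison)
    show "\<forall>\<^sub>F n in sequentially. norm (app (X n) (app (Y n) \<xi> - app y \<xi>)) \<le> B * norm (app (Y n) \<xi> - app y \<xi>)"
      by (intro always_eventually allI order_trans[OF norm_app] mult_right_mono assms) auto
    have "(\<lambda>n. B * norm (app (Y n) \<xi> - app y \<xi>)) \<longlonglongrightarrow> B * norm (app y \<xi> - app y \<xi>)"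
      using assms(2) by (intro tendsto_intros) (auto simp: strong_limit_def)
    then show "(\<lambda>n. B * norm (app (Y n) \<xi> - app y \<xi>)) \<longlonglongrightarrow> 0"
      by simp
  qed
  moreover have "(\<lambda>n. app (X n) (app y \<xi>)) \<longlonglongrightarrow> app x (app y \<xi>)"
    using assms(1) by (simp add: strong_limit_def)
  ultimately show "(\<lambda>n. app (X n * Y n) \<xi>) \<longlonglongrightarrow> app (x * y) \<xi>"
    using tendsto_add[of "\<lambda>n. app (X n) (app (Y n) \<xi> - app y \<xi>)" 0] by fastforce
qed

lemma strong_limit_exists:
  assumes "\<And>n. norm (X n) \<le> B" "\<And>\<xi>. Cauchy (\<lambda>n. app (X n) \<xi>)"
  obtains x where "strong_limit X x"
proof -
  define f where "f \<xi> = lim (\<lambda>n. app (X n) \<xi>)" for \<xi>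
  have f: "(\<lambda>n. app (X n) \<xi>) \<longlonglongrightarrow> f \<xi>" for \<xi>
    unfolding f_def using assms(2)[of \<xi>] Cauchy_convergent convergent_LIMSEQ_iff by blast
  have "f (\<xi> + \<eta>) = f \<xi> + f \<eta>" for \<xi> \<eta>
    using LIMSEQ_unique[OF f[of "\<xi> + \<eta>"]] tendsto_add[OF f[of \<xi>] f[of \<eta>]] by simp
  moreover have "f (a *\<^sub>C \<xi>) = a *\<^sub>C f \<xi>" for a \<xi>
    using LIMSEQ_unique[OF f[of "a *\<^sub>C \<xi>"]]
      bounded_linear.tendsto[OF bounded_linear_scaleC f[of \<xi>], of a] by simp
  moreover have "norm (f \<xi>) \<le> B * norm \<xi>" for \<xi>
  proof (rule Lim_norm_ubound[OF _ f])
    show "\<forall>\<^sub>F n in sequentially. norm (app (X n) \<xi>) \<le> B * norm \<xi>"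
      by (intro always_eventually allI order_trans[OF norm_app] mult_right_mono assms) auto
  qed simp
  ultimately obtain x where "\<And>\<xi>. app x \<xi> = f \<xi>"
    using cop_from_linear[of f B] by blast
  then show ?thesis
    using that[of x] f by (simp add: strong_limit_def)
qed

text \<open>The numbers \<open>inner (app (c n) \<xi>) \<xi>\<close> increase and are bounded, and
  their differences dominate the squared distances between the vectors
  \<open>app (X n) \<xi>\<close>. This serves both the polar decomposition and the exhaustion in
  \<open>comparison\<close>.\<close>

lemma Cauchy_app_of_monotone:
  assumes le: "\<And>m n. m \<le> n \<Longrightarrow> star (X n - X m) * (X n - X m) \<le> c n - c m"
    and c: "\<And>n. star (c n) = c n" "\<And>n. c n \<le> 1"
  shows "Cauchy (\<lambda>n. app (X n) \<xi>)"
proof -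
  define r where "r n = inner (app (c n) \<xi>) \<xi>" for n
  have d: "(norm (app (X n) \<xi> - app (X m) \<xi>))\<^sup>2 \<le> r n - r m" if "m \<le> n" for m n
  proof -
    have "(norm (app (X n) \<xi> - app (X m) \<xi>))\<^sup>2 =
        inner (app (X n - X m) \<xi>) (app (X n - X m) \<xi>)"
      by (simp only: power2_norm_eq_inner app_diff)
    also have "\<dots> = inner (app (star (X n - X m) * (X n - X m)) \<xi>) \<xi>"
      using inner_app[of "star (X n - X m)" "app (X n - X m) \<xi>" \<xi>]
      by (simp only: star_star app_mult)
    also have "\<dots> \<le> inner (app (c n - c m) \<xi>) \<xi>"
      using le[OF that] cop_le_iff[of "star (X n - X m) * (X n - X m)" "c n - c m"] c(1) by auto
    finally show ?thesis
      by (simp add: r_def inner_diff_left)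
  qed
  have "incseq r"
  proof (rule incseq_SucI)
    show "r n \<le> r (Suc n)" for n
      using d[of n "Suc n"] zero_le_power2[of "norm (app (X (Suc n)) \<xi> - app (X n) \<xi>)"] by linarith
  qed
  moreover have "r n \<le> (norm \<xi>)\<^sup>2" for n
    using c cop_le_iff[of "c n" 1] by (simp add: r_def power2_norm_eq_inner)
  ultimately have "convergent r"
    using incseq_convergent[of r "(norm \<xi>)\<^sup>2"] unfolding convergent_def by blast
  then have "Cauchy r"
    by (rule convergent_Cauchy)
  show ?thesis
  proof (rule metric_CauchyI)
    fix e :: real assume e: "e > 0"
    then obtain N where N: "\<And>m n. m \<ge> N \<Longrightarrow> n \<ge> N \<Longrightarrow> dist (r m) (r n) < e\<^sup>2"
      using metric_CauchyD[OF \<open>Cauchy r\<close>, of "e\<^sup>2"] by auto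
    have *: "norm (app (X n) \<xi> - app (X m) \<xi>) < e" if "m \<ge> N" "m \<le> n" for m n
    proof -
      have "(norm (app (X n) \<xi> - app (X m) \<xi>))\<^sup>2 < e\<^sup>2"
        using d[OF that(2)] N[of n m] that by (simp add: dist_real_def)
      then show ?thesis
        using e by (simp add: power2_less_imp_less)
    qed
    have "dist (app (X m) \<xi>) (app (X n) \<xi>) < e" if "m \<ge> N" "n \<ge> N" for m n
      using *[of m n] *[of n m] that by (cases "m \<le> n") (auto simp: dist_norm norm_minus_commute)
    then show "\<exists>M. \<forall>m\<ge>M. \<forall>n\<ge>M. dist (app (X m) \<xi>) (app (X n) \<xi>) < e"
      by blast
  qed
qed

text \<open>Taking adjoints is not strongly continuous, so convergence of the adjoints is a separate
  hypothesis; inner products then identify their limit.\<close>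

lemma strong_limit_star:
  assumes "strong_limit X x" "strong_limit (\<lambda>n. star (X n)) y"
  shows "y = star x"
proof -
  have "cinner (app x \<xi>) \<eta> = cinner \<xi> (app y \<eta>)" for \<xi> \<eta>
  proof -
    have i: "inner (app x \<xi>) \<eta> = inner \<xi> (app y \<eta>)" for \<xi> \<eta>
    proof (rule LIMSEQ_unique)
      show "(\<lambda>n. inner (app (X n) \<xi>) \<eta>) \<longlonglongrightarrow> inner (app x \<xi>) \<eta>"
        using assms(1) by (intro tendsto_intros) (simp add: strong_limit_def)
      show "(\<lambda>n. inner (app (X n) \<xi>) \<eta>) \<longlonglongrightarrow> inner \<xi> (app y \<eta>)"
        unfolding inner_app using assms(2) by (intro tendsto_intros) (simp add: strong_limit_def)
    qed
    show ?thesis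
      using i[of \<xi> \<eta>] i[of "\<i> *\<^sub>C \<xi>" \<eta>] by (simp add: cinner_eq_complex)
  qed
  then show ?thesis
    using star_unique by metis
qed

definition is_proj :: "'a :: chilbert_space cop \<Rightarrow> bool" where
  "is_proj e \<longleftrightarrow> e * e = e \<and> star e = e"

lemma is_proj_one_minus: "is_proj e \<Longrightarrow> is_proj (1 - e)"
  by (simp add: is_proj_def algebra_simps)

lemma is_proj_nonneg: "is_proj e \<Longrightarrow> 0 \<le> e"
  using star_mult_self_nonneg[of e] by (simp add: is_proj_def)

lemma is_proj_le_one: "is_proj e \<Longrightarrow> e \<le> 1"
  using is_proj_nonneg[OF is_proj_one_minus] by auto

lemma is_proj_norm_le: "is_proj e \<Longrightarrow> norm e \<le> 1"
  using self_adjoint_norm_bound[of e 1] is_proj_nonneg[of e] is_proj_le_one[of e]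
    order_trans[of "- 1" 0 e] by (simp add: is_proj_def)

definition partial_isometry :: "'a :: chilbert_space cop \<Rightarrow> bool" where
  "partial_isometry v \<longleftrightarrow> v * star v * v = v"

lemma partial_isometry_projs:
  assumes "partial_isometry v"
  shows "is_proj (star v * v)" "is_proj (v * star v)"
  using assms by (simp_all add: is_proj_def partial_isometry_def mult.assoc) (metis mult.assoc)+

lemma partial_isometry_star: "partial_isometry v \<Longrightarrow> partial_isometry (star v)"
proof -
  assume "partial_isometry v"
  then have "star (v * star v * v) = star v"
    by (simp add: partial_isometry_def)
  then show ?thesis
    by (simp add: partial_isometry_def mult.assoc)
qed

lemma partial_isometry_norm: "partial_isometry v \<Longrightarrow> norm v \<le> 1"
  using is_proj_norm_le[OF partial_isometry_projs(1), of v] norm_star_mult_self[of v]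
  by (simp add: power_le_one_iff)

section \<open>Polar decomposition and comparison of projections\<close>

context fin_factor
begin

lemma strong_limit_closed: "(\<And>n. X n \<in> M) \<Longrightarrow> strong_limit X x \<Longrightarrow> x \<in> M"
  unfolding strong_limit_def by (rule strongly_closed) auto

lemma strong_star_limit_exists:
  assumes M: "\<And>n. X n \<in> M" and B: "\<And>n. norm (X n) \<le> B"
    and le: "\<And>m n. m \<le> n \<Longrightarrow> star (X n - X m) * (X n - X m) \<le> c n - c m"
    and c: "\<And>n. star (c n) = c n" "\<And>n. c n \<le> 1"
    and le': "\<And>m n. m \<le> n \<Longrightarrow> (X n - X m) * star (X n - X m) \<le> d n - d m"
    and d: "\<And>n. star (d n) = d n" "\<And>n. d n \<le> 1"
  obtains x where "x \<in> M" "strong_limit X x" "strong_limit (\<lambda>n. star (X n)) (star x)"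
proof -
  obtain x where x: "strong_limit X x"
    by (rule strong_limit_exists[OF B Cauchy_app_of_monotone[OF le c]])
  have le'': "star (star (X n) - star (X m)) * (star (X n) - star (X m)) \<le> d n - d m" if "m \<le> n" for m n
    using le'[OF that] by simp
  have B': "norm (star (X n)) \<le> B" for n
    using B by simp
  obtain y where y: "strong_limit (\<lambda>n. star (X n)) y"
    by (rule strong_limit_exists[OF B' Cauchy_app_of_monotone[OF le'' d]])
  show ?thesis
    using that[of x] strong_limit_closed[OF M x] x y strong_limit_star[OF x y] by simp
qed

text \<open>\<open>v\<close> is the strong limit of \<open>a * fc (g n) (star a * a)\<close>, where
  \<open>g n s\<close> is the inverse square root of \<open>s\<close>, cut off below
  \<open>1 / Suc n\<close>. The listed properties of \<open>v\<close>, in particular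
  self-adjointness and anticommutation with \<open>s\<close>, hold for every approximant and survive
  the limit.\<close>

lemma polar_decomposition:
  assumes a: "a \<in> M"
  obtains v where "v \<in> M" "partial_isometry v" "a * (star v * v) = a"
    "\<And>e. star e = e \<Longrightarrow> a * e = a \<Longrightarrow> v * e = v" "\<And>f. f * a = a \<Longrightarrow> f * v = v"
    "star a = a \<Longrightarrow> star v = v"
    "\<And>s. star a = a \<Longrightarrow> s * a = - (a * s) \<Longrightarrow> s * v = - (v * s)"
proof -
  define g where "g n s = 1 / sqrt (max s (1 / real (Suc n)))" for n s
  define h where "h x = star x * x" for x :: "'a cop"
  have mx: "max s (1 / real (Suc n)) > 0" for n s
    by (simp add: less_max_iff_disj)
  have cg: "continuous_on UNIV (g n)" for n
    unfolding g_def using mx by (intro continuous_intros) (auto simp: less_imp_neq[symmetric])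
  have gpos: "g n s > 0" for n s
    using mx by (simp add: g_def)
  have gmono: "g m s \<le> g n s" if "m \<le> n" for m n s
  proof -
    have "max s (1 / real (Suc n)) \<le> max s (1 / real (Suc m))"
      using that by (intro max.mono) (auto simp: field_simps)
    then show ?thesis
      unfolding g_def using mx by (intro divide_left_mono) auto
  qed
  have gsq: "(g n s)\<^sup>2 = 1 / max s (1 / real (Suc n))" for n s
    using mx[of s n] by (simp add: g_def power_divide less_imp_le)
  \<comment> \<open>\<open>U n\<close> increases to the indicator function of the positive reals,
    and \<open>star (X a n) * X a n\<close> is \<open>fc (U n) (h a)\<close>; its strong limit
    \<open>star v * v\<close> is the support projection of \<open>a\<close>.\<close>
  define U where "U n s = s * (g n s * g n s)" for n s
  have cU: "continuous_on UNIV (U n)" for n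
    unfolding U_def by (intro continuous_intros cg)
  have U1: "0 \<le> U n s" "U n s \<le> 1" if "0 \<le> s" for n s
    using that mx[of s n] by (auto simp: U_def gsq simp flip: power2_eq_square)
  define X where "X x n = x * fc (g n) (h x)" for x n
  have h: "star (h x) = h x" "0 \<le> h x" for x
    by (simp_all add: h_def)
  have spec_h: "0 \<le> s" if "s \<in> spec (h x)" for s x
    using spec_nonneg h that by blast
  have XM: "X x n \<in> M" if "x \<in> M" for x n
    unfolding X_def using that h cg by (intro mult_closed fc_closed) (simp_all add: h_def)
  \<comment> \<open>The approximants belonging to \<open>star x\<close> are the adjoints of those
    belonging to \<open>x\<close>. One monotonicity estimate thus yields strong convergence of the
    approximants and of their adjoints.\<close>
  have starX: "star (X x n) = X (star x) n" for x n
  proof -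
    have "star x * fc (g n) (h (star x)) = fc (g n) (h x) * star x"
      by (rule fc_intertwine[OF h(1) h(1) cg]) (simp add: h_def mult.assoc)
    then show ?thesis
      by (simp add: X_def star_fc h cg)
  qed
  have fX: "fc f (h x) * h x * fc f (h x) = fc (\<lambda>s. s * (f s * f s)) (h x)" if f: "continuous_on UNIV f" for f x
  proof -
    have "fc (\<lambda>s. s * (f s * f s)) (h x) = h x * (fc f (h x) * fc f (h x))"
      using fc_mult[OF h(1), of "\<lambda>s. s" "\<lambda>s. f s * f s"] fc_mult[OF h(1) f f] fc_id[OF h(1)] f
      by (simp add: continuous_on_mult continuous_on_id)
    then show ?thesis
      using fc_commute[OF h(1) f, of "h x"] by (simp flip: mult.assoc)
  qed
  have XX: "star (X x n) * X x n = fc (U n) (h x)" for x n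
  proof -
    have "star (X x n) * X x n = fc (g n) (h x) * h x * fc (g n) (h x)"
      by (simp add: X_def star_fc h cg h_def mult.assoc)
    then show ?thesis
      unfolding U_def[abs_def] by (simp only: fX cg)
  qed
  have normX: "norm (X x n) \<le> 1" for x n
  proof -
    have "norm (star (X x n) * X x n) \<le> 1"
      unfolding XX using spec_h U1 by (intro norm_fc_le[OF h(1) cU]) auto
    then show ?thesis
      unfolding norm_star_mult_self by (simp add: power_le_one_iff)
  qed
  have incr: "star (X x n - X x m) * (X x n - X x m) \<le> fc (U n) (h x) - fc (U m) (h x)"
    if "m \<le> n" for x m n
  proof -
    have f: "continuous_on UNIV (\<lambda>s. g n s - g m s)"
      by (intro continuous_intros cg)
    have "X x n - X x m = x * fc (\<lambda>s. g n s - g m s) (h x)"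
      by (simp add: X_def fc_diff[OF h(1) cg cg] algebra_simps)
    then have "star (X x n - X x m) * (X x n - X x m) =
        fc (\<lambda>s. g n s - g m s) (h x) * h x * fc (\<lambda>s. g n s - g m s) (h x)"
      by (simp only: star_mult star_fc[OF h(1) f]) (simp add: h_def mult.assoc)
    also have "\<dots> = fc (\<lambda>s. s * ((g n s - g m s) * (g n s - g m s))) (h x)"
      by (rule fX[OF f])
    also have "\<dots> \<le> fc (\<lambda>s. U n s - U m s) (h x)"
    proof (rule fc_mono[OF h(1)])
      fix s assume "s \<in> spec (h x)"
      then have s: "0 \<le> s"
        by (rule spec_h)
      have "0 \<le> 2 * g m s * (g n s - g m s)"
        using gmono[OF that, of s] gpos[of m s] by simp
      then have "(g n s - g m s) * (g n s - g m s) \<le> g n s * g n s - g m s * g m s"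
        by (simp add: algebra_simps)
      from mult_left_mono[OF this s]
      show "s * ((g n s - g m s) * (g n s - g m s)) \<le> U n s - U m s"
        by (simp add: U_def algebra_simps)
    qed (intro continuous_intros cg cU)+
    also have "\<dots> = fc (U n) (h x) - fc (U m) (h x)"
      by (rule fc_diff[OF h(1) cU cU])
    finally show ?thesis .
  qed
  have Ule: "fc (U n) (h x) \<le> 1" for n x
    using fc_mono[OF h(1) cU continuous_on_const, of x n 1] spec_h U1 by (simp add: fc_const h)
  have incr': "(X a n - X a m) * star (X a n - X a m) \<le> fc (U n) (h (star a)) - fc (U m) (h (star a))"
    if "m \<le> n" for m n
    using incr[OF that, of "star a"] by (simp add: starX)
  obtain v where v: "v \<in> M" "strong_limit (X a) v" "strong_limit (\<lambda>n. star (X a n)) (star v)"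
    by (rule strong_star_limit_exists[OF XM[OF a] normX incr _ Ule incr' _ Ule])
      (simp_all add: star_fc h cU)
  have sa: "star v = v" if "star a = a"
    using v(2,3) strong_limit_unique by (simp add: starX that)
  have vv: "strong_limit (\<lambda>n. fc (U n) (h a)) (star v * v)"
    using strong_limit_mult[OF v(3,2), of 1] normX[of a] by (simp add: XX)
  have avv: "a * (star v * v) = a"
  proof -
    \<comment> \<open>The square of the norm is controlled by \<open>s * (U n s - 1)\<^sup>2\<close>
      on the spectrum. This is 0 for \<open>s\<close> above \<open>1 / Suc n\<close>; below, the
      second factor is at most 1.\<close>
    have le: "norm (a * fc (U n) (h a) - a) \<le> sqrt (1 / real (Suc n))" for n
    proof -
      define y where "y = a * fc (U n) (h a) - a"
      define f where "f s = U n s - 1" for s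
      have cf: "continuous_on UNIV f"
        unfolding f_def by (intro continuous_intros cU)
      have "y = a * fc f (h a)"
        unfolding f_def using fc_diff[OF h(1)[of a] cU[of n] continuous_on_const[of UNIV 1]]
        by (simp add: y_def fc_const h right_diff_distrib)
      then have "star y * y = fc f (h a) * h a * fc f (h a)"
        by (simp only: star_mult star_fc[OF h(1) cf]) (simp add: h_def mult.assoc)
      also have "\<dots> = fc (\<lambda>s. s * (f s * f s)) (h a)"
        by (rule fX[OF cf])
      finally have "norm (star y * y) \<le> 1 / real (Suc n)"
      proof (rule ssubst, intro norm_fc_le[OF h(1)])
        fix s assume "s \<in> spec (h a)"
        then have s: "0 \<le> s"
          by (rule spec_h)
        show "\<bar>s * (f s * f s)\<bar> \<le> 1 / real (Suc n)"
        proof (cases "s \<ge> 1 / real (Suc n)")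
          case True
          then have "s > 0"
            using less_le_trans[of 0 "1 / real (Suc n)" s] by simp
          then have "f s = 0"
            using True by (simp add: f_def U_def gsq max_absorb1 flip: power2_eq_square)
          then show ?thesis
            by simp
        next
          case False
          have "\<bar>f s\<bar> \<le> 1"
            using U1[OF s, of n] by (simp add: f_def)
          then have "\<bar>f s * f s\<bar> \<le> 1"
            unfolding abs_mult by (intro mult_le_one) auto
          then have "\<bar>s * (f s * f s)\<bar> \<le> s"
            using s by (simp add: abs_mult mult_left_le)
          then show ?thesis
            using False by linarith
        qed
      qed (auto intro!: continuous_intros cf)
      then have "(norm y)\<^sup>2 \<le> 1 / real (Suc n)"
        by (simp only: norm_star_mult_self)
      then show ?thesis
        unfolding y_def by (rule real_le_rsqrt)
    qed
    have "(\<lambda>n. sqrt (1 / real (Suc n))) \<longlonglongrightarrow> 0"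
      using tendsto_real_sqrt[OF LIMSEQ_inverse_real_of_nat] by (simp add: inverse_eq_divide)
    from Lim_null_comparison[OF always_eventually[OF allI[OF le]] this]
    have "(\<lambda>n. a * fc (U n) (h a)) \<longlonglongrightarrow> a"
      by (simp add: LIM_zero_iff)
    then show ?thesis
      using strong_limit_unique[OF strong_limit_mult_left[OF vv] strong_limit_norm] by blast
  qed
  have right: "v * e = v" if "star e = e" "a * e = a" for e
  proof -
    have ea: "e * star a = star a"
      using that by (metis star_mult star_star)
    have "e * h a = (e * star a) * a" "h a * e = star a * (a * e)"
      by (simp_all add: h_def mult.assoc)
    then have "e * h a = h a * e"
      by (simp add: ea that(2) h_def)
    then have c: "e * fc (g n) (h a) = fc (g n) (h a) * e" for n
      by (rule fc_commute[OF h(1) cg])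
    have "X a n * e = X a n" for n
    proof -
      have "X a n * e = (a * e) * fc (g n) (h a)"
        by (simp add: X_def mult.assoc c)
      then show ?thesis
        by (simp add: X_def that(2))
    qed
    then show ?thesis
      using strong_limit_unique[OF strong_limit_mult_right[OF v(2), of e]] v(2) by simp
  qed
  have left: "f * v = v" if "f * a = a" for f
  proof -
    have "f * X a n = X a n" for n
      using that by (simp add: X_def flip: mult.assoc)
    then show ?thesis
      using strong_limit_unique[OF strong_limit_mult_left[OF v(2), of f]] v(2) by simp
  qed
  have "partial_isometry v"
    using right[of "star v * v"] avv by (simp add: partial_isometry_def mult.assoc)
  moreover have "s * v = - (v * s)" if "star a = a" "s * a = - (a * s)" for s
  proof -
    have "s * h a = (s * a) * a" "h a * s = a * (a * s)"
      using that(1) by (simp_all add: h_def mult.assoc)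
    moreover have "(s * a) * a = - (a * (s * a))"
      by (simp add: that(2) mult.assoc)
    ultimately have "s * h a = h a * s"
      by (simp add: that(2))
    then have c: "s * fc (g n) (h a) = fc (g n) (h a) * s" for n
      by (rule fc_commute[OF h(1) cg])
    have "s * X a n = - (X a n * s)" for n
    proof -
      have "s * X a n = (s * a) * fc (g n) (h a)"
        by (simp add: X_def mult.assoc)
      also have "\<dots> = - (a * (s * fc (g n) (h a)))"
        by (simp add: that(2) mult.assoc)
      also have "\<dots> = - (X a n * s)"
        by (simp add: X_def c mult.assoc)
      finally show ?thesis .
    qed
    then show ?thesis
      using strong_limit_unique[OF strong_limit_mult_left[OF v(2), of s]]
        strong_limit_minus[OF strong_limit_mult_right[OF v(2), of s]] by simp
  qed
  ultimately show ?thesis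
    using that v(1) avv right left sa by blast
qed

lemma t_proj_nonneg: "e \<in> M \<Longrightarrow> is_proj e \<Longrightarrow> 0 \<le> t e"
  by (intro t_nonneg is_proj_nonneg)

lemma t_proj_le_one: "e \<in> M \<Longrightarrow> is_proj e \<Longrightarrow> t e \<le> 1"
  using t_mono[OF _ _ is_proj_le_one, of e] by (simp add: t_one)

lemma t_proj_zero: "e \<in> M \<Longrightarrow> is_proj e \<Longrightarrow> t e = 0 \<Longrightarrow> e = 0"
  by (intro t_faithful is_proj_nonneg)

text \<open>\<open>prime\<close> supplies \<open>z\<close> with \<open>f * z * e\<close> not 0; the
  partial isometry in the polar decomposition of this element links the two projections.\<close>

lemma nonzero_partial_isometry:
  assumes "e \<in> M" "is_proj e" "e \<noteq> 0" "f \<in> M" "is_proj f" "f \<noteq> 0"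
  obtains v where "v \<in> M" "partial_isometry v" "v \<noteq> 0" "v * e = v" "f * v = v"
proof -
  obtain z where z: "z \<in> M" "f * z * e \<noteq> 0"
    using prime[of f e] assms by blast
  define a where "a = f * z * e"
  have a: "a \<in> M" "a * e = a" "f * a = a"
    using z assms by (simp_all add: a_def is_proj_def mult.assoc) (simp_all flip: mult.assoc)
  obtain v where v: "v \<in> M" "partial_isometry v" "a * (star v * v) = a"
    "\<And>e. star e = e \<Longrightarrow> a * e = a \<Longrightarrow> v * e = v" "\<And>f. f * a = a \<Longrightarrow> f * v = v"
    by (rule polar_decomposition[OF a(1)]) blast
  have "v \<noteq> 0"
    using v(3) z(2) by (auto simp: a_def)
  then show ?thesis
    using that[of v] v a assms by (simp add: is_proj_def)
qed

definition links :: "'a cop \<Rightarrow> 'a cop \<Rightarrow> 'a cop set" where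
  "links e f = {v \<in> M. partial_isometry v \<and> v * e = v \<and> f * v = v}"

lemma links_zero: "0 \<in> links e f"
  by (simp add: links_def partial_isometry_def)

lemma links_extend:
  assumes "is_proj e" "is_proj f" "v \<in> links e f" "u \<in> links (e - star v * v) (f - v * star v)"
  shows "v + u \<in> links e f" "u * star v = 0" "star v * u = 0"
    "star (v + u) * (v + u) = star v * v + star u * u"
    "(v + u) * star (v + u) = v * star v + u * star u"
proof -
  have v: "v \<in> M" "v * star v * v = v" "v * e = v" "f * v = v"
    and u: "u \<in> M" "u * star u * u = u" "u * (e - star v * v) = u" "(f - v * star v) * u = u"
    using assms(3,4) by (auto simp: links_def partial_isometry_def)
  have sv: "e * star v = star v" "star v * f = star v" "star v * v * star v = star v"
    using v(2,3,4) assms(1,2) unfolding is_proj_def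
    by (metis star_mult, metis star_mult, metis mult.assoc star_mult star_star)
  have "u * star v = u * (e - star v * v) * star v"
    by (simp add: u(3))
  also have "\<dots> = u * (e * star v - star v * v * star v)"
    by (simp add: algebra_simps)
  finally show uv: "u * star v = 0"
    by (simp add: sv)
  have "star v * u = star v * ((f - v * star v) * u)"
    by (simp add: u(4))
  also have "\<dots> = (star v * f - star v * v * star v) * u"
    by (simp add: algebra_simps)
  finally show vu: "star v * u = 0"
    by (simp add: sv)
  have vu': "v * star u = 0" "star u * v = 0"
    using uv vu by (metis star_mult star_star star_zero)+
  show vv: "star (v + u) * (v + u) = star v * v + star u * u"
    by (simp add: algebra_simps vu vu')
  show "(v + u) * star (v + u) = v * star v + u * star u"
    by (simp add: algebra_simps uv vu')
  have ue: "u * e = u"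
  proof -
    have "u * e = u * (e - star v * v) * e"
      by (simp add: u(3))
    also have "\<dots> = u * (e * e - star v * (v * e))"
      by (simp add: algebra_simps)
    finally show ?thesis
      using assms(1) u(3) v(3) by (simp add: is_proj_def)
  qed
  have fu: "f * u = u"
  proof -
    have "f * u = f * ((f - v * star v) * u)"
      by (simp add: u(4))
    also have "\<dots> = (f * f - (f * v) * star v) * u"
      by (simp add: algebra_simps)
    finally show ?thesis
      using assms(2) u(4) v(4) by (simp add: is_proj_def)
  qed
  have "(v + u) * star (v + u) * (v + u) = v * star v * v + u * star u * u + v * (star v * u) + u * (star u * v)
      + (v * star u) * v + (v * star u) * u + (u * star v) * v + (u * star v) * u"
    by (simp add: algebra_simps)
  then have "partial_isometry (v + u)"
    by (simp add: partial_isometry_def vu vu' uv u v)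
  then show "v + u \<in> links e f"
    using u v ue fu by (simp add: links_def algebra_simps)
qed

lemma links_size:
  assumes "v \<in> links e f"
  shows "0 \<le> t (star v * v)" "t (star v * v) \<le> 1"
  using assms t_proj_le_one[OF _ partial_isometry_projs(1), of v] t_star_mult_nonneg[of v]
  by (auto simp: links_def)

text \<open>The supremum of the traces need not be attained, so half of it is used. This lets
  \<open>comparison\<close> proceed by a sequence of choices instead of a transfinite
  exhaustion.\<close>

lemma links_almost_maximal:
  obtains u where "u \<in> links e f" "\<And>w. w \<in> links e f \<Longrightarrow> t (star w * w) \<le> 2 * t (star u * u)"
proof -
  define S where "S = (\<lambda>v. t (star v * v)) ` links e f"
  have bdd: "bdd_above S" and ne: "S \<noteq> {}"
    using links_size links_zero[of e f] by (auto simp: S_def intro!: bdd_aboveI[of _ 1])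
  show ?thesis
  proof (cases "Sup S \<le> 0")
    case True
    then have "t (star w * w) \<le> 0" if "w \<in> links e f" for w
      using cSup_upper[OF _ bdd, of "t (star w * w)"] that by (force simp: S_def)
    then show ?thesis
      using that[of 0] links_zero by simp
  next
    case False
    then have "Sup S / 2 < Sup S"
      by simp
    then obtain y where "y \<in> S" "Sup S / 2 < y"
      using less_cSup_iff[OF ne bdd] by blast
    then obtain u where u: "u \<in> links e f" "Sup S / 2 < t (star u * u)"
      unfolding S_def by blast
    have "t (star w * w) \<le> 2 * t (star u * u)" if "w \<in> links e f" for w
      using cSup_upper[OF _ bdd, of "t (star w * w)"] that u(2) by (force simp: S_def)
    then show ?thesis
      using that u(1) by blast
  qed
qed

text \<open>Greedy exhaustion: each stage adds a partial isometry between the leftovers whose trace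
  is at least half of the possible one. The added traces are summable, and a link between the
  leftovers of the limit is a link at every stage, so it is 0. If both leftovers were nonzero,
  \<open>nonzero_partial_isometry\<close> would give a nonzero link; hence one leftover is 0, and
  \<open>t e \<le> t f\<close> makes it that of \<open>e\<close>.\<close>

lemma comparison:
  assumes e: "e \<in> M" "is_proj e" and f: "f \<in> M" "is_proj f" and le: "t e \<le> t f"
  obtains v where "v \<in> M" "star v * v = e" "is_proj (v * star v)" "f * v = v"
proof -
  define pick where "pick v = (SOME u. u \<in> links (e - star v * v) (f - v * star v) \<and>
    (\<forall>w\<in>links (e - star v * v) (f - v * star v). t (star w * w) \<le> 2 * t (star u * u)))" for v
  have pick: "pick v \<in> links (e - star v * v) (f - v * star v)"
    "\<And>w. w \<in> links (e - star v * v) (f - v * star v) \<Longrightarrow> t (star w * w) \<le> 2 * t (star (pick v) * pick v)"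
    for v
  proof -
    have "\<exists>u. u \<in> links (e - star v * v) (f - v * star v) \<and>
      (\<forall>w\<in>links (e - star v * v) (f - v * star v). t (star w * w) \<le> 2 * t (star u * u))"
      using links_almost_maximal[of "e - star v * v" "f - v * star v"] by (metis (no_types))
    from someI_ex[OF this]
    show "pick v \<in> links (e - star v * v) (f - v * star v)"
      "\<And>w. w \<in> links (e - star v * v) (f - v * star v) \<Longrightarrow> t (star w * w) \<le> 2 * t (star (pick v) * pick v)"
      unfolding pick_def[symmetric] by blast+
  qed
  define V where "V n = ((\<lambda>v. v + pick v) ^^ n) 0" for n
  have V0: "V 0 = 0" and VS: "V (Suc n) = V n + pick (V n)" for n
    by (simp_all add: V_def)
  have VL: "V n \<in> links e f" for n
  proof (induction n)
    case (Suc n)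
    then show ?case
      unfolding VS by (rule links_extend(1)[OF e(2) f(2) _ pick(1)])
  qed (simp add: V0 links_zero)
  have VM: "V n \<in> M" and Vpi: "partial_isometry (V n)" and Ve: "V n * e = V n" and fV: "f * V n = V n" for n
    using VL by (auto simp: links_def)
  note ext = links_extend[OF e(2) f(2) VL pick(1)]
  \<comment> \<open>Each stage restricts to the earlier ones, so that initial and final projections
    increase with \<open>n\<close>.\<close>
  have inc: "star (V m) * V n = star (V m) * V m \<and> V n * star (V m) = V m * star (V m)" if "m \<le> n" for m n
    using that
  proof (induction n rule: dec_induct)
    case (step n)
    define u where "u = pick (V n)"
    have u: "u * (e - star (V n) * V n) = u" "(f - V n * star (V n)) * u = u"
      using pick(1)[of "V n"] by (auto simp: links_def u_def)
    have s: "V m * star (V m) * V m = V m"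
      using Vpi by (simp add: partial_isometry_def)
    have s': "star (V m) * V m * star (V m) = star (V m)"
      using partial_isometry_star[OF Vpi[of m]] by (simp add: partial_isometry_def)
    have sf: "star (V m) * f = star (V m)" "e * star (V m) = star (V m)"
      using fV[of m] Ve[of m] e(2) f(2) unfolding is_proj_def by (metis star_mult)+
    have i1: "star (V m) * V n = star (V m) * V m" and i2: "V n * star (V m) = V m * star (V m)"
      using step.IH by auto
    have i3: "V m * star (V n) = V m * star (V m)" and i4: "star (V n) * V m = star (V m) * V m"
      using arg_cong[OF i2, of star] arg_cong[OF i1, of star] by simp_all
    have "star (V m) * u = star (V m) * ((f - V n * star (V n)) * u)"
      by (simp add: u)
    also have "\<dots> = (star (V m) * f - star (V m) * V n * star (V n)) * u"
      by (simp add: algebra_simps)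
    also have "star (V m) * V n * star (V n) = star (V m)"
      by (simp add: i1 i3 mult.assoc) (simp add: s' flip: mult.assoc)
    finally have mu: "star (V m) * u = 0"
      by (simp add: sf)
    have "u * star (V m) = u * (e - star (V n) * V n) * star (V m)"
      by (simp add: u)
    also have "\<dots> = u * (e * star (V m) - star (V n) * (V n * star (V m)))"
      by (simp add: algebra_simps)
    also have "star (V n) * (V n * star (V m)) = star (V m)"
      unfolding i2 by (simp add: i4 s' flip: mult.assoc)
    finally have um: "u * star (V m) = 0"
      by (simp add: sf)
    show ?case
      using i1 i2 mu um by (simp add: VS distrib_left distrib_right flip: u_def)
  qed simp
  have inc': "star (V n) * V m = star (V m) * V m" "V m * star (V n) = V m * star (V m)" if "m \<le> n" for m n
    using arg_cong[OF conjunct1[OF inc[OF that]], of star] arg_cong[OF conjunct2[OF inc[OF that]], of star]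
    by simp_all
  have diff1: "star (V n - V m) * (V n - V m) = star (V n) * V n - star (V m) * V m" if "m \<le> n" for m n
    using inc[OF that] inc'[OF that] by (simp add: algebra_simps)
  have diff2: "(V n - V m) * star (V n - V m) = V n * star (V n) - V m * star (V m)" if "m \<le> n" for m n
    using inc[OF that] inc'[OF that] by (simp add: algebra_simps)
  obtain v where v: "v \<in> M" "strong_limit V v" "strong_limit (\<lambda>n. star (V n)) (star v)"
    by (rule strong_star_limit_exists[of V 1 "\<lambda>n. star (V n) * V n" "\<lambda>n. V n * star (V n)"])
      (use VM partial_isometry_norm[OF Vpi] is_proj_le_one[OF partial_isometry_projs(1)[OF Vpi]]
        is_proj_le_one[OF partial_isometry_projs(2)[OF Vpi]] diff1 diff2 in auto)
  have nV: "norm (V n) \<le> 1" "norm (star (V n)) \<le> 1" for n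
    using partial_isometry_norm[OF Vpi] by auto
  have "strong_limit (\<lambda>n. V n * star (V n) * V n) (v * star v * v)"
  proof (rule strong_limit_mult[OF strong_limit_mult[OF v(2,3) nV(1)] v(2)])
    show "norm (V n * star (V n)) \<le> 1" for n
      by (rule is_proj_norm_le[OF partial_isometry_projs(2)[OF Vpi]])
  qed
  moreover have "V n * star (V n) * V n = V n" for n
    using Vpi by (simp add: partial_isometry_def)
  ultimately have "strong_limit V (v * star v * v)"
    by simp
  then have vpi: "partial_isometry v"
    unfolding partial_isometry_def by (rule strong_limit_unique[OF _ v(2)])
  have "strong_limit V (v * e)" "strong_limit V (f * v)"
    using strong_limit_mult_right[OF v(2), of e] strong_limit_mult_left[OF v(2), of f]
    by (simp_all only: Ve fV)
  then have ve: "v * e = v" and fv: "f * v = v"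
    using strong_limit_unique[OF _ v(2)] by blast+
  have vL: "v \<in> links e f"
    using v(1) vpi ve fv by (simp add: links_def)
  have lim_inc: "star (V m) * v = star (V m) * V m" "v * star (V m) = V m * star (V m)" for m
  proof -
    have "strong_limit (\<lambda>n. V (n + m)) v"
      unfolding strong_limit_def
    proof
      show "(\<lambda>n. app (V (n + m)) \<xi>) \<longlonglongrightarrow> app v \<xi>" for \<xi>
        using v(2) by (intro LIMSEQ_ignore_initial_segment) (simp add: strong_limit_def)
    qed
    then have "strong_limit (\<lambda>n. star (V m) * V (n + m)) (star (V m) * v)"
      "strong_limit (\<lambda>n. V (n + m) * star (V m)) (v * star (V m))"
      by (simp_all add: strong_limit_mult_left strong_limit_mult_right)
    then have "strong_limit (\<lambda>n. star (V m) * V m) (star (V m) * v)"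
      "strong_limit (\<lambda>n. V m * star (V m)) (v * star (V m))"
      using inc[of m "_ + m"] by (simp_all only: le_add2)
    then show "star (V m) * v = star (V m) * V m" "v * star (V m) = V m * star (V m)"
      using strong_limit_unique[OF _ strong_limit_const] by blast+
  qed
  \<comment> \<open>The partial sums of the traces of the added pieces are the traces of initial
    projections, bounded by 1.\<close>
  have small: "(\<lambda>n. t (star (pick (V n)) * pick (V n))) \<longlonglongrightarrow> 0"
  proof -
    have pM: "pick (V n) \<in> M" for n
      using pick(1)[of "V n"] by (simp add: links_def)
    have sum: "(\<Sum>k<n. t (star (pick (V k)) * pick (V k))) = t (star (V n) * V n)" for n
      by (induction n) (use ext(4) VM pM in \<open>simp_all add: V0 VS t_add\<close>)
    have "summable (\<lambda>n. t (star (pick (V n)) * pick (V n)))"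
    proof (rule bounded_imp_summable[of _ 1])
      show "(\<Sum>k\<le>n. t (star (pick (V k)) * pick (V k))) \<le> 1" for n
        using sum[of "Suc n"] links_size(2)[OF VL] by (simp add: lessThan_Suc_atMost)
    qed (use t_star_mult_nonneg[OF pM] in auto)
    then show ?thesis
      by (rule summable_LIMSEQ_zero)
  qed
  \<comment> \<open>\<open>z\<close> is a competitor at every stage, so its size is at most twice
    that of each piece chosen.\<close>
  have max: "z = 0" if z: "z \<in> links (e - star v * v) (f - v * star v)" for z
  proof -
    have zM: "z \<in> M" "partial_isometry z" "z * (e - star v * v) = z" "(f - v * star v) * z = z"
      using z by (auto simp: links_def)
    have zL: "z \<in> links (e - star (V m) * V m) (f - V m * star (V m))" for m
    proof -
      have sm: "star (V m) * V m * star (V m) = star (V m)"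
        using partial_isometry_star[OF Vpi[of m]] by (simp add: partial_isometry_def)
      have em: "e * star (V m) = star (V m)" "star (V m) * f = star (V m)"
        using fV[of m] Ve[of m] e(2) f(2) unfolding is_proj_def by (metis star_mult)+
      have lim': "star v * V m = star (V m) * V m" "V m * star v = V m * star (V m)"
        using arg_cong[OF lim_inc(1), of star m] arg_cong[OF lim_inc(2), of star m] by simp_all
      have "z * star (V m) = z * (e - star v * v) * star (V m)"
        by (simp add: zM)
      also have "\<dots> = z * (e * star (V m) - (star v * (v * star (V m))))"
        by (simp add: algebra_simps)
      also have "star v * (v * star (V m)) = star (V m)"
        unfolding lim_inc by (simp add: lim' sm flip: mult.assoc)
      finally have zV: "z * star (V m) = 0"
        by (simp add: em)
      have vvV: "star (V m) * v * star v = star (V m)"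
        by (simp add: lim_inc mult.assoc lim') (simp add: sm flip: mult.assoc)
      have "star (V m) * z = star (V m) * ((f - v * star v) * z)"
        by (simp add: zM)
      also have "\<dots> = (star (V m) * f - star (V m) * v * star v) * z"
        by (simp add: algebra_simps)
      finally have Vz: "star (V m) * z = 0"
        by (simp add: vvV em)
      have "z * e = z" "f * z = z"
        using links_extend(1)[OF e(2) f(2) vL z] vL by (simp_all add: links_def distrib_left distrib_right)
      moreover have "z * (e - star (V m) * V m) = z * e - (z * star (V m)) * V m"
        "(f - V m * star (V m)) * z = f * z - V m * (star (V m) * z)"
        by (simp_all add: algebra_simps)
      ultimately show ?thesis
        using zM(1,2) by (simp add: links_def zV Vz)
    qed
    have le2: "t (star z * z) \<le> 2 * t (star (pick (V n)) * pick (V n))" for n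
      by (rule pick(2)[OF zL])
    have "(\<lambda>n. 2 * t (star (pick (V n)) * pick (V n))) \<longlonglongrightarrow> 2 * 0"
      by (intro tendsto_intros small)
    then have "t (star z * z) \<le> 2 * 0"
      by (rule LIMSEQ_le_const) (use le2 in blast)
    then show ?thesis
      using t_star_mult_le_zero zM(1) by simp
  qed
  have pe: "is_proj (e - star v * v)" and pf: "is_proj (f - v * star v)"
  proof -
    have "e * star v = star v" "star v * f = star v"
      using ve fv e(2) f(2) unfolding is_proj_def by (metis star_mult)+
    then have "e * (star v * v) = star v * v" "(v * star v) * f = v * star v"
      "(star v * v) * e = star v * v" "f * (v * star v) = v * star v"
      using ve fv by (simp_all add: mult.assoc) (simp_all flip: mult.assoc)
    then show "is_proj (e - star v * v)" "is_proj (f - v * star v)"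
      using partial_isometry_projs[OF vpi] e(2) f(2) unfolding is_proj_def
      by (simp_all add: algebra_simps)
  qed
  have "e - star v * v = 0 \<or> f - v * star v = 0"
  proof (rule ccontr)
    assume "\<not> ?thesis"
    then obtain z where "z \<in> M" "partial_isometry z" "z \<noteq> 0" "z * (e - star v * v) = z" "(f - v * star v) * z = z"
      using nonzero_partial_isometry[OF _ pe _ _ pf] e(1) f(1) v(1) by (metis diff_closed mult_closed star_closed)
    then show False
      using max by (simp add: links_def)
  qed
  then have "e - star v * v = 0"
  proof
    assume "f - v * star v = 0"
    then have "t f = t (star v * v)"
      using t_comm[of v "star v"] v(1) by simp
    then have "t (e - star v * v) \<le> 0"
      using le e(1) v(1) by (simp add: t_diff)
    then have "t (e - star v * v) = 0"
      using t_proj_nonneg[OF _ pe] e(1) v(1) by simp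
    then show ?thesis
      using t_proj_zero[OF _ pe] e(1) v(1) by simp
  qed
  then show ?thesis
    using that[of v] v(1) fv partial_isometry_projs(2)[OF vpi] by simp
qed

end

text \<open>This and the next rule let a product relation fire at the front of a right-nested
  product.\<close>

lemma assoc2: "a * b = c \<Longrightarrow> a * (b * x) = c * (x :: 'a :: semigroup_mult)"
  by (simp flip: mult.assoc)

lemma assoc3: "a * b * c = d \<Longrightarrow> a * (b * (c * x)) = d * (x :: 'a :: semigroup_mult)"
  by (simp flip: mult.assoc)

lemma absorb_left: "a * w = w \<Longrightarrow> x * a = y \<Longrightarrow> x * w = y * (w :: 'a :: semigroup_mult)"
  by (metis mult.assoc)

lemma absorb_right: "w * a = w \<Longrightarrow> a * x = y \<Longrightarrow> w * x = w * (y :: 'a :: semigroup_mult)"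
  by (metis mult.assoc)

lemma star_mult_self_eq_zero: "star x * x = 0 \<Longrightarrow> x = 0"
  using norm_star_mult_self[of x] by simp

lemma mult_star_self_eq_zero: "x * star x = 0 \<Longrightarrow> x = 0"
  using star_mult_self_eq_zero[of "star x"] by simp

lemma is_proj_imp_partial_isometry:
  assumes "is_proj (v * star v)"
  shows "partial_isometry v"
proof -
  have e: "v * star v * (v * star v) = v * star v"
    using assms by (simp add: is_proj_def)
  have "(v * star v * v - v) * star (v * star v * v - v) =
      v * star v * (v * star v) * (v * star v) - v * star v * (v * star v) - v * star v * (v * star v) + v * star v"
    by (simp add: algebra_simps)
  then have "(v * star v * v - v) * star (v * star v * v - v) = 0"
    by (simp only: e) simp
  then have "v * star v * v - v = 0"
    by (rule mult_star_self_eq_zero)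
  then show ?thesis
    by (simp add: partial_isometry_def)
qed

section \<open>Projections of trace c: decompositions and anticommuting symmetries\<close>

context fin_factor
begin

definition Pc :: "real \<Rightarrow> 'a cop set" where
  "Pc c = {P \<in> M. is_proj P \<and> t P = c}"

lemma PcD: "P \<in> Pc c \<Longrightarrow> P \<in> M" "P \<in> Pc c \<Longrightarrow> is_proj P" "P \<in> Pc c \<Longrightarrow> t P = c"
  "P \<in> Pc c \<Longrightarrow> P * P = P" "P \<in> Pc c \<Longrightarrow> star P = P"
  by (auto simp: Pc_def is_proj_def)

lemma subprojection_diff:
  assumes "is_proj e" "is_proj f" "e * f = f"
  shows "is_proj (e - f)"
proof -
  have "f * e = f"
    using assms by (metis is_proj_def star_mult)
  then show ?thesis
    using assms by (simp add: is_proj_def algebra_simps)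
qed

lemma subprojection_eq:
  assumes "e \<in> M" "f \<in> M" "is_proj e" "is_proj f" "e * f = f" "t f = t e"
  shows "f = e"
  using t_proj_zero[OF _ subprojection_diff[OF assms(3-5)]] assms by (simp add: t_diff)

text \<open>As long as the trace of \<open>r\<close> exceeds \<open>c\<close>, a piece equivalent to
  \<open>P\<close> is split off; the last remainder is equivalent to a subprojection of
  \<open>P\<close>. The number of pieces is bounded because each full one has trace
  \<open>c\<close>.\<close>

lemma projection_decomposition:
  assumes P: "P \<in> Pc c" and c: "c > 0" and r: "r \<in> M" "is_proj r"
  obtains n and v :: "nat \<Rightarrow> 'a cop" where "\<And>i. v i \<in> M" "\<And>i. v i * P = v i" "\<And>i. r * v i = v i"
    "(\<Sum>i<n. v i * star (v i)) = r"
proof -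
  have "\<exists>(n::nat) v. (\<forall>i. v i \<in> M \<and> v i * P = v i \<and> r * v i = v i) \<and> (\<Sum>i<n. v i * star (v i)) = r"
    if "r \<in> M" "is_proj r" "t r \<le> real k * c" for k r
    using that
  proof (induction k arbitrary: r)
    case 0
    then have "t r = 0"
      using t_proj_nonneg[of r] by simp
    then have "r = 0"
      using 0 t_proj_zero by blast
    then show ?case
      by (intro exI[of _ 0] exI[of _ "\<lambda>_. 0"]) simp
  next
    case (Suc k)
    show ?case
    proof (cases "t r \<le> c")
      case True
      then obtain u where u: "u \<in> M" "star u * u = r" "is_proj (u * star u)" "P * u = u"
        using comparison[OF Suc.prems(1,2) PcD(1,2)[OF P]] PcD(3)[OF P] by metis
      have "partial_isometry (star u)"
        by (rule partial_isometry_star[OF is_proj_imp_partial_isometry[OF u(3)]])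
      then have "r * star u = star u"
        using u(2) by (simp add: partial_isometry_def)
      moreover have "star u * P = star u"
        using u(4) PcD(5)[OF P] by (metis star_mult)
      ultimately show ?thesis
        using u by (intro exI[of _ "1::nat"] exI[of _ "\<lambda>_. star u"]) simp
    next
      case False
      then obtain u where u: "u \<in> M" "star u * u = P" "is_proj (u * star u)" "r * u = u"
        using comparison[OF PcD(1,2)[OF P] Suc.prems(1,2)] PcD(3)[OF P] by (metis less_imp_le not_le)
      define r' where "r' = r - u * star u"
      have ru: "r * (u * star u) = u * star u"
        using u(4) by (simp flip: mult.assoc)
      have r': "r' \<in> M" "is_proj r'"
        unfolding r'_def using Suc.prems u(1) subprojection_diff[OF Suc.prems(2) u(3) ru] by simp_all
      have "t (u * star u) = c"
        using t_comm[of u "star u"] u PcD(3)[OF P] by simp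
      then have "t r' \<le> real k * c"
        using Suc.prems(1,3) u(1) by (simp add: r'_def t_diff algebra_simps)
      from Suc.IH[OF r' this] obtain n and v :: "nat \<Rightarrow> 'a cop" where
        v: "\<And>i. v i \<in> M" "\<And>i. v i * P = v i" "\<And>i. r' * v i = v i" "(\<Sum>i<n. v i * star (v i)) = r'"
        by blast
      have rr': "r * r' = r'"
        using ru Suc.prems(2) by (simp add: r'_def right_diff_distrib is_proj_def)
      have rv: "r * v i = v i" for i
        using v(3)[of i] rr' by (metis mult.assoc)
      have "partial_isometry u"
        using u(3) by (rule is_proj_imp_partial_isometry)
      then have uP: "u * P = u"
        using u(2) by (simp add: partial_isometry_def flip: u(2) mult.assoc)
      \<comment> \<open>Index \<open>n\<close> carries the new piece; the later values only have to
        meet the side conditions, which are required at every index.\<close>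
      define v' where "v' i = (if i < n then v i else u)" for i
      have "(\<Sum>i<Suc n. v' i * star (v' i)) = r"
        using v(4) by (simp add: v'_def r'_def)
      moreover have "v' i \<in> M \<and> v' i * P = v' i \<and> r * v' i = v' i" for i
        using v rv u uP by (simp add: v'_def)
      ultimately show ?thesis
        by blast
    qed
  qed
  moreover obtain k where "t r / c \<le> real k"
    using real_arch_simple by blast
  then have "t r \<le> real k * c"
    using c by (simp add: field_simps)
  ultimately obtain n and v :: "nat \<Rightarrow> 'a cop" where
    "\<And>i. v i \<in> M \<and> v i * P = v i \<and> r * v i = v i" "(\<Sum>i<n. v i * star (v i)) = r"
    using r by metis
  then show ?thesis
    using that[of v n] by simp
qed

text \<open>On the support of \<open>h = i(PQ - QP)\<close> the symmetry is the sign of \<open>h\<close>; on the complement \<open>P\<close>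
  and \<open>Q\<close> commute and the symmetry exchanges pairs of equivalent projections.\<close>

lemma common_anticommuting_symmetry:
  assumes P: "P \<in> Pc c" and Q: "Q \<in> Pc c" and c: "c \<le> 1 / 2"
  obtains E T where "E \<in> M" "is_proj E" "t E = 2 * c" "T \<in> M" "star T = T" "T * T = E" "E * T = T" "T * E = T"
    "P * E = P" "E * P = P" "Q * E = Q" "E * Q = Q" "P * T + T * P = T" "Q * T + T * Q = T"
proof -
  note P' = PcD[OF P] and Q' = PcD[OF Q]
  define h where "h = scalar \<i> * (P * Q - Q * P)"
  have h: "h \<in> M" "star h = h"
    using P' Q' by (simp_all add: h_def algebra_simps scalar_minus scalar_left_commute)
      (simp add: scalar_commute mult.assoc)
  \<comment> \<open>The symmetries \<open>2 *\<^sub>R P - 1\<close> and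
    \<open>2 *\<^sub>R Q - 1\<close> both anticommute with the commutator of \<open>P\<close> and
    \<open>Q\<close>. The polar decomposition passes this on to \<open>v\<close>.\<close>
  have anti: "(2 *\<^sub>R R - 1) * h = - (h * (2 *\<^sub>R R - 1))" if "R = P \<or> R = Q" for R
  proof -
    have "(2 *\<^sub>R R - 1) * (P * Q - Q * P) = - ((P * Q - Q * P) * (2 *\<^sub>R R - 1))"
    proof -
      have "P * (P * x) = P * x" "Q * (Q * x) = Q * x" for x
        using P' Q' by (simp_all flip: mult.assoc)
      then show ?thesis
        using that P' Q' by (auto simp: algebra_simps scaleR_2)
    qed
    then show ?thesis
      by (simp add: h_def scalar_left_commute mult.assoc)
  qed
  obtain v where v: "v \<in> M" "partial_isometry v" "h * (star v * v) = h" "star v = v"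
    "\<And>s. s * h = - (h * s) \<Longrightarrow> s * v = - (v * s)"
    by (rule polar_decomposition[OF h(1)]) (use h(2) in blast)
  have vvv: "v * v * v = v" "v * (v * v) = v"
    using v(2,4) by (simp_all add: partial_isometry_def mult.assoc)
  have Rv: "R * v + v * R = v" if "R = P \<or> R = Q" for R
  proof -
    have "2 *\<^sub>R (R * v + v * R) = 2 *\<^sub>R v"
      using v(5)[OF anti[OF that]] by (simp add: algebra_simps scaleR_2)
    then show ?thesis
      by simp
  qed
  have Rvv: "R * (v * v) = v * v * R" "2 * t (R * (v * v)) = t (v * v)" if "R = P \<or> R = Q" for R
  proof -
    have Rm: "R * v = v - v * R" "R \<in> M"
      using Rv[OF that] that P' Q' by (auto simp: eq_diff_eq)
    have "R * (v * v) = (R * v) * v"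
      by (simp add: mult.assoc)
    also have "\<dots> = v * v - v * (R * v)"
      by (simp add: Rm(1) left_diff_distrib mult.assoc)
    also have "\<dots> = v * v * R"
      by (simp add: Rm right_diff_distrib mult.assoc)
    finally show "R * (v * v) = v * v * R" .
    have "t (R * (v * v)) = t (v * (R * v))"
      using t_comm[of "R * v" v] v(1) Rm(2) by (simp add: mult.assoc)
    also have "\<dots> = t (v * v) - t (v * v * R)"
      using v(1) Rm by (simp add: right_diff_distrib t_diff mult.assoc)
    also have "t (v * v * R) = t (R * (v * v))"
      using t_comm[of "v * v" R] v(1) Rm(2) by simp
    finally show "2 * t (R * (v * v)) = t (v * v)"
      by simp
  qed
  have pvv: "is_proj (v * v)"
    using partial_isometry_projs(1)[OF v(2)] v(4) by simp
  define k where "k = 1 - v * v"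
  have k: "k \<in> M" "is_proj k" "k * k = k" "star k = k"
    using is_proj_one_minus[OF pvv] v(1) by (simp_all add: k_def is_proj_def)
  have vk: "v * k = 0" "k * v = 0"
    using vvv by (simp_all add: k_def algebra_simps)
  have Pk: "P * k = k * P" and Qk: "Q * k = k * Q"
    using Rvv(1) by (simp_all add: k_def algebra_simps)
  have hk: "P * Q * k = Q * P * k"
  proof -
    have "h * k = 0"
      using v(3,4) by (simp add: k_def algebra_simps)
    then have "scalar (- \<i>) * (h * k) = 0"
      by simp
    then show ?thesis
      by (simp add: h_def algebra_simps)
  qed
  define p where "p = P * k"
  define q where "q = Q * k"
  have pM: "p \<in> M" "q \<in> M"
    using k P' Q' by (simp_all add: p_def q_def)
  have hk': "Q * (P * k) = P * (Q * k)"
    using hk by (simp add: mult.assoc)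
  have kk: "P * (P * x) = P * x" "Q * (Q * x) = Q * x" "k * (k * x) = k * x"
    "k * (P * x) = P * (k * x)" "k * (Q * x) = Q * (k * x)" "Q * (P * (k * x)) = P * (Q * (k * x))" for x
    by (simp_all add: assoc2[OF P'(4)] assoc2[OF Q'(4)] assoc2[OF k(3)] assoc2[OF Pk[symmetric]]
        assoc2[OF Qk[symmetric]] assoc3[OF hk[symmetric]] mult.assoc)
  have ps: "star p = p" "star q = q" "p * p = p" "q * q = q" "p * q = q * p"
    "k * p = p" "k * q = q" "p * k = p" "q * k = q"
    using P' Q' k by (simp_all add: p_def q_def mult.assoc kk hk' Pk[symmetric] Qk[symmetric])
  have ps': "p * (p * x) = p * x" "q * (q * x) = q * x" "p * (q * x) = q * (p * x)" "k * (p * x) = p * x"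
    "k * (q * x) = q * x" for x
    by (simp_all add: assoc2[OF ps(3)] assoc2[OF ps(4)] assoc2[OF ps(5)] assoc2[OF ps(6)]
        assoc2[OF ps(7)] mult.assoc)
  have tp: "t p = c - t (v * v) / 2" "t q = c - t (v * v) / 2"
    using Rvv(2)[of P] Rvv(2)[of Q] P' Q' v(1)
    by (simp_all add: p_def q_def k_def right_diff_distrib t_diff)
  \<comment> \<open>Below \<open>k\<close> there are four joint spectral projections of the
    commuting \<open>p\<close> and \<open>q\<close>: in both, in \<open>p\<close> only, in
    \<open>q\<close> only, in neither. Below, \<open>w1\<close> maps the first into the last and
    \<open>w2\<close> maps the second onto the third, so \<open>w1 + w2\<close> maps
    \<open>p\<close> into its complement below \<open>k\<close> compatibly with
    \<open>q\<close>.\<close>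
  define g where "g = p * q"
  define \<alpha> where "\<alpha> = p - p * q"
  define \<beta> where "\<beta> = q - p * q"
  define \<gamma> where "\<gamma> = k - p - q + p * q"
  note defs = g_def \<alpha>_def \<beta>_def \<gamma>_def
  have inM: "g \<in> M" "\<alpha> \<in> M" "\<beta> \<in> M" "\<gamma> \<in> M"
    using pM k by (simp_all add: defs)
  have proj: "is_proj g" "is_proj \<alpha>" "is_proj \<beta>" "is_proj \<gamma>"
    using ps k by (simp_all add: is_proj_def defs algebra_simps ps')
  have "t \<alpha> = t \<beta>"
    using pM tp by (simp add: defs t_linear)
  \<comment> \<open>The difference of the two traces is \<open>1 - 2 * c\<close>; this is where
    \<open>c \<le> 1 / 2\<close> enters.\<close>
  moreover have "t g \<le> t \<gamma>"
    using pM k tp c v(1) by (simp add: defs t_linear) (simp add: k_def t_linear t_one)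
  ultimately obtain w1 w2 where
    w1: "w1 \<in> M" "star w1 * w1 = g" "is_proj (w1 * star w1)" "\<gamma> * w1 = w1" and
    w2: "w2 \<in> M" "star w2 * w2 = \<alpha>" "is_proj (w2 * star w2)" "\<beta> * w2 = w2"
    using comparison[OF inM(1) proj(1) inM(4) proj(4)] comparison[OF inM(2) proj(2) inM(3) proj(3)]
    by (metis order_refl)
  have w1g: "w1 * g = w1" and w2a: "w2 * \<alpha> = w2"
    using is_proj_imp_partial_isometry[OF w1(3)] is_proj_imp_partial_isometry[OF w2(3)] w1(2) w2(2)
    by (simp_all add: partial_isometry_def mult.assoc)
  have w2b: "w2 * star w2 = \<beta>"
  proof (rule subprojection_eq[OF inM(3) _ proj(3) w2(3)])
    show "\<beta> * (w2 * star w2) = w2 * star w2"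
      using w2(4) by (simp flip: mult.assoc)
    show "t (w2 * star w2) = t \<beta>"
      using t_comm[of w2 "star w2"] w2 \<open>t \<alpha> = t \<beta>\<close> by simp
  qed (use w2 in simp)
  define w where "w = w1 + w2"
  have wM: "w \<in> M"
    using w1 w2 by (simp add: w_def)
  have rel: "\<gamma> * p = 0" "\<gamma> * q = 0" "p * \<gamma> = 0" "q * \<gamma> = 0" "k * \<gamma> = \<gamma>" "p * \<beta> = 0" "q * \<beta> = \<beta>" "k * \<beta> = \<beta>"
    "g * p = g" "g * q = g" "\<alpha> * p = \<alpha>" "\<alpha> * q = 0" "\<gamma> * \<beta> = 0" "\<beta> * \<gamma> = 0"
    using ps k by (simp_all add: defs algebra_simps ps')
  have w1r: "p * w1 = 0" "q * w1 = 0" "k * w1 = w1" "w1 * p = w1" "w1 * q = w1"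
    using absorb_left[OF w1(4) rel(3)] absorb_left[OF w1(4) rel(4)] absorb_left[OF w1(4) rel(5)]
      absorb_right[OF w1g rel(9)] absorb_right[OF w1g rel(10)] w1(4) w1g by simp_all
  have w2r: "p * w2 = 0" "q * w2 = w2" "k * w2 = w2" "w2 * p = w2" "w2 * q = 0"
    using absorb_left[OF w2(4) rel(6)] absorb_left[OF w2(4) rel(7)] absorb_left[OF w2(4) rel(8)]
      absorb_right[OF w2a rel(11)] absorb_right[OF w2a rel(12)] w2(4) w2a by simp_all
  have "\<beta> * w1 = 0"
    using absorb_left[OF w1(4) rel(14)] by simp
  then have "star w1 * \<beta> = 0"
    using proj(3) by (metis is_proj_def star_mult star_zero)
  then have w12: "star w1 * w2 = 0"
    using absorb_left[OF w2(4)] by fastforce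
  have w12': "star w2 * w1 = 0"
    using arg_cong[OF w12, of star] by simp
  have ww: "star w * w = p"
    using w1(2) w2(2) by (simp add: w_def algebra_simps w12 w12' defs)
  have wr: "p * w = 0" "k * w = w" "w * p = w"
    by (simp_all add: w_def algebra_simps w1r w2r)
  have sw: "p * star w = star w"
    using arg_cong[OF wr(3), of star] ps(1) by simp
  have sw0: "star w * p = 0"
    using arg_cong[OF wr(1), of star] ps(1) by simp
  have Qw: "q * w + w * q = w"
    by (simp add: w_def algebra_simps w1r w2r)
  have w0: "w * w = 0"
    using assoc2[OF wr(3), of w] wr(1) by simp
  have w0': "star w * star w = 0"
    using arg_cong[OF w0, of star] by simp
  have kw: "w * k = w" "star w * k = star w" "k * star w = star w"
    using assoc2[OF wr(3), of k] ps(8) wr(3) arg_cong[OF wr(2), of star] k(4) by simp_all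
      (metis k(4) star_mult)
  have vw: "v * w = 0" "w * v = 0" "v * star w = 0" "star w * v = 0"
    using assoc2[OF vk(1), of w] assoc2[OF kw(1), of v] assoc2[OF vk(1), of "star w"]
      assoc2[OF kw(2), of v] vk kw wr by simp_all
  define T where "T = v + w + star w"
  define E where "E = T * T"
  have TM: "T \<in> M" "star T = T"
    using v(1,4) wM by (simp_all add: T_def algebra_simps)
  have E: "E = v * v + p + w * star w"
    by (simp add: E_def T_def algebra_simps vw w0 w0' ww)
  have sp: "star w * w * star w = star w" "w * star w * w = w"
    using ww wr(3) sw by (simp_all add: mult.assoc)
  have pv: "v * p = 0" "p * v = 0"
    using assoc2[OF vk(1), of p] ps assoc2[OF ps(8), of v] vk by simp_all
  \<comment> \<open>With \<open>E = T * T\<close> the product is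
    \<open>E * E * E - 2 *\<^sub>R (E * E) + E\<close>, which vanishes once \<open>E\<close> is
    idempotent.\<close>
  have "star (E * T - T) * (E * T - T) = 0"
  proof -
    have EE: "E * E = E"
    proof -
      have "v * v * p = 0" "p * (v * v) = 0" "v * v * (w * star w) = 0" "w * star w * (v * v) = 0"
        "p * (w * star w) = 0" "w * star w * p = 0" "w * star w * (w * star w) = w * star w" "v * v * (v * v) = v * v"
        using wr(1) sw0
        by (simp_all add: mult.assoc vw assoc2[OF vw(1)] assoc2[OF vw(4)] assoc2[OF wr(1)] assoc2[OF sp(2)] assoc2[OF pv(2)] sw0 vvv pv)
          (simp_all add: sp flip: mult.assoc)
      then show ?thesis
        by (simp add: E algebra_simps ps)
    qed
    have "star (E * T - T) * (E * T - T) = T * E * E * T - T * E * T - T * E * T + T * T"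
      using TM by (simp add: E_def algebra_simps)
    also have "\<dots> = E * E * E - E * E - E * E + E"
      by (simp add: E_def mult.assoc)
    finally show ?thesis
      by (simp add: EE)
  qed
  then have ET: "E * T = T"
    using star_mult_self_eq_zero by (metis eq_iff_diff_eq_0)
  then have TE: "T * E = T"
    by (simp add: E_def mult.assoc)
  have EM: "E \<in> M" "star E = E"
    using TM by (simp_all add: E_def)
  have Ep: "is_proj E"
    using ET EM by (simp add: is_proj_def E_def mult.assoc)
  have tE: "t E = 2 * c"
    using v(1) pM wM t_comm[of w "star w"] tp by (simp add: E t_linear ww)
  have kkw: "P * w = p * w" "Q * w = q * w"
    by (simp_all only: p_def q_def mult.assoc wr(2))
  have kkw': "w * P = w * p" "w * Q = w * q"
    by (simp_all only: p_def q_def Pk Qk assoc2[OF kw(1)])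
  have PT: "P * T + T * P = T"
  proof -
    have "P * w + w * P = w"
      by (simp add: kkw kkw' wr)
    then have "star (P * w + w * P) = star w"
      by simp
    then have "P * star w + star w * P = star w"
      using P' by (simp add: add.commute)
    then show ?thesis
      using \<open>P * w + w * P = w\<close> Rv[of P] by (simp add: T_def algebra_simps)
  qed
  have QT: "Q * T + T * Q = T"
  proof -
    have "Q * w + w * Q = w"
      by (simp add: kkw kkw' Qw)
    then have "star (Q * w + w * Q) = star w"
      by simp
    then have "Q * star w + star w * Q = star w"
      using Q' by (simp add: add.commute)
    then show ?thesis
      using \<open>Q * w + w * Q = w\<close> Rv[of Q] by (simp add: T_def algebra_simps)
  qed
  have comm_E: "R * E = E * R" if "R * T + T * R = T" for R
  proof -
    have RT: "R * T = T - T * R"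
      using that by (simp add: eq_diff_eq)
    have "R * E = (R * T) * T"
      by (simp add: E_def mult.assoc)
    also have "\<dots> = E - T * (R * T)"
      by (simp add: RT E_def left_diff_distrib mult.assoc)
    also have "\<dots> = E * R"
      by (simp add: RT E_def right_diff_distrib mult.assoc)
    finally show ?thesis .
  qed
  have vvE: "v * v * E = v * v"
    by (simp add: E distrib_left mult.assoc assoc2[OF vw(1)] vw vvv pv)
  have le_E: "R * E = R \<and> E * R = R" if "R * T + T * R = T" "k * R * E = k * R" for R
  proof -
    have "v * v * R * E = v * v * R"
    proof -
      have "v * v * R * E = (v * v * E) * R"
        by (simp add: mult.assoc comm_E[OF that(1)])
      then show ?thesis
        by (simp only: vvE)
    qed
    moreover have "R = k * R + v * v * R"
      by (simp add: k_def left_diff_distrib)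
    ultimately have "R * E = R"
      using that(2) by (metis distrib_right)
    then show ?thesis
      using comm_E[OF that(1)] by simp
  qed
  have "p * E = p"
    using assoc2[OF wr(1), of "star w"] assoc2[OF ps(8), of "v * v"] assoc2[OF vk(2), of v] ps
    by (simp add: E distrib_left mult.assoc)
  then have PE: "P * E = P \<and> E * P = P"
    by (intro le_E PT) (simp add: p_def Pk)
  have "q * (w * star w) = \<beta>"
  proof -
    have "q * w = w2"
      by (simp add: w_def algebra_simps w1r w2r)
    then have "q * (w * star w) = w2 * star w1 + w2 * star w2"
      by (simp add: w_def distrib_left assoc2)
    moreover have "w2 * star w1 = 0"
    proof -
      have "w2 * star w1 = w2 * \<alpha> * star (w1 * g)"
        by (simp add: w1g w2a)
      also have "\<dots> = w2 * (\<alpha> * g) * star w1"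
        using proj by (simp add: is_proj_def mult.assoc)
      also have "\<alpha> * g = 0"
        using ps by (simp add: defs algebra_simps ps')
      finally show ?thesis
        by simp
    qed
    ultimately show ?thesis
      by (simp add: w2b)
  qed
  then have "q * E = q"
    using assoc2[OF ps(9), of "v * v"] assoc2[OF vk(2), of v] ps(5)
    by (simp add: E distrib_left mult.assoc) (simp add: defs)
  then have QE: "Q * E = Q \<and> E * Q = Q"
    by (intro le_E QT) (simp add: q_def Qk)
  show ?thesis
    by (rule that[OF EM(1) Ep tE TM E_def[symmetric] ET TE conjunct1[OF PE] conjunct2[OF PE]
          conjunct1[OF QE] conjunct2[OF QE] PT QT])
qed

end

section \<open>The metric on projections of fixed trace\<close>

lemma powr_tangent_gt:
  fixes y :: real
  assumes "q > 1" "y \<ge> 0" "y \<noteq> 1"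
  shows "y powr q > 1 + q * (y - 1)"
proof (cases "y = 0")
  case False
  then have y: "y > 0" using assms by simp
  have d: "((\<lambda>x. x powr q) has_real_derivative q * x powr (q - 1)) (at x)" if "x > 0" for x
    using that by (auto intro!: derivative_eq_intros)
  consider "y < 1" | "y > 1" using assms(3) by linarith
  then show ?thesis
  proof cases
    case 1
    obtain z where z: "y < z" "z < 1" "1 powr q - y powr q = (1 - y) * (q * z powr (q - 1))"
      using MVT2[of y 1 "\<lambda>x. x powr q" "\<lambda>x. q * x powr (q - 1)"] d 1 y by auto
    have "z powr (q - 1) < 1 powr (q - 1)"
      using z y assms(1) by (intro powr_less_mono2) auto
    then have "(1 - y) * (q * z powr (q - 1)) < (1 - y) * (q * 1)"
      using 1 assms(1) by (intro mult_strict_left_mono) auto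
    then show ?thesis
      using z(3) by (simp add: algebra_simps)
  next
    case 2
    obtain z where z: "1 < z" "z < y" "y powr q - 1 powr q = (y - 1) * (q * z powr (q - 1))"
      using MVT2[of 1 y "\<lambda>x. x powr q" "\<lambda>x. q * x powr (q - 1)"] d 2 by auto
    have "1 powr (q - 1) < z powr (q - 1)"
      using z assms(1) by (intro powr_less_mono2) auto
    then have "(y - 1) * (q * 1) < (y - 1) * (q * z powr (q - 1))"
      using 2 assms(1) by (intro mult_strict_left_mono) auto
    then show ?thesis
      using z(3) by (simp add: algebra_simps)
  qed
qed (use assms in simp)

lemma powr_tangent_lt:
  fixes y :: real
  assumes "0 < q" "q < 1" "y \<ge> 0" "y \<noteq> 1"
  shows "y powr q < 1 + q * (y - 1)"
proof -
  \<comment> \<open>The exponent \<open>1 / q\<close> exceeds 1, so the strict tangent inequality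
    for convex powers applies to the inverse function.\<close>
  define w where "w = y powr q"
  have w: "w \<ge> 0" "w powr (1 / q) = y"
    using assms by (simp_all add: w_def powr_powr)
  have "w \<noteq> 1"
    using w assms(4) by auto
  then have "y > 1 + (1 / q) * (w - 1)"
    using powr_tangent_gt[of "1 / q" w] w assms by simp
  then show ?thesis
    using assms(1) by (simp add: w_def field_simps)
qed

definition tangent :: "real \<Rightarrow> real \<Rightarrow> real \<Rightarrow> real" where
  "tangent q s x = pw q s + q * s powr (q - 1) * (x - s)"

lemma pw_scale:
  assumes "s > 0" "x \<ge> 0"
  shows "pw q x = s powr q * (x / s) powr q" "tangent q s x = s powr q * (1 + q * (x / s - 1))"
proof -
  show "pw q x = s powr q * (x / s) powr q"
    using assms by (simp add: pw_def flip: powr_mult)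
  have "s powr (q - 1) = s powr q / s"
    using assms by (simp add: powr_diff)
  then show "tangent q s x = s powr q * (1 + q * (x / s - 1))"
    using assms by (simp add: tangent_def pw_def field_simps)
qed

lemma tangent_le_pw:
  assumes "q > 1" "s > 0" "x \<ge> 0"
  shows "tangent q s x \<le> pw q x" "tangent q s x = pw q x \<Longrightarrow> x = s"
proof -
  have "tangent q s x < pw q x" if "x \<noteq> s"
    unfolding pw_scale[OF assms(2,3)] using assms that
    by (intro mult_strict_left_mono powr_tangent_gt) auto
  moreover have "tangent q s s = pw q s"
    by (simp add: tangent_def)
  ultimately show "tangent q s x \<le> pw q x" "tangent q s x = pw q x \<Longrightarrow> x = s"
    by (cases "x = s"; force)+
qed

lemma pw_le_tangent:
  assumes "0 < q" "q < 1" "s > 0" "x \<ge> 0"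
  shows "pw q x \<le> tangent q s x" "tangent q s x = pw q x \<Longrightarrow> x = s"
proof -
  have "pw q x < tangent q s x" if "x \<noteq> s"
    unfolding pw_scale[OF assms(3,4)] using assms that
    by (intro mult_strict_left_mono powr_tangent_lt) auto
  moreover have "tangent q s s = pw q s"
    by (simp add: tangent_def)
  ultimately show "pw q x \<le> tangent q s x" "tangent q s x = pw q x \<Longrightarrow> x = s"
    by (cases "x = s"; force)+
qed

text \<open>A line through the point (1, 1) with positive slope that dominates the power on the unit
  interval: the tangent at 1 for \<open>q < 1\<close>, the diagonal otherwise. The positive slope
  turns maximal distance into orthogonality.\<close>

lemma pw_le_chord:
  assumes "q > 0"
  obtains d where "d > 0" "\<And>x. 0 \<le> x \<Longrightarrow> x \<le> 1 \<Longrightarrow> pw q x \<le> (1 - d) + d * x"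
proof (cases "q < 1")
  case True
  have "pw q x \<le> (1 - q) + q * x" if "0 \<le> x" for x
    using pw_le_tangent(1)[OF assms True _ that, of 1] by (simp add: tangent_def algebra_simps)
  then show ?thesis
    using that[of q] assms by simp
next
  case False
  have "pw q x \<le> x" if "0 \<le> x" "x \<le> 1" for x
    using that False powr_mono'[of 1 q x] by (cases "x = 0") (auto simp: pw_def)
  then show ?thesis
    using that[of 1] by simp
qed

lemma pw_mono: "q > 0 \<Longrightarrow> x \<le> y \<Longrightarrow> pw q x \<le> pw q y"
  unfolding pw_def by (intro powr_mono2) auto

lemma continuous_tangent: "continuous_on UNIV (tangent q s)"
  unfolding tangent_def by (intro continuous_intros)

text \<open>The mean value theorem is applied twice on the interval from 1/4 to 3/4, where the power
  is smooth; outside, the square is bounded below. The point 1/2 is the value of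
  \<open>(P - Q)\<^sup>2\<close> in the corner when the two symmetries anticommute.\<close>

lemma pw_tangent_quadratic:
  assumes "q > 0"
  obtains C where "C \<ge> 0" "\<And>x. 0 \<le> x \<Longrightarrow> x \<le> 1 \<Longrightarrow> \<bar>pw q x - tangent q (1/2) x\<bar> \<le> C * (x - 1/2)\<^sup>2"
proof -
  define h where "h x = q * (q - 1) * x powr (q - 2)" for x :: real
  have "continuous_on {1/4..3/4} h"
    unfolding h_def by (intro continuous_intros) auto
  then have "bounded (h ` {1/4..3/4})"
    by (intro compact_imp_bounded compact_continuous_image compact_Icc)
  then obtain B where "\<forall>y\<in>h ` {1/4..3/4}. norm y \<le> B"
    unfolding bounded_iff by blast
  then have B: "\<And>x. x \<in> {1/4..3/4} \<Longrightarrow> \<bar>h x\<bar> \<le> B"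
    by (simp only: ball_simps real_norm_def)
  have B0: "B \<ge> 0"
    using B[of "1/2"] by force
  define L where "L = 2 + q * (1/2) powr (q - 1)"
  have L0: "L \<ge> 0"
    using assms by (simp add: L_def)
  have near: "\<bar>pw q x - tangent q (1/2) x\<bar> \<le> B * (x - 1/2)\<^sup>2" if x: "x \<in> {1/4..3/4}" for x
  proof -
    define g where "g y = y powr q - (1/2) powr q - q * (1/2) powr (q - 1) * (y - 1/2)" for y :: real
    define g' where "g' y = q * y powr (q - 1) - q * (1/2) powr (q - 1)" for y :: real
    have dg: "(g has_real_derivative g' y) (at y)" if "y > 0" for y
      unfolding g_def g'_def using that by (auto intro!: derivative_eq_intros)
    have dg': "(g' has_real_derivative h y) (at y)" if "y > 0" for y
      unfolding g'_def h_def using that by (auto intro!: derivative_eq_intros simp: algebra_simps)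
    have g'b: "\<bar>g' y\<bar> \<le> B * \<bar>y - 1/2\<bar>" if "y \<in> {1/4..3/4}" for y
    proof -
      have "norm (g' y - g' (1/2)) \<le> B * norm (y - 1/2)"
      proof (rule field_differentiable_bound[of "{1/4..3/4}" g' h])
        show "(g' has_field_derivative h z) (at z within {1/4..3/4})" if "z \<in> {1/4..3/4}" for z
          using dg'[of z] that by (auto intro: has_field_derivative_at_within)
      qed (use B that in auto)
      then show ?thesis
        by (simp add: g'_def)
    qed
    have "norm (g x - g (1/2)) \<le> (B * \<bar>x - 1/2\<bar>) * norm (x - 1/2)"
    proof (rule field_differentiable_bound[of "closed_segment (1/2) x" g g'])
      have seg: "closed_segment (1/2) x \<subseteq> {1/4..3/4}"
        using x by (auto simp: closed_segment_eq_real_ivl split: if_splits)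
      fix z assume z: "z \<in> closed_segment (1/2) x"
      then have z': "z \<in> {1/4..3/4}"
        using seg by blast
      show "(g has_field_derivative g' z) (at z within closed_segment (1/2) x)"
        by (rule has_field_derivative_at_within, rule dg) (use z' in simp)
      have "\<bar>z - 1/2\<bar> \<le> \<bar>x - 1/2\<bar>"
        using z by (auto simp: closed_segment_eq_real_ivl split: if_splits)
      then show "norm (g' z) \<le> B * \<bar>x - 1/2\<bar>"
        using order_trans[OF g'b[OF z'] mult_left_mono[OF _ B0]] by simp
    qed auto
    then have "\<bar>g x\<bar> \<le> B * (x - 1/2)\<^sup>2"
      by (simp add: g_def power2_eq_square mult.assoc flip: abs_mult)
    then show ?thesis
      using x by (simp add: g_def tangent_def pw_def)
  qed
  \<comment> \<open>Here \<open>x\<close> is at distance at least 1/4 from 1/2, so the square is at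
    least 1/16, whence the factor 16.\<close>
  have far: "\<bar>pw q x - tangent q (1/2) x\<bar> \<le> (16 * L) * (x - 1/2)\<^sup>2" if "0 \<le> x" "x \<le> 1" "x \<notin> {1/4..3/4}" for x
  proof -
    have 1: "0 \<le> pw q x" "pw q x \<le> 1" "0 \<le> pw q (1/2)" "pw q (1/2) \<le> 1"
      using pw_mono[OF assms, of x 1] pw_mono[OF assms, of "1/2" 1] that by auto
    have "\<bar>q * (1/2) powr (q - 1) * (x - 1/2)\<bar> \<le> q * (1/2) powr (q - 1) * 1"
      using that assms unfolding abs_mult by (intro mult_mono) auto
    then have "\<bar>pw q x - tangent q (1/2) x\<bar> \<le> L"
      using 1 unfolding tangent_def L_def by linarith
    moreover have "1 / 4 \<le> \<bar>x - 1/2\<bar>"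
      using that by (auto simp: abs_if)
    then have "(1/4)\<^sup>2 \<le> (x - 1/2)\<^sup>2"
      by (metis abs_le_square_iff abs_of_nonneg zero_le_divide_1_iff zero_le_numeral)
    then have "L * 1 \<le> L * (16 * (x - 1/2)\<^sup>2)"
      using L0 by (intro mult_left_mono) (auto simp: power2_eq_square)
    ultimately show ?thesis
      by (simp add: algebra_simps)
  qed
  show ?thesis
  proof (rule that[of "B + 16 * L"])
    fix x :: real assume x: "0 \<le> x" "x \<le> 1"
    have "0 \<le> B * (x - 1/2)\<^sup>2" "0 \<le> (16 * L) * (x - 1/2)\<^sup>2"
      using B0 L0 by auto
    then show "\<bar>pw q x - tangent q (1/2) x\<bar> \<le> (B + 16 * L) * (x - 1/2)\<^sup>2"
      using near[of x] far[OF x] by (cases "x \<in> {1/4..3/4}") (auto simp: distrib_right)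
  qed (use B0 L0 in simp)
qed

lemma fc_scalar_one: "continuous_on UNIV f \<Longrightarrow> fc f (r *\<^sub>R 1 :: 'a :: chilbert_space cop) = f r *\<^sub>R 1"
proof -
  assume "continuous_on UNIV f"
  have "x = r" if "x \<in> spec (r *\<^sub>R 1 :: 'a cop)" for x
    using that spec_subset[of r "r *\<^sub>R 1 :: 'a cop" r] by auto
  then have "fc f (r *\<^sub>R 1 :: 'a cop) = fc (\<lambda>_. f r) (r *\<^sub>R 1)"
    by (intro fc_cong) auto
  then show ?thesis
    by (simp add: fc_const)
qed

text \<open>\<open>e\<close> intertwines \<open>b\<close> with every self-adjoint operator that
  agrees with \<open>b\<close> on the range of \<open>e\<close>, so the compressed calculus ignores
  the complement. The last form serves to complete a lower bound
  \<open>s *\<^sub>R e \<le> b\<close> to one by \<open>s *\<^sub>R 1\<close>.\<close>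

lemma fc_corner:
  fixes e b :: "'a :: chilbert_space cop"
  assumes "is_proj e" "star b = b" "continuous_on UNIV f"
  shows "e * fc f (r *\<^sub>R e) = f r *\<^sub>R e"
    "e * b = b \<Longrightarrow> f 0 = 0 \<Longrightarrow> e * fc f b = fc f b"
    "e * b = b \<Longrightarrow> e * fc f (b + r *\<^sub>R (1 - e)) = e * fc f b"
proof -
  have "e * fc f (r *\<^sub>R e) = fc f (r *\<^sub>R 1) * e"
    using assms by (intro fc_intertwine) (simp_all add: is_proj_def)
  then show "e * fc f (r *\<^sub>R e) = f r *\<^sub>R e"
    by (simp add: fc_scalar_one assms(3))
  assume eb: "e * b = b"
  then have be: "b * e = b"
    using assms by (metis is_proj_def star_mult)
  have ec: "e * fc f b = fc f b * e"
    by (rule fc_commute[OF assms(2,3)]) (simp add: eb be)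
  have "(1 - e) * fc f b = fc f (0 *\<^sub>R 1) * (1 - e)"
    using assms eb by (intro fc_intertwine) (simp_all add: algebra_simps)
  moreover have "fc f (0 *\<^sub>R 1 :: 'a cop) = 0" if "f 0 = 0"
    using fc_scalar_one[OF assms(3), of 0, where 'a = 'a] that by simp
  ultimately show "e * fc f b = fc f b" if "f 0 = 0"
    using that by (simp add: left_diff_distrib)
  have "e * fc f (b + r *\<^sub>R (1 - e)) = fc f b * e"
    using assms eb be by (intro fc_intertwine) (simp_all add: is_proj_def algebra_simps)
  then show "e * fc f (b + r *\<^sub>R (1 - e)) = e * fc f b"
    by (simp add: ec)
qed

context fin_factor
begin

lemma t_proj_mult_mono:
  assumes "R \<in> M" "is_proj R" "x \<in> M" "y \<in> M" "x \<le> y"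
  shows "t (R * x) \<le> t (R * y)"
proof -
  have *: "t (R * z) = t (star R * z * R)" if "z \<in> M" for z
    using t_comm[of R "z * R"] assms(1,2) that t_comm[of z R] by (simp add: is_proj_def mult.assoc)
  show ?thesis
    using assms t_mono[OF _ _ conj_mono[OF assms(5), of R]] by (simp add: *)
qed

definition corner_elem :: "'a cop \<Rightarrow> 'a cop \<Rightarrow> bool" where
  "corner_elem R b \<longleftrightarrow> R \<in> M \<and> is_proj R \<and> b \<in> M \<and> 0 \<le> b \<and> b \<le> R \<and> R * b = b"

lemma corner_elemD:
  assumes "corner_elem R b"
  shows "R \<in> M" "is_proj R" "b \<in> M" "star b = b" "R * b = b" "b * R = b" "R * R = R" "star R = R"
    "x \<in> spec b \<Longrightarrow> 0 \<le> x" "x \<in> spec b \<Longrightarrow> x \<le> 1"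
proof -
  have b: "star b = b" "0 \<le> b" "b \<le> 1 *\<^sub>R 1"
    using assms star_nonneg order_trans[OF _ is_proj_le_one] by (auto simp: corner_elem_def)
  then show "star b = b" "x \<in> spec b \<Longrightarrow> 0 \<le> x" "x \<in> spec b \<Longrightarrow> x \<le> 1"
    using spec_nonneg[of b x] spec_upper_bound[of b 1 x] by auto
  show "R \<in> M" "is_proj R" "b \<in> M" "R * b = b" "R * R = R" "star R = R"
    using assms by (auto simp: corner_elem_def is_proj_def)
  then show "b * R = b"
    using b(1) by (metis star_mult)
qed

lemma corner_fc_mono:
  assumes "corner_elem R b" "continuous_on UNIV f" "continuous_on UNIV g"
    and "\<And>x. 0 \<le> x \<Longrightarrow> x \<le> 1 \<Longrightarrow> f x \<le> g x"
  shows "t (R * fc f b) \<le> t (R * fc g b)"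
  using corner_elemD[OF assms(1)] assms
  by (intro t_proj_mult_mono fc_closed fc_mono) auto

lemma corner_fc_linear:
  assumes "corner_elem R b"
  shows "t (R * fc (\<lambda>x. \<alpha> + \<beta> * x) b) = \<alpha> * t R + \<beta> * t b"
proof -
  note b = corner_elemD[OF assms]
  have "fc (\<lambda>x. \<alpha> + \<beta> * x) b = \<alpha> *\<^sub>R 1 + \<beta> *\<^sub>R b"
    using fc_add[OF b(4), of "\<lambda>_. \<alpha>" "\<lambda>x. \<beta> * x"] fc_scale[OF b(4), of "\<lambda>x. x" \<beta>]
    by (simp add: fc_const fc_id b continuous_on_mult continuous_on_id)
  then show ?thesis
    using b by (simp add: distrib_left t_linear)
qed

lemma corner_fc_square:
  assumes "corner_elem R b"
  shows "t (R * fc (\<lambda>x. (x - s)\<^sup>2) b) = t ((b - s *\<^sub>R R) * (b - s *\<^sub>R R))"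
proof -
  note b = corner_elemD[OF assms]
  have c: "continuous_on UNIV (\<lambda>x. x - s)"
    by (intro continuous_intros)
  have "fc (\<lambda>x. x - s) b = b - s *\<^sub>R 1"
    using fc_diff[OF b(4), of "\<lambda>x. x" "\<lambda>_. s"] by (simp add: fc_const fc_id b continuous_on_id)
  then have "fc (\<lambda>x. (x - s)\<^sup>2) b = (b - s *\<^sub>R 1) * (b - s *\<^sub>R 1)"
    unfolding power2_eq_square using fc_mult[OF b(4) c c] by simp
  moreover have "R * ((b - s *\<^sub>R 1) * (b - s *\<^sub>R 1)) = (b - s *\<^sub>R R) * (b - s *\<^sub>R R)"
    using b assoc2[OF b(5), of b] by (simp add: algebra_simps)
  ultimately show ?thesis
    by simp
qed

text \<open>The equality case of a tangent inequality, without spectral measures. Away from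
  \<open>s\<close> compactness bounds \<open>F\<close> below, so
  \<open>(x - s)\<^sup>2 \<le> e + C * F x\<close> on the unit interval; applying the trace gives
  \<open>e\<close> as a bound for the trace of \<open>(b - s *\<^sub>R R)\<^sup>2\<close>, for every
  positive \<open>e\<close>.\<close>

lemma corner_fc_strict:
  assumes "corner_elem R b" "continuous_on UNIV F" "0 \<le> s" "s \<le> 1"
    and F: "\<And>x. 0 \<le> x \<Longrightarrow> x \<le> 1 \<Longrightarrow> 0 \<le> F x" "\<And>x. 0 \<le> x \<Longrightarrow> x \<le> 1 \<Longrightarrow> F x = 0 \<Longrightarrow> x = s"
    and zero: "t (R * fc F b) \<le> 0"
  shows "b = s *\<^sub>R R"
proof -
  note b = corner_elemD[OF assms(1)]
  have est: "\<exists>C\<ge>0. \<forall>x. 0 \<le> x \<and> x \<le> 1 \<longrightarrow> (x - s)\<^sup>2 \<le> e + C * F x" if e: "e > 0" for e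
  proof -
    define S where "S = {x. e \<le> (x - s)\<^sup>2} \<inter> {0..1}"
    have "compact S"
      unfolding S_def by (intro closed_Int_compact closed_Collect_le continuous_intros compact_Icc)
    show ?thesis
    proof (cases "S = {}")
      case True
      then have "(x - s)\<^sup>2 \<le> e" if "0 \<le> x \<and> x \<le> 1" for x
        using that by (force simp: S_def)
      then show ?thesis
        by (intro exI[of _ 0]) auto
    next
      case False
      obtain x0 where x0: "x0 \<in> S" "\<And>x. x \<in> S \<Longrightarrow> F x0 \<le> F x"
        using continuous_attains_inf[OF \<open>compact S\<close> False continuous_on_subset[OF assms(2)]] by auto
      have "x0 \<noteq> s" "0 \<le> x0" "x0 \<le> 1"
        using x0(1) e by (auto simp: S_def)
      then have pos: "F x0 > 0"
        using F[of x0] by fastforce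
      have "(x - s)\<^sup>2 \<le> e + (1 / F x0) * F x" if x: "0 \<le> x \<and> x \<le> 1" for x
      proof (cases "x \<in> S")
        case True
        have "\<bar>x - s\<bar> \<le> 1"
          using x assms(3,4) by auto
        then have "(x - s)\<^sup>2 \<le> 1"
          by (simp add: abs_square_le_1)
        moreover have "1 \<le> (1 / F x0) * F x"
          using x0(2)[OF True] pos by (simp add: field_simps)
        ultimately show ?thesis
          using e by linarith
      next
        case False
        then have "(x - s)\<^sup>2 \<le> e"
          using x by (auto simp: S_def)
        moreover have "0 \<le> (1 / F x0) * F x"
          using pos F(1) x by simp
        ultimately show ?thesis
          by linarith
      qed
      then show ?thesis
        using pos by (intro exI[of _ "1 / F x0"]) auto
    qed
  qed
  define d where "d = b - s *\<^sub>R R"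
  have d: "d \<in> M" "star d = d"
    using b by (simp_all add: d_def)
  have small: "t (star d * d) \<le> e" if e: "e > 0" for e
  proof -
    obtain C where C: "C \<ge> 0" "\<And>x. 0 \<le> x \<Longrightarrow> x \<le> 1 \<Longrightarrow> (x - s)\<^sup>2 \<le> e + C * F x"
      using est[OF e] by blast
    have "t (star d * d) = t (R * fc (\<lambda>x. (x - s)\<^sup>2) b)"
      using corner_fc_square[OF assms(1), of s] d by (simp add: d_def)
    also have "\<dots> \<le> t (R * fc (\<lambda>x. e + C * F x) b)"
      using C(2) by (intro corner_fc_mono[OF assms(1)] continuous_intros assms)
    also have "fc (\<lambda>x. e + C * F x) b = e *\<^sub>R 1 + C *\<^sub>R fc F b"
      using fc_add[OF b(4), of "\<lambda>_. e" "\<lambda>x. C * F x"] fc_scale[OF b(4) assms(2), of C] assms(2)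
      by (simp add: fc_const b continuous_on_mult)
    also have "t (R * (e *\<^sub>R 1 + C *\<^sub>R fc F b)) = e * t R + C * t (R * fc F b)"
      using b fc_closed[OF b(3,4) assms(2)] by (simp add: distrib_left t_linear)
    also have "\<dots> \<le> e * 1 + C * 0"
      using e C(1) zero t_proj_le_one[OF b(1,2)] by (intro add_mono mult_left_mono) auto
    finally show ?thesis
      by simp
  qed
  have "t (star d * d) \<le> 0"
    by (rule field_le_epsilon) (use small in force)
  then have "d = 0"
    by (rule t_star_mult_le_zero[OF d(1)])
  then show ?thesis
    by (simp add: d_def)
qed

text \<open>For \<open>q = p / 2\<close> this is the p-th power of the distance in the
  p-norm.\<close>

definition D :: "real \<Rightarrow> 'a cop \<Rightarrow> 'a cop \<Rightarrow> real" where
  "D q P Q = t (fc (pw q) ((P - Q) * (P - Q)))"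

lemma compress_corner:
  assumes "P \<in> Pc c" "R \<in> M" "is_proj R"
  shows "corner_elem R (R * P * R)" "corner_elem R (R - R * P * R)"
proof -
  have "star R * P * R \<le> star R * 1 * R"
    by (rule conj_mono[OF is_proj_le_one[OF PcD(2)[OF assms(1)]]])
  moreover have "0 \<le> star R * P * R"
    by (rule conj_nonneg[OF is_proj_nonneg[OF PcD(2)[OF assms(1)]]])
  ultimately show "corner_elem R (R * P * R)" "corner_elem R (R - R * P * R)"
    using PcD[OF assms(1)] assms(2,3)
    by (simp_all add: corner_elem_def is_proj_def right_diff_distrib flip: mult.assoc)
qed

text \<open>With \<open>Y = (P - Q)\<^sup>2\<close> and \<open>Z = P + Q - 1\<close> one has \<open>PZ = ZQ\<close> and \<open>Z\<^sup>2 = 1 - Y\<close>, so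
  \<open>\<tau>(P Y\<^sup>n) - \<tau>(Q Y\<^sup>n)\<close> does not depend on \<open>n\<close>.\<close>

lemma D_eq_corner:
  assumes P: "P \<in> Pc c" and Q: "Q \<in> Pc c" and q: "q > 0"
  shows "D q P Q = 2 * t (Q * fc (pw q) (Q - Q * P * Q))"
proof -
  note P' = PcD[OF P] and Q' = PcD[OF Q]
  define Y where "Y = (P - Q) * (P - Q)"
  define Z where "Z = P + Q - 1"
  note simps = assoc2[OF P'(4)] assoc2[OF Q'(4)] P'(4) Q'(4)
  have YM: "Y \<in> M" "star Y = Y" "Z \<in> M"
    using P' Q' by (simp_all add: Y_def Z_def)
  have PY: "P * Y = Y * P" and QY: "Q * Y = Y * Q" and ZY: "Z * Y = Y * Z"
    and ZZ: "Z * Z = 1 - Y" and PZ: "P * Z = Z * Q"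
    by (simp_all add: Y_def Z_def algebra_simps simps)
  have PQ: "t (P * pev f Y) = t (Q * pev f Y)" for f
  proof (induction f)
    case (pCons a f)
    define F where "F = pev f Y"
    have F: "F \<in> M" "Z * F = F * Z"
      using YM pev_intertwine[OF ZY] by (simp_all add: F_def)
    have "t (P * F * (Z * Z)) = t (Z * (P * F * Z))"
      using t_comm[of "P * F * Z" Z] F P' YM by (simp add: mult.assoc)
    also have "Z * (P * F * Z) = Z * (P * Z) * F"
      using F(2) by (simp add: mult.assoc)
    also have "\<dots> = Z * Z * Q * F"
      by (simp add: PZ mult.assoc)
    also have "t \<dots> = t (Q * F * (Z * Z))"
      using t_comm[of "Z * Z" "Q * F"] F Q' YM by (simp add: mult.assoc)
    finally have "t (P * F) - t (P * F * Y) = t (Q * F) - t (Q * F * Y)"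
      using F P' Q' YM by (simp add: ZZ right_diff_distrib t_diff)
    moreover have "F * Y = Y * F"
      unfolding F_def by (rule pev_intertwine[symmetric]) simp
    ultimately have "t (P * (Y * F)) = t (Q * (Y * F))"
      using pCons.IH by (simp add: F_def mult.assoc)
    then show ?case
      using P' Q' YM F by (simp add: distrib_left t_linear flip: F_def)
  qed simp
  have compress: "(R * Y) * pev g (R * Y) = R * (Y * pev g Y)" if "R * R = R" "R * Y = Y * R" for R g
  proof -
    have "R * pev g Y = pev g (R * Y) * R"
      by (rule pev_intertwine) (use that in \<open>simp add: mult.assoc\<close>)
    moreover have "(R * Y) * pev g (R * Y) = pev g (R * Y) * (R * Y)"
      by (rule pev_intertwine) simp
    ultimately have "(R * Y) * pev g (R * Y) = R * pev g Y * Y"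
      by (simp flip: mult.assoc)
    moreover have "pev g Y * Y = Y * pev g Y"
      by (rule pev_intertwine[symmetric]) simp
    ultimately show ?thesis
      by (simp add: mult.assoc)
  qed
  have QYe: "Q * Y = Q - Q * P * Q" and PYe: "P * Y = P * (1 - Q) * star (P * (1 - Q))"
    and QYe': "(1 - Q) * Y = star (P * (1 - Q)) * (P * (1 - Q))"
    using P' Q' by (simp_all add: Y_def algebra_simps simps)
  \<comment> \<open>With \<open>x = P * (1 - Q)\<close> the elements \<open>(1 - Q) * Y\<close> and
    \<open>P * Y\<close> are \<open>star x * x\<close> and \<open>x * star x\<close>. So the part of
    \<open>W\<close> under \<open>1 - Q\<close> has the same trace as the part under
    \<open>P\<close>, and by \<open>PQ\<close> the same as the part under \<open>Q\<close>; hence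
    the factor 2.\<close>
  have eq: "t (Y * pev g Y) = 2 * t ((Q - Q * P * Q) * pev g (Q - Q * P * Q))" for g
  proof -
    define W where "W = Y * pev g Y"
    have WM: "W \<in> M"
      using YM by (simp add: W_def)
    have "t ((1 - Q) * W) = t (((1 - Q) * Y) * pev g ((1 - Q) * Y))"
      unfolding W_def using Q' QY by (subst compress) (simp_all add: algebra_simps)
    also have "\<dots> = t (P * Y * pev g (P * Y))"
    proof -
      have "t (fc (poly (pCons 0 g)) (star (P * (1 - Q)) * (P * (1 - Q)))) =
          t (fc (poly (pCons 0 g)) (P * (1 - Q) * star (P * (1 - Q))))"
        using P' Q' by (intro t_fc_star_mult continuous_intros) auto
      then show ?thesis
        unfolding QYe' PYe by (subst (asm) (1 2) fc_poly) simp_all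
    qed
    also have "\<dots> = t (P * W)"
      unfolding W_def by (subst compress) (use P' PY in simp_all)
    also have "\<dots> = t (Q * W)"
      using PQ[of "pCons 0 g"] by (simp add: W_def)
    finally have "t W = 2 * t (Q * W)"
      using Q' WM by (simp add: left_diff_distrib t_diff)
    then show ?thesis
      unfolding W_def QYe[symmetric] by (subst compress) (use Q' QY in simp_all)
  qed
  have c: "corner_elem Q (Q - Q * P * Q)"
    using compress_corner[OF P Q'(1,2)] by simp
  have "D q P Q = 2 * t (fc (pw q) (Q - Q * P * Q))"
    unfolding D_def Y_def[symmetric]
    by (rule t_fc_eq[OF YM(1,2) _ _ continuous_pw[OF q] _ eq]) (use corner_elemD[OF c] in auto)
  also have "fc (pw q) (Q - Q * P * Q) = Q * fc (pw q) (Q - Q * P * Q)"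
    using fc_corner(2)[OF Q'(2) corner_elemD(4)[OF c] continuous_pw[OF q] corner_elemD(5)[OF c]] by simp
  finally show ?thesis .
qed

lemma D_of_scalar:
  assumes "P \<in> Pc c" "Q \<in> Pc c" "q > 0" "Q * P * Q = s *\<^sub>R Q"
  shows "D q P Q = 2 * (c * pw q (1 - s))"
proof -
  have "Q - Q * P * Q = (1 - s) *\<^sub>R Q"
    by (simp only: assms(4)) (simp add: algebra_simps)
  then show ?thesis
    using D_eq_corner[OF assms(1-3)] PcD[OF assms(2)]
    by (simp add: fc_corner(1)[OF _ star_one continuous_pw[OF assms(3)]] t_scaleR)
qed

text \<open>Bounding \<open>pw q\<close> by a line \<open>(1 - d) + d * x\<close> with positive
  \<open>d\<close> turns the maximal value into \<open>t (Q * P * Q) \<le> 0\<close>, and the trace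
  is faithful.\<close>

lemma D_max_iff_orthogonal:
  assumes P: "P \<in> Pc c" and Q: "Q \<in> Pc c" and q: "q > 0" and c: "c > 0"
  shows "D q P Q = 2 * c \<longleftrightarrow> P * Q = 0"
proof
  assume "P * Q = 0"
  then show "D q P Q = 2 * c"
    using D_of_scalar[OF P Q q, of 0] by (simp add: mult.assoc)
next
  note P' = PcD[OF P] and Q' = PcD[OF Q]
  have ce: "corner_elem Q (Q - Q * P * Q)"
    using compress_corner[OF P Q'(1,2)] by simp
  assume "D q P Q = 2 * c"
  then have eq: "t (Q * fc (pw q) (Q - Q * P * Q)) = c"
    using D_eq_corner[OF P Q q] by simp
  obtain d where d: "d > 0" "\<And>x. 0 \<le> x \<Longrightarrow> x \<le> 1 \<Longrightarrow> pw q x \<le> (1 - d) + d * x"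
    using pw_le_chord[OF q] by auto
  have "c \<le> t (Q * fc (\<lambda>x. (1 - d) + d * x) (Q - Q * P * Q))"
    unfolding eq[symmetric] by (intro corner_fc_mono[OF ce] continuous_pw[OF q] continuous_intros d)
  also have "\<dots> = (1 - d) * c + d * (c - t (Q * P * Q))"
    unfolding corner_fc_linear[OF ce] using P' Q' by (simp add: t_diff)
  finally have "d * t (Q * P * Q) \<le> 0"
    by (simp add: algebra_simps)
  then have "t (star (P * Q) * (P * Q)) \<le> 0"
    using d(1) P' Q' by (simp add: mult_le_0_iff mult.assoc assoc2[OF P'(4)])
  then show "P * Q = 0"
    using P' Q' by (intro t_star_mult_le_zero) simp_all
qed

end

section \<open>Symmetries in corners of trace \<open>2 * c\<close> and the distances between their
  spectral projections\<close>

lemma nonneg_of_mult_nonneg: "0 \<le> a * b \<Longrightarrow> 0 < a \<Longrightarrow> 0 \<le> (b :: real)"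
  by (simp add: zero_le_mult_iff)

definition sym_proj :: "'a :: chilbert_space cop \<Rightarrow> 'a cop \<Rightarrow> 'a cop" where
  "sym_proj E S = (1/2) *\<^sub>R (E + S)"

context fin_factor
begin

text \<open>Trace 0 makes both spectral projections \<open>sym_proj E S\<close> and
  \<open>sym_proj E (- S)\<close> have trace \<open>c\<close>.\<close>

definition corner_symmetry :: "real \<Rightarrow> 'a cop \<Rightarrow> 'a cop \<Rightarrow> bool" where
  "corner_symmetry c E S \<longleftrightarrow> E \<in> M \<and> is_proj E \<and> t E = 2 * c \<and> S \<in> M \<and> star S = S \<and> S * S = E \<and>
     E * S = S \<and> S * E = S \<and> t S = 0"

lemma corner_symmetryD:
  assumes "corner_symmetry c E S"
  shows "E \<in> M" "is_proj E" "t E = 2 * c" "S \<in> M" "star S = S" "S * S = E" "E * S = S" "S * E = S" "t S = 0"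
    "E * E = E" "star E = E"
  using assms by (auto simp: corner_symmetry_def is_proj_def)

lemma corner_symmetry_minus: "corner_symmetry c E S \<Longrightarrow> corner_symmetry c E (- S)"
  by (simp add: corner_symmetry_def t_minus)

lemma sym_proj_Pc: "corner_symmetry c E S \<Longrightarrow> sym_proj E S \<in> Pc c"
  using corner_symmetryD[of c E S]
  by (auto simp: Pc_def sym_proj_def is_proj_def t_linear algebra_simps scaleR_2 simp flip: scaleR_scaleR)
    (simp flip: scaleR_add_left)

lemma sym_proj_orth: "corner_symmetry c E S \<Longrightarrow> sym_proj E S * sym_proj E (- S) = 0"
  using corner_symmetryD[of c E S] by (auto simp: sym_proj_def algebra_simps)

text \<open>The relation gives \<open>B * A * B = (2 * \<alpha>) *\<^sub>R B - A\<close>, and the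
  compression becomes scalar. The distance of such a pair depends only on this scalar.\<close>

lemma sym_proj_compress:
  assumes "corner_symmetry c E A" "corner_symmetry c E B" "A * B + B * A = (2 * \<alpha>) *\<^sub>R E"
  shows "sym_proj E B * sym_proj E A * sym_proj E B = ((1 + \<alpha>) / 2) *\<^sub>R sym_proj E B"
proof -
  note A = corner_symmetryD[OF assms(1)] and B = corner_symmetryD[OF assms(2)]
  have AB: "A * B = (2 * \<alpha>) *\<^sub>R E - B * A"
    using assms(3) by (simp add: eq_diff_eq)
  have BAB: "B * (A * B) = (2 * \<alpha>) *\<^sub>R B - A"
    using A B assoc2[OF B(6), of A] by (simp add: AB right_diff_distrib)
  have "(E + B) * (E + A) * (E + B) = 2 *\<^sub>R (E + B) + (A * B + B * A) + (A + B * (A * B))"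
    using A B by (simp add: algebra_simps scaleR_2 assoc2[OF B(6)])
  also have "\<dots> = (2 * (1 + \<alpha>)) *\<^sub>R (E + B)"
    unfolding BAB assms(3) by (simp add: algebra_simps)
  finally show ?thesis
    by (simp add: sym_proj_def mult.assoc)
qed

text \<open>The squared difference of the projections is
  \<open>(1/2) *\<^sub>R E - (z / 4) *\<^sub>R X\<close>, a perturbation of half the unit of the
  corner, where \<open>pw q\<close> equals its tangent up to a quadratic error.\<close>

lemma D_expansion:
  assumes S: "corner_symmetry c E S" and W: "corner_symmetry c E W" and X: "S * W + W * S = z *\<^sub>R X" "X \<in> M"
    and q: "q > 0" and C: "\<And>x. 0 \<le> x \<Longrightarrow> x \<le> 1 \<Longrightarrow> \<bar>pw q x - tangent q (1/2) x\<bar> \<le> C * (x - 1/2)\<^sup>2"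
  shows "\<bar>D q (sym_proj E S) (sym_proj E W) -
      (2 * c * pw q (1/2) - q * (1/2) powr (q - 1) * (z / 4) * t X)\<bar> \<le> C * (z / 4)\<^sup>2 * t (X * X)"
proof -
  note s = corner_symmetryD[OF S] and w = corner_symmetryD[OF W]
  define b where "b = (sym_proj E S - sym_proj E W) * (sym_proj E S - sym_proj E W)"
  define \<beta> where "\<beta> = q * (1/2) powr (q - 1)"
  have b: "b = (1/2) *\<^sub>R E - (z / 4) *\<^sub>R X"
  proof -
    have "b = (1/4) *\<^sub>R ((S - W) * (S - W))"
      by (simp add: b_def sym_proj_def flip: scaleR_diff_right)
    also have "(S - W) * (S - W) = 2 *\<^sub>R E - (S * W + W * S)"
      using s w by (simp add: algebra_simps scaleR_2)
    finally show ?thesis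
      unfolding X(1) by (simp add: scaleR_diff_right)
  qed
  have Eb: "E - b = ((1/2) *\<^sub>R (S + W)) * ((1/2) *\<^sub>R (S + W))"
  proof -
    have "(S + W) * (S + W) = 2 *\<^sub>R E + (S * W + W * S)"
      using s w by (simp add: algebra_simps scaleR_2)
    then have "((1/2) *\<^sub>R (S + W)) * ((1/2) *\<^sub>R (S + W)) = (1/4) *\<^sub>R (2 *\<^sub>R E + z *\<^sub>R X)"
      by (simp add: X)
    also have "\<dots> = E - b"
      using scaleR_add_left[of "1/2" "1/2" E] by (simp add: b algebra_simps)
    finally show ?thesis ..
  qed
  have ce: "corner_elem E b"
    unfolding corner_elem_def
  proof (intro conjI)
    show "b \<in> M"
      using s w by (simp add: b_def sym_proj_def)
    show "0 \<le> b"
      unfolding b_def using s w by (intro square_nonneg) (simp add: sym_proj_def)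
    have "0 \<le> E - b"
      unfolding Eb using s w by (intro square_nonneg) simp
    then show "b \<le> E"
      by simp
    have "E * (sym_proj E S - sym_proj E W) = sym_proj E S - sym_proj E W"
      using s w by (simp add: sym_proj_def algebra_simps)
    then show "E * b = b"
      unfolding b_def by (simp flip: mult.assoc)
  qed (use s in auto)
  note cb = corner_elemD[OF ce]
  have De: "D q (sym_proj E S) (sym_proj E W) = t (E * fc (pw q) b)"
    using fc_corner(2)[OF cb(2,4) continuous_pw[OF q] cb(5)] by (simp add: D_def flip: b_def)
  have lin: "t (E * fc (tangent q (1/2)) b) = 2 * c * pw q (1/2) - \<beta> * (z / 4) * t X"
  proof -
    have "tangent q (1/2) = (\<lambda>x. (pw q (1/2) - \<beta> / 2) + \<beta> * x)"
      by (simp add: tangent_def \<beta>_def fun_eq_iff algebra_simps)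
    then have "t (E * fc (tangent q (1/2)) b) = (pw q (1/2) - \<beta> / 2) * t E + \<beta> * t b"
      using corner_fc_linear[OF ce] by simp
    also have "t b = c - (z / 4) * t X"
      using s X(2) by (simp add: b t_linear)
    finally show ?thesis
      using s by (simp add: algebra_simps)
  qed
  have sq: "t (E * fc (\<lambda>x. (x - 1/2)\<^sup>2) b) = (z / 4)\<^sup>2 * t (X * X)"
    using corner_fc_square[OF ce, of "1/2"] X(2) by (simp add: b t_linear power2_eq_square)
  have c1: "continuous_on UNIV (\<lambda>x::real. C * (x - 1/2)\<^sup>2)" "continuous_on UNIV (\<lambda>x::real. (x - 1/2)\<^sup>2)"
    by (intro continuous_intros)+
  have fcs: "fc (\<lambda>x. C * (x - 1/2)\<^sup>2) b = C *\<^sub>R fc (\<lambda>x. (x - 1/2)\<^sup>2) b"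
    by (rule fc_scale[OF cb(4) c1(2)])
  note inM = fc_closed[OF cb(3,4) c1(2)] fc_closed[OF cb(3,4) continuous_pw[OF q]]
    fc_closed[OF cb(3,4) continuous_tangent[of q "1/2"]]
  have up: "t (E * fc (pw q) b) \<le> t (E * fc (\<lambda>x. tangent q (1/2) x + C * (x - 1/2)\<^sup>2) b)"
  proof (rule corner_fc_mono[OF ce continuous_pw[OF q] continuous_on_add[OF continuous_tangent c1(1)]])
    show "pw q x \<le> tangent q (1/2) x + C * (x - 1/2)\<^sup>2" if "0 \<le> x" "x \<le> 1" for x
      using C[OF that] by linarith
  qed
  have lo: "t (E * fc (\<lambda>x. tangent q (1/2) x - C * (x - 1/2)\<^sup>2) b) \<le> t (E * fc (pw q) b)"
  proof (rule corner_fc_mono[OF ce continuous_on_diff[OF continuous_tangent c1(1)] continuous_pw[OF q]])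
    show "tangent q (1/2) x - C * (x - 1/2)\<^sup>2 \<le> pw q x" if "0 \<le> x" "x \<le> 1" for x
      using C[OF that] by linarith
  qed
  show ?thesis
    using up lo cb(1) inM
    unfolding fc_add[OF cb(4) continuous_tangent c1(1)] fc_diff[OF cb(4) continuous_tangent c1(1)] fcs
    by (simp add: distrib_left right_diff_distrib t_linear lin sq De \<beta>_def[symmetric])
qed

end

section \<open>Isometries preserve scalar compressions and scalar anticommutators\<close>

locale projection_isometry = A: fin_factor M t + B: fin_factor N u
  for M :: "'a :: chilbert_space cop set" and t and N :: "'b :: chilbert_space cop set" and u +
  fixes c q :: real and \<phi> :: "'a cop \<Rightarrow> 'b cop"
  assumes c: "0 < c" "c \<le> 1 / 2" and q: "0 < q"
    and image: "\<phi> ` A.Pc c = B.Pc c"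
    and isometry: "P \<in> A.Pc c \<Longrightarrow> Q \<in> A.Pc c \<Longrightarrow> B.D q (\<phi> P) (\<phi> Q) = A.D q P Q"
begin

lemma phi_Pc: "P \<in> A.Pc c \<Longrightarrow> \<phi> P \<in> B.Pc c"
  using image by blast

lemma phi_orth_iff: "P \<in> A.Pc c \<Longrightarrow> Q \<in> A.Pc c \<Longrightarrow> \<phi> P * \<phi> Q = 0 \<longleftrightarrow> P * Q = 0"
  using A.D_max_iff_orthogonal[OF _ _ q c(1), of P Q] B.D_max_iff_orthogonal[OF phi_Pc phi_Pc q c(1), of P Q]
    isometry[of P Q] by simp

text \<open>The distances from \<open>\<phi> R\<close> to the two orthogonal images and the tangent
  inequality give \<open>s * c \<le> u x\<close> and \<open>(1 - s) * c \<le> u y\<close> for the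
  compressions \<open>x\<close> and \<open>y\<close>. Since \<open>x + y \<le> \<phi> R\<close>,
  both are equalities, and strict convexity makes \<open>x\<close> scalar.\<close>

lemma phi_scalar_gt_1:
  assumes q1: "q > 1" and Q: "Q \<in> A.Pc c" and Q': "Q' \<in> A.Pc c" and R: "R \<in> A.Pc c"
    and orth: "Q * Q' = 0" and s: "0 < s" "s < 1" and RQ: "R * Q * R = s *\<^sub>R R" and RQ': "R * Q' * R = (1 - s) *\<^sub>R R"
  shows "\<phi> R * \<phi> Q * \<phi> R = s *\<^sub>R \<phi> R"
proof -
  note r = B.PcD[OF phi_Pc[OF R]] and v = B.PcD[OF phi_Pc[OF Q]] and w = B.PcD[OF phi_Pc[OF Q']]
  define x where "x = \<phi> R * \<phi> Q * \<phi> R"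
  define y where "y = \<phi> R * \<phi> Q' * \<phi> R"
  have xy: "B.corner_elem (\<phi> R) (\<phi> R - x)" "B.corner_elem (\<phi> R) (\<phi> R - y)" "x \<in> N" "y \<in> N"
    unfolding x_def y_def using B.compress_corner(2)[OF phi_Pc r(1,2)] Q Q' r v w by simp_all
  have Lx: "u (\<phi> R * fc (pw q) (\<phi> R - x)) = c * pw q (1 - s)"
    using B.D_eq_corner[OF phi_Pc[OF Q] phi_Pc[OF R] q] A.D_of_scalar[OF Q R q RQ] isometry[OF Q R]
    by (simp add: x_def)
  have Ly: "u (\<phi> R * fc (pw q) (\<phi> R - y)) = c * pw q s"
    using B.D_eq_corner[OF phi_Pc[OF Q'] phi_Pc[OF R] q] A.D_of_scalar[OF Q' R q RQ'] isometry[OF Q' R]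
    by (simp add: y_def)
  have tangent_val: "u (\<phi> R * fc (tangent q a) (\<phi> R - b)) = c * pw q a + q * a powr (q - 1) * (c - u b - a * c)"
    if "B.corner_elem (\<phi> R) (\<phi> R - b)" "b \<in> N" for a b
  proof -
    have "tangent q a = (\<lambda>z. (pw q a - q * a powr (q - 1) * a) + q * a powr (q - 1) * z)"
      by (simp add: tangent_def fun_eq_iff algebra_simps)
    then have "u (\<phi> R * fc (tangent q a) (\<phi> R - b)) =
        (pw q a - q * a powr (q - 1) * a) * u (\<phi> R) + q * a powr (q - 1) * u (\<phi> R - b)"
      using B.corner_fc_linear[OF that(1)] by simp
    then show ?thesis
      using that(2) r by (simp add: B.t_diff algebra_simps)
  qed
  have tl: "u (\<phi> R * fc (tangent q a) b) \<le> u (\<phi> R * fc (pw q) b)"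
    if "B.corner_elem (\<phi> R) b" "a > 0" for a b
    using that(2) by (intro B.corner_fc_mono[OF that(1) continuous_tangent continuous_pw[OF q]] tangent_le_pw(1)[OF q1])
  have "q * (1 - s) powr (q - 1) * (c - u x - (1 - s) * c) \<le> 0"
    using tl[OF xy(1), of "1 - s"] tangent_val[OF xy(1,3), of "1 - s"] s Lx by simp
  then have "c - u x - (1 - s) * c \<le> 0"
    using q s by (simp add: mult_le_0_iff)
  then have ux: "s * c \<le> u x"
    by (simp add: algebra_simps)
  have "q * s powr (q - 1) * (c - u y - s * c) \<le> 0"
    using tl[OF xy(2), of s] tangent_val[OF xy(2,4), of s] s Ly by simp
  then have "c - u y - s * c \<le> 0"
    using q s by (simp add: mult_le_0_iff)
  then have uy: "(1 - s) * c \<le> u y"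
    by (simp add: algebra_simps)
  have "u x + u y \<le> c"
  proof -
    have "\<phi> Q * \<phi> Q' = 0"
      using phi_orth_iff[OF Q Q'] orth by simp
    moreover have "\<phi> Q' * \<phi> Q = 0"
      using arg_cong[OF calculation, of star] v w by simp
    ultimately have "is_proj (\<phi> Q + \<phi> Q')"
      using v w by (simp add: is_proj_def algebra_simps)
    from conj_mono[OF is_proj_le_one[OF this], of "\<phi> R"] have "x + y \<le> \<phi> R"
      using r by (simp add: x_def y_def algebra_simps)
    then show ?thesis
      using B.t_mono[of "x + y" "\<phi> R"] xy r by (simp add: B.t_add)
  qed
  then have uxs: "u x = s * c"
    using ux uy by (simp add: algebra_simps)
  have "\<phi> R - x = (1 - s) *\<^sub>R \<phi> R"
  proof (rule B.corner_fc_strict[OF xy(1)])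
    define F where "F z = pw q z - tangent q (1 - s) z" for z
    show "continuous_on UNIV F"
      unfolding F_def by (intro continuous_on_diff continuous_pw[OF q] continuous_tangent)
    show "0 \<le> F z" "F z = 0 \<Longrightarrow> z = 1 - s" if "0 \<le> z" "z \<le> 1" for z
      using tangent_le_pw[OF q1, of "1 - s" z] s that by (auto simp: F_def)
    note b = B.corner_elemD[OF xy(1)]
    have "u (\<phi> R * fc F (\<phi> R - x)) = 0"
      unfolding F_def fc_diff[OF b(4) continuous_pw[OF q] continuous_tangent]
      using tangent_val[OF xy(1,3), of "1 - s"] uxs Lx r(1)
      by (simp add: right_diff_distrib B.t_diff algebra_simps B.fc_closed[OF b(3,4) continuous_pw[OF q]]
          B.fc_closed[OF b(3,4) continuous_tangent])
    then show "u (\<phi> R * fc F (\<phi> R - x)) \<le> 0"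
      by simp
  qed (use s in auto)
  then have "x = s *\<^sub>R \<phi> R"
    by (simp add: algebra_simps)
  then show ?thesis
    by (simp add: x_def)
qed

text \<open>For a concave power the distance to \<open>\<phi> Q\<close> gives only
  \<open>u x \<le> s * c\<close>. The reverse bound comes from the complement \<open>Z\<close> of
  \<open>\<phi> Q\<close> in a corner of trace \<open>2 * c\<close> containing
  \<open>\<phi> R\<close>: its preimage is orthogonal to \<open>Q\<close>, which bounds its distance
  to \<open>R\<close> from below.\<close>

lemma phi_scalar_lt_1:
  assumes q1: "q < 1" and Q: "Q \<in> A.Pc c" and R: "R \<in> A.Pc c"
    and s: "0 < s" "s < 1" and RQ: "R * Q * R = s *\<^sub>R R"
  shows "\<phi> R * \<phi> Q * \<phi> R = s *\<^sub>R \<phi> R"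
proof -
  note r = B.PcD[OF phi_Pc[OF R]] and v = B.PcD[OF phi_Pc[OF Q]]
  have low: "2 * (c * pw q s) \<le> A.D q Z R" if Z: "Z \<in> A.Pc c" "Z * Q = 0" for Z
  proof -
    note R' = A.PcD[OF R] and Z' = A.PcD[OF Z(1)] and Q' = A.PcD[OF Q]
    define b where "b = R - R * Z * R"
    have ce: "A.corner_elem R b"
      unfolding b_def using A.compress_corner(2)[OF Z(1) R'(1,2)] .
    note b = A.corner_elemD[OF ce]
    have "Q * Z = 0"
      using arg_cong[OF Z(2), of star] Z' Q' by simp
    then have "is_proj (1 - Q - Z)"
      using Z(2) Z' Q' by (simp add: is_proj_def algebra_simps)
    from conj_nonneg[OF is_proj_nonneg[OF this], of R] have sb: "s *\<^sub>R R \<le> b"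
      using R' RQ by (simp add: b_def algebra_simps)
    \<comment> \<open>Only \<open>s *\<^sub>R R \<le> b\<close> is known, which says nothing outside
      the corner. Adding \<open>s\<close> on the complement gives a bound by
      \<open>s *\<^sub>R 1\<close> without changing the compressed calculus.\<close>
    define b' where "b' = b + s *\<^sub>R (1 - R)"
    have b': "b' \<in> M" "star b' = b'" "s *\<^sub>R 1 \<le> b'"
      using b sb by (simp_all add: b'_def algebra_simps)
    have "pw q s *\<^sub>R 1 \<le> fc (pw q) b'"
    proof -
      have "fc (\<lambda>_. pw q s) b' \<le> fc (pw q) b'"
        using spec_lower_bound[OF b'(2,3)] by (intro fc_mono[OF b'(2)] continuous_pw q pw_mono) auto
      then show ?thesis
        by (simp add: fc_const b')
    qed
    then have "t (R * (pw q s *\<^sub>R 1)) \<le> t (R * fc (pw q) b')"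
      by (intro A.t_proj_mult_mono R' A.fc_closed[OF b'(1,2) continuous_pw[OF q]]) simp
    then show ?thesis
      using A.D_eq_corner[OF Z(1) R q] fc_corner(3)[OF R'(2) b(4) continuous_pw[OF q] b(5), of s] R'
      by (simp add: A.t_scaleR b_def[symmetric] b'_def mult.commute)
  qed
  define x where "x = \<phi> R * \<phi> Q * \<phi> R"
  have xc: "B.corner_elem (\<phi> R) x" "B.corner_elem (\<phi> R) (\<phi> R - x)" "x \<in> N"
    unfolding x_def using B.compress_corner[OF phi_Pc[OF Q] r(1,2)] r v by simp_all
  have Lx: "u (\<phi> R * fc (pw q) (\<phi> R - x)) = c * pw q (1 - s)"
    using B.D_eq_corner[OF phi_Pc[OF Q] phi_Pc[OF R] q] A.D_of_scalar[OF Q R q RQ] isometry[OF Q R]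
    by (simp add: x_def)
  have Lx': "c * pw q s \<le> u (\<phi> R * fc (pw q) x)"
  proof -
    obtain E T where E: "E \<in> N" "is_proj E" "u E = 2 * c" "\<phi> Q * E = \<phi> Q" "E * \<phi> Q = \<phi> Q" "\<phi> R * E = \<phi> R" "E * \<phi> R = \<phi> R"
      by (rule B.common_anticommuting_symmetry[OF phi_Pc[OF Q] phi_Pc[OF R] c(2)])
    define Z where "Z = E - \<phi> Q"
    have Z: "Z \<in> B.Pc c" "Z * \<phi> Q = 0"
      using E v by (simp_all add: Z_def B.Pc_def is_proj_def algebra_simps B.t_diff)
    then obtain Z0 where Z0: "Z0 \<in> A.Pc c" "Z = \<phi> Z0"
      using image by blast
    then have "Z0 * Q = 0"
      using phi_orth_iff[OF Z0(1) Q] Z by simp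
    then have "2 * (c * pw q s) \<le> B.D q Z (\<phi> R)"
      using low[OF Z0(1)] isometry[OF Z0(1) R] Z0 by simp
    also have "\<dots> = 2 * u (\<phi> R * fc (pw q) (\<phi> R - \<phi> R * Z * \<phi> R))"
      by (rule B.D_eq_corner[OF Z(1) phi_Pc[OF R] q])
    also have "\<phi> R - \<phi> R * Z * \<phi> R = x"
      using E r by (simp add: Z_def x_def algebra_simps)
    finally show ?thesis
      by simp
  qed
  have tangent_val: "u (\<phi> R * fc (tangent q a) b) = c * pw q a + q * a powr (q - 1) * (u b - a * c)"
    if "B.corner_elem (\<phi> R) b" for a b
  proof -
    have "tangent q a = (\<lambda>z. (pw q a - q * a powr (q - 1) * a) + q * a powr (q - 1) * z)"
      by (simp add: tangent_def fun_eq_iff algebra_simps)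
    then have "u (\<phi> R * fc (tangent q a) b) =
        (pw q a - q * a powr (q - 1) * a) * u (\<phi> R) + q * a powr (q - 1) * u b"
      using B.corner_fc_linear[OF that(1)] by simp
    then show ?thesis
      using r by (simp add: algebra_simps)
  qed
  have tl: "u (\<phi> R * fc (pw q) b) \<le> u (\<phi> R * fc (tangent q a) b)"
    if "B.corner_elem (\<phi> R) b" "a > 0" for a b
    using that(2) by (intro B.corner_fc_mono[OF that(1) continuous_pw[OF q] continuous_tangent] pw_le_tangent(1)[OF q q1])
  have "0 \<le> q * s powr (q - 1) * (u x - s * c)"
    using tl[OF xc(1) s(1)] tangent_val[OF xc(1), of s] Lx' by simp
  then have "0 \<le> u x - s * c"
    by (rule nonneg_of_mult_nonneg) (use q s in simp)
  then have "s * c \<le> u x"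
    by simp
  moreover have "0 \<le> q * (1 - s) powr (q - 1) * (u (\<phi> R - x) - (1 - s) * c)"
    using tl[OF xc(2), of "1 - s"] tangent_val[OF xc(2), of "1 - s"] s Lx by simp
  then have "0 \<le> u (\<phi> R - x) - (1 - s) * c"
    by (rule nonneg_of_mult_nonneg) (use q s in simp)
  then have "u x \<le> s * c"
    using xc r by (simp add: B.t_diff algebra_simps)
  ultimately have uxs: "u x = s * c"
    by simp
  have "x = s *\<^sub>R \<phi> R"
  proof (rule B.corner_fc_strict[OF xc(1)])
    define F where "F z = tangent q s z - pw q z" for z
    show "continuous_on UNIV F"
      unfolding F_def by (intro continuous_on_diff continuous_pw[OF q] continuous_tangent)
    show "0 \<le> F z" "F z = 0 \<Longrightarrow> z = s" if "0 \<le> z" "z \<le> 1" for z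
      using pw_le_tangent[OF q q1, of s z] s that by (auto simp: F_def)
    note b = B.corner_elemD[OF xc(1)]
    show "u (\<phi> R * fc F x) \<le> 0"
      unfolding F_def fc_diff[OF b(4) continuous_tangent continuous_pw[OF q]]
      using tangent_val[OF xc(1), of s] uxs Lx' r(1)
      by (simp add: right_diff_distrib B.t_diff B.fc_closed[OF b(3,4) continuous_pw[OF q]]
          B.fc_closed[OF b(3,4) continuous_tangent])
  qed (use s in auto)
  then show ?thesis
    by (simp add: x_def)
qed

text \<open>The value that a linear extension of \<open>\<phi>\<close> would have at the symmetry
  \<open>S\<close>; linearity is not yet available, so it is defined by the two spectral
  projections.\<close>

definition hat :: "'a cop \<Rightarrow> 'a cop \<Rightarrow> 'b cop" where
  "hat E S = \<phi> (sym_proj E S) - \<phi> (sym_proj E (- S))"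

definition hat_unit :: "'a cop \<Rightarrow> 'a cop \<Rightarrow> 'b cop" where
  "hat_unit E S = \<phi> (sym_proj E S) + \<phi> (sym_proj E (- S))"

lemma hat_symmetry:
  assumes S: "A.corner_symmetry c E S"
  shows "B.corner_symmetry c (hat_unit E S) (hat E S)" "sym_proj (hat_unit E S) (hat E S) = \<phi> (sym_proj E S)"
proof -
  note P = A.sym_proj_Pc[OF S] and P' = A.sym_proj_Pc[OF A.corner_symmetry_minus[OF S]]
  note r = B.PcD[OF phi_Pc[OF P]] and r' = B.PcD[OF phi_Pc[OF P']]
  have o: "\<phi> (sym_proj E S) * \<phi> (sym_proj E (- S)) = 0"
    using phi_orth_iff[OF P P'] A.sym_proj_orth[OF S] by simp
  have o': "\<phi> (sym_proj E (- S)) * \<phi> (sym_proj E S) = 0"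
    using arg_cong[OF o, of star] r r' by simp
  show "B.corner_symmetry c (hat_unit E S) (hat E S)"
    using r r' o o' by (simp add: B.corner_symmetry_def hat_def hat_unit_def is_proj_def algebra_simps B.t_linear)
  show "sym_proj (hat_unit E S) (hat E S) = \<phi> (sym_proj E S)"
    by (simp add: sym_proj_def hat_def hat_unit_def flip: scaleR_2)
qed

text \<open>A scalar anticommutator means scalar compressions between all spectral projections of
  the two symmetries, and these are preserved. The case \<open>q = 1\<close> is excluded because
  then \<open>pw q\<close> is linear on the nonnegative reals and has no strict equality
  case.\<close>

lemma hat_anticommutator:
  assumes q1: "q \<noteq> 1" and S: "A.corner_symmetry c E S" and W: "A.corner_symmetry c E W"
    and SW: "S * W + W * S = (2 * \<alpha>) *\<^sub>R E" and \<alpha>: "\<bar>\<alpha>\<bar> < 1"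
  shows "hat_unit E S = hat_unit E W" "hat E S * hat E W + hat E W * hat E S = (2 * \<alpha>) *\<^sub>R hat_unit E S"
proof -
  note S' = A.corner_symmetry_minus[OF S] and W' = A.corner_symmetry_minus[OF W]
  note P = A.sym_proj_Pc[OF S] A.sym_proj_Pc[OF S'] A.sym_proj_Pc[OF W] A.sym_proj_Pc[OF W']
  have scal: "\<phi> R * \<phi> Q * \<phi> R = s *\<^sub>R \<phi> R"
    if "Q \<in> A.Pc c" "Q' \<in> A.Pc c" "R \<in> A.Pc c" "Q * Q' = 0" "0 < s" "s < 1" "R * Q * R = s *\<^sub>R R"
      "R * Q' * R = (1 - s) *\<^sub>R R" for Q Q' R s
    using phi_scalar_gt_1[of Q Q' R s] phi_scalar_lt_1[of Q R s] that q1 by force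
  have o1: "sym_proj E S * sym_proj E (- S) = 0" and o2: "sym_proj E (- S) * sym_proj E S = 0"
    using A.sym_proj_orth[OF S] A.sym_proj_orth[OF S'] by simp_all
  define a b r r' where "a = \<phi> (sym_proj E S)" and "b = \<phi> (sym_proj E (- S))"
    and "r = \<phi> (sym_proj E W)" and "r' = \<phi> (sym_proj E (- W))"
  note defs = a_def b_def r_def r'_def
  have neg: "- (S * W) - W * S = - ((2 * \<alpha>) *\<^sub>R E)"
    by (simp flip: SW)
  have cmp: "sym_proj E W * sym_proj E S * sym_proj E W = ((1 + \<alpha>) / 2) *\<^sub>R sym_proj E W"
    "sym_proj E W * sym_proj E (- S) * sym_proj E W = ((1 - \<alpha>) / 2) *\<^sub>R sym_proj E W"
    "sym_proj E (- W) * sym_proj E S * sym_proj E (- W) = ((1 - \<alpha>) / 2) *\<^sub>R sym_proj E (- W)"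
    "sym_proj E (- W) * sym_proj E (- S) * sym_proj E (- W) = ((1 + \<alpha>) / 2) *\<^sub>R sym_proj E (- W)"
    using A.sym_proj_compress[OF S W, of \<alpha>] A.sym_proj_compress[OF S' W, of "- \<alpha>"]
      A.sym_proj_compress[OF S W', of "- \<alpha>"] A.sym_proj_compress[OF S' W', of \<alpha>] SW
      neg
    by (simp_all flip: minus_add_distrib)
  have half: "1 - (1 + \<alpha>) / 2 = (1 - \<alpha>) / 2" "1 - (1 - \<alpha>) / 2 = (1 + \<alpha>) / 2"
    by (simp_all add: field_simps)
  have k: "r * a * r = ((1 + \<alpha>) / 2) *\<^sub>R r" "r * b * r = ((1 - \<alpha>) / 2) *\<^sub>R r"
    "r' * a * r' = ((1 - \<alpha>) / 2) *\<^sub>R r'" "r' * b * r' = ((1 + \<alpha>) / 2) *\<^sub>R r'"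
    unfolding defs using P o1 o2 \<alpha> cmp by (intro scal; simp add: half; fail)+
  define e where "e = hat_unit E S"
  have eab: "e = a + b"
    by (simp add: e_def hat_unit_def defs)
  note es = B.corner_symmetryD[OF hat_symmetry(1)[OF S], folded e_def]
  note fs = B.corner_symmetryD[OF hat_symmetry(1)[OF W]]
  note rp = B.PcD[OF phi_Pc[OF P(3)], folded defs] and r'p = B.PcD[OF phi_Pc[OF P(4)], folded defs]
  \<comment> \<open>For projections \<open>x\<close> and \<open>e\<close> the condition
    \<open>x * e * x = x\<close> means that \<open>x\<close> lies below \<open>e\<close>. Thus
    \<open>r + r'\<close> lies below \<open>e\<close>, and equality of traces makes them
    equal.\<close>
  have absorb: "e * x = x" if "x * x = x" "star x = x" "x * e * x = x" for x
  proof -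
    have "star ((1 - e) * x) * ((1 - e) * x) = x * ((1 - e) * (1 - e)) * x"
      using that es by (simp add: mult.assoc)
    also have "(1 - e) * (1 - e) = 1 - e"
      using es by (simp add: algebra_simps)
    also have "x * (1 - e) * x = 0"
      using that by (simp add: algebra_simps)
    finally have "(1 - e) * x = 0"
      by (rule star_mult_self_eq_zero)
    then show ?thesis
      by (simp add: algebra_simps)
  qed
  have sc: "((1 + \<alpha>) / 2) *\<^sub>R x + ((1 - \<alpha>) / 2) *\<^sub>R x = x" for x :: "'b cop"
  proof -
    have "(1 + \<alpha>) / 2 + (1 - \<alpha>) / 2 = 1"
      by (simp add: field_simps)
    then show ?thesis
      by (metis scaleR_add_left scaleR_one)
  qed
  have sc': "((1 + \<alpha>) / 2) *\<^sub>R x - ((1 - \<alpha>) / 2) *\<^sub>R x = \<alpha> *\<^sub>R x" for x :: "'b cop"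
  proof -
    have "(1 + \<alpha>) / 2 - (1 - \<alpha>) / 2 = \<alpha>"
      by (simp add: field_simps)
    then show ?thesis
      by (metis scaleR_diff_left)
  qed
  have er: "e * r = r" and er': "e * r' = r'"
    by (rule absorb; use rp r'p k sc[of r] sc[of r'] in \<open>simp add: eab distrib_left distrib_right add.commute\<close>)+
  have f: "hat_unit E W = r + r'"
    by (simp add: hat_unit_def defs)
  have fe: "hat_unit E W = e"
  proof (rule B.subprojection_eq[OF es(1) fs(1) es(2) fs(2)])
    show "e * hat_unit E W = hat_unit E W"
      by (simp add: f distrib_left er er')
  qed (use es fs in simp)
  then show "hat_unit E S = hat_unit E W"
    by (simp add: e_def)
  define H where "H = a - b"
  have H: "hat E S = H" "hat E W = r - r'"
    by (simp_all add: hat_def H_def defs)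
  have eH: "e * H = H" "H * e = H"
    using es H by simp_all
  have rr': "r + r' = e"
    using f fe by simp
  have rH: "r * H * r = \<alpha> *\<^sub>R r" "r' * H * r' = - (\<alpha> *\<^sub>R r')"
    using sc'[of r] sc'[of r'] k by (simp_all add: H_def algebra_simps)
  have "x = r * x + r' * x" if "e * x = x" for x
    using that by (simp flip: rr' add: distrib_right)
  moreover have "x = x * r + x * r'" if "x * e = x" for x
    using that by (simp flip: rr' add: distrib_left)
  ultimately have e1: "H * r = r * H * r + r' * H * r" "H * r' = r * H * r' + r' * H * r'"
    "r * H = r * H * r + r * H * r'" "r' * H = r' * H * r + r' * H * r'"
    using eH assoc2[OF eH(1)] by (metis mult.assoc)+
  \<comment> \<open>The off-diagonal blocks of \<open>H\<close> with respect to \<open>r\<close> and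
    \<open>r'\<close> cancel here, leaving twice the diagonal ones, which are known scalars.\<close>
  have "H * (r - r') + (r - r') * H = (H * r - H * r') + (r * H - r' * H)"
    by (simp add: left_diff_distrib right_diff_distrib)
  also have "\<dots> = ((r * H * r + r' * H * r) - (r * H * r' + r' * H * r')) +
      ((r * H * r + r * H * r') - (r' * H * r + r' * H * r'))"
    using e1 by argo
  also have "\<dots> = 2 *\<^sub>R (r * H * r) - 2 *\<^sub>R (r' * H * r')"
    by (simp add: scaleR_2)
  also have "\<dots> = (2 * \<alpha>) *\<^sub>R (r + r')"
    by (simp only: rH) (simp add: algebra_simps)
  finally show "hat E S * hat E W + hat E W * hat E S = (2 * \<alpha>) *\<^sub>R hat_unit E S"
    by (simp add: H rr' e_def)
qed

end

lemma scaleR_4: "4 *\<^sub>R x = x + x + x + (x :: 'a :: real_vector)"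
proof -
  have "4 *\<^sub>R x = (2 + 2) *\<^sub>R x"
    by simp
  then show ?thesis
    unfolding scaleR_add_left scaleR_2 by (simp only: add.assoc)
qed

section \<open>The trace of a product recovered from distances\<close>

context projection_isometry
begin

text \<open>Given \<open>P\<close> and \<open>Q\<close>, choose a symmetry anticommuting with both; the distance from \<open>P\<close> to the
  points of the circle through that symmetry and \<open>Q\<close> has derivative proportional to \<open>\<tau>(PQ)\<close> plus a
  constant.\<close>

theorem trace_preserved:
  assumes P: "P \<in> A.Pc c" and Q: "Q \<in> A.Pc c"
  shows "u (\<phi> P * \<phi> Q) = t (P * Q)"
proof (cases "q = 1")
  case True
  \<comment> \<open>On nonnegative operators the calculus for \<open>pw 1\<close> is the identity,
    so the distance is directly \<open>2 * (c - t (P * Q))\<close>.\<close>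
  have lin: "pw 1 x = x" if "0 \<le> x" for x
    using that by (simp add: pw_def)
  have "A.D 1 P Q = 2 * (c - t (P * Q))"
  proof -
    note ce = A.compress_corner(2)[OF P A.PcD(1,2)[OF Q]]
    note b = A.corner_elemD[OF ce]
    have "fc (pw 1) (Q - Q * P * Q) = Q - Q * P * Q"
      using fc_cong[of "Q - Q * P * Q" "pw 1" "\<lambda>x. x"] lin b(9) fc_id[OF b(4)] by auto
    then have "A.D 1 P Q = 2 * t (Q - Q * P * Q)"
      using A.D_eq_corner[OF P Q, of 1] b by simp
    also have "t (Q * P * Q) = t (P * Q)"
      using A.t_comm[of Q "P * Q"] A.PcD[OF P] A.PcD[OF Q] by (simp add: mult.assoc)
    then have "t (Q - Q * P * Q) = c - t (P * Q)"
      using A.PcD[OF P] A.PcD[OF Q] by (simp add: A.t_diff)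
    finally show ?thesis .
  qed
  moreover have "B.D 1 (\<phi> P) (\<phi> Q) = 2 * (c - u (\<phi> P * \<phi> Q))"
  proof -
    note P' = phi_Pc[OF P] and Q' = phi_Pc[OF Q]
    note ce = B.compress_corner(2)[OF P' B.PcD(1,2)[OF Q']]
    note b = B.corner_elemD[OF ce]
    have "fc (pw 1) (\<phi> Q - \<phi> Q * \<phi> P * \<phi> Q) = \<phi> Q - \<phi> Q * \<phi> P * \<phi> Q"
      using fc_cong[of "\<phi> Q - \<phi> Q * \<phi> P * \<phi> Q" "pw 1" "\<lambda>x. x"] lin b(9) fc_id[OF b(4)] by auto
    then have "B.D 1 (\<phi> P) (\<phi> Q) = 2 * u (\<phi> Q - \<phi> Q * \<phi> P * \<phi> Q)"
      using B.D_eq_corner[OF P' Q', of 1] b by simp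
    also have "u (\<phi> Q * \<phi> P * \<phi> Q) = u (\<phi> P * \<phi> Q)"
      using B.t_comm[of "\<phi> Q" "\<phi> P * \<phi> Q"] B.PcD[OF P'] B.PcD[OF Q'] by (simp add: mult.assoc)
    then have "u (\<phi> Q - \<phi> Q * \<phi> P * \<phi> Q) = c - u (\<phi> P * \<phi> Q)"
      using B.PcD[OF P'] B.PcD[OF Q'] by (simp add: B.t_diff)
    finally show ?thesis .
  qed
  ultimately show ?thesis
    using isometry[OF P Q] True by simp
next
  case False
  note p = A.PcD[OF P] and r = A.PcD[OF Q]
  obtain E T0 where E: "E \<in> M" "is_proj E" "t E = 2 * c" "T0 \<in> M" "star T0 = T0" "T0 * T0 = E" "E * T0 = T0" "T0 * E = T0"
    "P * E = P" "E * P = P" "Q * E = Q" "E * Q = Q" "P * T0 + T0 * P = T0" "Q * T0 + T0 * Q = T0"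
    by (rule A.common_anticommuting_symmetry[OF P Q c(2)])
  have EE: "E * E = E" "star E = E"
    using E(2) by (auto simp: is_proj_def)
  define S where "S = 2 *\<^sub>R P - E"
  define T where "T = 2 *\<^sub>R Q - E"
  have symS: "A.corner_symmetry c E S" and symT: "A.corner_symmetry c E T"
    using E EE p r by (simp_all add: A.corner_symmetry_def S_def T_def A.t_linear algebra_simps scaleR_2)
  \<comment> \<open>Compressing \<open>P * T0 + T0 * P = T0\<close> by \<open>P\<close> shows
    \<open>P * T0 * P = 0\<close>, hence \<open>t (P * T0) = 0\<close>.\<close>
  have tT0: "t T0 = 0"
  proof -
    have "P * (P * T0 + T0 * P) * P = P * T0 * P"
      by (simp add: E(13))
    then have "P * T0 * P = 0"
      using p assoc2[OF p(4)] by (simp add: distrib_left distrib_right mult.assoc)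
    moreover have "t (P * T0) = t (P * T0 * P)"
      using A.t_comm[of P "T0 * P"] A.t_comm[of "T0" P] p E(4) by (simp add: mult.assoc)
    moreover have "t T0 = t (P * T0) + t (T0 * P)"
      using A.t_add[of "P * T0" "T0 * P"] p E by simp
    ultimately show ?thesis
      using A.t_comm[of T0 P] p E(4) by simp
  qed
  have sym0: "A.corner_symmetry c E T0"
    using E tT0 by (simp add: A.corner_symmetry_def)
  have anti: "S * T0 + T0 * S = (2 * 0) *\<^sub>R E" "T * T0 + T0 * T = (2 * 0) *\<^sub>R E"
  proof -
    have "2 *\<^sub>R (P * T0 + T0 * P) = 2 *\<^sub>R T0" "2 *\<^sub>R (Q * T0 + T0 * Q) = 2 *\<^sub>R T0"
      by (simp_all add: E)
    then show "S * T0 + T0 * S = (2 * 0) *\<^sub>R E" "T * T0 + T0 * T = (2 * 0) *\<^sub>R E"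
      using E by (simp_all add: S_def T_def algebra_simps scaleR_2)
  qed
  define X where "X = S * T + T * S"
  define Y where "Y = hat E S * hat E T + hat E T * hat E S"
  define e where "e = hat_unit E T0"
  note hS = hat_symmetry[OF symS] and hT = hat_symmetry[OF symT] and h0 = hat_symmetry[OF sym0]
  have u1: "hat_unit E S = e" and a1: "hat E S * hat E T0 + hat E T0 * hat E S = 0"
    using hat_anticommutator[OF False symS sym0 anti(1)] by (simp_all add: e_def)
  have u2: "hat_unit E T = e" and a2: "hat E T * hat E T0 + hat E T0 * hat E T = 0"
    using hat_anticommutator[OF False symT sym0 anti(2)] by (simp_all add: e_def)
  note s' = B.corner_symmetryD[OF hS(1)] and t' = B.corner_symmetryD[OF hT(1)] and z' = B.corner_symmetryD[OF h0(1)]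
  have XM: "X \<in> M" and YN: "Y \<in> N"
    using A.corner_symmetryD[OF symS] A.corner_symmetryD[OF symT] s' t' by (simp_all add: X_def Y_def)
  obtain C where C: "C \<ge> 0" "\<And>x. 0 \<le> x \<Longrightarrow> x \<le> 1 \<Longrightarrow> \<bar>pw q x - tangent q (1/2) x\<bar> \<le> C * (x - 1/2)\<^sup>2"
    using pw_tangent_quadratic[OF q] by auto
  define \<beta> where "\<beta> = q * (1/2) powr (q - 1)"
  have \<beta>: "\<beta> > 0"
    using q by (simp add: \<beta>_def)
  \<comment> \<open>\<open>W\<close> lies on the quarter circle from \<open>T0\<close> to
    \<open>T\<close>, and \<open>z\<close> is the sine of its angle. The distances on both sides
    agree and have the same constant term, so only the linear terms in \<open>t X\<close> and
    \<open>u Y\<close> remain; dividing by \<open>z / 4\<close> leaves an error of order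
    \<open>z\<close>.\<close>
  have key: "\<beta> * \<bar>t X - u Y\<bar> \<le> z * (C / 4 * (t (X * X) + u (Y * Y)))" if z: "0 < z" "z < 1" for z
  proof -
    define k where "k = sqrt (1 - z\<^sup>2)"
    have "z\<^sup>2 < 1"
      using z by (simp add: power_less_one_iff)
    moreover have "0 < z\<^sup>2"
      using z by simp
    ultimately have k: "k\<^sup>2 + z\<^sup>2 = 1" "0 < k" "k < 1"
      by (auto simp: k_def)
    have kz: "k * k + z * z = 1"
      using k(1) by (simp add: power2_eq_square)
    define W where "W = k *\<^sub>R T0 + z *\<^sub>R T"
    note s = A.corner_symmetryD[OF symS] and tt = A.corner_symmetryD[OF symT] and z0 = A.corner_symmetryD[OF sym0]
    have sum1: "(k * k) *\<^sub>R x + (z * z) *\<^sub>R x = x" for x :: "'d :: real_vector"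
      by (metis kz scaleR_add_left scaleR_one)
    have symW: "A.corner_symmetry c E W"
    proof -
      have "W * W = (k * k) *\<^sub>R E + (z * z) *\<^sub>R E + (k * z) *\<^sub>R (T * T0 + T0 * T)"
        using tt z0 by (simp add: W_def algebra_simps)
      then have "W * W = E"
        by (simp add: anti sum1)
      then show ?thesis
        using tt z0 by (simp add: A.corner_symmetry_def W_def algebra_simps A.t_linear)
    qed
    have "T0 * W + W * T0 = (2 * k) *\<^sub>R E + z *\<^sub>R (T * T0 + T0 * T)"
      using z0 by (simp add: W_def algebra_simps scaleR_2 flip: scaleR_scaleR)
    then have w0: "T0 * W + W * T0 = (2 * k) *\<^sub>R E"
      by (simp add: anti)
    have "T * W + W * T = (2 * z) *\<^sub>R E + k *\<^sub>R (T * T0 + T0 * T)"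
      using tt by (simp add: W_def algebra_simps scaleR_2 flip: scaleR_scaleR)
    then have wT: "T * W + W * T = (2 * z) *\<^sub>R E"
      by (simp add: anti)
    have "S * W + W * S = z *\<^sub>R X + k *\<^sub>R (S * T0 + T0 * S)"
      by (simp add: W_def X_def algebra_simps)
    then have SW: "S * W + W * S = z *\<^sub>R X"
      by (simp add: anti)
    have uW: "hat_unit E W = e" and hW0: "hat E T0 * hat E W + hat E W * hat E T0 = (2 * k) *\<^sub>R e"
      using hat_anticommutator[OF False sym0 symW w0] k by (simp_all add: e_def)
    have hWT: "hat E T * hat E W + hat E W * hat E T = (2 * z) *\<^sub>R e"
      using hat_anticommutator[OF False symT symW wT] z u2 by simp
    note w' = B.corner_symmetryD[OF hat_symmetry(1)[OF symW]]
    \<comment> \<open>The anticommutators of \<open>hat E W\<close> with \<open>hat E T0\<close> and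
      \<open>hat E T\<close> are known, and they make the square of the self-adjoint
      \<open>V\<close> vanish: circles go to circles.\<close>
    define V where "V = hat E W - k *\<^sub>R hat E T0 - z *\<^sub>R hat E T"
    have "V * V = e + ((k * k) *\<^sub>R e + (z * z) *\<^sub>R e) - k *\<^sub>R (hat E T0 * hat E W + hat E W * hat E T0)
        - z *\<^sub>R (hat E T * hat E W + hat E W * hat E T) + (k * z) *\<^sub>R (hat E T * hat E T0 + hat E T0 * hat E T)"
      using w'(6) t'(6) z'(6) by (simp add: V_def algebra_simps uW u2 flip: e_def)
    also have "\<dots> = e - ((k * k) *\<^sub>R e + (z * z) *\<^sub>R e)"
    proof -
      have "x *\<^sub>R (2 * x) *\<^sub>R e = (x * x) *\<^sub>R e + (x * x) *\<^sub>R e" for x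
        by (simp flip: scaleR_add_left)
      then show ?thesis
        unfolding hW0 hWT a2 by simp
    qed
    also have "\<dots> = 0"
      unfolding sum1 by simp
    finally have "star V * V = 0"
      using w' t' z' by (simp add: V_def)
    then have hW: "hat E W = k *\<^sub>R hat E T0 + z *\<^sub>R hat E T"
      using star_mult_self_eq_zero[of V] by (simp add: V_def algebra_simps)
    have "hat E S * hat E W + hat E W * hat E S = z *\<^sub>R Y + k *\<^sub>R (hat E S * hat E T0 + hat E T0 * hat E S)"
      by (simp add: hW Y_def algebra_simps)
    then have SW': "hat E S * hat E W + hat E W * hat E S = z *\<^sub>R Y"
      by (simp add: a1)
    define K where "K = 2 * c * pw q (1/2)"
    have dA: "\<bar>A.D q (sym_proj E S) (sym_proj E W) - (K - \<beta> * (z / 4) * t X)\<bar> \<le> C * (z / 4)\<^sup>2 * t (X * X)"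
      using A.D_expansion[OF symS symW SW XM q C(2)] by (simp add: K_def \<beta>_def)
    have dB: "\<bar>B.D q (sym_proj e (hat E S)) (sym_proj e (hat E W)) - (K - \<beta> * (z / 4) * u Y)\<bar>
        \<le> C * (z / 4)\<^sup>2 * u (Y * Y)"
      using B.D_expansion[OF hS(1)[unfolded u1] hat_symmetry(1)[OF symW, unfolded uW] SW' YN q C(2)]
      by (simp add: K_def \<beta>_def)
    have "B.D q (sym_proj e (hat E S)) (sym_proj e (hat E W)) = A.D q (sym_proj E S) (sym_proj E W)"
      using hS(2) hat_symmetry(2)[OF symW] isometry[OF A.sym_proj_Pc[OF symS] A.sym_proj_Pc[OF symW]]
      by (simp add: u1 uW)
    then have "\<bar>\<beta> * (z / 4) * t X - \<beta> * (z / 4) * u Y\<bar> \<le> C * (z / 4)\<^sup>2 * t (X * X) + C * (z / 4)\<^sup>2 * u (Y * Y)"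
      using dA dB by linarith
    also have "\<dots> = (z / 4) * (z * (C / 4 * (t (X * X) + u (Y * Y))))"
      by (simp add: power2_eq_square field_simps)
    also have "\<bar>\<beta> * (z / 4) * t X - \<beta> * (z / 4) * u Y\<bar> = (z / 4) * (\<beta> * \<bar>t X - u Y\<bar>)"
    proof -
      have "\<beta> * (z / 4) * t X - \<beta> * (z / 4) * u Y = (z / 4) * (\<beta> * (t X - u Y))"
        by (simp add: algebra_simps)
      moreover have "\<bar>(z / 4) * (\<beta> * (t X - u Y))\<bar> = (z / 4) * (\<beta> * \<bar>t X - u Y\<bar>)"
        using z \<beta> unfolding abs_mult by simp
      ultimately show ?thesis
        by (rule ssubst)
    qed
    finally show ?thesis
      using z by simp
  qed
  define L where "L = C / 4 * (t (X * X) + u (Y * Y))"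
  have "\<beta> * \<bar>t X - u Y\<bar> \<le> 0"
  proof (rule field_le_epsilon)
    fix \<epsilon> :: real assume \<epsilon>: "\<epsilon> > 0"
    \<comment> \<open>Chosen so that \<open>z * L\<close> is at most \<open>\<epsilon>\<close>; the
      summand 1 avoids division by 0, and 1/2 keeps \<open>z\<close> below 1.\<close>
    define z where "z = min (1/2) (\<epsilon> / (\<bar>L\<bar> + 1))"
    have z: "0 < z" "z < 1" "z \<le> \<epsilon> / (\<bar>L\<bar> + 1)"
      using \<epsilon> by (auto simp: z_def)
    have "z * L \<le> z * (\<bar>L\<bar> + 1)"
      using z by (intro mult_left_mono) auto
    also have "\<dots> \<le> \<epsilon>"
      using z(3) by (simp add: field_simps add_pos_nonneg)
    finally show "\<beta> * \<bar>t X - u Y\<bar> \<le> 0 + \<epsilon>"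
      using key[OF z(1,2)] by (simp add: L_def)
  qed
  then have XY: "t X = u Y"
    using \<beta> by (simp add: mult_le_0_iff)
  have tX: "t X = 8 * t (P * Q) - 4 * c"
  proof -
    have "X = 4 *\<^sub>R (P * Q + Q * P) - 4 *\<^sub>R P - 4 *\<^sub>R Q + 2 *\<^sub>R E"
      using E EE by (simp add: X_def S_def T_def algebra_simps scaleR_2 scaleR_4)
    then show ?thesis
      using p r E A.t_comm[of Q P] by (simp add: A.t_linear)
  qed
  have phiP: "sym_proj e (hat E S) = \<phi> P" and phiQ: "sym_proj e (hat E T) = \<phi> Q"
  proof -
    have "sym_proj E S = P" "sym_proj E T = Q"
      by (simp_all add: sym_proj_def S_def T_def)
    then show "sym_proj e (hat E S) = \<phi> P" "sym_proj e (hat E T) = \<phi> Q"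
      using hS(2) hT(2) by (simp_all add: u1 u2)
  qed
  have "u Y = 8 * u (\<phi> P * \<phi> Q) - 4 * c"
  proof -
    have hs: "hat E S = 2 *\<^sub>R \<phi> P - e" "hat E T = 2 *\<^sub>R \<phi> Q - e"
      by (simp_all add: sym_proj_def flip: phiP phiQ)
    note p' = B.PcD[OF phi_Pc[OF P]] and r' = B.PcD[OF phi_Pc[OF Q]]
    have e: "e \<in> N" "e * e = e" "u e = 2 * c" "\<phi> P * e = \<phi> P" "e * \<phi> P = \<phi> P" "\<phi> Q * e = \<phi> Q" "e * \<phi> Q = \<phi> Q"
      using s' t' by (simp_all add: u1 u2 sym_proj_def algebra_simps flip: phiP phiQ)
    have "Y = 4 *\<^sub>R (\<phi> P * \<phi> Q + \<phi> Q * \<phi> P) - 4 *\<^sub>R \<phi> P - 4 *\<^sub>R \<phi> Q + 2 *\<^sub>R e"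
      using e by (simp add: Y_def hs algebra_simps scaleR_2 scaleR_4)
    then show ?thesis
      using p' r' e B.t_comm[of "\<phi> Q" "\<phi> P"] by (simp add: B.t_linear)
  qed
  then show ?thesis
    using XY tX by simp
qed

end

section \<open>Tangent vectors of the space of projections\<close>

text \<open>
  For \<open>b \<in> (1 - P)MP\<close> there are projections \<open>P + s(b + b\<^sup>*) + s\<^sup>2(bb\<^sup>* - b\<^sup>*b) + o(s\<^sup>2)\<close>.
\<close>

definition herm :: "'a :: chilbert_space cop \<Rightarrow> 'a cop" where
  "herm b = b + star b"

definition curv :: "'a :: chilbert_space cop \<Rightarrow> 'a cop" where
  "curv b = b * star b - star b * b"

lemma star_herm [simp]: "star (herm b) = herm b"
  by (simp add: herm_def add.commute)

lemma herm_add: "herm (a + b) = herm a + herm b" and herm_scaleR: "herm (r *\<^sub>R b) = r *\<^sub>R herm b"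
  and curv_scaleR: "curv (r *\<^sub>R b) = (r * r) *\<^sub>R curv b"
  by (simp_all add: herm_def curv_def algebra_simps)

context fin_factor
begin

definition off :: "'a cop \<Rightarrow> 'a cop set" where
  "off P = {b \<in> M. P * b = 0 \<and> b * P = b}"

lemma offD:
  assumes "is_proj P" "b \<in> off P"
  shows "b \<in> M" "P * b = 0" "b * P = b" "P * star b = star b" "star b * P = 0" "b * b = 0" "star b * star b = 0"
proof -
  show b: "b \<in> M" "P * b = 0" "b * P = b"
    using assms(2) by (auto simp: off_def)
  have P: "star P = P"
    using assms(1) by (simp add: is_proj_def)
  show "P * star b = star b" "star b * P = 0"
    using arg_cong[OF b(3), of star] arg_cong[OF b(2), of star] P by simp_all
  have "b * b = b * (P * b)"
    using b(3) by (simp flip: mult.assoc)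
  then show "b * b = 0"
    by (simp add: b)
  then have "star (b * b) = 0"
    by simp
  then show "star b * star b = 0"
    by simp
qed

lemma off_add: "a \<in> off P \<Longrightarrow> b \<in> off P \<Longrightarrow> a + b \<in> off P"
  and off_diff: "a \<in> off P \<Longrightarrow> b \<in> off P \<Longrightarrow> a - b \<in> off P"
  and off_minus: "b \<in> off P \<Longrightarrow> - b \<in> off P"
  and off_scaleR: "b \<in> off P \<Longrightarrow> r *\<^sub>R b \<in> off P"
  by (simp_all add: off_def algebra_simps)

lemma off_scalar: "b \<in> off P \<Longrightarrow> scalar z * b \<in> off P"
  by (simp add: off_def scalar_left_commute mult.assoc)

lemma off_compress:
  assumes "is_proj P" "P \<in> M" "x \<in> M"
  shows "(1 - P) * x * P \<in> off P"
proof -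
  have "P * ((1 - P) * x * P) = (P - P * P) * x * P"
    by (simp add: algebra_simps)
  then show ?thesis
    using assms by (simp add: off_def is_proj_def mult.assoc)
qed

lemma herm_in [simp]: "b \<in> M \<Longrightarrow> herm b \<in> M"
  and curv_in [simp]: "b \<in> M \<Longrightarrow> curv b \<in> M"
  by (simp_all add: herm_def curv_def)

lemma t_off_zero: "is_proj P \<Longrightarrow> P \<in> M \<Longrightarrow> b \<in> off P \<Longrightarrow> t b = 0"
  using t_comm[of P b] offD[of P b] by simp

lemma t_herm_diag_zero:
  assumes "is_proj P" "P \<in> M" "b \<in> off P" "x \<in> M" "P * x = x * P"
  shows "t (herm b * x) = 0"
proof -
  note b = offD[OF assms(1,3)]
  have zero: "t (b * x) = 0" if "x \<in> M" "P * x = x * P" for x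
  proof -
    have "b * x = b * (P * x)"
      by (simp add: assoc2[OF b(3)])
    also have "\<dots> = (b * x) * P"
      by (simp add: that(2) mult.assoc)
    finally have "t (b * x) = t ((b * x) * P)"
      by (rule arg_cong)
    also have "\<dots> = t (P * (b * x))"
      using b that assms(2) by (intro t_comm) simp_all
    also have "P * (b * x) = 0"
      by (simp add: assoc2[OF b(2)])
    finally show ?thesis
      by simp
  qed
  have "P * star x = star x * P"
    using assms(1) arg_cong[OF assms(5), of star] by (simp add: is_proj_def)
  then have "t (b * star x) = 0"
    using assms(4) by (intro zero) simp_all
  moreover have "t (star b * x) = t (b * star x)"
    using t_star[of "star b * x"] t_comm[of b "star x"] b assms(4) by simp
  ultimately show ?thesis
    using zero[OF assms(4,5)] b assms(4) by (simp add: herm_def distrib_right t_add)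
qed

lemma t_herm_herm:
  assumes "is_proj P" "P \<in> M" "a \<in> off P" "b \<in> off P"
  shows "t (herm a * herm b) = 2 * t (a * star b)"
proof -
  note a = offD[OF assms(1,3)] and b = offD[OF assms(1,4)]
  have ab: "a * b = 0"
    using assoc2[OF a(3), of b] b(2) by simp
  then have ab': "star b * star a = 0"
    by (metis star_mult star_zero)
  have ba: "b * a = 0"
    using assoc2[OF b(3), of a] a(2) by simp
  then have "star a * star b = 0"
    by (metis star_mult star_zero)
  then have "herm a * herm b = a * star b + star a * b"
    by (simp add: herm_def algebra_simps ab)
  moreover have "t (star a * b) = t (a * star b)"
    using t_star[of "star a * b"] t_comm[of a "star b"] a b by simp
  ultimately show ?thesis
    using a b by (simp add: t_add)
qed

text \<open>\<open>g\<close> is the smaller root of \<open>y\<^sup>2 - y + x = 0\<close>;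
  subtracting \<open>g\<close> at \<open>star b * b\<close> and adding \<open>g\<close> at
  \<open>b * star b\<close> makes \<open>P + herm b\<close> idempotent. The bound 1/2 on
  \<open>b\<close> keeps the spectra in the range up to 1/4, where the root is real, and
  \<open>g x \<le> 2 * x\<close> gives the size of the correction.\<close>

lemma perturbed_projection:
  assumes P: "is_proj P" "P \<in> M" and b: "b \<in> off P" and nb: "norm b \<le> 1/2"
  obtains \<Delta> where "\<Delta> \<in> M" "star \<Delta> = \<Delta>" "P * \<Delta> = \<Delta> * P" "is_proj (P + herm b + \<Delta>)"
    "t (P + herm b + \<Delta>) = t P"
    "t (\<Delta> * \<Delta>) \<le> 4 * (t (star b * b * (star b * b)) + t (b * star b * (b * star b)))"
proof -
  define g where "g x = (1 - sqrt (max 0 (1 - 4 * x))) / 2" for x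
  have cg: "continuous_on UNIV g"
    unfolding g_def by (intro continuous_intros) auto
  have g0: "g 0 = 0"
    by (simp add: g_def)
  have geq: "g x * g x = g x - x" if "x \<le> 1/4" for x
  proof -
    have "(sqrt (1 - 4 * x))\<^sup>2 = 1 - 4 * x"
      using that by simp
    then show ?thesis
      using that by (simp add: g_def field_simps power2_eq_square)
  qed
  have gle: "0 \<le> g x" "g x \<le> 2 * x" if "0 \<le> x" "x \<le> 1/4" for x
  proof -
    have "g x \<le> 1/2" and g: "0 \<le> g x"
      using that by (auto simp: g_def)
    then have "0 \<le> g x * (1/2 - g x)"
      by (intro mult_nonneg_nonneg) auto
    then show "g x \<le> 2 * x"
      using geq[OF that(2)] by (simp add: algebra_simps)
    show "0 \<le> g x" by fact
  qed
  note bb = offD[OF P(1) b]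
  have PP: "P * P = P" "star P = P"
    using P(1) by (auto simp: is_proj_def)
  define p where "p = star b * b"
  define r where "r = b * star b"
  have pr: "p \<in> M" "star p = p" "0 \<le> p" "r \<in> M" "star r = r" "0 \<le> r"
    using bb by (simp_all add: p_def r_def)
  have "norm p \<le> 1/4" "norm r \<le> 1/4"
    using norm_star_mult_self[of b] norm_star_mult_self[of "star b"] nb power_mono[OF nb norm_ge_zero, of 2]
    by (simp_all add: p_def r_def power2_eq_square)
  then have sp: "0 \<le> x \<and> x \<le> 1/4" if "x \<in> spec p \<or> x \<in> spec r" for x
    using that spec_norm_bound[of p x] spec_norm_bound[of r x] spec_nonneg[of p x] spec_nonneg[of r x] pr
    by auto
  define G1 where "G1 = fc g p"
  define G2 where "G2 = fc g r"
  have G: "G1 \<in> M" "star G1 = G1" "G2 \<in> M" "star G2 = G2"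
    unfolding G1_def G2_def by (intro fc_closed star_fc pr cg)+
  have sq: "G1 * G1 = G1 - p" "G2 * G2 = G2 - r"
  proof -
    have *: "fc g x * fc g x = fc g x - x" if "star x = x" "\<And>y. y \<in> spec x \<Longrightarrow> y \<le> 1/4" for x
    proof -
      have "fc g x * fc g x = fc (\<lambda>y. g y * g y) x"
        by (rule fc_mult[OF that(1) cg cg, symmetric])
      also have "\<dots> = fc (\<lambda>y. g y - y) x"
        by (rule fc_cong) (use geq that(2) in auto)
      also have "\<dots> = fc g x - x"
        using fc_diff[OF that(1) cg continuous_on_id] by (simp add: fc_id that(1))
      finally show ?thesis .
    qed
    show "G1 * G1 = G1 - p" "G2 * G2 = G2 - r"
      unfolding G1_def G2_def using pr sp by (intro *; blast)+
  qed
  have PG1: "P * G1 = G1" "G1 * P = G1"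
  proof -
    show 1: "P * G1 = G1"
      unfolding G1_def using bb by (intro fc_corner(2)[OF P(1) pr(2) cg _ g0]) (simp add: p_def assoc2[OF bb(4)])
    show "G1 * P = G1"
      using arg_cong[OF 1, of star] G PP by simp
  qed
  have PG2: "P * G2 = 0" "G2 * P = 0"
  proof -
    have "(1 - P) * G2 = G2"
      unfolding G2_def using bb
      by (intro fc_corner(2)[OF is_proj_one_minus[OF P(1)] pr(5) cg _ g0])
        (simp add: r_def left_diff_distrib assoc2[OF bb(2)])
    then show 1: "P * G2 = 0"
      by (simp add: left_diff_distrib)
    show "G2 * P = 0"
      using arg_cong[OF 1, of star] G PP by simp
  qed
  have int: "b * G1 = G2 * b"
    unfolding G1_def G2_def by (rule fc_intertwine[OF pr(2,5) cg]) (simp add: p_def r_def mult.assoc)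
  then have int': "G1 * star b = star b * G2"
    using G by (metis star_mult)
  have z: "b * G2 = 0" "G1 * b = 0" "G1 * G2 = 0" "G2 * G1 = 0" "star b * G1 = 0" "G2 * star b = 0"
  proof -
    show 1: "b * G2 = 0" and 2: "G1 * b = 0" and 3: "G1 * G2 = 0"
      using absorb_right[OF bb(3) PG2(1)] absorb_right[OF PG1(2) bb(2)] absorb_right[OF PG1(2) PG2(1)]
      by simp_all
    show "G2 * G1 = 0" "star b * G1 = 0" "G2 * star b = 0"
      using arg_cong[OF 1, of star] arg_cong[OF 2, of star] arg_cong[OF 3, of star] G by simp_all
  qed
  define \<Delta> where "\<Delta> = G2 - G1"
  have D: "\<Delta> \<in> M" "star \<Delta> = \<Delta>" "P * \<Delta> = \<Delta> * P"
    using G by (simp_all add: \<Delta>_def algebra_simps PG1 PG2)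
  have "(P + herm b + \<Delta>) * (P + herm b + \<Delta>) = P + herm b + \<Delta>"
    using bb PP by (simp add: herm_def \<Delta>_def algebra_simps PG1 PG2 z int int' sq flip: p_def r_def)
  then have proj: "is_proj (P + herm b + \<Delta>)"
    using D PP by (simp add: is_proj_def)
  have tG: "t G1 = t G2"
    unfolding G1_def G2_def p_def r_def by (rule t_fc_star_mult[OF bb(1) cg g0])
  then have tr: "t (P + herm b + \<Delta>) = t P"
    using bb P G t_off_zero[OF P b] by (simp add: \<Delta>_def herm_def t_linear t_star)
  have le: "t (fc g x * fc g x) \<le> 4 * t (x * x)"
    if x: "x \<in> M" "star x = x" "\<And>y. y \<in> spec x \<Longrightarrow> 0 \<le> y \<and> y \<le> 1/4" for x
  proof -
    have "fc g x * fc g x = fc (\<lambda>y. g y * g y) x"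
      by (rule fc_mult[OF x(2) cg cg, symmetric])
    also have "\<dots> \<le> fc (\<lambda>y. 4 * (y * y)) x"
    proof (rule fc_mono[OF x(2)])
      show "g y * g y \<le> 4 * (y * y)" if "y \<in> spec x" for y
        using mult_mono[OF gle(2) gle(2), of y y] gle(1)[of y] x(3)[OF that] by simp
    qed (intro continuous_intros cg)+
    also have "\<dots> = 4 *\<^sub>R (x * x)"
      using fc_scale[OF x(2), of "\<lambda>y. y * y" 4] fc_mult[OF x(2) continuous_on_id continuous_on_id] x(2)
      by (simp add: fc_id continuous_on_mult continuous_on_id)
    finally have "t (fc g x * fc g x) \<le> t (4 *\<^sub>R (x * x))"
      using x fc_closed[OF x(1,2) cg] by (intro t_mono) simp_all
    then show ?thesis
      using x by (simp add: t_scaleR)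
  qed
  have "\<Delta> * \<Delta> = G1 * G1 + G2 * G2"
    by (simp add: \<Delta>_def algebra_simps z)
  then have "t (\<Delta> * \<Delta>) = t (G1 * G1) + t (G2 * G2)"
    using G by (simp add: t_add)
  also have "\<dots> \<le> 4 * t (p * p) + 4 * t (r * r)"
    unfolding G1_def G2_def using pr sp by (intro add_mono le) blast+
  finally have "t (\<Delta> * \<Delta>) \<le> 4 * (t (p * p) + t (r * r))"
    by simp
  then show ?thesis
    using that[OF D proj tr] by (simp add: p_def r_def)
qed

text \<open>The part of the idempotent equation commuting with \<open>J = 1 - 2 *\<^sub>R P\<close>
  reads \<open>J * \<Delta> = \<Delta> * \<Delta> + herm b * herm b\<close>, so
  \<open>\<Delta>\<close> differs from \<open>curv b\<close> by
  \<open>J * (\<Delta> * \<Delta>)\<close>. An arbitrary diagonal \<open>\<Delta>\<close> is allowed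
  because the images of the constructed projections are not known explicitly.\<close>

lemma second_order:
  assumes P: "is_proj P" "P \<in> M" and b: "b \<in> off P" and D: "\<Delta> \<in> M" "star \<Delta> = \<Delta>" "P * \<Delta> = \<Delta> * P"
    and R: "is_proj (P + herm b + \<Delta>)" and z: "z \<in> M"
  shows "\<bar>t (\<Delta> * z) - t (curv b * z)\<bar> \<le> 3 * norm z * t (\<Delta> * \<Delta>)"
proof -
  note bb = offD[OF P(1) b]
  have PP: "P * P = P" "star P = P"
    using P(1) by (auto simp: is_proj_def)
  define J where "J = 1 - 2 *\<^sub>R P"
  have JJ: "J * J = 1" "J \<in> M"
    using P(2) PP by (simp_all add: J_def algebra_simps scaleR_2)
  have yy: "herm b * herm b = star b * b + b * star b"
    using bb by (simp add: herm_def algebra_simps)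
  have "(P + herm b + \<Delta>) * (P + herm b + \<Delta>) = P + herm b + \<Delta>"
    using R by (simp add: is_proj_def)
  moreover have "(P + herm b + \<Delta>) * (P + herm b + \<Delta>) =
      P + herm b + 2 *\<^sub>R (P * \<Delta>) + \<Delta> * \<Delta> + herm b * herm b + (herm b * \<Delta> + \<Delta> * herm b)"
    using PP bb D(3) by (simp add: herm_def algebra_simps scaleR_2)
  ultimately have eq: "\<Delta> - 2 *\<^sub>R (P * \<Delta>) = \<Delta> * \<Delta> + herm b * herm b + (herm b * \<Delta> + \<Delta> * herm b)"
    by (simp add: algebra_simps)
  \<comment> \<open>\<open>W\<close> anticommutes with \<open>J\<close>, while all other terms of
    the equation commute with it. So \<open>W\<close> does both and is 0.\<close>
  define W where "W = herm b * \<Delta> + \<Delta> * herm b"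
  have "J * \<Delta> = \<Delta> * \<Delta> + herm b * herm b + W"
    using eq by (simp add: J_def W_def left_diff_distrib)
  moreover have "J * W = - (W * J)" "J * (\<Delta> * \<Delta> + herm b * herm b) = (\<Delta> * \<Delta> + herm b * herm b) * J"
    "J * (J * \<Delta>) = (J * \<Delta>) * J"
  proof -
    have Jy: "J * herm b = - (herm b * J)" and JD: "J * \<Delta> = \<Delta> * J"
      using bb D(3) by (simp_all add: J_def herm_def algebra_simps scaleR_2)
    have "J * (herm b * \<Delta>) = - (herm b * (J * \<Delta>))" "J * (\<Delta> * herm b) = \<Delta> * (J * herm b)"
      by (simp_all only: assoc2[OF Jy] assoc2[OF JD] mult_minus_left mult.assoc)
    then show "J * W = - (W * J)"
      by (simp add: W_def distrib_left distrib_right Jy JD mult.assoc)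
    have "J * (\<Delta> * \<Delta>) = \<Delta> * (J * \<Delta>)" "J * (herm b * herm b) = - (herm b * (J * herm b))"
      by (simp_all only: assoc2[OF Jy] assoc2[OF JD] mult_minus_left mult.assoc)
    then show "J * (\<Delta> * \<Delta> + herm b * herm b) = (\<Delta> * \<Delta> + herm b * herm b) * J"
      by (simp add: distrib_left distrib_right Jy JD mult.assoc)
    show "J * (J * \<Delta>) = (J * \<Delta>) * J"
      by (simp add: mult.assoc flip: JD)
  qed
  ultimately have c1: "J * W = W * J" and c2: "J * W = - (W * J)"
    by (simp_all add: distrib_left distrib_right)
  have "2 *\<^sub>R (J * W) = W * J + J * W"
    unfolding scaleR_2 by (simp only: c1)
  also have "\<dots> = 0"
    by (simp only: c2 right_minus)
  finally have "J * W = 0"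
    by simp
  then have "W = 0"
    using assoc2[OF JJ(1), of W] by simp
  then have "J * \<Delta> = \<Delta> * \<Delta> + herm b * herm b"
    using \<open>J * \<Delta> = \<Delta> * \<Delta> + herm b * herm b + W\<close> by simp
  then have "\<Delta> = J * (\<Delta> * \<Delta>) + J * (herm b * herm b)"
    using assoc2[OF JJ(1), of \<Delta>] by (simp add: distrib_left)
  moreover have "J * (herm b * herm b) = curv b"
    using bb by (simp add: yy J_def curv_def algebra_simps scaleR_2 assoc2[OF bb(4)] assoc2[OF bb(2)])
  ultimately have "\<Delta> - curv b = J * (\<Delta> * \<Delta>)"
    by (simp add: algebra_simps)
  then have "\<Delta> * z - curv b * z = J * (\<Delta> * \<Delta>) * z"
    by (simp flip: left_diff_distrib)
  then have "t (\<Delta> * z) - t (curv b * z) = t (J * (\<Delta> * \<Delta>) * z)"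
    using D bb z by (metis t_diff curv_in mult_closed)
  also have "\<dots> = t (star \<Delta> * (z * J) * \<Delta>)"
    using t_comm[of "J * \<Delta>" "\<Delta> * z"] D z JJ by (simp add: mult.assoc)
  finally have "\<bar>t (\<Delta> * z) - t (curv b * z)\<bar> \<le> norm (z * J) * t (star \<Delta> * \<Delta>)"
    using t_conj_le[OF D(1), of "z * J"] z JJ by simp
  \<comment> \<open>The factor 3 is the triangle inequality bound for the norm of
    \<open>1 - 2 *\<^sub>R P\<close>.\<close>
  also have "\<dots> \<le> (norm z * 3) * t (star \<Delta> * \<Delta>)"
  proof (intro mult_right_mono t_star_mult_nonneg D)
    have "norm J \<le> norm (1 :: 'a cop) + norm (2 *\<^sub>R P)"
      unfolding J_def by (rule norm_triangle_ineq4)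
    then have "norm J \<le> 3"
      using norm_one_le[where 'a = 'a] is_proj_norm_le[OF P(1)] by simp
    then show "norm (z * J) \<le> norm z * 3"
      by (intro order_trans[OF norm_mult_ineq] mult_left_mono) auto
  qed
  finally show ?thesis
    using D by (simp add: mult.commute)
qed

end

text \<open>Two expansions of one otherwise unknown function are compared in their quadratic
  coefficients: divide by the square of \<open>s\<close> and let \<open>s\<close> tend to 0.\<close>

lemma eq_of_quartic_approximation:
  fixes \<alpha> \<beta> :: real
  assumes "\<And>s. 0 < s \<Longrightarrow> s \<le> 1 \<Longrightarrow> \<bar>f s - s\<^sup>2 * \<alpha>\<bar> \<le> K * s ^ 4"
    and "\<And>s. 0 < s \<Longrightarrow> s \<le> 1 \<Longrightarrow> \<bar>f s - s\<^sup>2 * \<beta>\<bar> \<le> L * s ^ 4"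
  shows "\<alpha> = \<beta>"
proof -
  have le: "\<bar>\<alpha> - \<beta>\<bar> \<le> (K + L) * s\<^sup>2" if s: "0 < s" "s \<le> 1" for s
  proof -
    have "\<bar>s\<^sup>2 * \<alpha> - s\<^sup>2 * \<beta>\<bar> \<le> K * s ^ 4 + L * s ^ 4"
      using assms(1)[OF s] assms(2)[OF s] by linarith
    moreover have "\<bar>s\<^sup>2 * \<alpha> - s\<^sup>2 * \<beta>\<bar> = s\<^sup>2 * \<bar>\<alpha> - \<beta>\<bar>"
      by (simp add: abs_mult flip: right_diff_distrib)
    moreover have "K * s ^ 4 + L * s ^ 4 = s\<^sup>2 * ((K + L) * s\<^sup>2)"
      by (simp add: power4_eq_xxxx power2_eq_square algebra_simps)
    ultimately show ?thesis
      using s by simp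
  qed
  have "((\<lambda>s. (K + L) * s\<^sup>2) \<longlongrightarrow> (K + L) * 0\<^sup>2) (at_right (0 :: real))"
    by (intro tendsto_intros)
  moreover have "\<forall>\<^sub>F s in at_right (0 :: real). \<bar>\<alpha> - \<beta>\<bar> \<le> (K + L) * s\<^sup>2"
    using le by (intro eventually_at_rightI[of 0 1]) auto
  ultimately have "\<bar>\<alpha> - \<beta>\<bar> \<le> (K + L) * 0\<^sup>2"
    by (rule tendsto_lowerbound) simp
  then show ?thesis
    by simp
qed

section \<open>Linearization of trace preserving maps\<close>

text \<open>Keeps the membership of \<open>y\<close> in the span among the induction hypotheses,
  where it supplies closure facts such as \<open>span_A\<close>.\<close>

lemma span_induct_member [consumes 1, case_names base step]:
  assumes "x \<in> span S" "h 0"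
    "\<And>r x y. x \<in> S \<Longrightarrow> y \<in> span S \<Longrightarrow> h y \<Longrightarrow> h (r *\<^sub>R x + y)"
  shows "h x"
proof -
  have "x \<in> span S \<and> h x"
    using assms(1) by (induction rule: span_induct_alt) (auto intro: assms(2,3) span_add span_scale span_base span_zero)
  then show ?thesis
    by simp
qed

locale trace_isometry = A: fin_factor M t + B: fin_factor N u
  for M :: "'a :: chilbert_space cop set" and t and N :: "'b :: chilbert_space cop set" and u +
  fixes c :: real and \<phi> :: "'a cop \<Rightarrow> 'b cop"
  assumes c: "0 < c" "c < 1"
    and bij: "bij_betw \<phi> (A.Pc c) (B.Pc c)"
    and trace: "P \<in> A.Pc c \<Longrightarrow> Q \<in> A.Pc c \<Longrightarrow> u (\<phi> P * \<phi> Q) = t (P * Q)"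
begin

lemma phi_Pc: "P \<in> A.Pc c \<Longrightarrow> \<phi> P \<in> B.Pc c"
  using bij by (auto simp: bij_betw_def)

lemma inverse: "trace_isometry N u M t c (inv_into (A.Pc c) \<phi>)"
proof
  show "bij_betw (inv_into (A.Pc c) \<phi>) (B.Pc c) (A.Pc c)"
    by (rule bij_betw_inv_into[OF bij])
  fix P Q assume "P \<in> B.Pc c" "Q \<in> B.Pc c"
  then show "t (inv_into (A.Pc c) \<phi> P * inv_into (A.Pc c) \<phi> Q) = u (P * Q)"
    using trace[of "inv_into (A.Pc c) \<phi> P" "inv_into (A.Pc c) \<phi> Q"] bij
    by (auto simp: bij_betw_def inv_into_into f_inv_into_f)
qed (use c in auto)

lemma span_A: "x \<in> span (A.Pc c) \<Longrightarrow> x \<in> M \<and> star x = x"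
  by (induction rule: span_induct_alt) (auto simp: A.PcD)

lemma span_B: "y \<in> span (B.Pc c) \<Longrightarrow> y \<in> N \<and> star y = y"
  by (induction rule: span_induct_alt) (auto simp: B.PcD)

text \<open>Unlike \<open>Psi\<close>, this relation makes sense outside the spans, as is needed for
  \<open>curv b\<close>.\<close>

definition corresponds :: "'a cop \<Rightarrow> 'b cop \<Rightarrow> bool" where
  "corresponds x y \<longleftrightarrow> (\<forall>P\<in>A.Pc c. u (y * \<phi> P) = t (x * P))"

lemma corresponds_unique:
  assumes "y \<in> span (B.Pc c)" "y' \<in> span (B.Pc c)" "corresponds x y" "corresponds x y'"
  shows "y = y'"
proof -
  define z where "z = y - y'"
  have z: "z \<in> span (B.Pc c)"
    unfolding z_def using assms by (intro span_diff)
  note zN = span_B[OF z] and yN = span_B[OF assms(1)] and yN' = span_B[OF assms(2)]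
  have 0: "u (z * Q) = 0" if "Q \<in> B.Pc c" for Q
  proof -
    obtain P where "P \<in> A.Pc c" "Q = \<phi> P"
      using \<open>Q \<in> B.Pc c\<close> bij by (auto simp: bij_betw_def)
    then show ?thesis
      using assms(3,4) yN yN' B.PcD[OF \<open>Q \<in> B.Pc c\<close>] by (simp add: corresponds_def z_def left_diff_distrib B.t_diff)
  qed
  have "u (z * w) = 0" if "w \<in> span (B.Pc c)" for w
    using that
  proof (induction rule: span_induct_member)
    case (step r Q w)
    then show ?case
      using zN 0 B.PcD[OF step(1)] span_B[OF step(2)] by (simp add: distrib_left B.t_linear)
  qed simp
  from this[OF z] have "u (star z * z) \<le> 0"
    using zN by simp
  then have "z = 0"
    using B.t_star_mult_le_zero zN by blast
  then show ?thesis
    by (simp add: z_def)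
qed

text \<open>Defining the extension by trace pairings avoids checking independence of the chosen
  linear combination; \<open>corresponds_unique\<close> makes the choice unique.\<close>

definition Psi :: "'a cop \<Rightarrow> 'b cop" where
  "Psi x = (SOME y. y \<in> span (B.Pc c) \<and> corresponds x y)"

lemma Psi:
  assumes "x \<in> span (A.Pc c)"
  shows "Psi x \<in> span (B.Pc c)" "corresponds x (Psi x)"
proof -
  have "\<exists>y. y \<in> span (B.Pc c) \<and> corresponds x y"
    using assms
  proof (induction rule: span_induct_member)
    case base
    show ?case
      by (intro exI[of _ 0]) (simp add: corresponds_def span_zero)
  next
    case (step r Q x)
    then obtain y where y: "y \<in> span (B.Pc c)" "corresponds x y"
      by blast
    have "corresponds (r *\<^sub>R Q + x) (r *\<^sub>R \<phi> Q + y)"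
      using y(2) trace[OF _ step(1)] trace[OF step(1)] A.PcD[OF step(1)] B.PcD[OF phi_Pc[OF step(1)]] span_A[OF step(2)] span_B[OF y(1)]
        A.PcD B.PcD[OF phi_Pc]
      by (simp add: corresponds_def distrib_right A.t_linear B.t_linear)
    moreover have "r *\<^sub>R \<phi> Q + y \<in> span (B.Pc c)"
      by (intro span_add span_scale span_base phi_Pc step(1) y)
    ultimately show ?case
      by blast
  qed
  from someI_ex[OF this] show "Psi x \<in> span (B.Pc c)" "corresponds x (Psi x)"
    unfolding Psi_def by blast+
qed

lemma Psi_eqI: "x \<in> span (A.Pc c) \<Longrightarrow> y \<in> span (B.Pc c) \<Longrightarrow> corresponds x y \<Longrightarrow> Psi x = y"
  using corresponds_unique Psi by blast

lemma Psi_phi: "P \<in> A.Pc c \<Longrightarrow> Psi P = \<phi> P"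
  by (rule Psi_eqI) (auto intro: span_base phi_Pc simp: corresponds_def trace)

lemma Psi_add:
  assumes "x \<in> span (A.Pc c)" "z \<in> span (A.Pc c)"
  shows "Psi (x + z) = Psi x + Psi z"
proof (rule Psi_eqI)
  show "corresponds (x + z) (Psi x + Psi z)"
    using Psi(2)[OF assms(1)] Psi(2)[OF assms(2)] span_A[OF assms(1)] span_A[OF assms(2)]
      span_B[OF Psi(1)[OF assms(1)]] span_B[OF Psi(1)[OF assms(2)]] A.PcD B.PcD[OF phi_Pc]
    by (simp add: corresponds_def distrib_right A.t_linear B.t_linear)
qed (intro span_add assms Psi)+

lemma Psi_scaleR:
  assumes "x \<in> span (A.Pc c)"
  shows "Psi (r *\<^sub>R x) = r *\<^sub>R Psi x"
proof (rule Psi_eqI)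
  show "corresponds (r *\<^sub>R x) (r *\<^sub>R Psi x)"
    using Psi(2)[OF assms(1)] span_A[OF assms(1)]
      span_B[OF Psi(1)[OF assms(1)]] A.PcD B.PcD[OF phi_Pc]
    by (simp add: corresponds_def A.t_linear B.t_linear)
qed (intro span_scale assms Psi)+

lemma Psi_diff:
  assumes "x \<in> span (A.Pc c)" "z \<in> span (A.Pc c)"
  shows "Psi (x - z) = Psi x - Psi z"
  using Psi_add[OF assms(1) span_scale[OF assms(2), of "- 1"]] Psi_scaleR[OF assms(2), of "- 1"] by simp

lemma Psi_pairing:
  assumes "corresponds x y" "x \<in> M" "y \<in> N" "z \<in> span (A.Pc c)"
  shows "u (y * Psi z) = t (x * z)"
  using assms(4)
proof (induction rule: span_induct_member)
  case base
  have "Psi (0 :: 'a cop) = 0"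
    by (rule Psi_eqI) (auto simp: corresponds_def span_zero)
  then show ?case
    by simp
next
  case (step r Q z)
  have "Psi (r *\<^sub>R Q + z) = r *\<^sub>R \<phi> Q + Psi z"
    using step(1,2) by (simp add: Psi_add Psi_scaleR Psi_phi span_scale span_base)
  then show ?case
    using step assms(1-3) A.PcD[OF step(1)] B.PcD[OF phi_Pc[OF step(1)]] span_A[OF step(2)] span_B[OF Psi(1)[OF step(2)]]
    by (simp add: corresponds_def distrib_left A.t_linear B.t_linear)
qed

lemma Psi_inner:
  assumes "x \<in> span (A.Pc c)" "z \<in> span (A.Pc c)"
  shows "u (Psi x * Psi z) = t (x * z)"
  using Psi_pairing[OF Psi(2)[OF assms(1)] _ _ assms(2)] span_A[OF assms(1)] span_B[OF Psi(1)[OF assms(1)]] by blast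

text \<open>The last conclusion names the preimage as the value of the extension of the inverse map,
  so that results for the inverse apply to it in \<open>rho_surj\<close>.\<close>

lemma Psi_surj:
  assumes "y \<in> span (B.Pc c)"
  obtains x where "x \<in> span (A.Pc c)" "Psi x = y" "trace_isometry.Psi N u M t c (inv_into (A.Pc c) \<phi>) y = x"
proof -
  interpret I: trace_isometry N u M t c "inv_into (A.Pc c) \<phi>"
    by (rule inverse)
  define x where "x = I.Psi y"
  have x: "x \<in> span (A.Pc c)" "I.corresponds y x"
    using I.Psi[OF assms] by (simp_all add: x_def)
  have "corresponds x y"
    unfolding corresponds_def
  proof
    fix P assume "P \<in> A.Pc c"
    then show "u (y * \<phi> P) = t (x * P)"
      using x(2) phi_Pc[of P] bij by (auto simp: I.corresponds_def bij_betw_def dest!: bspec[of _ _ "\<phi> P"])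
  qed
  then have "Psi x = y"
    by (rule Psi_eqI[OF x(1) assms])
  then show ?thesis
    by (rule that[OF x(1) _ x_def[symmetric]])
qed

lemma small_perturbation:
  assumes P: "P \<in> A.Pc c" and b: "b \<in> A.off P" and nb: "norm b \<le> 1/2" and s: "\<bar>s\<bar> \<le> 1"
  obtains \<Delta> where "\<Delta> \<in> M" "star \<Delta> = \<Delta>" "P * \<Delta> = \<Delta> * P" "P + herm (s *\<^sub>R b) + \<Delta> \<in> A.Pc c"
    "t (\<Delta> * \<Delta>) \<le> 4 * (t (star b * b * (star b * b)) + t (b * star b * (b * star b))) * s ^ 4"
proof -
  note p = A.PcD[OF P]
  have "\<bar>s\<bar> * norm b \<le> 1 * (1/2)"
    using s nb by (intro mult_mono) auto
  then have "norm (s *\<^sub>R b) \<le> 1/2"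
    by simp
  from A.perturbed_projection[OF p(2,1) A.off_scaleR[OF b] this] obtain \<Delta> where
    D: "\<Delta> \<in> M" "star \<Delta> = \<Delta>" "P * \<Delta> = \<Delta> * P" "is_proj (P + herm (s *\<^sub>R b) + \<Delta>)"
    "t (P + herm (s *\<^sub>R b) + \<Delta>) = t P"
    "t (\<Delta> * \<Delta>) \<le> 4 * (t (star (s *\<^sub>R b) * (s *\<^sub>R b) * (star (s *\<^sub>R b) * (s *\<^sub>R b))) +
      t ((s *\<^sub>R b) * star (s *\<^sub>R b) * ((s *\<^sub>R b) * star (s *\<^sub>R b))))"
    by metis
  have "b \<in> M"
    using A.offD[OF p(2) b] by simp
  moreover from this have "P + herm (s *\<^sub>R b) + \<Delta> \<in> A.Pc c"
    using D p by (simp add: A.Pc_def)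
  ultimately show ?thesis
    using that[of \<Delta>] D by (simp add: A.t_scaleR power4_eq_xxxx algebra_simps)
qed

text \<open>Conjugation by the symmetry \<open>1 - 2 *\<^sub>R P\<close> fixes
  \<open>P + \<Delta>\<close> and changes the sign of \<open>herm b\<close>, so
  \<open>herm b\<close> is half the difference of two projections of trace \<open>c\<close>.\<close>

lemma herm_small_in_span:
  assumes P: "P \<in> A.Pc c" and b: "b \<in> A.off P" and nb: "norm b \<le> 1/2"
  shows "herm b \<in> span (A.Pc c)"
proof -
  note p = A.PcD[OF P]
  obtain \<Delta> where D: "\<Delta> \<in> M" "star \<Delta> = \<Delta>" "P * \<Delta> = \<Delta> * P" "is_proj (P + herm b + \<Delta>)" "t (P + herm b + \<Delta>) = t P"
    using A.perturbed_projection[OF p(2,1) b nb] by metis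
  note bb = A.offD[OF p(2) b]
  define J where "J = 1 - 2 *\<^sub>R P"
  have J: "J * J = 1" "star J = J" "J \<in> M"
    using p by (simp_all add: J_def algebra_simps scaleR_2)
  define R where "R = P + herm b + \<Delta>"
  have R: "R \<in> A.Pc c"
    using D p bb by (simp add: R_def A.Pc_def)
  have JRJ: "J * R * J = P - herm b + \<Delta>"
  proof -
    have "J * P = - P" "J * herm b = - (herm b * J)" "J * \<Delta> = \<Delta> * J"
      using p bb D(3) by (simp_all add: J_def herm_def algebra_simps scaleR_2)
    then have "J * R = (P - herm b + \<Delta>) * J"
      using p by (simp add: R_def distrib_left distrib_right left_diff_distrib) (simp add: J_def algebra_simps scaleR_2 p)
    then show ?thesis
      by (simp add: mult.assoc J(1))
  qed
  have "J * R * J \<in> A.Pc c"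
  proof -
    have "J * R * J * (J * R * J) = J * (R * (J * J) * R) * J"
      by (simp only: mult.assoc)
    then have "J * R * J * (J * R * J) = J * R * J"
      using A.PcD[OF R] by (simp add: J mult.assoc)
    moreover have "t (J * R * J) = t R"
      using A.t_comm[of "J * R" J] A.PcD[OF R] J by (simp flip: mult.assoc)
    ultimately show ?thesis
      using J A.PcD[OF R] by (simp add: A.Pc_def is_proj_def mult.assoc)
  qed
  moreover have "herm b = (1/2) *\<^sub>R (R - J * R * J)"
    unfolding JRJ by (simp add: R_def flip: scaleR_2)
  ultimately show ?thesis
    using R by (simp add: span_scale span_diff span_base)
qed

lemma small_multiple:
  fixes b :: "'a cop"
  obtains r where "r > 0" "norm (r *\<^sub>R b) \<le> 1/2"
proof -
  have "norm ((1 / (2 * (norm b + 1))) *\<^sub>R b) \<le> 1/2"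
    by (simp add: divide_le_eq add_nonneg_pos)
  then show ?thesis
    using that[of "1 / (2 * (norm b + 1))"] by (simp add: add_nonneg_pos)
qed

lemma herm_in_span:
  assumes P: "P \<in> A.Pc c" and b: "b \<in> A.off P"
  shows "herm b \<in> span (A.Pc c)"
proof -
  obtain r where r: "r > 0" "norm (r *\<^sub>R b) \<le> 1/2"
    by (rule small_multiple)
  have "herm b = (1 / r) *\<^sub>R herm (r *\<^sub>R b)"
    using r by (simp add: herm_scaleR)
  then show ?thesis
    using herm_small_in_span[OF P A.off_scaleR[OF b] r(2)] by (simp add: span_scale)
qed

text \<open>\<open>Z\<close> measures how far \<open>Psi (herm b)\<close> is from being off-diagonal
  at \<open>\<phi> P\<close>. The images of the nearby projections are idempotent, with first order
  defect \<open>s *\<^sub>R Z\<close>; paired with \<open>Z\<close>, the remaining terms are of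
  order the square of \<open>s\<close>, so \<open>u (Z * Z)\<close> is 0.\<close>

lemma Psi_herm_off_small:
  assumes P: "P \<in> A.Pc c" and b: "b \<in> A.off P" and nb: "norm b \<le> 1/2"
  shows "\<phi> P * Psi (herm b) + Psi (herm b) * \<phi> P = Psi (herm b)"
proof -
  note p = A.PcD[OF P] and p' = B.PcD[OF phi_Pc[OF P]] and bb = A.offD[OF A.PcD(2)[OF P] b]
  have ys: "herm b \<in> span (A.Pc c)"
    by (rule herm_in_span[OF P b])
  define Y where "Y = Psi (herm b)"
  have Y: "Y \<in> N" "star Y = Y"
    using span_B[OF Psi(1)[OF ys]] by (simp_all add: Y_def)
  define Z where "Z = \<phi> P * Y + Y * \<phi> P - Y"
  have Z: "Z \<in> N" "star Z = Z"
    using Y p' by (simp_all add: Z_def add.commute)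
  \<comment> \<open>The map sending \<open>X\<close> to
    \<open>\<phi> P * X + X * \<phi> P - X\<close> is symmetric for the trace pairing, and
    \<open>V\<close> is its value at \<open>Z\<close>; Cauchy-Schwarz can then be applied to
    \<open>X\<close> against \<open>V\<close>.\<close>
  define V where "V = Z * \<phi> P + \<phi> P * Z - Z"
  have V: "V \<in> N"
    using Z p' by (simp add: V_def)
  define C where "C = 4 * (t (star b * b * (star b * b)) + t (b * star b * (b * star b)))"
  have "0 \<le> t (star (star b * b) * (star b * b))" "0 \<le> t (star (b * star b) * (b * star b))"
    using bb by (intro A.t_star_mult_nonneg; simp)+
  then have C0: "0 \<le> C"
    by (simp add: C_def)
  define L where "L = sqrt (C * u (star V * V)) + norm Z * (t (herm b * herm b) + C)"
  have est: "u (Z * Z) \<le> L * s" if s: "0 < s" "s \<le> 1" for s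
  proof -
    obtain \<Delta> where D: "\<Delta> \<in> M" "star \<Delta> = \<Delta>" "P * \<Delta> = \<Delta> * P" "P + herm (s *\<^sub>R b) + \<Delta> \<in> A.Pc c" "t (\<Delta> * \<Delta>) \<le> C * s ^ 4"
      using small_perturbation[OF P b nb, of s] s unfolding C_def by (metis abs_of_pos)
    define R where "R = P + herm (s *\<^sub>R b) + \<Delta>"
    note r = B.PcD[OF phi_Pc[OF D(4)], folded R_def]
    have De: "\<Delta> = R - P - s *\<^sub>R herm b"
      by (simp add: R_def herm_scaleR)
    have RP: "R \<in> span (A.Pc c)" "P \<in> span (A.Pc c)" "s *\<^sub>R herm b \<in> span (A.Pc c)"
      using span_base[OF D(4)] span_base[OF P] span_scale[OF ys] by (simp_all only: R_def)
    have Ds: "\<Delta> \<in> span (A.Pc c)"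
      unfolding De by (intro span_diff RP)
    define X where "X = Psi \<Delta>"
    have Xe: "X = \<phi> R - \<phi> P - s *\<^sub>R Y"
    proof -
      have "X = Psi (R - P - s *\<^sub>R herm b)"
        by (simp only: X_def De)
      also have "\<dots> = Psi R - Psi P - s *\<^sub>R Psi (herm b)"
        using RP ys by (simp only: Psi_diff span_diff Psi_scaleR)
      finally show ?thesis
        using Psi_phi[OF P] Psi_phi[OF D(4)] by (simp only: Y_def R_def)
    qed
    have X: "X \<in> N" "star X = X"
      using span_B[OF Psi(1)[OF Ds]] by (simp_all add: X_def)
    define W where "W = s *\<^sub>R Y + X"
    have W: "W \<in> N" "star W = W"
      using X Y by (simp_all add: W_def)
    have Re: "\<phi> R = \<phi> P + W"
      by (simp add: Xe W_def)
    have "(\<phi> P + W) * (\<phi> P + W) = \<phi> P + W"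
      using r(4) by (simp add: Re)
    then have "\<phi> P * W + W * \<phi> P - W = - (W * W)"
      using p' by (simp add: algebra_simps)
    \<comment> \<open>The idempotent equation for \<open>\<phi> P + W\<close>, solved for the part
      coming from \<open>s *\<^sub>R Y\<close>.\<close>
    then have eq: "s *\<^sub>R Z = - (\<phi> P * X + X * \<phi> P - X) - W * W"
      by (simp add: W_def Z_def algebra_simps)
    have "s * u (Z * Z) = u ((s *\<^sub>R Z) * Z)"
      using Z by (simp add: B.t_scaleR)
    also have "\<dots> = - u ((\<phi> P * X + X * \<phi> P - X) * Z) - u (W * W * Z)"
      unfolding eq using p' X W Z by (simp add: left_diff_distrib B.t_linear)
    also have "u ((\<phi> P * X + X * \<phi> P - X) * Z) = u (star X * V)"
      using p' X Z B.t_comm[of "\<phi> P" "X * Z"]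
      by (simp add: V_def algebra_simps B.t_linear)
    finally have main: "s * u (Z * Z) \<le> \<bar>u (star X * V)\<bar> + \<bar>u (W * W * Z)\<bar>"
      by linarith
    have uXX: "u (star X * X) \<le> C * s ^ 4"
      using Psi_inner[OF Ds Ds] D(5) X by (simp add: X_def)
    have "(u (star X * V))\<^sup>2 \<le> u (star X * X) * u (star V * V)"
      by (rule B.t_Cauchy_Schwarz[OF X(1) V])
    also have "\<dots> \<le> (C * s ^ 4) * u (star V * V)"
      by (intro mult_right_mono uXX B.t_star_mult_nonneg V)
    also have "\<dots> = (sqrt (C * u (star V * V)) * s\<^sup>2)\<^sup>2"
      using C0 B.t_star_mult_nonneg[OF V] by (simp add: power_mult_distrib flip: power_mult)
    finally have b1: "\<bar>u (star X * V)\<bar> \<le> sqrt (C * u (star V * V)) * s\<^sup>2"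
      using C0 B.t_star_mult_nonneg[OF V] by (intro power2_le_imp_le[of "\<bar>_\<bar>"]) simp_all
    have b2: "\<bar>u (W * W * Z)\<bar> \<le> norm Z * (t (herm b * herm b) + C) * s\<^sup>2"
    proof -
      have "u (W * W * Z) = u (star W * Z * W)"
        using B.t_comm[of W "W * Z"] W Z by (simp add: mult.assoc)
      then have "\<bar>u (W * W * Z)\<bar> \<le> norm Z * u (star W * W)"
        using B.t_conj_le[OF W(1) Z(1)] by simp
      moreover have "u (star W * W) = s\<^sup>2 * t (herm b * herm b) + t (\<Delta> * \<Delta>)"
      proof -
        have "W = Psi (s *\<^sub>R herm b + \<Delta>)"
          using ys Ds by (simp add: W_def X_def Y_def Psi_add Psi_scaleR span_scale)
        then have "u (star W * W) = t ((s *\<^sub>R herm b + \<Delta>) * (s *\<^sub>R herm b + \<Delta>))"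
          using Psi_inner[of "s *\<^sub>R herm b + \<Delta>" "s *\<^sub>R herm b + \<Delta>"] ys Ds W by (simp add: span_add span_scale)
        also have "\<dots> = s\<^sup>2 * t (herm b * herm b) + 2 * s * t (herm b * \<Delta>) + t (\<Delta> * \<Delta>)"
          using bb D A.t_comm[of \<Delta> "herm b"] by (simp add: distrib_left distrib_right A.t_linear power2_eq_square)
        also have "t (herm b * \<Delta>) = 0"
          using A.t_herm_diag_zero[OF p(2,1) b D(1,3)] .
        finally show ?thesis
          by simp
      qed
      moreover have "t (\<Delta> * \<Delta>) \<le> C * s\<^sup>2"
      proof -
        have "s ^ 4 \<le> s ^ 2"
          using s by (intro power_decreasing) auto
        then show ?thesis
          using D(5) C0 mult_left_mono[of "s ^ 4" "s ^ 2" C] by linarith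
      qed
      moreover have "norm Z * (s\<^sup>2 * t (herm b * herm b) + C * s\<^sup>2) = norm Z * (t (herm b * herm b) + C) * s\<^sup>2"
        by (simp add: algebra_simps)
      moreover have "norm Z * u (star W * W) \<le> norm Z * (s\<^sup>2 * t (herm b * herm b) + C * s\<^sup>2)"
        using calculation(2,3) by (intro mult_left_mono) simp_all
      ultimately show ?thesis
        by linarith
    qed
    have "s * u (Z * Z) \<le> L * s\<^sup>2"
      using main b1 b2 unfolding L_def distrib_right by linarith
    then have "s * u (Z * Z) \<le> s * (L * s)"
      by (simp add: power2_eq_square mult.commute mult.left_commute)
    then show ?thesis
      using s by simp
  qed
  have "((\<lambda>s. L * s) \<longlongrightarrow> L * 0) (at_right (0 :: real))"
    by (intro tendsto_intros)
  moreover have "\<forall>\<^sub>F s in at_right (0 :: real). u (Z * Z) \<le> L * s"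
    using est by (intro eventually_at_rightI[of 0 1]) auto
  ultimately have "u (Z * Z) \<le> L * 0"
    by (rule tendsto_lowerbound) simp
  then have "Z = 0"
    using B.t_star_mult_le_zero[OF Z(1)] Z(2) by simp
  then show ?thesis
    by (simp add: Z_def Y_def)
qed

lemma Psi_herm_off:
  assumes P: "P \<in> A.Pc c" and b: "b \<in> A.off P"
  shows "\<phi> P * Psi (herm b) + Psi (herm b) * \<phi> P = Psi (herm b)"
proof -
  obtain r where r: "r > 0" "norm (r *\<^sub>R b) \<le> 1/2"
    by (rule small_multiple)
  have "Psi (herm (r *\<^sub>R b)) = r *\<^sub>R Psi (herm b)"
    using herm_in_span[OF P b] by (simp add: herm_scaleR Psi_scaleR)
  then have "r *\<^sub>R (\<phi> P * Psi (herm b) + Psi (herm b) * \<phi> P) = r *\<^sub>R Psi (herm b)"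
    using Psi_herm_off_small[OF P A.off_scaleR[OF b] r(2)] by (simp add: scaleR_add_right)
  then show ?thesis
    using r(1) by simp
qed

end

context fin_factor
begin

lemma off_eq_zero:
  assumes "is_proj P" "x \<in> off P" "\<And>y. y \<in> off P \<Longrightarrow> t (x * star y) = 0"
  shows "x = 0"
proof -
  have "t (star (star x) * star x) \<le> 0"
    using assms(3)[OF assms(2)] by simp
  then have "star x = 0"
    using offD(1)[OF assms(1,2)] by (intro t_star_mult_le_zero) simp_all
  then show ?thesis
    by (metis star_star star_zero)
qed

text \<open>Removing the off-diagonal part \<open>herm x\<close> from \<open>X\<close> leaves an
  element that commutes with \<open>Q\<close> and is orthogonal to \<open>herm x\<close>. The
  hypothesis at \<open>x\<close> then makes \<open>x\<close> vanish.\<close>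

lemma commute_if_herm_orthogonal:
  assumes Q: "is_proj Q" "Q \<in> M" and X: "X \<in> M" "star X = X"
    and orth: "\<And>y. y \<in> off Q \<Longrightarrow> t (herm y * X) = 0"
  shows "Q * X = X * Q"
proof -
  have pp: "Q * Q = Q" "star Q = Q"
    using Q by (simp_all add: is_proj_def)
  define x where "x = (1 - Q) * X * Q"
  have x: "x \<in> off Q"
    unfolding x_def by (rule off_compress[OF Q X(1)])
  note xx = offD[OF Q(1) x]
  define Z where "Z = X - herm x"
  have Z: "Z \<in> M"
    using X xx by (simp add: Z_def)
  have Ze: "Z = X - X * Q - Q * X + 2 *\<^sub>R (Q * (X * Q))"
    using X pp by (simp add: Z_def herm_def x_def algebra_simps scaleR_2)
  have Zc: "Q * Z = Z * Q"
    unfolding Ze using pp by (simp add: algebra_simps scaleR_2 assoc2[OF pp(1)])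
  have "X = Z + herm x"
    by (simp add: Z_def)
  then have "t (herm x * Z) + t (herm x * herm x) = 0"
    using Z xx orth[OF x] by (simp add: distrib_left t_add)
  then have "t (x * star x) = 0"
    using t_herm_diag_zero[OF Q x Z Zc] t_herm_herm[OF Q x x] by simp
  then have "star x = 0"
    using xx t_star_mult_le_zero[of "star x"] by simp
  then have "herm x = 0"
    by (metis add.right_neutral herm_def star_star star_zero)
  then show ?thesis
    using Zc by (simp add: Z_def)
qed

text \<open>Products of two elements of this corner vanish; the ternary product is the
  multiplication it carries.\<close>

lemma off_triple:
  assumes "is_proj P" "a \<in> off P" "b \<in> off P" "e \<in> off P"
  shows "a * star b * e \<in> off P"
  using offD[OF assms(1,2)] offD[OF assms(1,3)] offD[OF assms(1,4)]
  by (simp add: off_def mult.assoc assoc2[OF offD(2)[OF assms(1,2)]])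

end

section \<open>The tangent map at a fixed projection\<close>

locale pointed_trace_isometry = trace_isometry M t N u c \<phi>
  for M :: "'a :: chilbert_space cop set" and t and N :: "'b :: chilbert_space cop set" and u c \<phi> +
  fixes P :: "'a cop"
  assumes base: "P \<in> A.Pc c"
begin

definition rho :: "'a cop \<Rightarrow> 'b cop" where
  "rho b = (1 - \<phi> P) * Psi (herm b) * \<phi> P"

lemma base_proj: "is_proj P" "P \<in> M" and base_image: "is_proj (\<phi> P)" "\<phi> P \<in> N"
  using A.PcD[OF base] B.PcD[OF phi_Pc[OF base]] by simp_all

lemma rho_off: "b \<in> A.off P \<Longrightarrow> rho b \<in> B.off (\<phi> P)"
  unfolding rho_def using span_B[OF Psi(1)[OF herm_in_span[OF base]]]
  by (intro B.off_compress base_image) blast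

lemma Psi_herm:
  assumes "b \<in> A.off P"
  shows "Psi (herm b) = herm (rho b)"
proof -
  define Y where "Y = Psi (herm b)"
  have Y: "star Y = Y" "\<phi> P * Y + Y * \<phi> P = Y"
    using span_B[OF Psi(1)[OF herm_in_span[OF base assms]]] Psi_herm_off[OF base assms] by (simp_all add: Y_def)
  have pp: "\<phi> P * \<phi> P = \<phi> P" "star (\<phi> P) = \<phi> P"
    using base_image by (simp_all add: is_proj_def)
  have "\<phi> P * Y = \<phi> P * (\<phi> P * Y + Y * \<phi> P)"
    by (simp only: Y)
  then have "\<phi> P * (Y * \<phi> P) = 0"
    by (simp add: distrib_left assoc2[OF pp(1)])
  then have r: "rho b = Y * \<phi> P"
    by (simp add: rho_def left_diff_distrib mult.assoc flip: Y_def)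
  have "herm (rho b) = \<phi> P * Y + Y * \<phi> P"
    by (simp add: r herm_def Y(1) pp(2) add.commute)
  then show ?thesis
    by (simp only: Y(2) flip: Y_def)
qed

lemma rho_add: "a \<in> A.off P \<Longrightarrow> b \<in> A.off P \<Longrightarrow> rho (a + b) = rho a + rho b"
  and rho_scaleR: "a \<in> A.off P \<Longrightarrow> rho (r *\<^sub>R a) = r *\<^sub>R rho a"
  using herm_in_span[OF base]
  by (simp_all add: rho_def herm_add Psi_add herm_scaleR Psi_scaleR distrib_left distrib_right)

lemma rho_inner:
  assumes "a \<in> A.off P" "b \<in> A.off P"
  shows "u (rho a * star (rho b)) = t (a * star b)"
  using Psi_inner[OF herm_in_span[OF base assms(1)] herm_in_span[OF base assms(2)]]
    A.t_herm_herm[OF base_proj assms] B.t_herm_herm[OF base_image rho_off[OF assms(1)] rho_off[OF assms(2)]]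
  by (simp add: Psi_herm assms)

text \<open>The results so far apply to the inverse map at the base point \<open>\<phi> P\<close>;
  its tangent map supplies the preimage.\<close>

lemma rho_surj:
  assumes y: "y \<in> B.off (\<phi> P)"
  obtains b where "b \<in> A.off P" "rho b = y"
proof -
  have inv: "inv_into (A.Pc c) \<phi> (\<phi> P) = P"
    using bij base by (simp add: bij_betw_def)
  interpret I: trace_isometry N u M t c "inv_into (A.Pc c) \<phi>"
    by (rule inverse)
  interpret I: pointed_trace_isometry N u M t c "inv_into (A.Pc c) \<phi>" "\<phi> P"
    by unfold_locales (rule phi_Pc[OF base])
  obtain x where x: "Psi x = herm y" "I.Psi (herm y) = x"
    by (rule Psi_surj[OF I.herm_in_span[OF phi_Pc[OF base] y]])
  have b: "I.rho y \<in> A.off P" "x = herm (I.rho y)"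
    using I.rho_off[OF y] I.Psi_herm[OF y] x(2) by (simp_all add: inv)
  have "rho (I.rho y) = (1 - \<phi> P) * herm y * \<phi> P"
    unfolding rho_def b(2)[symmetric] x(1) ..
  also have "\<dots> = y"
    using B.offD[OF base_image(1) y] by (simp add: herm_def left_diff_distrib distrib_left distrib_right)
  finally show ?thesis
    using that b(1) by blast
qed

lemma rho_eqI:
  assumes "x \<in> A.off P" "y \<in> B.off (\<phi> P)" "\<And>a. a \<in> A.off P \<Longrightarrow> u (y * star (rho a)) = t (x * star a)"
  shows "rho x = y"
proof -
  have "rho x - y = 0"
  proof (rule B.off_eq_zero[OF base_image(1)])
    show d: "rho x - y \<in> B.off (\<phi> P)"
      by (intro B.off_diff rho_off assms)
    fix z assume "z \<in> B.off (\<phi> P)"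
    then obtain a where a: "a \<in> A.off P" "rho a = z"
      by (rule rho_surj)
    have "rho x \<in> N" "y \<in> N" "rho a \<in> N"
      using B.offD(1)[OF base_image(1)] rho_off assms(1,2) a(1) by blast+
    then have "u ((rho x - y) * star (rho a)) = 0"
      using rho_inner[OF assms(1) a(1)] assms(3)[OF a(1)] by (simp add: left_diff_distrib B.t_diff)
    then show "u ((rho x - y) * star z) = 0"
      using a(2) by simp
  qed
  then show ?thesis
    by simp
qed

text \<open>Commuting with \<open>P\<close> implies trace orthogonality to all
  \<open>herm b\<close>. \<open>Psi\<close> preserves this orthogonality, and
  \<open>commute_if_herm_orthogonal\<close> converts it back.\<close>

lemma Psi_commute:
  assumes D: "D \<in> span (A.Pc c)" "P * D = D * P"
  shows "\<phi> P * Psi D = Psi D * \<phi> P"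
proof (rule B.commute_if_herm_orthogonal[OF base_image])
  show "Psi D \<in> N" "star (Psi D) = Psi D"
    using span_B[OF Psi(1)[OF D(1)]] by simp_all
  fix y assume "y \<in> B.off (\<phi> P)"
  then obtain b where b: "b \<in> A.off P" "rho b = y"
    by (rule rho_surj)
  have "u (herm y * Psi D) = t (herm b * D)"
    using Psi_inner[OF herm_in_span[OF base b(1)] D(1)] by (simp add: Psi_herm b)
  also have "\<dots> = 0"
    using span_A[OF D(1)] by (intro A.t_herm_diag_zero[OF base_proj b(1)] D(2)) simp
  finally show "u (herm y * Psi D) = 0" .
qed

text \<open>Compares the second order expansions of projections near \<open>P\<close> and of their images near \<open>\<phi> P\<close>.\<close>

lemma curv_pairing_small:
  assumes b: "b \<in> A.off P" "norm b \<le> 1/2" and z: "corresponds z z'" "z \<in> M" "z' \<in> N"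
  shows "t (curv b * z) = u (curv (rho b) * z')"
proof -
  note bb = A.offD[OF base_proj(1) b(1)] and bb' = B.offD[OF base_image(1) rho_off[OF b(1)]]
  have hs: "herm b \<in> span (A.Pc c)"
    by (rule herm_in_span[OF base b(1)])
  define C where "C = 4 * (t (star b * b * (star b * b)) + t (b * star b * (b * star b)))"
  have "\<exists>f. \<forall>s. 0 < s \<and> s \<le> 1 \<longrightarrow>
      \<bar>f s - s\<^sup>2 * t (curv b * z)\<bar> \<le> (3 * norm z * C) * s ^ 4 \<and>
      \<bar>f s - s\<^sup>2 * u (curv (rho b) * z')\<bar> \<le> (3 * norm z' * C) * s ^ 4"
  proof (rule choice, rule allI)
    fix s :: real
    show "\<exists>y. 0 < s \<and> s \<le> 1 \<longrightarrow>
      \<bar>y - s\<^sup>2 * t (curv b * z)\<bar> \<le> (3 * norm z * C) * s ^ 4 \<and>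
      \<bar>y - s\<^sup>2 * u (curv (rho b) * z')\<bar> \<le> (3 * norm z' * C) * s ^ 4"
    proof (cases "0 < s \<and> s \<le> 1")
      case True
      then have s: "\<bar>s\<bar> \<le> 1"
        by simp
      obtain \<Delta> where D: "\<Delta> \<in> M" "star \<Delta> = \<Delta>" "P * \<Delta> = \<Delta> * P" "P + herm (s *\<^sub>R b) + \<Delta> \<in> A.Pc c"
        "t (\<Delta> * \<Delta>) \<le> C * s ^ 4"
        unfolding C_def by (rule small_perturbation[OF base b s])
      define R where "R = P + herm (s *\<^sub>R b) + \<Delta>"
      have sb: "s *\<^sub>R b \<in> A.off P"
        by (rule A.off_scaleR[OF b(1)])
      have De: "\<Delta> = R - P - herm (s *\<^sub>R b)"
        by (simp add: R_def)
      have sp: "R \<in> span (A.Pc c)" "P \<in> span (A.Pc c)" "herm (s *\<^sub>R b) \<in> span (A.Pc c)"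
        using span_base[OF D(4)] span_base[OF base] herm_in_span[OF base sb] by (simp_all only: R_def)
      have Ds: "\<Delta> \<in> span (A.Pc c)"
        unfolding De by (intro span_diff sp)
      define X where "X = Psi \<Delta>"
      have "X = Psi (R - P - herm (s *\<^sub>R b))"
        by (simp only: X_def De)
      also have "\<dots> = \<phi> R - \<phi> P - herm (rho (s *\<^sub>R b))"
        using sp Psi_phi[OF base] Psi_phi[OF D(4)] Psi_herm[OF sb] by (simp only: Psi_diff span_diff flip: R_def)
      finally have R': "\<phi> R = \<phi> P + herm (rho (s *\<^sub>R b)) + X"
        by simp
      have X: "X \<in> N" "star X = X" "\<phi> P * X = X * \<phi> P"
        using span_B[OF Psi(1)[OF Ds]] Psi_commute[OF Ds D(3)] by (simp_all add: X_def)
      have pr: "is_proj (P + herm (s *\<^sub>R b) + \<Delta>)" "is_proj (\<phi> P + herm (rho (s *\<^sub>R b)) + X)"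
        using A.PcD(2)[OF D(4)] B.PcD(2)[OF phi_Pc[OF D(4)]] by (simp_all only: R' flip: R_def)
      have "\<bar>t (\<Delta> * z) - t (curv (s *\<^sub>R b) * z)\<bar> \<le> 3 * norm z * t (\<Delta> * \<Delta>)"
        by (rule A.second_order[OF base_proj sb D(1,2,3) pr(1) z(2)])
      moreover have "\<bar>u (X * z') - u (curv (rho (s *\<^sub>R b)) * z')\<bar> \<le> 3 * norm z' * u (X * X)"
        by (rule B.second_order[OF base_image rho_off[OF sb] X(1,2,3) pr(2) z(3)])
      \<comment> \<open>One number with two expansions in \<open>s\<close>, whose quadratic
        coefficients must agree.\<close>
      moreover have "u (X * z') = t (\<Delta> * z)"
        using Psi_pairing[OF z Ds] A.t_comm[OF D(1) z(2)] B.t_comm[OF X(1) z(3)] by (simp add: X_def)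
      moreover have "u (X * X) = t (\<Delta> * \<Delta>)"
        unfolding X_def by (rule Psi_inner[OF Ds Ds])
      moreover have "t (curv (s *\<^sub>R b) * z) = s\<^sup>2 * t (curv b * z)"
        using bb z(2) by (simp add: curv_scaleR A.t_scaleR power2_eq_square)
      moreover have "u (curv (rho (s *\<^sub>R b)) * z') = s\<^sup>2 * u (curv (rho b) * z')"
        using bb' z(3) b(1) by (simp add: rho_scaleR curv_scaleR B.t_scaleR power2_eq_square)
      ultimately show ?thesis
        using mult_left_mono[OF D(5), of "3 * norm z"] mult_left_mono[OF D(5), of "3 * norm z'"]
        by (intro exI[of _ "t (\<Delta> * z)"]) (simp add: mult.assoc)
    qed auto
  qed
  then obtain f where f: "\<And>s. 0 < s \<Longrightarrow> s \<le> 1 \<Longrightarrow> \<bar>f s - s\<^sup>2 * t (curv b * z)\<bar> \<le> (3 * norm z * C) * s ^ 4"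
      "\<And>s. 0 < s \<Longrightarrow> s \<le> 1 \<Longrightarrow> \<bar>f s - s\<^sup>2 * u (curv (rho b) * z')\<bar> \<le> (3 * norm z' * C) * s ^ 4"
    by blast
  show ?thesis
    by (rule eq_of_quartic_approximation[OF f])
qed

lemma curv_pairing:
  assumes b: "b \<in> A.off P" and z: "corresponds z z'" "z \<in> M" "z' \<in> N"
  shows "t (curv b * z) = u (curv (rho b) * z')"
proof -
  obtain r where r: "r > 0" "norm (r *\<^sub>R b) \<le> 1/2"
    by (rule small_multiple)
  have "r * r * t (curv b * z) = r * r * u (curv (rho b) * z')"
    using curv_pairing_small[OF A.off_scaleR[OF b] r(2) z] A.offD(1)[OF base_proj(1) b]
      B.offD(1)[OF base_image(1) rho_off[OF b]] z b
    by (simp add: rho_scaleR curv_scaleR A.t_scaleR B.t_scaleR)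
  then show ?thesis
    using r(1) by simp
qed

text \<open>\<open>curv b\<close> is not shown to lie in the span, so \<open>Psi\<close> cannot be
  used for it. The correspondence is what \<open>curv_pairing\<close> requires of its second
  argument, which allows pairing two curvature terms in \<open>curv_curv\<close>.\<close>

lemma curv_corresponds: "b \<in> A.off P \<Longrightarrow> corresponds (curv b) (curv (rho b))"
  unfolding corresponds_def
proof
  fix Q assume b: "b \<in> A.off P" and Q: "Q \<in> A.Pc c"
  have "corresponds Q (\<phi> Q)"
    by (simp add: corresponds_def trace Q)
  then show "u (curv (rho b) * \<phi> Q) = t (curv b * Q)"
    using curv_pairing[OF b] A.PcD[OF Q] B.PcD[OF phi_Pc[OF Q]] by simp
qed

lemma curv_curv:
  assumes "a \<in> A.off P" "b \<in> A.off P"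
  shows "t (curv b * curv a) = u (curv (rho b) * curv (rho a))"
  using A.offD(1)[OF base_proj(1) assms(1)] B.offD(1)[OF base_image(1) rho_off[OF assms(1)]]
  by (intro curv_pairing[OF assms(2)] curv_corresponds[OF assms(1)]) simp_all

end

context fin_factor
begin

text \<open>Rewrites the pairing as a quadratic form in \<open>a\<close> for fixed \<open>b\<close>,
  ready for polarization.\<close>

lemma t_curv_curv:
  assumes "is_proj P" "a \<in> off P" "b \<in> off P"
  shows "t (curv b * curv a) = t ((b * star b * a + a * star b * b) * star a)"
proof -
  note a = offD[OF assms(1,2)] and b = offD[OF assms(1,3)]
  have ba': "star b * star a = 0"
    using assoc2[OF b(5), of "star a"] a(4) by simp
  have ba: "b * a = 0"
    using assoc2[OF b(3), of a] a(2) by simp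
  have "curv b * curv a = b * star b * a * star a + star b * b * star a * a"
    by (simp add: curv_def algebra_simps assoc2[OF ba] assoc2[OF ba'])
  moreover have "t (star b * b * star a * a) = t (a * star b * b * star a)"
    using t_comm[of "star b * b * star a" a] a b by (simp add: mult.assoc)
  ultimately show ?thesis
    using a b by (simp add: distrib_right t_add)
qed

text \<open>Twice the Jordan triple product of \<open>b\<close>, \<open>b\<close> and
  \<open>a\<close>.\<close>

definition sym_triple :: "'a cop \<Rightarrow> 'a cop \<Rightarrow> 'a cop" where
  "sym_triple b a = b * star b * a + a * star b * b"

lemma t_sym_triple_commute:
  assumes "a \<in> M" "b \<in> M" "e \<in> M"
  shows "t (sym_triple b e * star a) = t (sym_triple b a * star e)"
proof -
  have "t (b * star b * e * star a) = t (b * star b * a * star e)"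
    using t_star[of "b * star b * e * star a"] t_comm[of "a * star e" "b * star b"] assms
    by (simp add: mult.assoc)
  moreover have "t (e * star b * b * star a) = t (a * star b * b * star e)"
    using t_star[of "e * star b * b * star a"] assms by (simp add: mult.assoc)
  ultimately show ?thesis
    using assms by (simp add: sym_triple_def distrib_right t_add)
qed

end

context pointed_trace_isometry
begin

text \<open>Polarizes \<open>curv_curv\<close> in \<open>a\<close>; the form is symmetric by
  \<open>t_sym_triple_commute\<close>, so its diagonal values determine it.\<close>

lemma t_sym_triple:
  assumes "a \<in> A.off P" "b \<in> A.off P" "e \<in> A.off P"
  shows "u (B.sym_triple (rho b) (rho a) * star (rho e)) = t (A.sym_triple b a * star e)"
proof -
  have quad: "u (B.sym_triple (rho b) (rho a) * star (rho a)) = t (A.sym_triple b a * star a)" if "a \<in> A.off P" for a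
    using curv_curv[OF that assms(2)] A.t_curv_curv[OF base_proj(1) that assms(2)]
      B.t_curv_curv[OF base_image(1) rho_off[OF that] rho_off[OF assms(2)]]
    by (simp add: A.sym_triple_def B.sym_triple_def)
  have m: "a \<in> M" "b \<in> M" "e \<in> M" "rho a \<in> N" "rho b \<in> N" "rho e \<in> N"
    using A.offD(1)[OF base_proj(1)] B.offD(1)[OF base_image(1)] rho_off assms by blast+
  then have s: "A.sym_triple b x \<in> M" "B.sym_triple (rho b) y \<in> N" if "x \<in> M" "y \<in> N" for x y
    using that by (simp_all add: A.sym_triple_def B.sym_triple_def)
  have "A.sym_triple b (a + e) = A.sym_triple b a + A.sym_triple b e"
    "B.sym_triple (rho b) (rho (a + e)) = B.sym_triple (rho b) (rho a) + B.sym_triple (rho b) (rho e)"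
    using assms by (simp_all add: A.sym_triple_def B.sym_triple_def rho_add distrib_left distrib_right)
  then have "u (B.sym_triple (rho b) (rho e) * star (rho a)) + u (B.sym_triple (rho b) (rho a) * star (rho e))
      = t (A.sym_triple b e * star a) + t (A.sym_triple b a * star e)"
    using quad[OF assms(1)] quad[OF assms(3)] quad[OF A.off_add[OF assms(1,3)]] m s assms
    by (simp add: rho_add distrib_left distrib_right A.t_add B.t_add)
  then show ?thesis
    using A.t_sym_triple_commute[OF m(1,2,3)] B.t_sym_triple_commute[OF m(4,5,6)] by simp
qed

lemma rho_sym_triple:
  assumes "a \<in> A.off P" "b \<in> A.off P"
  shows "rho (A.sym_triple b a) = B.sym_triple (rho b) (rho a)"
proof (rule rho_eqI)
  show "A.sym_triple b a \<in> A.off P" "B.sym_triple (rho b) (rho a) \<in> B.off (\<phi> P)"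
    unfolding A.sym_triple_def B.sym_triple_def
    by (intro A.off_add A.off_triple B.off_add B.off_triple base_proj base_image rho_off assms)+
qed (rule t_sym_triple[OF assms])

lemma rho_triple:
  assumes a: "a \<in> A.off P" and b: "b \<in> A.off P"
  shows "rho (a * star b * a) = rho a * star (rho b) * rho a"
proof -
  note o = A.off_triple[OF base_proj(1)]
  \<comment> \<open>Replacing \<open>b\<close> by \<open>b + a\<close> isolates the product
    \<open>a * star b * a\<close> among the mixed terms.\<close>
  have "A.sym_triple (b + a) a = A.sym_triple b a + A.sym_triple a a + A.sym_triple a b + 2 *\<^sub>R (a * star b * a)"
    by (simp add: A.sym_triple_def algebra_simps scaleR_2)
  then have "rho (A.sym_triple (b + a) a) = rho (A.sym_triple b a) + rho (A.sym_triple a a) + rho (A.sym_triple a b) + 2 *\<^sub>R rho (a * star b * a)"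
    using a b by (simp add: rho_add rho_scaleR A.off_add A.off_scaleR o A.sym_triple_def)
  moreover have "B.sym_triple (rho b + rho a) (rho a) = B.sym_triple (rho b) (rho a) + B.sym_triple (rho a) (rho a) + B.sym_triple (rho a) (rho b) + 2 *\<^sub>R (rho a * star (rho b) * rho a)"
    by (simp add: B.sym_triple_def algebra_simps scaleR_2)
  ultimately have "2 *\<^sub>R rho (a * star b * a) = 2 *\<^sub>R (rho a * star (rho b) * rho a)"
    using a b by (simp add: rho_sym_triple A.off_add rho_add)
  then show ?thesis
    by simp
qed

end

section \<open>Jordan triple isomorphisms of corners\<close>

text \<open>A group is not the union of two proper subgroups: a sum of witnesses against the two
  alternatives satisfies neither.\<close>

lemma additive_dichotomy:
  fixes S :: "'a :: ab_group_add set"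
  assumes add: "\<And>x y. x \<in> S \<Longrightarrow> y \<in> S \<Longrightarrow> x + y \<in> S"
    and A: "\<And>x y. x \<in> S \<Longrightarrow> y \<in> S \<Longrightarrow> A x \<Longrightarrow> A y \<Longrightarrow> A (x - y)"
    and B: "\<And>x y. x \<in> S \<Longrightarrow> y \<in> S \<Longrightarrow> B x \<Longrightarrow> B y \<Longrightarrow> B (x - y)"
    and cover: "\<And>x. x \<in> S \<Longrightarrow> A x \<or> B x"
  shows "(\<forall>x\<in>S. A x) \<or> (\<forall>x\<in>S. B x)"
proof (rule ccontr)
  assume "\<not> ?thesis"
  then obtain a b where ab: "a \<in> S" "\<not> A a" "B a" "b \<in> S" "\<not> B b" "A b"
    using cover by blast
  have "a + b - b = a" "a + b - a = b"
    by simp_all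
  then show False
    using cover[OF add[OF ab(1,4)]] A[OF add[OF ab(1,4)] ab(4)] B[OF add[OF ab(1,4)] ab(1)] ab by auto
qed

lemma scalar_i_conj: "scalar \<i> * x * y * (scalar \<i> * z) = - (x * y * z)" for x :: "'c :: chilbert_space cop"
proof -
  have "y * (scalar \<i> * z) = scalar \<i> * (y * z)" "x * (scalar \<i> * (y * z)) = scalar \<i> * (x * (y * z))"
    by (rule scalar_left_commute)+
  then show ?thesis
    by (simp add: mult.assoc)
qed

context fin_factor
begin

text \<open>Moving \<open>x\<close> across \<open>y\<close> in two different ways shows that
  \<open>y * z * (x * w * x)\<close> equals its own negative; \<open>prime\<close> is then applied
  twice.\<close>

lemma anticommuting_eq_zero:
  assumes M: "x \<in> M" "y \<in> M" and anti: "\<And>z. z \<in> M \<Longrightarrow> x * z * y = - (y * z * x)"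
  shows "x = 0 \<or> y = 0"
proof -
  have "y * z * (x * w * x) = 0" if "z \<in> M" "w \<in> M" for z w
  proof -
    have "x * z * (y * w * x) = (x * z * y) * w * x"
      by (simp only: mult.assoc)
    also have "\<dots> = - (y * z * x) * w * x"
      by (simp only: anti[OF that(1)])
    finally have 1: "x * z * (y * w * x) = - (y * z * (x * w * x))"
      by (simp add: mult.assoc)
    have "y * w * x = - (x * w * y)"
      using anti[OF that(2)] by simp
    then have "x * z * (y * w * x) = - (x * (z * x * w) * y)"
      by (simp add: mult.assoc)
    also have "\<dots> = y * (z * x * w) * x"
      using that M by (subst anti) simp_all
    finally have "y * z * (x * w * x) = - (y * z * (x * w * x))"
      using 1 by (simp add: mult.assoc)
    then have "2 *\<^sub>R (y * z * (x * w * x)) = 0"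
      by (metis scaleR_2 right_minus)
    then show ?thesis
      by simp
  qed
  then have "y = 0 \<or> x * w * x = 0" if "w \<in> M" for w
    using that M prime[of y "x * w * x"] by simp
  then show ?thesis
    using prime[OF M(1,1)] by blast
qed

text \<open>Between elements of the corner only the part \<open>Q * z * (1 - Q)\<close> of
  \<open>z\<close> contributes, so testing with adjoints of corner elements is enough.\<close>

lemma off_anticommuting_eq_zero:
  assumes Q: "is_proj Q" "Q \<in> M" and xy: "x \<in> off Q" "y \<in> off Q"
    and anti: "\<And>z. z \<in> off Q \<Longrightarrow> x * star z * y = - (y * star z * x)"
  shows "x = 0 \<or> y = 0"
proof (rule anticommuting_eq_zero)
  note x = offD[OF Q(1) xy(1)] and y = offD[OF Q(1) xy(2)]
  show "x \<in> M" "y \<in> M"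
    by (fact x y)+
  fix z assume z: "z \<in> M"
  define v where "v = (1 - Q) * star z * Q"
  have "v \<in> off Q"
    unfolding v_def by (rule off_compress[OF Q star_closed[OF z]])
  moreover have "star v = Q * z * (1 - Q)"
    using Q(1) by (simp add: v_def is_proj_def mult.assoc)
  moreover have "x * (Q * z * (1 - Q)) * y = x * z * y" "y * (Q * z * (1 - Q)) * x = y * z * x"
    using x y by (simp_all add: left_diff_distrib right_diff_distrib mult.assoc assoc2[OF x(3)] assoc2[OF y(3)])
  ultimately show "x * z * y = - (y * z * x)"
    using anti[of v] by simp
qed

end

locale corner_map = A: fin_factor M t + B: fin_factor N u
  for M :: "'a :: chilbert_space cop set" and t and N :: "'b :: chilbert_space cop set" and u +
  fixes P :: "'a cop" and P' :: "'b cop" and \<rho> :: "'a cop \<Rightarrow> 'b cop"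
  assumes P: "is_proj P" "P \<in> M" and P': "is_proj P'" "P' \<in> N"
    and image: "\<rho> ` A.off P = B.off P'"
    and add: "a \<in> A.off P \<Longrightarrow> b \<in> A.off P \<Longrightarrow> \<rho> (a + b) = \<rho> a + \<rho> b"
    and scaleR: "a \<in> A.off P \<Longrightarrow> \<rho> (r *\<^sub>R a) = r *\<^sub>R \<rho> a"
    and inner: "a \<in> A.off P \<Longrightarrow> b \<in> A.off P \<Longrightarrow> u (\<rho> a * star (\<rho> b)) = t (a * star b)"
begin

lemma off: "a \<in> A.off P \<Longrightarrow> \<rho> a \<in> B.off P'"
  using image by blast

lemma diff: "a \<in> A.off P \<Longrightarrow> b \<in> A.off P \<Longrightarrow> \<rho> (a - b) = \<rho> a - \<rho> b"
  using add[of a "- 1 *\<^sub>R b"] scaleR[of b "- 1"] A.off_scaleR[of b P "- 1"] by simp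

lemma minus: "a \<in> A.off P \<Longrightarrow> \<rho> (- a) = - \<rho> a"
  using scaleR[of a "- 1"] by simp

lemma eq_zero:
  assumes "a \<in> A.off P" "\<rho> a = 0"
  shows "a = 0"
proof (rule A.off_eq_zero[OF P(1) assms(1)])
  fix b assume "b \<in> A.off P"
  then show "t (a * star b) = 0"
    using inner[OF assms(1), of b] assms(2) by simp
qed

lemma image_induct:
  assumes "y \<in> B.off P'" "\<And>a. a \<in> A.off P \<Longrightarrow> h (\<rho> a)"
  shows "h y"
proof -
  have "y \<in> \<rho> ` A.off P"
    by (simp add: image assms(1))
  then show ?thesis
    by (rule imageE) (simp add: assms(2))
qed

end

locale jordan_corner_map = corner_map M t N u P P' \<rho>
  for M :: "'a :: chilbert_space cop set" and t and N :: "'b :: chilbert_space cop set" and u P P' \<rho> +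
  assumes triple: "a \<in> A.off P \<Longrightarrow> b \<in> A.off P \<Longrightarrow> \<rho> (a * star b * a) = \<rho> a * star (\<rho> b) * \<rho> a"
begin

text \<open>The triple identity gives
  \<open>w * star y * w = - (\<rho> a * star y * \<rho> a)\<close> for
  \<open>w = \<rho> (scalar \<i> * a)\<close>. Hence \<open>w - scalar \<i> * \<rho> a\<close> and
  \<open>w + scalar \<i> * \<rho> a\<close> satisfy the hypothesis of
  \<open>off_anticommuting_eq_zero\<close>.\<close>

lemma scalar_i_cases:
  assumes a: "a \<in> A.off P"
  shows "\<rho> (scalar \<i> * a) = scalar \<i> * \<rho> a \<or> \<rho> (scalar \<i> * a) = scalar (- \<i>) * \<rho> a"
proof -
  define w where "w = \<rho> (scalar \<i> * a)"
  have ia: "scalar \<i> * a \<in> A.off P"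
    by (rule A.off_scalar[OF a])
  have wy: "w * star y * w = - (\<rho> a * star y * \<rho> a)" if "y \<in> B.off P'" for y
    using that
  proof (rule image_induct)
    fix b assume b: "b \<in> A.off P"
    show "w * star (\<rho> b) * w = - (\<rho> a * star (\<rho> b) * \<rho> a)"
      using triple[OF ia b] triple[OF a b] minus[OF A.off_triple[OF P(1) a b a]]
      by (simp only: w_def scalar_i_conj)
  qed
  have "w - scalar \<i> * \<rho> a = 0 \<or> w + scalar \<i> * \<rho> a = 0"
  proof (rule B.off_anticommuting_eq_zero[OF P'])
    show "w - scalar \<i> * \<rho> a \<in> B.off P'" "w + scalar \<i> * \<rho> a \<in> B.off P'"
      unfolding w_def by (intro B.off_diff B.off_add B.off_scalar off a ia)+
    fix y assume "y \<in> B.off P'"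
    note w = wy[OF this] scalar_i_conj[of "\<rho> a" "star y" "\<rho> a"]
    show "(w - scalar \<i> * \<rho> a) * star y * (w + scalar \<i> * \<rho> a) =
        - ((w + scalar \<i> * \<rho> a) * star y * (w - scalar \<i> * \<rho> a))"
      by (simp add: distrib_left distrib_right left_diff_distrib right_diff_distrib w)
  qed
  then show ?thesis
    by (auto simp: w_def scalar_minus add_eq_0_iff2)
qed

text \<open>By additivity the sign is the same for all \<open>a\<close>; it decides whether the map
  is complex-linear or antilinear.\<close>

lemma scalar_i:
  obtains \<epsilon> :: complex where "\<epsilon> = 1 \<or> \<epsilon> = - 1" "\<And>a. a \<in> A.off P \<Longrightarrow> \<rho> (scalar \<i> * a) = scalar (\<epsilon> * \<i>) * \<rho> a"
proof -
  have "(\<forall>a\<in>A.off P. \<rho> (scalar \<i> * a) = scalar \<i> * \<rho> a) \<or> (\<forall>a\<in>A.off P. \<rho> (scalar \<i> * a) = scalar (- \<i>) * \<rho> a)"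
    by (rule additive_dichotomy)
      (simp_all add: A.off_add scalar_i_cases right_diff_distrib diff A.off_scalar)
  then show ?thesis
    using that[of 1] that[of "- 1"] by auto
qed

lemma triple_add:
  assumes a: "a \<in> A.off P" and b: "b \<in> A.off P" and e: "e \<in> A.off P"
  shows "\<rho> (a * star b * e) + \<rho> (e * star b * a) = \<rho> a * star (\<rho> b) * \<rho> e + \<rho> e * star (\<rho> b) * \<rho> a"
proof -
  note o = A.off_triple[OF P(1)]
  have "(a + e) * star b * (a + e) = a * star b * a + e * star b * e + (a * star b * e + e * star b * a)"
    by (simp add: algebra_simps)
  then have "\<rho> ((a + e) * star b * (a + e)) = \<rho> (a * star b * a) + \<rho> (e * star b * e) + (\<rho> (a * star b * e) + \<rho> (e * star b * a))"
    using a b e by (simp add: add A.off_add o)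
  moreover have "(\<rho> a + \<rho> e) * star (\<rho> b) * (\<rho> a + \<rho> e) = \<rho> a * star (\<rho> b) * \<rho> a + \<rho> e * star (\<rho> b) * \<rho> e +
      (\<rho> a * star (\<rho> b) * \<rho> e + \<rho> e * star (\<rho> b) * \<rho> a)"
    by (simp add: algebra_simps)
  ultimately show ?thesis
    using a b e by (simp add: triple A.off_add add)
qed

text \<open>The outer product is a nest of products \<open>a * star z * a\<close>, each of which
  \<open>triple\<close> already handles.\<close>

lemma triple_outer:
  assumes a: "a \<in> A.off P" and b: "b \<in> A.off P" and e: "e \<in> A.off P" and x: "x \<in> A.off P"
  shows "\<rho> ((a * star b * e) * star x * (e * star b * a)) =
    (\<rho> a * star (\<rho> b) * \<rho> e) * star (\<rho> x) * (\<rho> e * star (\<rho> b) * \<rho> a)"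
proof -
  note o = A.off_triple[OF P(1)]
  define y where "y = e * star x * e"
  define z where "z = b * star y * b"
  have y: "y \<in> A.off P" "\<rho> y = \<rho> e * star (\<rho> x) * \<rho> e"
    using o[OF e x e] triple[OF e x] by (simp_all add: y_def)
  have z: "z \<in> A.off P" "\<rho> z = \<rho> b * star (\<rho> y) * \<rho> b"
    using o[OF b y(1) b] triple[OF b y(1)] by (simp_all add: z_def)
  have "(a * star b * e) * star x * (e * star b * a) = a * star z * a"
    by (simp add: y_def z_def mult.assoc)
  then show ?thesis
    using triple[OF a z(1)] by (simp add: y z mult.assoc)
qed

text \<open>
  Herstein's argument: the defects of \<open>\<rho>\<close> from being a homomorphism and from being an
  antihomomorphism of ternary rings annihilate each other.
\<close>

lemma ternary_cases:
  assumes a: "a \<in> A.off P" and b: "b \<in> A.off P" and e: "e \<in> A.off P"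
  shows "\<rho> (a * star b * e) = \<rho> a * star (\<rho> b) * \<rho> e \<or> \<rho> (a * star b * e) = \<rho> e * star (\<rho> b) * \<rho> a"
proof -
  note o = A.off_triple[OF P(1)] and o' = B.off_triple[OF P'(1)]
  define s where "s = \<rho> (a * star b * e)"
  define s' where "s' = \<rho> (e * star b * a)"
  define U where "U = \<rho> a * star (\<rho> b) * \<rho> e"
  define V where "V = \<rho> e * star (\<rho> b) * \<rho> a"
  have sum: "s' = U + V - s"
    using triple_add[OF a b e] by (simp add: s_def s'_def U_def V_def algebra_simps)
  have "s - U = 0 \<or> s - V = 0"
  proof (rule B.off_anticommuting_eq_zero[OF P'])
    show "s - U \<in> B.off P'" "s - V \<in> B.off P'"
      unfolding s_def U_def V_def by (intro B.off_diff off o o' a b e)+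
    fix y assume "y \<in> B.off P'"
    then show "(s - U) * star y * (s - V) = - ((s - V) * star y * (s - U))"
    proof (rule image_induct)
      fix x assume x: "x \<in> A.off P"
      have "s * star (\<rho> x) * s' + s' * star (\<rho> x) * s = U * star (\<rho> x) * V + V * star (\<rho> x) * U"
        using triple_add[OF o[OF a b e] x o[OF e b a]] triple_outer[OF a b e x] triple_outer[OF e b a x]
        by (simp add: s_def s'_def U_def V_def)
      then show "(s - U) * star (\<rho> x) * (s - V) = - ((s - V) * star (\<rho> x) * (s - U))"
        unfolding sum by (simp add: algebra_simps)
    qed
  qed
  then show ?thesis
    by (simp add: s_def U_def V_def)
qed

text \<open>\<open>additive_dichotomy\<close> is used once for each variable, making the choice in
  \<open>ternary_cases\<close> uniform first in \<open>e\<close>, then in \<open>b\<close>, then in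
  \<open>a\<close>.\<close>

lemma ternary:
  "(\<forall>a\<in>A.off P. \<forall>b\<in>A.off P. \<forall>e\<in>A.off P. \<rho> (a * star b * e) = \<rho> a * star (\<rho> b) * \<rho> e) \<or>
   (\<forall>a\<in>A.off P. \<forall>b\<in>A.off P. \<forall>e\<in>A.off P. \<rho> (a * star b * e) = \<rho> e * star (\<rho> b) * \<rho> a)"
proof -
  note o = A.off_triple[OF P(1)]
  have 1: "(\<forall>e\<in>A.off P. \<rho> (a * star b * e) = \<rho> a * star (\<rho> b) * \<rho> e) \<or>
      (\<forall>e\<in>A.off P. \<rho> (a * star b * e) = \<rho> e * star (\<rho> b) * \<rho> a)" if "a \<in> A.off P" "b \<in> A.off P" for a b
    by (rule additive_dichotomy) (simp_all add: A.off_add that ternary_cases right_diff_distrib left_diff_distrib diff o)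
  have 2: "(\<forall>b\<in>A.off P. \<forall>e\<in>A.off P. \<rho> (a * star b * e) = \<rho> a * star (\<rho> b) * \<rho> e) \<or>
      (\<forall>b\<in>A.off P. \<forall>e\<in>A.off P. \<rho> (a * star b * e) = \<rho> e * star (\<rho> b) * \<rho> a)" if "a \<in> A.off P" for a
    by (rule additive_dichotomy) (simp_all add: A.off_add that 1 right_diff_distrib left_diff_distrib diff o)
  show ?thesis
    by (rule additive_dichotomy) (simp_all add: A.off_add 2 right_diff_distrib left_diff_distrib diff o)
qed

end

sublocale pointed_trace_isometry \<subseteq> jordan_corner_map M t N u P "\<phi> P" rho
proof unfold_locales
  show "rho ` A.off P = B.off (\<phi> P)"
    using rho_off rho_surj by (metis image_eqI image_subsetI subsetI subset_antisym)
qed (rule base_proj base_image rho_add rho_scaleR rho_inner rho_triple; assumption)+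

section \<open>Extending ternary isomorphisms of corners to isomorphisms of factors\<close>

text \<open>\<open>w\<close> carries \<open>P\<close> into its complement, the \<open>v i\<close>
  decompose the complement into finitely many pieces subordinate to \<open>P\<close>, and
  \<open>\<epsilon>\<close> records linearity or antilinearity.\<close>

locale ternary_corner_map = corner_map M t N u P P' \<rho>
  for M :: "'a :: chilbert_space cop set" and t and N :: "'b :: chilbert_space cop set" and u P P' \<rho> +
  fixes w :: "'a cop" and n :: nat and v :: "nat \<Rightarrow> 'a cop" and \<epsilon> :: complex
  assumes nontrivial: "P \<noteq> 0"
    and ternary: "a \<in> A.off P \<Longrightarrow> b \<in> A.off P \<Longrightarrow> e \<in> A.off P \<Longrightarrow> \<rho> (a * star b * e) = \<rho> a * star (\<rho> b) * \<rho> e"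
    and scalar_i: "a \<in> A.off P \<Longrightarrow> \<rho> (scalar \<i> * a) = scalar (\<epsilon> * \<i>) * \<rho> a"
    and w: "w \<in> A.off P" "star w * w = P"
    and v: "v i \<in> A.off P" "(\<Sum>i<n. v i * star (v i)) = 1 - P"
begin

definition col :: "'a cop set" where
  "col = {z \<in> M. z * P = z}"

text \<open>The isomorphism of \<open>P M P\<close> onto \<open>P' N P'\<close> induced by
  \<open>\<rho>\<close>. Since \<open>w = w * P\<close>, the value depends only on
  \<open>P * y\<close>.\<close>

definition \<alpha> :: "'a cop \<Rightarrow> 'b cop" where
  "\<alpha> y = star (\<rho> w) * \<rho> (w * y)"

text \<open>
  \<open>ext\<close> extends \<open>\<rho>\<close> to \<open>MP\<close>: left multiplication by \<open>w\<close> moves the part of \<open>z\<close> in \<open>PMP\<close> to the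
  domain \<open>(1 - P)MP\<close> of \<open>\<rho>\<close>.
\<close>

definition ext :: "'a cop \<Rightarrow> 'b cop" where
  "ext z = \<alpha> (P * z) + \<rho> (z - P * z)"

definition frame :: "nat \<Rightarrow> 'a cop" where
  "frame k = (case k of 0 \<Rightarrow> P | Suc i \<Rightarrow> v i)"

text \<open>
  Left multiplication by \<open>x\<close> on \<open>MP\<close>, transported along \<open>ext\<close>; the finite frame shows that the result
  is left multiplication by an element of \<open>N\<close>.
\<close>

definition g :: "'a cop \<Rightarrow> 'b cop" where
  "g x = (\<Sum>k<Suc n. ext (x * frame k) * star (ext (frame k)))"

lemma PP: "P * P = P" "star P = P" "P' * P' = P'" "star P' = P'"
  using P P' by (simp_all add: is_proj_def)

lemma colD: "z \<in> col \<Longrightarrow> z \<in> M" "z \<in> col \<Longrightarrow> z * P = z"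
  by (simp_all add: col_def)

lemma off_iff: "a \<in> A.off P \<longleftrightarrow> a \<in> col \<and> P * a = 0"
  by (auto simp: col_def A.off_def)

lemma off_col: "a \<in> A.off P \<Longrightarrow> a \<in> col"
  by (simp add: off_iff)

lemma col_star: "P * star z = star z" "P * (star z * x) = star z * x" if "z \<in> col"
proof -
  show *: "P * star z = star z"
    using arg_cong[OF colD(2)[OF that], of star] by (simp add: PP)
  show "P * (star z * x) = star z * x"
    by (rule assoc2[OF *])
qed

lemma col_add: "y \<in> col \<Longrightarrow> z \<in> col \<Longrightarrow> y + z \<in> col"
  and col_scaleR: "z \<in> col \<Longrightarrow> r *\<^sub>R z \<in> col"
  and col_mult: "x \<in> M \<Longrightarrow> z \<in> col \<Longrightarrow> x * z \<in> col"
  and P_col: "P \<in> col"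
  using P by (auto simp: col_def distrib_right mult.assoc PP)

lemma off_mult_col: "a \<in> A.off P \<Longrightarrow> z \<in> col \<Longrightarrow> a * z \<in> A.off P"
  using A.offD[OF P(1)] by (simp add: off_iff col_mult assoc2[of P a 0])

lemma off_part: "z \<in> col \<Longrightarrow> z - P * z \<in> A.off P"
  using P by (simp add: off_iff col_def left_diff_distrib right_diff_distrib mult.assoc assoc2[OF PP(1)])

lemma frame: "frame k \<in> col"
  by (auto simp: frame_def P_col off_col v split: nat.split)

lemma sum_frame: "(\<Sum>k<Suc n. frame k * star (frame k)) = 1"
  unfolding sum.lessThan_Suc_shift by (simp add: frame_def PP v)

lemma col_sum: "z \<in> col \<Longrightarrow> (\<Sum>k<Suc n. x * frame k * (star (frame k) * z)) = x * z"
proof -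
  have "(\<Sum>k<Suc n. x * frame k * (star (frame k) * z)) = x * (\<Sum>k<Suc n. frame k * star (frame k)) * z"
    unfolding sum_distrib_left sum_distrib_right by (simp only: mult.assoc)
  then show ?thesis
    by (simp only: sum_frame mult_1_right)
qed

lemma rho_w: "\<rho> w \<in> B.off P'"
  by (rule off[OF w(1)])

lemma rho_in [simp]: "a \<in> A.off P \<Longrightarrow> \<rho> a \<in> N"
  using B.offD(1)[OF P'(1) off] by blast

lemma P'_nonzero: "P' \<noteq> 0" and P'_not_one: "P' \<noteq> 1"
proof -
  have "\<rho> w \<noteq> 0"
    using eq_zero[OF w(1)] w(2) nontrivial by auto
  then show "P' \<noteq> 0" "P' \<noteq> 1"
    using B.offD[OF P'(1) rho_w] by auto
qed

text \<open>The ternary law applied to \<open>a\<close>, \<open>w\<close>, \<open>w\<close> makes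
  \<open>star (\<rho> w) * \<rho> w\<close> a right unit for the corner of \<open>N\<close>, and
  \<open>prime\<close> identifies it with \<open>P'\<close>.\<close>

lemma rho_w_star: "star (\<rho> w) * \<rho> w = P'"
proof -
  define e where "e = star (\<rho> w) * \<rho> w"
  note rw = B.offD[OF P'(1) rho_w]
  have e: "e \<in> N" "P' * e = e"
    using rw by (simp_all add: e_def assoc2[OF rw(4)])
  have "y * e = y" if "y \<in> B.off P'" for y
    using that
  proof (rule image_induct)
    fix a assume a: "a \<in> A.off P"
    then show "\<rho> a * e = \<rho> a"
      using ternary[OF a w(1) w(1)] A.offD[OF P(1) a] by (simp add: e_def mult.assoc w(2))
  qed
  then have *: "(1 - P') * z * P' * e = (1 - P') * z * P'" if "z \<in> N" for z
    using B.off_compress[OF P' that] by blast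
  have "(1 - P') * z * (P' - e) = 0" if "z \<in> N" for z
  proof -
    have "(1 - P') * z * e = (1 - P') * z * P' * e"
      by (simp only: mult.assoc e(2))
    then show ?thesis
      unfolding right_diff_distrib[of "(1 - P') * z"] by (simp only: *[OF that] diff_self)
  qed
  then have "1 - P' = 0 \<or> P' - e = 0"
    using e P' by (intro B.prime) simp_all
  then show ?thesis
    using P'_not_one by (auto simp: e_def)
qed

lemma alpha_star_mult: "a \<in> A.off P \<Longrightarrow> b \<in> A.off P \<Longrightarrow> \<alpha> (star a * b) = star (\<rho> a) * \<rho> b"
proof -
  assume a: "a \<in> A.off P" and b: "b \<in> A.off P"
  have "\<alpha> (star a * b) = star (\<rho> w) * \<rho> w * (star (\<rho> a) * \<rho> b)"
    using ternary[OF w(1) a b] by (simp add: \<alpha>_def mult.assoc)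
  then show ?thesis
    using B.offD[OF P'(1) off[OF a]] by (simp add: rho_w_star assoc2)
qed

lemma corner: "y \<in> col \<Longrightarrow> star w * (w * y) = P * y"
  using w(2) by (simp flip: mult.assoc)

lemma w_P: "w * P = w"
  using A.offD[OF P(1) w(1)] by simp

lemma rho_mult: "a \<in> A.off P \<Longrightarrow> y \<in> col \<Longrightarrow> \<rho> (a * y) = \<rho> a * \<alpha> y"
proof -
  assume a: "a \<in> A.off P" and y: "y \<in> col"
  have "a * y = a * star w * (w * y)"
    using A.offD(3)[OF P(1) a] by (simp add: mult.assoc corner[OF y] assoc2)
  then show ?thesis
    using ternary[OF a w(1) off_mult_col[OF w(1) y]] by (simp add: \<alpha>_def mult.assoc)
qed

lemma alpha_col: "y \<in> col \<Longrightarrow> \<alpha> y \<in> N" "y \<in> col \<Longrightarrow> P' * \<alpha> y = \<alpha> y" "y \<in> col \<Longrightarrow> \<alpha> y * P' = \<alpha> y"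
  using B.offD[OF P'(1) rho_w] B.offD[OF P'(1) off[OF off_mult_col[OF w(1)]]]
  by (simp_all add: \<alpha>_def mult.assoc off_mult_col w assoc2[OF B.offD(4)[OF P'(1) rho_w]])

lemma alpha_mult: "y \<in> col \<Longrightarrow> z \<in> col \<Longrightarrow> \<alpha> (y * z) = \<alpha> y * \<alpha> z" if "P * y = y"
  using rho_mult[OF off_mult_col[OF w(1)]] by (simp add: \<alpha>_def mult.assoc)

lemma alpha_add: "y \<in> col \<Longrightarrow> z \<in> col \<Longrightarrow> \<alpha> (y + z) = \<alpha> y + \<alpha> z"
  by (simp add: \<alpha>_def distrib_left add off_mult_col w)

lemma alpha_scaleR: "y \<in> col \<Longrightarrow> \<alpha> (r *\<^sub>R y) = r *\<^sub>R \<alpha> y"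
  by (simp add: \<alpha>_def scaleR off_mult_col w)

lemma alpha_scalar_i: "y \<in> col \<Longrightarrow> \<alpha> (scalar \<i> * y) = scalar (\<epsilon> * \<i>) * \<alpha> y"
  using scalar_i[OF off_mult_col[OF w(1)], of y] scalar_left_commute[of w \<i> y] scalar_left_commute[of "star (\<rho> w)" "\<epsilon> * \<i>"]
  by (simp add: \<alpha>_def)

lemma alpha_P: "\<alpha> P = P'"
  by (simp add: \<alpha>_def w_P rho_w_star)

lemma ext_in: "z \<in> col \<Longrightarrow> ext z \<in> N"
  by (simp add: ext_def alpha_col col_mult P off_part)

lemma ext_right: "z \<in> col \<Longrightarrow> ext z * P' = ext z"
  using B.offD[OF P'(1) off[OF off_part]] by (simp add: ext_def alpha_col col_mult P distrib_right)

lemma ext_off: "b \<in> A.off P \<Longrightarrow> ext b = \<rho> b"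
  using off_iff[of b] alpha_scaleR[of b 0] by (simp add: ext_def)

lemma ext_P: "ext P = P'"
  using scaleR[OF w(1), of 0] by (simp add: ext_def PP alpha_P)

lemma ext_add: "y \<in> col \<Longrightarrow> z \<in> col \<Longrightarrow> ext (y + z) = ext y + ext z"
  using add[OF off_part off_part, of y z]
  by (simp add: ext_def distrib_left alpha_add col_mult P algebra_simps)

lemma ext_scaleR: "z \<in> col \<Longrightarrow> ext (r *\<^sub>R z) = r *\<^sub>R ext z"
  using scaleR[OF off_part, of z r]
  by (simp add: ext_def alpha_scaleR col_mult P algebra_simps)

lemma ext_scalar_i: "z \<in> col \<Longrightarrow> ext (scalar \<i> * z) = scalar (\<epsilon> * \<i>) * ext z"
  using scalar_i[OF off_part, of z] alpha_scalar_i[of "P * z"] scalar_left_commute[of P \<i> z]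
  by (simp add: ext_def col_mult P right_diff_distrib distrib_left)

lemma alpha_corner_star:
  assumes y: "y \<in> col" "P * y = y" and z: "z \<in> col"
  shows "\<alpha> (star y * z) = star (\<alpha> y) * \<alpha> z"
proof -
  have "\<alpha> (star y * z) = \<alpha> (star (w * y) * (w * z))"
    using y by (simp add: mult.assoc assoc2[OF w(2)]) (metis PP(2) mult.assoc star_mult)
  also have "\<dots> = star (\<rho> w * \<alpha> y) * (\<rho> w * \<alpha> z)"
    using alpha_star_mult[OF off_mult_col[OF w(1) y(1)] off_mult_col[OF w(1) z]]
    by (simp add: rho_mult w y z)
  also have "\<dots> = star (\<alpha> y) * \<alpha> z"
    using alpha_col[OF z] by (simp add: mult.assoc assoc2[OF rho_w_star])
  finally show ?thesis .
qed

text \<open>\<open>M P\<close> is a right module with inner product \<open>star y * z\<close> in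
  \<open>P M P\<close>; along \<open>\<alpha>\<close> the map \<open>ext\<close> is a unitary of
  such modules.\<close>

lemma ext_inner:
  assumes y: "y \<in> col" and z: "z \<in> col"
  shows "star (ext y) * ext z = \<alpha> (star y * z)"
proof -
  note oy = off_part[OF y] and oz = off_part[OF z]
  note ry = B.offD[OF P'(1) off[OF oy]] and rz = B.offD[OF P'(1) off[OF oz]]
  have c: "P * y \<in> col" "P * z \<in> col" "star y * z \<in> col" "star (P * y) * (P * z) \<in> col" "star (y - P * y) * (z - P * z) \<in> col"
    using colD(1)[OF y] by (simp_all add: col_mult y z off_col[OF oz] P)
  have a: "P' * \<alpha> (P * z) = \<alpha> (P * z)" "star (\<alpha> (P * y)) * P' = star (\<alpha> (P * y))"
    using alpha_col[OF c(2)] arg_cong[OF alpha_col(2)[OF c(1)], of star] by (simp_all add: PP)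
  have "star (\<alpha> (P * y)) * \<rho> (z - P * z) = 0" "star (\<rho> (y - P * y)) * \<alpha> (P * z) = 0"
    using absorb_left[OF a(1) ry(5)] absorb_right[OF a(2) rz(2)] by simp_all
  then have "star (ext y) * ext z = star (\<alpha> (P * y)) * \<alpha> (P * z) + star (\<rho> (y - P * y)) * \<rho> (z - P * z)"
    by (simp add: ext_def distrib_left distrib_right)
  also have "\<dots> = \<alpha> (star (P * y) * (P * z) + star (y - P * y) * (z - P * z))"
    using c by (simp only: alpha_add alpha_corner_star[OF c(1) assoc2[OF PP(1)] c(2)] alpha_star_mult[OF oy oz])
  also have "star (P * y) * (P * z) + star (y - P * y) * (z - P * z) = star y * z"
    by (simp add: algebra_simps PP assoc2[OF PP(1)])
  finally show ?thesis .
qed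

lemma ext_mult: "y \<in> col \<Longrightarrow> z \<in> col \<Longrightarrow> P * z = z \<Longrightarrow> ext (y * z) = ext y * \<alpha> z"
  using rho_mult[OF off_part, of y z] alpha_mult[of "P * y" z]
  by (simp add: ext_def col_mult P colD PP assoc2[OF PP(1)] mult.assoc distrib_right left_diff_distrib)

lemma ext_eq_zero:
  assumes "z \<in> col" "ext z = 0"
  shows "z = 0"
proof -
  have zz: "star z * z \<in> col"
    using colD[OF assms(1)] by (simp add: col_mult assms(1))
  have "\<rho> (w * (star z * z)) = \<rho> w * (star (ext z) * ext z)"
    using rho_mult[OF w(1) zz] ext_inner[OF assms(1,1)] by simp
  then have "w * (star z * z) = 0"
    using assms(2) eq_zero[OF off_mult_col[OF w(1) zz]] by simp
  then have "P * (star z * z) = 0"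
    using corner[OF zz] by simp
  then have "star z * z = 0"
    by (simp add: col_star[OF assms(1)])
  then show ?thesis
    by (rule star_mult_self_eq_zero)
qed

lemma ext_surj:
  assumes "y \<in> N" "y * P' = y"
  obtains z where "z \<in> col" "ext z = y"
proof -
  have "y - P' * y \<in> B.off P'"
    using assms P' by (simp add: B.off_def left_diff_distrib right_diff_distrib mult.assoc assoc2[OF PP(3)])
  moreover have "\<rho> w * y \<in> B.off P'" 
    using assms B.offD[OF P'(1) rho_w] by (simp add: B.off_def mult.assoc assoc2[of P' "\<rho> w" 0])
  ultimately obtain b d where bd: "b \<in> A.off P" "\<rho> b = y - P' * y" "d \<in> A.off P" "\<rho> d = \<rho> w * y"
    using image by (metis imageE)
  note dd = A.offD[OF P(1) bd(3)] and ww = A.offD[OF P(1) w(1)]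
  have c: "star w * d \<in> col" "b \<in> col"
    using ww by (simp_all add: col_mult off_col bd)
  have "P * (star w * d) = star w * d"
    using ww by (simp add: assoc2)
  then have "ext (star w * d) = \<alpha> (star w * d)"
    using scaleR[OF w(1), of 0] by (simp add: ext_def)
  also have "\<dots> = P' * y"
    unfolding alpha_star_mult[OF w(1) bd(3)] bd(4) by (rule assoc2[OF rho_w_star])
  finally have "ext (star w * d + b) = y"
    using c by (simp add: ext_add ext_off bd)
  then show ?thesis
    using that col_add[OF c] by blast
qed

lemma g_in: "x \<in> M \<Longrightarrow> g x \<in> N"
  unfolding g_def by (intro B.sum_closed B.mult_closed B.star_closed ext_in col_mult frame)

lemma g_ext:
  assumes "x \<in> M" "z \<in> col"
  shows "g x * ext z = ext (x * z)"
proof -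
  have sz: "star (frame k) * z \<in> col" for k
    using frame colD by (intro col_mult assms(2)) simp
  have ext_sum: "ext (\<Sum>k\<in>K. f k) = (\<Sum>k\<in>K. ext (f k))" if "finite K" "\<And>k. f k \<in> col" for f and K :: "nat set"
    using that
  proof (induction rule: finite_induct)
    case empty
    show ?case
      using ext_scaleR[OF P_col, of 0] by simp
  next
    case (insert k K)
    have "sum f K \<in> col"
      using insert(1,4) by (induction rule: finite_induct) (auto simp: col_add col_scaleR[OF P_col, of 0, simplified])
    then show ?case
      using insert by (simp add: ext_add)
  qed
  have "g x * ext z = (\<Sum>k<Suc n. ext (x * frame k) * (star (ext (frame k)) * ext z))"
    unfolding g_def sum_distrib_right by (simp only: mult.assoc)
  also have "\<dots> = (\<Sum>k<Suc n. ext (x * frame k * (star (frame k) * z)))"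
  proof (rule sum.cong)
    fix k
    have "P * (star (frame k) * z) = star (frame k) * z"
      by (rule col_star[OF frame])
    then show "ext (x * frame k) * (star (ext (frame k)) * ext z) = ext (x * frame k * (star (frame k) * z))"
      using ext_mult[OF col_mult[OF assms(1) frame] sz] ext_inner[OF frame assms(2)] by simp
  qed simp
  also have "\<dots> = ext (x * z)"
    using ext_sum[of "{..<Suc n}" "\<lambda>k. x * frame k * (star (frame k) * z)"] col_sum[OF assms(2)]
      colD(1)[OF frame] assms(1) sz by (simp add: col_mult)
  finally show ?thesis .
qed

lemma eq_zero_if_ext:
  assumes "X \<in> N" "\<And>z. z \<in> col \<Longrightarrow> X * ext z = 0"
  shows "X = 0"
proof -
  have "X * y * P' = 0" if "y \<in> N" for y
  proof -
    have "y * P' \<in> N" "y * P' * P' = y * P'"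
      using P' that by (simp_all add: mult.assoc PP)
    then obtain z where "z \<in> col" "ext z = y * P'"
      by (rule ext_surj)
    then show ?thesis
      using assms(2)[of z] by (simp add: mult.assoc)
  qed
  then show ?thesis
    using B.prime[OF assms(1) P'(2)] P'_nonzero by blast
qed

text \<open>An element of \<open>N\<close> is determined by its left action on the range of
  \<open>ext\<close>, so every law for \<open>g\<close> can be checked there.\<close>

lemma g_eqI:
  assumes "X \<in> N" "x \<in> M" "\<And>z. z \<in> col \<Longrightarrow> X * ext z = ext (x * z)"
  shows "g x = X"
proof -
  have "g x - X = 0"
  proof (rule eq_zero_if_ext)
    show "g x - X \<in> N"
      by (intro B.diff_closed g_in assms)
    fix z assume "z \<in> col"
    then show "(g x - X) * ext z = 0"
      unfolding left_diff_distrib by (simp only: assms(3) g_ext[OF assms(2)] diff_self)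
  qed
  then show ?thesis
    by simp
qed

lemma g_add: "x \<in> M \<Longrightarrow> y \<in> M \<Longrightarrow> g (x + y) = g x + g y"
  by (rule g_eqI) (simp_all add: g_in distrib_right g_ext ext_add col_mult)

lemma g_scaleR: "x \<in> M \<Longrightarrow> g (r *\<^sub>R x) = r *\<^sub>R g x"
  by (rule g_eqI) (simp_all add: g_in g_ext ext_scaleR col_mult)

lemma g_mult: "x \<in> M \<Longrightarrow> y \<in> M \<Longrightarrow> g (x * y) = g x * g y"
  by (rule g_eqI) (simp_all add: g_in mult.assoc g_ext col_mult)

lemma g_scalar_i: "x \<in> M \<Longrightarrow> g (scalar \<i> * x) = scalar (\<epsilon> * \<i>) * g x"
  by (rule g_eqI) (simp_all add: g_in mult.assoc g_ext col_mult ext_scalar_i)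

lemma g_ext_mult:
  assumes "y \<in> col" "z \<in> col"
  shows "g (y * star z) = ext y * star (ext z)"
proof (rule g_eqI)
  fix z' assume z': "z' \<in> col"
  have "P * (star z * z') = star z * z'" "star z * z' \<in> col"
    using colD(1)[OF assms(2)] by (simp_all add: col_star assms(2) col_mult z')
  from ext_mult[OF assms(1) this(2,1)] show "ext y * star (ext z) * ext z' = ext (y * star z * z')"
    using ext_inner[OF assms(2) z'] by (simp add: mult.assoc)
qed (use assms ext_in colD in auto)

lemma g_star:
  assumes "x \<in> M"
  shows "g (star x) = star (g x)"
proof -
  have "star (ext y) * (star (g (star x)) - g x) = 0" if "y \<in> col" for y
  proof (rule eq_zero_if_ext)
    fix z assume z: "z \<in> col"
    have "star (ext y) * (star (g (star x)) - g x) * ext z = star (g (star x) * ext y) * ext z - star (ext y) * (g x * ext z)"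
      by (simp add: left_diff_distrib right_diff_distrib mult.assoc)
    also have "\<dots> = \<alpha> (star (star x * y) * z) - \<alpha> (star y * (x * z))"
      by (simp only: g_ext[OF A.star_closed[OF assms] that] g_ext[OF assms z]
          ext_inner[OF col_mult[OF A.star_closed[OF assms] that] z] ext_inner[OF that col_mult[OF assms z]])
    finally show "star (ext y) * (star (g (star x)) - g x) * ext z = 0"
      by (simp add: mult.assoc)
  qed (use assms that ext_in g_in in simp)
  then have "star (star (ext y) * (star (g (star x)) - g x)) = 0" if "y \<in> col" for y
    using that by simp
  then have "(g (star x) - star (g x)) * ext y = 0" if "y \<in> col" for y
    using that by simp
  then show ?thesis
    using eq_zero_if_ext[of "g (star x) - star (g x)"] g_in assms by simp
qed

lemma g_off: "b \<in> A.off P \<Longrightarrow> g b = \<rho> b"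
  using g_ext_mult[OF off_col P_col, of b] A.offD[OF P(1), of b] B.offD[OF P'(1) off, of b]
  by (simp add: PP ext_off ext_P)

lemma g_one: "g 1 = 1"
  by (rule g_eqI) simp_all

lemma g_eq_zero:
  assumes "x \<in> M" "g x = 0"
  shows "x = 0"
proof -
  have "x * y * P = 0" if "y \<in> M" for y
    using assms that P g_ext[OF assms(1), of "y * P"] col_mult[OF that P_col]
    by (simp add: mult.assoc ext_eq_zero col_mult)
  then show ?thesis
    using A.prime[OF assms(1) P(2)] nontrivial by blast
qed

lemma g_bij: "bij_betw g M N"
  unfolding bij_betw_def
proof
  have sub: "g (x - y) = g x - g y" if "x \<in> M" "y \<in> M" for x y
    using g_add[of x "- 1 *\<^sub>R y"] g_scaleR[of y "- 1"] that by simp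
  show "inj_on g M"
    by (rule inj_onI) (use g_eq_zero sub in \<open>metis A.diff_closed right_minus_eq\<close>)
  show "g ` M = N"
  proof (intro equalityI subsetI)
    fix y assume y: "y \<in> N"
    have "\<exists>z. z \<in> col \<and> ext z = y * ext (frame k)" for k
      using ext_surj[of "y * ext (frame k)"] ext_right[OF frame] ext_in[OF frame] y
      by (metis B.mult_closed mult.assoc)
    then obtain z where z: "\<And>k. z k \<in> col" "\<And>k. ext (z k) = y * ext (frame k)"
      by metis
    have gs: "g (\<Sum>k\<in>K. z k * star (frame k)) = (\<Sum>k\<in>K. ext (z k) * star (ext (frame k)))" if "finite K" for K
      using that
    proof (induction rule: finite_induct)
      case empty
      show ?case
        using g_scaleR[of 0 0] by simp
    next
      case (insert k K)
      then show ?case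
        using z(1) frame colD(1) by (simp add: g_add g_ext_mult)
    qed
    \<comment> \<open>Expanding \<open>g 1\<close> over the frame writes \<open>y\<close> as a
      finite sum of products \<open>ext z * star (ext z')\<close>, each in the range of
      \<open>g\<close>.\<close>
    have "y = y * g 1"
      by (simp add: g_one)
    also have "\<dots> = (\<Sum>k<Suc n. ext (z k) * star (ext (frame k)))"
      unfolding g_def sum_distrib_left by (simp add: z mult.assoc)
    also have "\<dots> = g (\<Sum>k<Suc n. z k * star (frame k))"
      by (rule gs[symmetric]) simp
    finally show "y \<in> g ` M"
      using z(1) frame colD(1) by (intro image_eqI[of _ _ "\<Sum>k<Suc n. z k * star (frame k)"] A.sum_closed) simp_all
  qed (use g_in in blast)
qed

lemma u_alpha:
  assumes y: "y \<in> col" "P * y = y"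
  shows "u (\<alpha> y) = t y"
proof -
  note o = off_mult_col[OF w(1) y(1)]
  have m: "w \<in> M" "y \<in> M"
    using A.offD[OF P(1) w(1)] colD[OF y(1)] by simp_all
  have "u (\<alpha> y) = u (\<rho> (w * y) * star (\<rho> w))"
    unfolding \<alpha>_def using o w by (intro B.t_comm) simp_all
  also have "\<dots> = t (w * y * star w)"
    by (rule inner[OF o w(1)])
  also have "\<dots> = t (star w * (w * y))"
    using m by (intro A.t_comm) simp_all
  finally show ?thesis
    by (simp add: corner y)
qed

text \<open>Trace preservation passes from \<open>\<rho>\<close> to \<open>\<alpha>\<close> and
  through the frame to \<open>g\<close>. It is what evaluates the scalar in the comparison of
  \<open>\<phi> Q\<close> with \<open>g Q\<close>.\<close>

lemma u_g:
  assumes "x \<in> M"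
  shows "u (g x) = t x"
proof -
  have f: "frame k \<in> M" "ext (frame k) \<in> N" "ext (x * frame k) \<in> N" for k
    using frame colD ext_in col_mult[OF assms frame] by simp_all
  have "u (ext (x * frame k) * star (ext (frame k))) = t (x * (frame k * star (frame k)))" for k
  proof -
    have "u (ext (x * frame k) * star (ext (frame k))) = u (star (ext (frame k)) * ext (x * frame k))"
      using f by (intro B.t_comm) simp_all
    also have "\<dots> = t (star (frame k) * (x * frame k))"
    proof -
      have "P * (star (frame k) * (x * frame k)) = star (frame k) * (x * frame k)"
        by (rule col_star[OF frame])
      then show ?thesis
        unfolding ext_inner[OF frame col_mult[OF assms frame]] using f assms frame by (intro u_alpha col_mult) simp_all
    qed
    also have "\<dots> = t (x * frame k * star (frame k))"
      using f assms by (intro A.t_comm) simp_all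
    finally show ?thesis
      by (simp add: mult.assoc)
  qed
  then have "(\<Sum>k<Suc n. u (ext (x * frame k) * star (ext (frame k)))) = (\<Sum>k<Suc n. t (x * (frame k * star (frame k))))"
    by (simp only:)
  moreover have "u (g x) = (\<Sum>k<Suc n. u (ext (x * frame k) * star (ext (frame k))))"
    unfolding g_def by (intro B.t_sum) (simp add: f)
  moreover have "t (\<Sum>k<Suc n. x * (frame k * star (frame k))) = (\<Sum>k<Suc n. t (x * (frame k * star (frame k))))"
    by (intro A.t_sum) (simp add: f assms)
  ultimately have "u (g x) = t (\<Sum>k<Suc n. x * (frame k * star (frame k)))"
    by (simp only:)
  also have "(\<Sum>k<Suc n. x * (frame k * star (frame k))) = x"
    unfolding sum_distrib_left[symmetric] sum_frame by simp
  finally show ?thesis .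
qed

end

section \<open>Trace preserving bijections between projections extend to factors\<close>

definition cop_iso :: "'a :: chilbert_space cop set \<Rightarrow> 'b :: chilbert_space cop set \<Rightarrow> ('a cop \<Rightarrow> 'b cop) \<Rightarrow> bool" where
  "cop_iso M N f \<longleftrightarrow> bij_betw f M N \<and>
    (\<forall>x\<in>M. \<forall>y\<in>M. f (x + y) = f x + f y) \<and> (\<forall>z. \<forall>x\<in>M. f (scalar z * x) = scalar z * f x) \<and>
    (\<forall>x\<in>M. f (star x) = star (f x)) \<and>
    ((\<forall>x\<in>M. \<forall>y\<in>M. f (x * y) = f x * f y) \<or> (\<forall>x\<in>M. \<forall>y\<in>M. f (x * y) = f y * f x))"

lemma scalar_decompose: "scalar z * x = Re z *\<^sub>R x + Im z *\<^sub>R (scalar \<i> * x)"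
proof -
  have "scalar (a + b) = scalar a + scalar b" for a b
    by (rule cop_eqI) (simp add: scaleC_add_left)
  moreover have "z = complex_of_real (Re z) + complex_of_real (Im z) * \<i>"
    by (simp add: complex_eq_iff)
  ultimately have "scalar z * x = (scalar (complex_of_real (Re z)) + scalar (complex_of_real (Im z) * \<i>)) * x"
    by metis
  also have "\<dots> = Re z *\<^sub>R x + Im z *\<^sub>R (scalar \<i> * x)"
    by (simp add: scaleR_eq_scalar distrib_right)
  finally show ?thesis .
qed

context ternary_corner_map
begin

text \<open>For \<open>\<epsilon> = - 1\<close> the map \<open>g\<close> is antilinear and
  multiplicative. Composed with \<open>star\<close> it becomes linear and antimultiplicative, with
  the same values at self-adjoint elements and in particular at projections.\<close>

lemma exists_cop_iso:
  assumes eps: "\<epsilon> = 1 \<or> \<epsilon> = - 1"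
  obtains f where "cop_iso M N f" "\<And>x. x \<in> M \<Longrightarrow> star x = x \<Longrightarrow> f x = g x"
proof (cases "\<epsilon> = 1")
  case True
  have "g (scalar z * x) = scalar z * g x" if "x \<in> M" for z x
    unfolding scalar_decompose[of z] using that True
    by (simp add: g_add g_scaleR g_scalar_i)
  then have "cop_iso M N g"
    using g_bij by (simp add: cop_iso_def g_add g_star g_mult)
  then show ?thesis
    using that by blast
next
  case False
  with eps have eps: "\<epsilon> = - 1"
    by simp
  have "g (scalar z * x) = scalar (cnj z) * g x" if "x \<in> M" for z x
    unfolding scalar_decompose[of z] scalar_decompose[of "cnj z"] using that eps
    by (simp add: g_add g_scaleR g_scalar_i scalar_minus)
  then have "star (g (scalar z * x)) = scalar z * star (g x)" if "x \<in> M" for z x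
    using that by (simp add: scalar_commute)
  moreover have "bij_betw star N N"
    by (rule bij_betw_byWitness[of _ star]) auto
  then have "bij_betw (\<lambda>x. star (g x)) M N"
    using bij_betw_trans[OF g_bij, of star] by (simp add: comp_def)
  ultimately have "cop_iso M N (\<lambda>x. star (g x))"
    by (simp add: cop_iso_def g_add g_star g_mult)
  moreover have "star (g x) = g x" if "x \<in> M" "star x = x" for x
    using g_star[OF that(1)] that(2) by simp
  ultimately show ?thesis
    using that by blast
qed

lemma g_herm: "b \<in> A.off P \<Longrightarrow> g (herm b) = herm (\<rho> b)"
  and g_curv: "b \<in> A.off P \<Longrightarrow> g (curv b) = curv (\<rho> b)"
proof -
  have diff: "g (x - y) = g x - g y" if "x \<in> M" "y \<in> M" for x y
    using g_add[of x "- 1 *\<^sub>R y"] g_scaleR[of y "- 1"] that by simp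
  assume b: "b \<in> A.off P"
  then have "b \<in> M"
    using A.offD[OF P(1)] by blast
  then show "g (herm b) = herm (\<rho> b)" "g (curv b) = curv (\<rho> b)"
    using b by (simp_all add: herm_def curv_def g_add diff g_mult g_star g_off)
qed

end

context fin_factor
begin

text \<open>Orthogonality to \<open>herm y\<close> makes \<open>X\<close> commute with
  \<open>Q\<close>; polarized orthogonality to \<open>curv y\<close> makes it commute with the
  off-diagonal corner. By \<open>prime\<close> it then commutes with both diagonal corners, hence
  with the factor.\<close>

lemma scalar_if_orthogonal:
  assumes Q: "is_proj Q" "Q \<in> M" "Q \<noteq> 0" "Q \<noteq> 1" and X: "X \<in> M" "star X = X"
    and herm: "\<And>y. y \<in> off Q \<Longrightarrow> t (herm y * X) = 0"
    and curv: "\<And>y. y \<in> off Q \<Longrightarrow> t (curv y * X) = 0"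
  obtains r where "X = r *\<^sub>R 1"
proof -
  have pp: "Q * Q = Q" "star Q = Q"
    using Q by (simp_all add: is_proj_def)
  have QX: "Q * X = X * Q"
    by (rule commute_if_herm_orthogonal[OF Q(1,2) X herm])
  have yX: "X * y = y * X" if y: "y \<in> off Q" for y
  proof -
    have y': "y \<in> M" "Q * y = 0" "y * Q = y"
      using offD[OF Q(1) y] by simp_all
    have "X * y - y * X = 0"
    proof (rule off_eq_zero[OF Q(1)])
      have "y * (X * Q) = y * X"
        by (simp add: assoc2[OF y'(3)] flip: QX)
      moreover have "Q * (X * y) = 0"
        by (simp add: assoc2[OF QX] y'(2) mult.assoc)
      ultimately show "X * y - y * X \<in> off Q"
        using y' X by (simp add: off_def left_diff_distrib right_diff_distrib mult.assoc assoc2[OF y'(2)])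
      fix z assume z: "z \<in> off Q"
      note z' = offD(1)[OF Q(1) z]
      have "t (curv (y + z) * X) = t (curv y * X) + t (curv z * X) +
          (t (y * star z * X) + t (z * star y * X) - t (star y * z * X) - t (star z * y * X))"
        using y'(1) z' X by (simp add: curv_def distrib_left distrib_right left_diff_distrib t_linear)
      moreover have "t (z * star y * X) = t (y * star z * X)" "t (star y * z * X) = t (star z * y * X)"
        using t_star[of "z * star y * X"] t_comm[of X "y * star z"] t_star[of "star y * z * X"] t_comm[of X "star z * y"]
          y'(1) z' X by simp_all
      ultimately have "t (y * star z * X) = t (star z * y * X)"
        using curv[OF y] curv[OF z] curv[OF off_add[OF y z]] by simp
      moreover have "t (X * y * star z) = t (y * star z * X)" "t (y * X * star z) = t (star z * y * X)"
        using t_comm[of X "y * star z"] t_comm[of "y * X" "star z"] y'(1) z' X by (simp_all add: mult.assoc)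
      ultimately show "t ((X * y - y * X) * star z) = 0"
        using y'(1) z' X by (simp add: left_diff_distrib t_diff)
    qed
    then show ?thesis
      by simp
  qed
  define C where "C x \<longleftrightarrow> X * x = x * X" for x
  have C_add: "C (x + y)" if "C x" "C y" for x y
    using that by (simp add: C_def distrib_left distrib_right)
  have C_star: "C (star x)" if "C x" for x
    using arg_cong[OF that[unfolded C_def], of star] X by (simp add: C_def)
  have C_off: "C ((1 - Q) * x * Q)" if "x \<in> M" for x
    unfolding C_def by (rule yX[OF off_compress[OF Q(1,2) that]])
  \<comment> \<open>\<open>X\<close> commutes with \<open>(1 - q) * z * q\<close> and with its
    product by \<open>q * x * q\<close>. So the commutator of \<open>X\<close> with
    \<open>q * x * q\<close> is annihilated from the left by all \<open>(1 - q) * z\<close>.\<close>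
  have C_corner: "C (q * x * q)" if q: "is_proj q" "q \<in> M" "1 - q \<noteq> 0" "C q" and x: "x \<in> M"
    and off: "\<And>z. z \<in> M \<Longrightarrow> C ((1 - q) * z * q)" for q x
  proof -
    have qq: "q * q = q"
      using q by (simp add: is_proj_def)
    define k where "k = q * x * q"
    define y where "y = X * k - k * X"
    have qk: "q * k = k"
      by (simp add: k_def mult.assoc assoc2[OF qq])
    have "q * (X * k) = X * k" "q * (k * X) = k * X"
      using assoc2[OF q(4)[unfolded C_def, symmetric], of k] assoc2[OF qk, of X] by (simp_all add: mult.assoc qk)
    then have qy: "q * y = y"
      by (simp add: y_def right_diff_distrib)
    have "(1 - q) * z * y = 0" if z: "z \<in> M" for z
    proof -
      define a where "a = (1 - q) * z * q"
      have a: "X * a = a * X"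
        using off[OF z] by (simp add: a_def C_def)
      have "(1 - q) * (z * q * x) * q = a * k"
        by (simp add: a_def k_def mult.assoc assoc2[OF qq])
      then have ak: "X * (a * k) = a * k * X"
        using off[of "z * q * x"] z q x by (simp add: C_def)
      have "(1 - q) * z * y = a * y"
        by (simp add: a_def mult.assoc qy)
      also have "\<dots> = a * (X * k) - a * k * X"
        by (simp add: y_def right_diff_distrib mult.assoc)
      also have "a * (X * k) = X * (a * k)"
        using assoc2[OF a[symmetric], of k] by (simp add: mult.assoc)
      finally show ?thesis
        by (simp only: ak diff_self)
    qed
    then have "1 - q = 0 \<or> y = 0"
      using q x X by (intro prime) (simp_all add: y_def k_def)
    then show ?thesis
      using q by (simp add: C_def y_def k_def)
  qed
  have "X * x = x * X" if x: "x \<in> M" for x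
  proof -
    have CQ: "C Q" "C (1 - Q)"
      using QX by (simp_all add: C_def left_diff_distrib right_diff_distrib)
    have off': "C ((1 - (1 - Q)) * z * (1 - Q))" if "z \<in> M" for z
      using C_star[OF C_off[OF star_closed[OF that]]] pp by (simp add: mult.assoc)
    have "C (Q * x * Q + (1 - Q) * x * Q + Q * x * (1 - Q) + (1 - Q) * x * (1 - Q))"
      using off'[OF x] C_off[OF x] C_corner[OF Q(1,2) _ CQ(1) x C_off]
        C_corner[OF is_proj_one_minus[OF Q(1)] _ _ CQ(2) x off'] Q(2,3,4)
      by (intro C_add) simp_all
    also have "Q * x * Q + (1 - Q) * x * Q + Q * x * (1 - Q) + (1 - Q) * x * (1 - Q) = x"
      by (simp add: algebra_simps)
    finally show ?thesis
      by (simp add: C_def)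
  qed
  then obtain k where k: "X = scalar k"
    using center[OF X(1)] by metis
  have "2 *\<^sub>R X = scalar k + scalar (cnj k)"
    using X(2) k by (simp add: scaleR_2)
  also have "\<dots> = (2 * Re k) *\<^sub>R 1"
    using scaleR_add_left[of "Re k" "Re k" "1 :: 'a cop"] scalar_decompose[of k "1 :: 'a cop"]
      scalar_decompose[of "cnj k" "1 :: 'a cop"] by simp
  finally have "(1/2) *\<^sub>R (2 *\<^sub>R X) = (1/2) *\<^sub>R ((2 * Re k) *\<^sub>R 1)"
    by (rule arg_cong)
  then have "X = Re k *\<^sub>R 1"
    by simp
  then show ?thesis
    by (rule that)
qed

text \<open>\<open>c \<le> 1/2\<close> says that \<open>P\<close> is no larger than
  \<open>1 - P\<close> in trace, which provides \<open>w\<close>.\<close>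

lemma exists_frame:
  assumes P: "P \<in> Pc c" and c: "0 < c" "c \<le> 1/2"
  obtains w n and v :: "nat \<Rightarrow> 'a cop" where "w \<in> off P" "star w * w = P" "\<And>i. v i \<in> off P"
    "(\<Sum>i<n. v i * star (v i)) = 1 - P"
proof -
  note p = PcD[OF P]
  have r: "1 - P \<in> M" "is_proj (1 - P)"
    using p is_proj_one_minus by auto
  have "t P \<le> t (1 - P)"
    using c p by (simp add: t_diff t_one)
  then obtain w where w: "w \<in> M" "star w * w = P" "is_proj (w * star w)" "(1 - P) * w = w"
    by (rule comparison[OF p(1,2) r])
  obtain n v where v: "\<And>i. v i \<in> M" "\<And>i. v i * P = v i" "\<And>i. (1 - P) * v i = v i"
    "(\<Sum>i<(n::nat). v i * star (v i)) = 1 - P"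
    by (rule projection_decomposition[OF P c(1) r]) blast
  have "partial_isometry w"
    by (rule is_proj_imp_partial_isometry[OF w(3)])
  then have "w * P = w"
    by (simp add: partial_isometry_def mult.assoc flip: w(2))
  then have "w \<in> off P"
    using w by (simp add: off_def left_diff_distrib)
  moreover have "v i \<in> off P" for i
    using v(1,2,3)[of i] by (simp add: off_def left_diff_distrib)
  ultimately show ?thesis
    using that w(2) v(4) by blast
qed

lemma off_star:
  assumes "is_proj Q" "y \<in> off Q"
  shows "star y \<in> off (1 - Q)"
  using offD[OF assms] by (simp add: off_def left_diff_distrib right_diff_distrib)

end

context pointed_trace_isometry
begin

lemma image_nontrivial: "\<phi> P \<noteq> 0" "\<phi> P \<noteq> 1" and base_nontrivial: "P \<noteq> 0"
  using B.PcD(3)[OF phi_Pc[OF base]] A.PcD(3)[OF base] c B.t_one by auto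

text \<open>The sign \<open>\<sigma>\<close> covers both cases: the extension of \<open>rho\<close>
  with 1 and the extension of its negative adjoint with -1.\<close>

lemma scalar_difference:
  assumes Q: "Q \<in> A.Pc c" and G: "G \<in> N" "star G = G" and \<sigma>: "\<sigma> * \<sigma> = 1"
    and herm: "\<And>b. b \<in> A.off P \<Longrightarrow> u (herm (rho b) * G) = \<sigma> * t (herm b * Q)"
    and curv: "\<And>b. b \<in> A.off P \<Longrightarrow> u (curv (rho b) * G) = \<sigma> * t (curv b * Q)"
  obtains r where "\<phi> Q - \<sigma> *\<^sub>R G = r *\<^sub>R 1"
proof (rule B.scalar_if_orthogonal[OF base_image image_nontrivial])
  note q = B.PcD[OF phi_Pc[OF Q]]
  show "\<phi> Q - \<sigma> *\<^sub>R G \<in> N" "star (\<phi> Q - \<sigma> *\<^sub>R G) = \<phi> Q - \<sigma> *\<^sub>R G"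
    using q G by simp_all
  fix y assume y: "y \<in> B.off (\<phi> P)"
  then obtain b where b: "b \<in> A.off P" "rho b = y"
    by (rule rho_surj)
  have yN: "y \<in> N"
    using B.offD[OF base_image(1) y] by simp
  have "u (herm y * \<phi> Q) = t (herm b * Q)" "u (curv y * \<phi> Q) = t (curv b * Q)"
    using Psi(2)[OF herm_in_span[OF base b(1)]] curv_corresponds[OF b(1)] Q
    by (simp_all add: corresponds_def Psi_herm b)
  moreover have "u (herm y * G) = \<sigma> * t (herm b * Q)" "u (curv y * G) = \<sigma> * t (curv b * Q)"
    using herm[OF b(1)] curv[OF b(1)] by (simp_all add: b)
  ultimately show "u (herm y * (\<phi> Q - \<sigma> *\<^sub>R G)) = 0" "u (curv y * (\<phi> Q - \<sigma> *\<^sub>R G)) = 0"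
    using yN G q \<sigma> by (simp_all add: right_diff_distrib B.t_linear flip: mult.assoc)
qed (use that in blast)

lemma extension_hom:
  assumes c': "c \<le> 1/2"
    and hom: "\<And>a b e. a \<in> A.off P \<Longrightarrow> b \<in> A.off P \<Longrightarrow> e \<in> A.off P \<Longrightarrow> rho (a * star b * e) = rho a * star (rho b) * rho e"
  obtains f where "cop_iso M N f" "\<And>Q. Q \<in> A.Pc c \<Longrightarrow> \<phi> Q = f Q"
proof -
  obtain \<epsilon> where eps: "\<epsilon> = 1 \<or> \<epsilon> = - 1" "\<And>a. a \<in> A.off P \<Longrightarrow> rho (scalar \<i> * a) = scalar (\<epsilon> * \<i>) * rho a"
    by (rule scalar_i) blast
  obtain w n v where w: "w \<in> A.off P" "star w * w = P" and v: "\<And>i. v i \<in> A.off P"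
    "(\<Sum>i<(n::nat). v i * star (v i)) = 1 - P"
    by (rule A.exists_frame[OF base c(1) c']) blast
  interpret T: ternary_corner_map M t N u P "\<phi> P" rho w n v \<epsilon>
    by unfold_locales (fact base_nontrivial hom eps(2) w v)+
  obtain f where f: "cop_iso M N f" "\<And>x. x \<in> M \<Longrightarrow> star x = x \<Longrightarrow> f x = T.g x"
    by (rule T.exists_cop_iso[OF eps(1)]) blast
  have "\<phi> Q = f Q" if Q: "Q \<in> A.Pc c" for Q
  proof -
    note q = A.PcD[OF Q] and q' = B.PcD[OF phi_Pc[OF Q]]
    have G: "T.g Q \<in> N" "star (T.g Q) = T.g Q" "u (T.g Q) = c"
      using T.g_star[OF q(1)] q by (simp_all add: T.g_in T.u_g)
    have pair: "u (herm (rho b) * T.g Q) = 1 * t (herm b * Q)" "u (curv (rho b) * T.g Q) = 1 * t (curv b * Q)" if b: "b \<in> A.off P" for b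
      using A.offD(1)[OF base_proj(1) b] q b by (simp_all add: T.u_g flip: T.g_herm T.g_curv T.g_mult)
    obtain r where r: "\<phi> Q - 1 *\<^sub>R T.g Q = r *\<^sub>R 1"
      by (rule scalar_difference[OF Q G(1,2), of 1]) (simp, (erule pair)+, blast)
    have "r = u (\<phi> Q - 1 *\<^sub>R T.g Q)"
      unfolding r by (simp add: B.t_scaleR B.t_one)
    then have "r = 0"
      using G q' by (simp add: B.t_diff)
    then show ?thesis
      using r f(2)[OF q(1,5)] by simp
  qed
  then show ?thesis
    using that f(1) by blast
qed

text \<open>The adjoint of \<open>rho\<close> maps into the opposite corner and reverses products,
  so its negative satisfies the ternary law there. With the negative sign both \<open>herm\<close>
  and \<open>curv\<close> are negated, matching \<open>1 - f Q\<close>, whose first and second order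
  terms are the negatives of those of \<open>f Q\<close>.\<close>

lemma extension_antihom:
  assumes c': "c \<le> 1/2"
    and anti: "\<And>a b e. a \<in> A.off P \<Longrightarrow> b \<in> A.off P \<Longrightarrow> e \<in> A.off P \<Longrightarrow> rho (a * star b * e) = rho e * star (rho b) * rho a"
  obtains f where "c = 1/2" "cop_iso M N f" "\<And>Q. Q \<in> A.Pc c \<Longrightarrow> \<phi> Q = 1 - f Q"
proof -
  obtain \<epsilon> where eps: "\<epsilon> = 1 \<or> \<epsilon> = - 1" "\<And>a. a \<in> A.off P \<Longrightarrow> rho (scalar \<i> * a) = scalar (\<epsilon> * \<i>) * rho a"
    by (rule scalar_i) blast
  obtain w n v where w: "w \<in> A.off P" "star w * w = P" and v: "\<And>i. v i \<in> A.off P"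
    "(\<Sum>i<(n::nat). v i * star (v i)) = 1 - P"
    by (rule A.exists_frame[OF base c(1) c']) blast
  define \<rho> where "\<rho> a = - star (rho a)" for a
  have rN: "rho a \<in> N" if "a \<in> A.off P" for a
    using B.offD(1)[OF base_image(1) rho_off[OF that]] .
  interpret T: ternary_corner_map M t N u P "1 - \<phi> P" \<rho> w n v "- \<epsilon>"
  proof unfold_locales
    show "is_proj (1 - \<phi> P)" "1 - \<phi> P \<in> N"
      using base_image is_proj_one_minus by simp_all
    show "\<rho> ` A.off P = B.off (1 - \<phi> P)"
    proof (intro equalityI subsetI)
      fix y assume "y \<in> B.off (1 - \<phi> P)"
      then have "star y \<in> B.off (1 - (1 - \<phi> P))"
        by (rule B.off_star[OF is_proj_one_minus[OF base_image(1)]])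
      then have "- star y \<in> B.off (\<phi> P)"
        using B.off_minus by simp
      then obtain b where b: "b \<in> A.off P" "rho b = - star y"
        by (rule rho_surj)
      then show "y \<in> \<rho> ` A.off P"
        by (intro image_eqI[of _ _ b]) (simp_all add: \<rho>_def)
    next
      fix y assume "y \<in> \<rho> ` A.off P"
      then show "y \<in> B.off (1 - \<phi> P)"
        unfolding \<rho>_def by (auto intro!: B.off_minus B.off_star base_image rho_off)
    qed
    show "u (\<rho> a * star (\<rho> b)) = t (a * star b)" if "a \<in> A.off P" "b \<in> A.off P" for a b
    proof -
      have "u (\<rho> a * star (\<rho> b)) = u (rho b * star (rho a))"
        using B.t_comm[of "star (rho a)" "rho b"] rN that by (simp add: \<rho>_def)
      also have "\<dots> = u (rho a * star (rho b))"
        using B.t_star[of "rho a * star (rho b)"] rN that by simp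
      finally show ?thesis
        using rho_inner[OF that] by simp
    qed
    show "\<rho> (scalar \<i> * a) = scalar (- \<epsilon> * \<i>) * \<rho> a" if "a \<in> A.off P" for a
      using eps(1) eps(2)[OF that] by (auto simp: \<rho>_def scalar_minus scalar_commute[of \<i>])
    show "\<rho> (a * star b * e) = \<rho> a * star (\<rho> b) * \<rho> e"
      if "a \<in> A.off P" "b \<in> A.off P" "e \<in> A.off P" for a b e
      using arg_cong[OF anti[OF that], of star] by (simp add: \<rho>_def mult.assoc)
  qed (simp_all add: base_proj base_nontrivial w v \<rho>_def rho_add rho_scaleR)
  obtain f where f: "cop_iso M N f" "\<And>x. x \<in> M \<Longrightarrow> star x = x \<Longrightarrow> f x = T.g x"
    by (rule T.exists_cop_iso) (use eps(1) in auto)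
  have eq: "\<phi> Q + T.g Q = (2 * c) *\<^sub>R 1" if Q: "Q \<in> A.Pc c" for Q
  proof -
    note q = A.PcD[OF Q] and q' = B.PcD[OF phi_Pc[OF Q]]
    have G: "T.g Q \<in> N" "star (T.g Q) = T.g Q" "u (T.g Q) = c"
      using T.g_star[OF q(1)] q by (simp_all add: T.g_in T.u_g)
    have pair: "u (herm (rho b) * T.g Q) = - 1 * t (herm b * Q)" "u (curv (rho b) * T.g Q) = - 1 * t (curv b * Q)" if b: "b \<in> A.off P" for b
    proof -
      have bM: "b \<in> M"
        by (rule A.offD(1)[OF base_proj(1) b])
      have "herm (\<rho> b) = - herm (rho b)" "curv (\<rho> b) = - curv (rho b)"
        by (simp_all add: \<rho>_def herm_def curv_def)
      then have "herm (rho b) = - T.g (herm b)" "curv (rho b) = - T.g (curv b)"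
        using b by (simp_all add: T.g_herm T.g_curv)
      then show "u (herm (rho b) * T.g Q) = - 1 * t (herm b * Q)" "u (curv (rho b) * T.g Q) = - 1 * t (curv b * Q)"
        using bM q by (simp_all add: B.t_minus T.g_in T.u_g flip: T.g_mult)
    qed
    obtain r where r: "\<phi> Q - (- 1) *\<^sub>R T.g Q = r *\<^sub>R 1"
      by (rule scalar_difference[OF Q G(1,2), of "- 1"]) (simp, (erule pair)+, blast)
    have "r = u (\<phi> Q - (- 1) *\<^sub>R T.g Q)"
      unfolding r by (simp add: B.t_scaleR B.t_one)
    then have "r = 2 * c"
      using G q' by (simp add: B.t_add)
    then show ?thesis
      using r by simp
  qed
  \<comment> \<open>\<open>\<phi> P\<close> is \<open>2 * c\<close> minus the idempotent
    \<open>e\<close>. Its idempotency yields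
    \<open>(2 * c - 1) *\<^sub>R (e - c *\<^sub>R 1) = 0\<close>, and \<open>e\<close> is not
    \<open>c *\<^sub>R 1\<close> because \<open>c\<close> is neither 0 nor 1.\<close>
  have half: "c = 1/2"
  proof -
    define e where "e = T.g P"
    define s where "s = 2 * c"
    define k where "k = c *\<^sub>R (1 :: 'b cop)"
    have e: "e * e = e" "\<phi> P = s *\<^sub>R 1 - e"
      using eq[OF base] base_proj T.g_mult[of P P] by (simp_all add: s_def e_def is_proj_def eq_diff_eq)
    have sq: "(s * s) *\<^sub>R 1 - s *\<^sub>R e - (s *\<^sub>R e - e) = s *\<^sub>R 1 - e"
    proof -
      have "\<phi> P * \<phi> P = \<phi> P"
        using base_image by (simp add: is_proj_def)
      then show ?thesis
        unfolding e(2) by (simp add: left_diff_distrib right_diff_distrib e(1) scaleR_diff_right)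
    qed
    have kk: "k + k = s *\<^sub>R 1"
      unfolding k_def s_def using scaleR_add_left[of c c "1 :: 'b cop"] by simp
    have "s *\<^sub>R k + s *\<^sub>R k = (s * s) *\<^sub>R 1"
      by (simp only: kk scaleR_scaleR flip: scaleR_add_right)
    then have "(s *\<^sub>R (e - k) - (e - k)) + (s *\<^sub>R (e - k) - (e - k)) =
        - ((s * s) *\<^sub>R 1 - s *\<^sub>R e - (s *\<^sub>R e - e) - (s *\<^sub>R 1 - e))"
      unfolding kk[symmetric] by (simp only: scaleR_diff_right flip: kk) (simp add: algebra_simps)
    also have "\<dots> = 0"
      by (simp only: sq diff_self minus_zero)
    finally have "2 *\<^sub>R (s *\<^sub>R (e - k) - (e - k)) = 0"
      by (simp only: scaleR_2)
    then have "(s - 1) *\<^sub>R (e - k) = 0"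
      by (simp add: scaleR_diff_left)
    moreover have "e \<noteq> k"
    proof
      assume "e = k"
      then have "(c * c) *\<^sub>R (1 :: 'b cop) = c *\<^sub>R 1"
        using e(1) by (simp add: k_def)
      then have "c * c = c"
        using image_nontrivial by (metis B.t_one B.t_scaleR B.one_in mult_1_right)
      then show False
        using c by simp
    qed
    ultimately show ?thesis
      by (simp add: s_def)
  qed
  have "\<phi> Q = 1 - f Q" if Q: "Q \<in> A.Pc c" for Q
    using eq[OF Q] f(2)[of Q] A.PcD[OF Q] by (simp add: half eq_diff_eq)
  then show ?thesis
    using that half f(1) by blast
qed

theorem extension:
  assumes "c \<le> 1/2"
  obtains f where "cop_iso M N f" "(\<forall>Q\<in>A.Pc c. \<phi> Q = f Q) \<or> c = 1/2 \<and> (\<forall>Q\<in>A.Pc c. \<phi> Q = 1 - f Q)"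
  using ternary
proof
  assume "\<forall>a\<in>A.off P. \<forall>b\<in>A.off P. \<forall>e\<in>A.off P. rho (a * star b * e) = rho a * star (rho b) * rho e"
  then obtain f where "cop_iso M N f" "\<And>Q. Q \<in> A.Pc c \<Longrightarrow> \<phi> Q = f Q"
    using extension_hom[OF assms] by metis
  then show ?thesis
    using that by metis
next
  assume "\<forall>a\<in>A.off P. \<forall>b\<in>A.off P. \<forall>e\<in>A.off P. rho (a * star b * e) = rho e * star (rho b) * rho a"
  then obtain f where "c = 1/2" "cop_iso M N f" "\<And>Q. Q \<in> A.Pc c \<Longrightarrow> \<phi> Q = 1 - f Q"
    using extension_antihom[OF assms] by metis
  then show ?thesis
    using that by metis
qed

end

section \<open>Reduction to c at most 1/2 by complements\<close>

context fin_factor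
begin

lemma Pc_complement: "P \<in> Pc c \<Longrightarrow> 1 - P \<in> Pc (1 - c)"
  by (simp add: Pc_def is_proj_one_minus t_diff t_one)

lemma D_complement: "D q (1 - P) (1 - Q) = D q P Q"
proof -
  have "(1 - P) - (1 - Q) = - (P - Q)"
    by simp
  then have "(1 - P - (1 - Q)) * (1 - P - (1 - Q)) = (P - Q) * (P - Q)"
    by (simp only: minus_mult_minus)
  then show ?thesis
    by (simp only: D_def)
qed

lemma D_nonneg:
  assumes "P \<in> Pc c" "Q \<in> Pc c" "q > 0"
  shows "0 \<le> D q P Q"
proof -
  have s: "star ((P - Q) * (P - Q)) = (P - Q) * (P - Q)" "(P - Q) * (P - Q) \<in> M"
    using PcD[OF assms(1)] PcD[OF assms(2)] by simp_all
  show ?thesis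
    unfolding D_def using assms(3)
    by (intro t_nonneg fc_closed fc_nonneg s continuous_pw) (simp_all add: pw_def)
qed

end

lemma cop_iso_one:
  assumes "cop_iso M N f" "1 \<in> M" "1 \<in> N"
  shows "f 1 = 1"
proof -
  obtain x where x: "x \<in> M" "f x = 1"
    using assms(1,3) by (auto simp: cop_iso_def bij_betw_def)
  then have "f (x * 1) = f x * f 1 \<or> f (x * 1) = f 1 * f x"
    using assms(1,2) unfolding cop_iso_def by blast
  then show ?thesis
    by (simp add: x)
qed

locale factor_pair = A: fin_factor M t + B: fin_factor N u
  for M :: "'a :: chilbert_space cop set" and t and N :: "'b :: chilbert_space cop set" and u
begin

lemma isometry_extension_small:
  assumes c: "0 < c" "c \<le> 1/2" and q: "0 < q" and ne: "A.Pc c \<noteq> {}" and image: "\<phi> ` A.Pc c = B.Pc c"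
    and isom: "\<And>P Q. P \<in> A.Pc c \<Longrightarrow> Q \<in> A.Pc c \<Longrightarrow> B.D q (\<phi> P) (\<phi> Q) = A.D q P Q"
  shows "\<exists>f. cop_iso M N f \<and> ((\<forall>Q\<in>A.Pc c. \<phi> Q = f Q) \<or> c = 1/2 \<and> (\<forall>Q\<in>A.Pc c. \<phi> Q = 1 - f Q))"
proof -
  interpret I: projection_isometry M t N u c q \<phi>
    by unfold_locales (use assms in auto)
  \<comment> \<open>\<open>t\<close> of \<open>(P - Q)\<^sup>2\<close> is a combination of traces of
    products, all of which are preserved.\<close>
  have "inj_on \<phi> (A.Pc c)"
  proof (rule inj_onI)
    fix P Q assume PQ: "P \<in> A.Pc c" "Q \<in> A.Pc c" "\<phi> P = \<phi> Q"
    note p = A.PcD[OF PQ(1)] and q = A.PcD[OF PQ(2)]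
    have "t (P * Q) = c" "t (Q * P) = c"
      using I.trace_preserved[OF PQ(1,2)] I.trace_preserved[OF PQ(2,1)] I.trace_preserved[OF PQ(1,1)] p PQ(3) by simp_all
    then have "t (star (P - Q) * (P - Q)) = 0"
      using p q by (simp add: left_diff_distrib right_diff_distrib A.t_diff)
    then show "P = Q"
      using A.t_star_mult_zero[of "P - Q"] p q by simp
  qed
  obtain P where P: "P \<in> A.Pc c"
    using ne by blast
  interpret T: pointed_trace_isometry M t N u c \<phi> P
    by unfold_locales (use c P image I.trace_preserved \<open>inj_on \<phi> (A.Pc c)\<close> in \<open>auto simp: bij_betw_def\<close>)
  show ?thesis
    using T.extension[OF c(2)] by metis
qed

theorem isometry_extension:
  assumes c: "0 < c" "c < 1" and q: "0 < q" and ne: "A.Pc c \<noteq> {}" and image: "\<phi> ` A.Pc c = B.Pc c"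
    and isom: "\<And>P Q. P \<in> A.Pc c \<Longrightarrow> Q \<in> A.Pc c \<Longrightarrow> B.D q (\<phi> P) (\<phi> Q) = A.D q P Q"
  shows "\<exists>f. cop_iso M N f \<and> ((\<forall>Q\<in>A.Pc c. \<phi> Q = f Q) \<or> c = 1/2 \<and> (\<forall>Q\<in>A.Pc c. \<phi> Q = 1 - f Q))"
proof (cases "c \<le> 1/2")
  case True
  show ?thesis
    by (rule isometry_extension_small[OF c(1) True q ne image isom])
next
  case False
  \<comment> \<open>Complements preserve \<open>D\<close>, so \<open>\<psi>\<close> is an isometry
    for the trace value \<open>1 - c\<close>, which is less than 1/2.\<close>
  define \<psi> where "\<psi> P = 1 - \<phi> (1 - P)" for P
  have compA: "1 - P \<in> A.Pc c" if "P \<in> A.Pc (1 - c)" for P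
    using A.Pc_complement[OF that] by simp
  have compB: "1 - P \<in> B.Pc c" if "P \<in> B.Pc (1 - c)" for P
    using B.Pc_complement[OF that] by simp
  have "\<psi> ` A.Pc (1 - c) = B.Pc (1 - c)"
  proof (intro equalityI subsetI)
    fix y assume "y \<in> \<psi> ` A.Pc (1 - c)"
    then show "y \<in> B.Pc (1 - c)"
      using image compA by (auto simp: \<psi>_def intro!: B.Pc_complement)
  next
    fix y assume "y \<in> B.Pc (1 - c)"
    then have "1 - y \<in> \<phi> ` A.Pc c"
      unfolding image by (rule compB)
    then obtain P where P: "P \<in> A.Pc c" "1 - y = \<phi> P"
      by blast
    have "\<psi> (1 - P) = y"
      by (simp add: \<psi>_def flip: P(2))
    then show "y \<in> \<psi> ` A.Pc (1 - c)"
      using A.Pc_complement[OF P(1)] by blast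
  qed
  moreover have "B.D q (\<psi> P) (\<psi> Q) = A.D q P Q" if "P \<in> A.Pc (1 - c)" "Q \<in> A.Pc (1 - c)" for P Q
    using isom[OF compA[OF that(1)] compA[OF that(2)]] by (simp add: \<psi>_def A.D_complement B.D_complement)
  moreover have "A.Pc (1 - c) \<noteq> {}"
    using ne A.Pc_complement by blast
  ultimately obtain f where f: "cop_iso M N f" "(\<forall>Q\<in>A.Pc (1 - c). \<psi> Q = f Q) \<or> 1 - c = 1/2 \<and> (\<forall>Q\<in>A.Pc (1 - c). \<psi> Q = 1 - f Q)"
    using isometry_extension_small[of "1 - c" q \<psi>] False c q by auto
  have "\<phi> Q = f Q" if Q: "Q \<in> A.Pc c" for Q
  proof -
    \<comment> \<open>The other alternative would require \<open>1 - c = 1/2\<close>, which is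
      excluded in this case.\<close>
    have "\<psi> (1 - Q) = f (1 - Q)"
      using f(2) False A.Pc_complement[OF Q] by auto
    moreover have "f (1 - Q + Q) = f (1 - Q) + f Q"
      using f(1) A.PcD(1)[OF Q] unfolding cop_iso_def by (metis A.diff_closed A.one_in)
    ultimately have "\<phi> Q + f (1 - Q) = f Q + f (1 - Q)"
      using cop_iso_one[OF f(1)] by (simp add: \<psi>_def algebra_simps)
    then show ?thesis
      by (simp only: add_right_cancel)
  qed
  then show ?thesis
    using f(1) by blast
qed

end

section \<open>Transfer to operators\<close>

lemma projections_of_trace_eq:
  assumes "finite_factor M \<tau>"
  shows "projections_of_trace M \<tau> c =
    Rep_cop ` fin_factor.Pc {x. Rep_cop x \<in> M} (\<lambda>x. Re (\<tau> (Rep_cop x))) c"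
proof -
  note F = fin_factor_of_finite_factor[OF assms]
  have "\<tau> (Rep_cop x) = complex_of_real c \<longleftrightarrow> Re (\<tau> (Rep_cop x)) = c" if "Rep_cop x \<in> M" "star x = x" for x
    using F(3)[of x] that by (auto simp: complex_eq_iff complex_is_Real_iff)
  then have iff: "Rep_cop x \<in> projections_of_trace M \<tau> c \<longleftrightarrow>
      x \<in> fin_factor.Pc {x. Rep_cop x \<in> M} (\<lambda>x. Re (\<tau> (Rep_cop x))) c" for x
    by (auto simp: projections_of_trace_def fin_factor.Pc_def[OF F(1)] projection_op_Rep_cop is_proj_def)
  show ?thesis
  proof (intro equalityI subsetI)
    fix A assume A: "A \<in> projections_of_trace M \<tau> c"
    then have "A \<in> Rep_cop ` {x. Rep_cop x \<in> M}"
      unfolding F(2) by (simp add: projections_of_trace_def)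
    then obtain x where "A = Rep_cop x"
      by blast
    then show "A \<in> Rep_cop ` fin_factor.Pc {x. Rep_cop x \<in> M} (\<lambda>x. Re (\<tau> (Rep_cop x))) c"
      using A iff by simp
  next
    fix A assume "A \<in> Rep_cop ` fin_factor.Pc {x. Rep_cop x \<in> M} (\<lambda>x. Re (\<tau> (Rep_cop x))) c"
    then show "A \<in> projections_of_trace M \<tau> c"
      using iff by (elim imageE) simp
  qed
qed

lemma Lp_norm_diff_Rep_cop:
  assumes "finite_factor M \<tau>" "p > 0" "star x = x" "star y = y"
  shows "Lp_norm \<tau> p (Rep_cop x - Rep_cop y) =
    fin_factor.D (\<lambda>x. Re (\<tau> (Rep_cop x))) (p / 2) x y powr (1 / p)"
  using Lp_norm_Rep_cop[of "x - y" p \<tau>] assms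
  by (simp add: fin_factor.D_def[OF fin_factor_of_finite_factor(1)[OF assms(1)]] minus_cop.rep_eq)

lemma scale_op_Rep_cop: "scale_op a (Rep_cop x) = Rep_cop (scalar a * x)"
  by (rule blinfun_eqI) (simp add: times_cop.rep_eq scalar.rep_eq)

lemma star_isomorphism_of_cop_iso:
  assumes "cop_iso {x. Rep_cop x \<in> M} {y. Rep_cop y \<in> N} f"
    and M: "Rep_cop ` {x. Rep_cop x \<in> M} = M" and N: "Rep_cop ` {y. Rep_cop y \<in> N} = N"
  defines "g \<equiv> \<lambda>A. Rep_cop (f (Abs_cop A))"
  shows "star_isomorphism M N g \<or> star_anti_isomorphism M N g"
proof -
  have gR: "g (Rep_cop x) = Rep_cop (f x)" for x
    by (simp add: g_def Rep_cop_inverse)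
  have f: "bij_betw f {x. Rep_cop x \<in> M} {y. Rep_cop y \<in> N}"
    "\<And>x y. Rep_cop x \<in> M \<Longrightarrow> Rep_cop y \<in> M \<Longrightarrow> f (x + y) = f x + f y"
    "\<And>z x. Rep_cop x \<in> M \<Longrightarrow> f (scalar z * x) = scalar z * f x"
    "\<And>x. Rep_cop x \<in> M \<Longrightarrow> f (star x) = star (f x)"
    and mult: "(\<forall>x y. Rep_cop x \<in> M \<longrightarrow> Rep_cop y \<in> M \<longrightarrow> f (x * y) = f x * f y) \<or>
      (\<forall>x y. Rep_cop x \<in> M \<longrightarrow> Rep_cop y \<in> M \<longrightarrow> f (x * y) = f y * f x)"
    using assms(1) by (auto simp: cop_iso_def)
  have rep: "\<exists>x. A = Rep_cop x \<and> Rep_cop x \<in> M" if "A \<in> M" for A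
    using that M by blast
  have "bij_betw g M N"
  proof (rule bij_betw_imageI)
    show "inj_on g M"
    proof (rule inj_onI)
      fix A B assume AB: "A \<in> M" "B \<in> M" "g A = g B"
      then obtain x y where "A = Rep_cop x" "Rep_cop x \<in> M" "B = Rep_cop y" "Rep_cop y \<in> M"
        using rep by metis
      moreover from this AB(3) have "f x = f y"
        by (simp add: gR Rep_cop_inject)
      ultimately show "A = B"
        using inj_onD[OF bij_betw_imp_inj_on[OF f(1)], of x y] by simp
    qed
    have "g ` M = Rep_cop ` f ` {x. Rep_cop x \<in> M}"
      by (subst M[symmetric]) (simp add: image_image gR)
    then show "g ` M = N"
      using bij_betw_imp_surj_on[OF f(1)] N by simp
  qed
  moreover have "g (A + B) = g A + g B" if AB: "A \<in> M" "B \<in> M" for A B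
  proof -
    obtain x y where "A = Rep_cop x" "Rep_cop x \<in> M" "B = Rep_cop y" "Rep_cop y \<in> M"
      using rep AB by metis
    then show ?thesis
      by (simp add: gR f flip: plus_cop.rep_eq)
  qed
  moreover have "g (scale_op a A) = scale_op a (g A)" "g (adj_op A) = adj_op (g A)" if "A \<in> M" for a A
  proof -
    obtain x where "A = Rep_cop x" "Rep_cop x \<in> M"
      using rep \<open>A \<in> M\<close> by metis
    then show "g (scale_op a A) = scale_op a (g A)" "g (adj_op A) = adj_op (g A)"
      by (simp_all add: gR f scale_op_Rep_cop adj_op_Rep_cop)
  qed
  ultimately have "star_linear_bij M N g"
    by (simp add: star_linear_bij_def)
  moreover have "(\<forall>A\<in>M. \<forall>B\<in>M. g (A o\<^sub>L B) = g A o\<^sub>L g B) \<or> (\<forall>A\<in>M. \<forall>B\<in>M. g (A o\<^sub>L B) = g B o\<^sub>L g A)"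
    using mult
  proof (elim disjE)
    assume h: "\<forall>x y. Rep_cop x \<in> M \<longrightarrow> Rep_cop y \<in> M \<longrightarrow> f (x * y) = f x * f y"
    have "g (A o\<^sub>L B) = g A o\<^sub>L g B" if AB: "A \<in> M" "B \<in> M" for A B
    proof -
      obtain x y where "A = Rep_cop x" "Rep_cop x \<in> M" "B = Rep_cop y" "Rep_cop y \<in> M"
        using rep AB by metis
      then show ?thesis
        using h by (simp add: gR flip: times_cop.rep_eq)
    qed
    then show ?thesis
      by blast
  next
    assume h: "\<forall>x y. Rep_cop x \<in> M \<longrightarrow> Rep_cop y \<in> M \<longrightarrow> f (x * y) = f y * f x"
    have "g (A o\<^sub>L B) = g B o\<^sub>L g A" if AB: "A \<in> M" "B \<in> M" for A B
    proof -
      obtain x y where "A = Rep_cop x" "Rep_cop x \<in> M" "B = Rep_cop y" "Rep_cop y \<in> M"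
        using rep AB by metis
      then show ?thesis
        using h by (simp add: gR flip: times_cop.rep_eq)
    qed
    then show ?thesis
      by blast
  qed
  ultimately show ?thesis
    by (auto simp: star_isomorphism_def star_anti_isomorphism_def)
qed

theorem theorem1p3:
  fixes c p :: real
    and M1 :: "('a :: chilbert_space \<Rightarrow>\<^sub>L 'a) set" and \<tau>1 :: "('a \<Rightarrow>\<^sub>L 'a) \<Rightarrow> complex"
    and M2 :: "('b :: chilbert_space \<Rightarrow>\<^sub>L 'b) set" and \<tau>2 :: "('b \<Rightarrow>\<^sub>L 'b) \<Rightarrow> complex"
    and \<phi> :: "('a \<Rightarrow>\<^sub>L 'a) \<Rightarrow> ('b \<Rightarrow>\<^sub>L 'b)"
  assumes c: "0 < c" "c < 1" and p: "0 < p"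
    and M1: "finite_factor M1 \<tau>1" "projections_of_trace M1 \<tau>1 c \<noteq> {}"
    and M2: "finite_factor M2 \<tau>2" "projections_of_trace M2 \<tau>2 c \<noteq> {}"
    and surj: "\<phi> ` projections_of_trace M1 \<tau>1 c = projections_of_trace M2 \<tau>2 c"
    and isom: "Lp_isometry_on (projections_of_trace M1 \<tau>1 c) \<tau>1 \<tau>2 p \<phi>"
  shows "(c \<noteq> 1 / 2 \<longrightarrow>
            (\<exists>f. (star_isomorphism M1 M2 f \<or> star_anti_isomorphism M1 M2 f) \<and>
                 (\<forall>P \<in> projections_of_trace M1 \<tau>1 c. \<phi> P = f P))) \<and>
         (c = 1 / 2 \<longrightarrow>
            (\<exists>f. (star_isomorphism M1 M2 f \<or> star_anti_isomorphism M1 M2 f) \<and>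
                 ((\<forall>P \<in> projections_of_trace M1 \<tau>1 (1 / 2). \<phi> P = f P) \<or>
                  (\<forall>P \<in> projections_of_trace M1 \<tau>1 (1 / 2). \<phi> P = id_blinfun - f P))))"
proof -
  define t where "t = (\<lambda>x. Re (\<tau>1 (Rep_cop x)))"
  define u where "u = (\<lambda>x. Re (\<tau>2 (Rep_cop x)))"
  define M where "M = {x. Rep_cop x \<in> M1}"
  define N where "N = {x. Rep_cop x \<in> M2}"
  have F: "fin_factor M t" "fin_factor N u"
    using fin_factor_of_finite_factor(1)[OF M1(1)] fin_factor_of_finite_factor(1)[OF M2(1)]
    by (simp_all add: M_def N_def t_def u_def)
  interpret factor_pair M t N u
    by (intro factor_pair.intro F)
  have pr: "projections_of_trace M1 \<tau>1 c = Rep_cop ` A.Pc c" "projections_of_trace M2 \<tau>2 c = Rep_cop ` B.Pc c"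
    using projections_of_trace_eq[OF M1(1)] projections_of_trace_eq[OF M2(1)]
    by (simp_all add: M_def N_def t_def u_def)
  define \<psi> where "\<psi> x = Abs_cop (\<phi> (Rep_cop x))" for x
  have psi: "Rep_cop (\<psi> x) = \<phi> (Rep_cop x)" "\<psi> x \<in> B.Pc c" if "x \<in> A.Pc c" for x
  proof -
    have "\<phi> (Rep_cop x) \<in> Rep_cop ` B.Pc c"
      using surj that unfolding pr by blast
    then show "Rep_cop (\<psi> x) = \<phi> (Rep_cop x)" "\<psi> x \<in> B.Pc c"
      by (auto simp: \<psi>_def Rep_cop_inverse)
  qed
  have "Rep_cop ` \<psi> ` A.Pc c = Rep_cop ` B.Pc c"
    using surj unfolding pr by (simp add: image_image psi)
  then have image: "\<psi> ` A.Pc c = B.Pc c"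
    by (simp add: inj_image_eq_iff inj_def Rep_cop_inject)
  have "B.D (p / 2) (\<psi> x) (\<psi> y) = A.D (p / 2) x y" if xy: "x \<in> A.Pc c" "y \<in> A.Pc c" for x y
  proof -
    have "Lp_norm \<tau>1 p (Rep_cop x - Rep_cop y) = Lp_norm \<tau>2 p (Rep_cop (\<psi> x) - Rep_cop (\<psi> y))"
      using isom xy unfolding Lp_isometry_on_def pr by (simp add: psi)
    then have "A.D (p / 2) x y powr (1 / p) = B.D (p / 2) (\<psi> x) (\<psi> y) powr (1 / p)"
      using Lp_norm_diff_Rep_cop[OF M1(1) p, of x y] Lp_norm_diff_Rep_cop[OF M2(1) p, of "\<psi> x" "\<psi> y"]
        A.PcD(5)[OF xy(1)] A.PcD(5)[OF xy(2)] B.PcD(5)[OF psi(2)[OF xy(1)]] B.PcD(5)[OF psi(2)[OF xy(2)]]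
      by (simp flip: t_def u_def)
    \<comment> \<open>Raising to the power p undoes the root because both values of \<open>D\<close>
      are nonnegative.\<close>
    then have "(A.D (p / 2) x y powr (1 / p)) powr p = (B.D (p / 2) (\<psi> x) (\<psi> y) powr (1 / p)) powr p"
      by simp
    then show ?thesis
      using p A.D_nonneg[OF xy, of "p / 2"] B.D_nonneg[OF psi(2)[OF xy(1)] psi(2)[OF xy(2)], of "p / 2"]
      by (simp add: powr_powr)
  qed
  moreover have "A.Pc c \<noteq> {}"
    using M1(2) pr by auto
  ultimately obtain f where f: "cop_iso M N f"
    "(\<forall>Q\<in>A.Pc c. \<psi> Q = f Q) \<or> c = 1/2 \<and> (\<forall>Q\<in>A.Pc c. \<psi> Q = 1 - f Q)"
    using isometry_extension[OF c _ _ image, of "p / 2"] p by auto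
  define g where "g = (\<lambda>A. Rep_cop (f (Abs_cop A)))"
  have g: "star_isomorphism M1 M2 g \<or> star_anti_isomorphism M1 M2 g"
    unfolding g_def using f(1) fin_factor_of_finite_factor(2)[OF M1(1)] fin_factor_of_finite_factor(2)[OF M2(1)]
    by (intro star_isomorphism_of_cop_iso) (simp_all add: M_def N_def)
  have "(\<forall>P\<in>projections_of_trace M1 \<tau>1 c. \<phi> P = g P) \<or>
      c = 1/2 \<and> (\<forall>P\<in>projections_of_trace M1 \<tau>1 c. \<phi> P = id_blinfun - g P)"
    using f(2)
  proof (elim disjE conjE)
    assume h: "\<forall>Q\<in>A.Pc c. \<psi> Q = f Q"
    have "\<phi> (Rep_cop x) = g (Rep_cop x)" if "x \<in> A.Pc c" for x
      using psi(1)[OF that] h that by (simp add: g_def Rep_cop_inverse)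
    then show ?thesis
      unfolding pr by blast
  next
    assume half: "c = 1/2" and h: "\<forall>Q\<in>A.Pc c. \<psi> Q = 1 - f Q"
    have "\<phi> (Rep_cop x) = id_blinfun - g (Rep_cop x)" if "x \<in> A.Pc c" for x
      using psi(1)[OF that] h that by (simp add: g_def Rep_cop_inverse minus_cop.rep_eq one_cop.rep_eq)
    then show ?thesis
      using half unfolding pr by blast
  qed
  then show ?thesis
    using g by blast
qed

end
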